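(* For $\epsilon\in\{1,-1\}$, let $K_\epsilon$ be the standard complex of the group presentation $$H_\epsilon=\langle a,c,d \mid a^{[c^d,c]}=a^{\epsilon},\ c^{3d}=c^5\rangle .$$ Thus $K_\epsilon$ is a finite two-dimensional CW-complex with exactly one vertex, three edges and two 2-cells. Then $K_1$ and $K_{-1}$ have a common covering, but have no finite common covering. That is, there exist a CW-complex $K$ and cellular covering maps $K_1\leftarrow K\to K_{-1}$, but there exists no finite CW-complex $K$ admitting cellular covering maps $K_1\leftarrow K\to K_{-1}$.
   Context: Notation: for elements $x,y$ of a group and $k\in\mathbb Z$, $x^{y}=y^{-1}xy$ and $x^{ky}=y^{-1}x^ky$; $[x,y]=x^{-1}y^{-1}xy$. So the two relations of $H_\epsilon$ correspond to the relators $\hat h^{-1}a\hat h a^{-\epsilon}$, where $\hat h=[c^d,c]=d^{-1}c^{-1}d\,c^{-1}\,d^{-1}cd\,c$, and $d^{-1}c^3d\,c^{-5}$. The standard complex of a group presentation $\langle X\mid R\rangle$ is the two-dimensional CW-complex with one vertex, one (oriented) edge (a loop) for each generator in $X$, and one 2-cell for each relator in $R$, attached along the closed edge path spelled by that relator. All maps between CW-complexes are assumed to be cellular (the $n$-skeleton is mapped into the $n$-skeleton for every $n$). A common covering of CW-complexes $K_1,K_2$ is a (nonempty) CW-complex $K$ together with cellular covering maps $K\to K_1$ and $K\to K_2$ (covering maps are surjective); it is a finite common covering if $K$ is a finite CW-complex, i.e. has finitely many cells. *)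

theory Defs
  imports "HOL-Analysis.Analysis"
begin

section \<open>CW-complexes\<close>

definition closed_disc :: "nat \<Rightarrow> (nat \<Rightarrow> real) topology" where
  "closed_disc n = subtopology (Euclidean_space n) {x. (\<Sum>i<n. (x i)\<^sup>2) \<le> 1}"

definition open_disc :: "nat \<Rightarrow> (nat \<Rightarrow> real) topology" where
  "open_disc n = subtopology (Euclidean_space n) {x. (\<Sum>i<n. (x i)\<^sup>2) < 1}"

definition boundary_sphere :: "nat \<Rightarrow> (nat \<Rightarrow> real) set" where
  "boundary_sphere n = {x \<in> topspace (Euclidean_space n). (\<Sum>i<n. (x i)\<^sup>2) = 1}"

text \<open>A space together with, for every \<open>n\<close>, a set of subsets of it: its open \<open>n\<close>-cells.\<close>

record 'a cell_complex =
  space_of :: "'a topology"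
  cells :: "nat \<Rightarrow> 'a set set"

definition skeleton :: "'a cell_complex \<Rightarrow> nat \<Rightarrow> 'a set" where
  "skeleton K n = (\<Union>m\<le>n. \<Union>(cells K m))"

definition characteristic_map ::
    "'a cell_complex \<Rightarrow> nat \<Rightarrow> 'a set \<Rightarrow> ((nat \<Rightarrow> real) \<Rightarrow> 'a) \<Rightarrow> bool" where
  "characteristic_map K n e \<phi> \<longleftrightarrow>
     continuous_map (closed_disc n) (space_of K) \<phi> \<and>
     homeomorphic_map (open_disc n) (subtopology (space_of K) e) \<phi> \<and>
     (\<exists>F. finite F \<and> F \<subseteq> (\<Union>m<n. cells K m) \<and> \<phi> ` boundary_sphere n \<subseteq> \<Union>F)"

text \<open>Whitehead's definition: a Hausdorff space partitioned into open cells that have characteristic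
  maps, with closure finiteness (the last clause of \<^const>\<open>characteristic_map\<close>) and the weak topology.\<close>

definition cw_complex :: "'a cell_complex \<Rightarrow> bool" where
  "cw_complex K \<longleftrightarrow>
     Hausdorff_space (space_of K) \<and>
     (\<Union>n. \<Union>(cells K n)) = topspace (space_of K) \<and>
     (\<forall>m n. \<forall>e\<in>cells K m. \<forall>f\<in>cells K n. (m, e) \<noteq> (n, f) \<longrightarrow> disjnt e f) \<and>
     (\<forall>n. \<forall>e\<in>cells K n. \<exists>\<phi>. characteristic_map K n e \<phi>) \<and>
     (\<forall>A \<subseteq> topspace (space_of K).
        (\<forall>n. \<forall>e\<in>cells K n. closedin (space_of K) (A \<inter> (space_of K) closure_of e)) \<longrightarrow>
        closedin (space_of K) A)"

definition finite_cw_complex :: "'a cell_complex \<Rightarrow> bool" where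
  "finite_cw_complex K \<longleftrightarrow> cw_complex K \<and> finite (SIGMA n:UNIV. cells K n)"

definition cellular_map :: "'a cell_complex \<Rightarrow> 'b cell_complex \<Rightarrow> ('a \<Rightarrow> 'b) \<Rightarrow> bool" where
  "cellular_map K L f \<longleftrightarrow>
     continuous_map (space_of K) (space_of L) f \<and> (\<forall>n. f ` skeleton K n \<subseteq> skeleton L n)"


section \<open>Coverings\<close>

text \<open>The library's \<^const>\<open>covering_space\<close> only speaks about subsets of types of class
  \<open>topological_space\<close>; this is its version for abstract topologies.\<close>

definition covering_map :: "'a topology \<Rightarrow> 'b topology \<Rightarrow> ('a \<Rightarrow> 'b) \<Rightarrow> bool" where
  "covering_map X Y p \<longleftrightarrow>
     continuous_map X Y p \<and> p ` topspace X = topspace Y \<and>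
     (\<forall>y\<in>topspace Y. \<exists>T. y \<in> T \<and> openin Y T \<and>
        (\<exists>\<V>. \<Union>\<V> = {x \<in> topspace X. p x \<in> T} \<and>
             (\<forall>U\<in>\<V>. openin X U) \<and>
             pairwise disjnt \<V> \<and>
             (\<forall>U\<in>\<V>. homeomorphic_map (subtopology X U) (subtopology Y T) p)))"

lemma homeomorphic_map_top_of_set_open:
  fixes S :: "'a::topological_space set" and T :: "'b::topological_space set"
  assumes "openin (top_of_set S) U" "openin (top_of_set T) W"
  shows "homeomorphic_map (subtopology (top_of_set S) U) (subtopology (top_of_set T) W) p
         \<longleftrightarrow> (\<exists>q. homeomorphism U W p q)"
proof -
  have "S \<inter> U = U" "T \<inter> W = W"
    using assms openin_imp_subset by fastforce+
  then have "homeomorphic_map (subtopology (top_of_set S) U) (subtopology (top_of_set T) W) p \<longleftrightarrow>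
             homeomorphic_map (top_of_set U) (top_of_set W) p"
    by (simp add: subtopology_subtopology)
  also have "\<dots> \<longleftrightarrow> (\<exists>q. homeomorphism U W p q)"
    unfolding homeomorphic_map_maps homeomorphic_maps_def homeomorphism_def
    apply (simp add: continuous_map_in_subtopology Pi_iff)
    apply (simp only: ex_simps[symmetric])
    apply (rule ex_cong1)
    apply (safe; force)
    done
  finally show ?thesis .
qed

lemma covering_map_top_of_set:
  "covering_map (top_of_set S) (top_of_set T) p \<longleftrightarrow> covering_space S p T"
proof -
  have pre: "S \<inter> p -` W = {x \<in> S. p x \<in> W}" for W
    by auto
  have cont: "continuous_map (top_of_set S) (top_of_set T) p \<and> p ` S = T \<longleftrightarrow>
      continuous_on S p \<and> p ` S = T"
    by (auto simp: continuous_map_in_subtopology)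
  show ?thesis
    unfolding covering_map_def covering_space_def pre topspace_euclidean_subtopology
      conj_assoc[symmetric] cont
    unfolding conj_assoc
    apply (intro conj_cong refl ball_cong ex_cong1)
    by (rule homeomorphic_map_top_of_set_open; blast)
qed

definition common_covering ::
    "'a cell_complex \<Rightarrow> 'b cell_complex \<Rightarrow> 'c cell_complex \<Rightarrow> bool" where
  "common_covering K K1 K2 \<longleftrightarrow>
     cw_complex K \<and> topspace (space_of K) \<noteq> {} \<and>
     (\<exists>p. covering_map (space_of K) (space_of K1) p \<and> cellular_map K K1 p) \<and>
     (\<exists>q. covering_map (space_of K) (space_of K2) q \<and> cellular_map K K2 q)"

definition finite_common_covering ::
    "'a cell_complex \<Rightarrow> 'b cell_complex \<Rightarrow> 'c cell_complex \<Rightarrow> bool" where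
  "finite_common_covering K K1 K2 \<longleftrightarrow> finite_cw_complex K \<and> common_covering K K1 K2"


section \<open>Words\<close>

text \<open>\<open>(g, True)\<close> is the letter \<open>g\<close> and \<open>(g, False)\<close> is its formal inverse. Words are not reduced.\<close>

type_synonym 'g word = "('g \<times> bool) list"

definition letter :: "'g \<Rightarrow> 'g word" where
  "letter g = [(g, True)]"

definition winv :: "'g word \<Rightarrow> 'g word" where
  "winv w = rev (map (\<lambda>(g, s). (g, \<not> s)) w)"

definition wpow :: "'g word \<Rightarrow> int \<Rightarrow> 'g word" where
  "wpow w k = concat (replicate (nat \<bar>k\<bar>) (if k \<ge> 0 then w else winv w))"

definition wconj :: "'g word \<Rightarrow> 'g word \<Rightarrow> 'g word" where
  "wconj x y = winv y @ x @ y"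

definition wcomm :: "'g word \<Rightarrow> 'g word \<Rightarrow> 'g word" where
  "wcomm x y = winv x @ winv y @ x @ y"

text \<open>The relator of the relation \<open>u = v\<close>.\<close>

definition relator :: "'g word \<Rightarrow> 'g word \<Rightarrow> 'g word" where
  "relator u v = u @ winv v"


section \<open>The standard complex of a presentation\<close>

text \<open>The points of the open edge of a generator are parametrised by \<open>0 < t < 1\<close>, those of the open
  2-cell of a relator by the complex numbers \<open>z\<close> with \<open>norm z < 1\<close>.\<close>

datatype 'g point = Vertex | Edge 'g real | Face "'g word" complex

definition edge_map :: "'g \<Rightarrow> real \<Rightarrow> 'g point" where
  "edge_map g t = (if 0 < t \<and> t < 1 then Edge g t else Vertex)"

text \<open>The closed edge path spelled by \<open>w\<close>, at the time \<open>0 \<le> t < 1\<close>; each of the letters takes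
  time \<open>1 / length w\<close>.\<close>

definition word_path :: "'g word \<Rightarrow> real \<Rightarrow> 'g point" where
  "word_path w t =
     (if w = [] then Vertex
      else let s = real (length w) * t; (g, positive) = w ! nat \<lfloor>s\<rfloor>
           in edge_map g (if positive then frac s else 1 - frac s))"

definition face_map :: "'g word \<Rightarrow> complex \<Rightarrow> 'g point" where
  "face_map r z = (if norm z < 1 then Face r z else word_path r (Arg2pi z / (2 * pi)))"

definition open_edge :: "'g \<Rightarrow> 'g point set" where
  "open_edge g = Edge g ` {0<..<1}"

definition open_face :: "'g word \<Rightarrow> 'g point set" where
  "open_face r = Face r ` ball 0 1"

text \<open>The quotient topology from the disjoint union of the vertex, the closed edges and the closed
  discs.\<close>

definition standard_open :: "'g set \<Rightarrow> 'g word set \<Rightarrow> 'g point set \<Rightarrow> bool" where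
  "standard_open X R U \<longleftrightarrow>
     U \<subseteq> {Vertex} \<union> (\<Union>g\<in>X. open_edge g) \<union> (\<Union>r\<in>R. open_face r) \<and>
     (\<forall>g\<in>X. openin (top_of_set {0..1}) ({0..1} \<inter> edge_map g -` U)) \<and>
     (\<forall>r\<in>R. openin (top_of_set (cball 0 1)) (cball 0 1 \<inter> face_map r -` U))"

definition standard_complex :: "'g set \<Rightarrow> 'g word set \<Rightarrow> 'g point cell_complex" where
  "standard_complex X R =
     \<lparr>space_of = topology (standard_open X R),
      cells = (\<lambda>n. if n = 0 then {{Vertex}}
                   else if n = 1 then open_edge ` X
                   else if n = 2 then open_face ` R
                   else {})\<rparr>"

lemma openin_preimage_Int:
  assumes "openin Z (A \<inter> f -` S)" "openin Z (A \<inter> f -` T)"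
  shows "openin Z (A \<inter> f -` (S \<inter> T))"
proof -
  have "A \<inter> f -` (S \<inter> T) = (A \<inter> f -` S) \<inter> (A \<inter> f -` T)"
    by auto
  with assms show ?thesis
    by (metis openin_Int)
qed

lemma openin_preimage_Union:
  assumes "\<And>S. S \<in> \<K> \<Longrightarrow> openin Z (A \<inter> f -` S)"
  shows "openin Z (A \<inter> f -` \<Union>\<K>)"
proof -
  have "A \<inter> f -` \<Union>\<K> = (\<Union>S\<in>\<K>. A \<inter> f -` S)"
    by auto
  with assms show ?thesis
    by (metis (no_types, lifting) imageE openin_Union)
qed

lemma istopology_standard_open: "istopology (standard_open X R)"
  unfolding istopology_def
proof (intro conjI allI impI)
  fix S T assume "standard_open X R S" "standard_open X R T"
  then show "standard_open X R (S \<inter> T)"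
    unfolding standard_open_def by (intro conjI ballI openin_preimage_Int) blast+
next
  fix \<K> assume "\<forall>S\<in>\<K>. standard_open X R S"
  then show "standard_open X R (\<Union>\<K>)"
    unfolding standard_open_def by (intro conjI ballI openin_preimage_Union Union_least) blast+
qed

lemma openin_standard_complex:
  "openin (space_of (standard_complex X R)) U \<longleftrightarrow> standard_open X R U"
  by (simp add: standard_complex_def istopology_standard_open)


section \<open>The presentations \<open>H\<^sub>\<epsilon>\<close>\<close>

datatype gen = Gen_a | Gen_c | Gen_d

definition H_relators :: "int \<Rightarrow> gen word set" where
  "H_relators \<epsilon> =
     (let a = letter Gen_a; c = letter Gen_c; d = letter Gen_d
      in {relator (wconj a (wcomm (wconj c d) c)) (wpow a \<epsilon>),
          relator (wconj (wpow c 3) d) (wpow c 5)})"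

lemma wcomm_wconj_explicit:
  "wcomm (wconj (letter Gen_c) (letter Gen_d)) (letter Gen_c) =
     [(Gen_d, False), (Gen_c, False), (Gen_d, True), (Gen_c, False),
      (Gen_d, False), (Gen_c, True), (Gen_d, True), (Gen_c, True)]"
  by (simp add: wcomm_def wconj_def letter_def winv_def)

definition K_complex :: "int \<Rightarrow> gen point cell_complex" where
  "K_complex \<epsilon> = standard_complex {Gen_a, Gen_c, Gen_d} (H_relators \<epsilon>)"

end

theory Submission
  imports Defs "HOL-Library.Nat_Bijection" "HOL-Combinatorics.Cycles"
begin

text \<open>Let \<open>h = [c\<^sup>d, c]\<close>. The second relation says that \<open>u = c\<^sup>d\<close> satisfies \<open>u\<^sup>3 = c\<^sup>5\<close>; the group \<open>\<langle>c, d\<rangle>\<close> has an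
  action on an infinite set in which \<open>h\<close> has only even cycles. Let \<open>a\<close> act trivially; the resulting
  coverings of \<open>K\<^sub>1\<close> and \<open>K\<^sub>-\<^sub>1\<close> are homeomorphic, by reversing the loop \<open>a\<close> at every second point of each
  cycle of \<open>h\<close>.

  In a finite covering \<open>c\<close> has finite order, which is prime to \<open>3\<close>, so \<open>c\<close> is a power of \<open>c\<^sup>3\<close>, its conjugate by
  \<open>d\<close> commutes with \<open>c\<close>, and \<open>h\<close> acts trivially on the fibre. Hence every lift of the first 2-cell is closed
  up along \<open>a\<close> to an annulus if \<open>\<epsilon> = 1\<close>, and the two copies of \<open>h\<close> on its boundary stay apart; if
  \<open>\<epsilon> = -1\<close>, then the collars of the copies of \<open>h\<close> are joined across \<open>a\<close>. The preimage of the graph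
  formed by the loops \<open>c\<close> and \<open>d\<close> is the closed set of points with no planar neighbourhood, and the
  vertices are the branch points of that graph; so both are the same for the two coverings of a common
  space. Near this preimage its complement falls apart into three pieces per vertex when it is seen
  from \<open>K\<^sub>1\<close> (two from the annulus, one from the other 2-cell), but into at most two when it is seen
  from \<open>K\<^sub>-\<^sub>1\<close>.\<close>

section \<open>Positions on the boundary circle of a face\<close>

text \<open>The even cycles come from choosing in an unusual order. Two permutations with countably
  infinitely many cycles, all of them infinite, are conjugate. So \<open>c\<close> and
  \<open>u\<close> are chosen first, subject only to \<open>u^3 = c^5\<close>, and \<open>d\<close>
  is found afterwards as a conjugating permutation. Both act on pairs of an integer and a natural
  number: \<open>c\<close> adds 3 and \<open>u\<close> adds 5 to the integer, so both powers add 15,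
  while on the natural numbers they act with orders 5 and 3. There the commutator is a finite
  computation, and its integer part is zero. In the second half the cells of a hypothetical finite
  covering are never compared with the cells below. Lifts of edges and faces are built from the
  covering map, and only a count in the one common space is made: with n vertices, the first
  covering provides 3n disjoint open sets near the graph, the second covers the same region by 2n
  connected sets. The two families need not match in any other way.\<close>

text \<open>The boundary of a face whose relator has length \<open>n\<close> is parametrised by \<open>[0, n]\<close>: the letter
  with index \<open>i\<close> is read between the positions \<open>i\<close> and \<open>i + 1\<close>.\<close>

definition circ :: "nat \<Rightarrow> real \<Rightarrow> complex" where
  "circ n x = cis (2 * pi * x / real n)"

lemma norm_circ [simp]: "norm (circ n x) = 1"
  by (simp add: circ_def)

lemma circ_nonzero [simp]: "circ n x \<noteq> 0"
  by (metis norm_circ norm_zero zero_neq_one)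

lemma continuous_on_circ [continuous_intros]:
  "continuous_on S f \<Longrightarrow> continuous_on S (\<lambda>t. circ n (f t))"
  unfolding circ_def divide_inverse by (intro continuous_intros)

lemma circ_period: "n > 0 \<Longrightarrow> circ n (x + real n) = circ n x"
proof -
  assume "n > 0"
  then have "2 * pi * (x + real n) / real n = 2 * pi * x / real n + 2 * pi" by (simp add: field_simps)
  then show ?thesis by (simp add: circ_def flip: cis_mult)
qed

lemma circ_add: "circ n (x + y) = circ n x * circ n y"
  by (simp add: circ_def cis_mult field_simps add_divide_distrib)

lemma cnj_circ: "cnj (circ n x) = circ n (- x)"
  by (simp add: circ_def cis_cnj)

lemma sgn_circ [simp]: "sgn (circ n x) = circ n x"
  by (simp add: sgn_div_norm)

lemma Arg2pi_circ: "n > 0 \<Longrightarrow> 0 \<le> x \<Longrightarrow> x < real n \<Longrightarrow> Arg2pi (circ n x) = 2 * pi * x / real n"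
  by (rule Arg2pi_unique[where r=1]) (auto simp: circ_def cis_conv_exp field_simps)

lemma circ_eq_iff:
  assumes "n > 0" "0 \<le> x" "x < real n" "0 \<le> y" "y < real n"
  shows "circ n x = circ n y \<longleftrightarrow> x = y"
proof
  assume "circ n x = circ n y"
  then have "2 * pi * x / real n = 2 * pi * y / real n"
    using assms Arg2pi_circ by metis
  then show "x = y" using assms(1) by (simp add: field_simps)
qed simp

lemma circ_surj:
  assumes "n > 0" "norm z = 1"
  obtains i t where "i < n" "0 \<le> t" "t < 1" "z = circ n (real i + t)"
proof -
  define s where "s = real n * (Arg2pi z / (2 * pi))"
  have s0: "0 \<le> s" by (simp add: s_def Arg2pi_ge_0)
  have s1: "s < real n"
    using assms(1) Arg2pi_lt_2pi[of z] by (simp add: s_def field_simps)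
  have z: "z = circ n s"
    using Arg2pi_eq[of z] assms by (simp add: s_def circ_def cis_conv_exp mult.commute)
  define i where "i = nat \<lfloor>s\<rfloor>"
  have "real i = of_int \<lfloor>s\<rfloor>" using s0 by (simp add: i_def)
  then have "real i \<le> s" "s < real i + 1" by linarith+
  moreover from this s1 have "i < n" by linarith
  ultimately show thesis using that[of i "s - real i"] z by simp
qed

lemma polar_circ:
  assumes "n > 0" "z \<noteq> 0"
  obtains i t where "i < n" "0 \<le> t" "t < 1" "z = norm z * circ n (real i + t)"
proof -
  have "norm (sgn z) = 1" using assms by (simp add: norm_sgn)
  then obtain i t where "i < n" "0 \<le> t" "t < 1" "sgn z = circ n (real i + t)"
    using circ_surj assms by blast
  moreover have "z = norm z * sgn z" using assms by (simp add: sgn_div_norm scaleR_conv_of_real)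
  ultimately show thesis using that by metis
qed

text \<open>Letters are half-open, [i, i + 1), so that they tile the circle exactly once; hence the
  bounds s < 1 and t < 1. The end of a letter counts as the start of the next one.\<close>

lemma circ_letter_unique:
  assumes "i < n" "j < n" "0 \<le> s" "s < 1" "0 \<le> t" "t < 1" "circ n (real i + s) = circ n (real j + t)"
  shows "i = j" "s = t"
proof -
  have "real i + s < real n" "real j + t < real n" "n > 0"
    using assms by linarith+
  then have e: "real i + s = real j + t"
    using circ_eq_iff[of n "real i + s" "real j + t"] assms by simp
  show "i = j"
  proof (rule ccontr)
    assume "i \<noteq> j"
    then have "real i + 1 \<le> real j \<or> real j + 1 \<le> real i" by linarith
    with e assms show False by linarith
  qed
  with e show "s = t" by simp
qed

lemma edge_map_0 [simp]: "edge_map g 0 = Vertex" and edge_map_1 [simp]: "edge_map g 1 = Vertex"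
  and edge_map_inner: "0 < t \<Longrightarrow> t < 1 \<Longrightarrow> edge_map g t = Edge g t"
  by (simp_all add: edge_map_def)

text \<open>By its floor, \<open>word_path\<close> reads the letter \<open>i\<close> only for t < 1.
  At t = 1 it already reads the next letter, but both readings give \<open>Vertex\<close>, since
  every edge is a loop; so each letter may be used as a closed interval.\<close>

lemma face_map_circ:
  assumes "i < length r" "0 \<le> t" "t \<le> 1"
  shows "face_map r (circ (length r) (real i + t)) =
    edge_map (fst (r ! i)) (if snd (r ! i) then t else 1 - t)"
proof -
  let ?n = "length r"
  have n: "?n > 0" using assms by linarith
  have main: "face_map r (circ ?n (real j + s)) = edge_map (fst (r ! j)) (if snd (r ! j) then s else 1 - s)"
    if "j < ?n" "0 \<le> s" "s < 1" for j s
  proof -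
    have l: "real j + s < real ?n" using that by linarith
    have "Arg2pi (circ ?n (real j + s)) / (2 * pi) = (real j + s) / ?n"
      using Arg2pi_circ[OF n _ l] that by simp
    moreover have "\<lfloor>real j + s\<rfloor> = int j" using that by linarith
    moreover have "frac (real j + s) = s" using that by (simp add: frac_def \<open>\<lfloor>real j + s\<rfloor> = int j\<close>)
    ultimately show ?thesis
      using n by (auto simp: face_map_def word_path_def Let_def split: prod.split)
  qed
  show ?thesis
  proof (cases "t < 1")
    case True then show ?thesis using main assms by blast
  next
    case False
    then have t: "t = 1" using assms by simp
    define j where "j = (if Suc i < ?n then Suc i else 0)"
    have "circ ?n (real i + t) = circ ?n (real j + 0)"
    proof (cases "Suc i < ?n")
      case False
      then have "real i + t = 0 + real ?n" using assms t by linarith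
      then show ?thesis using circ_period[OF n, of 0] False by (simp add: j_def)
    qed (simp add: j_def t add.commute)
    then have "face_map r (circ ?n (real i + t)) = edge_map (fst (r ! j)) (if snd (r ! j) then 0 else 1 - 0)"
      using main[of j 0] n by (auto simp: j_def)
    then show ?thesis by (simp add: t)
  qed
qed

lemma face_map_inner: "norm z < 1 \<Longrightarrow> face_map r z = Face r z"
  by (simp add: face_map_def)

section \<open>Sectors\<close>

text \<open>The open sector of half-width \<open>h\<close>, measured in letters, about the ray at
  position \<open>x\<close>. It is written as an inequality between real functions so that openness
  is immediate; the factor \<open>norm z\<close> makes the strict inequality fail at the
  origin.\<close>

definition sector :: "nat \<Rightarrow> real \<Rightarrow> real \<Rightarrow> complex set" where
  "sector n x h = {z. Re (z * circ n (- x)) > cos (2 * pi * h / real n) * norm z}"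

lemma open_sector: "open (sector n x h)"
  unfolding sector_def by (intro open_Collect_less continuous_intros)

lemma cos_abs_less:
  fixes a b :: real
  assumes "\<bar>a\<bar> \<le> pi" "0 < b" "b \<le> pi"
  shows "cos b < cos a \<longleftrightarrow> \<bar>a\<bar> < b"
  using cos_mono_less_eq[of b "\<bar>a\<bar>"] assms by (simp add: cos_abs_real)

text \<open>\<open>Re (z * circ n (- x))\<close> is \<open>norm z\<close> times the cosine of the
  angle between \<open>z\<close> and the central ray, and the cosine decreases on [0, pi]. The bound
  h \<le> n/2 keeps the half-width within this range.\<close>

lemma sector_polar:
  assumes n: "n > 0" and h: "0 < h" "h \<le> real n / 2"
  shows "z \<in> sector n x h \<longleftrightarrow> (\<exists>y. \<bar>y - x\<bar> < h \<and> z \<noteq> 0 \<and> z = norm z * circ n y)"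
proof -
  have rot: "Re (norm z * circ n y * circ n (- x)) = norm z * cos (2 * pi * (y - x) / n)" for y
    by (simp add: circ_def cis_mult mult.assoc diff_divide_distrib algebra_simps)
  have b: "0 < 2 * pi * h / n" "2 * pi * h / n \<le> pi" using n h by (auto simp: field_simps)
  show ?thesis
  proof
    assume a: "z \<in> sector n x h"
    then have z: "z \<noteq> 0" by (auto simp: sector_def)
    define w where "w = z * circ n (- x)"
    have w: "w \<noteq> 0" "norm w = norm z" using z by (auto simp: w_def norm_mult)
    define y where "y = x + real n * Arg w / (2 * pi)"
    have "cis (Arg w) = circ n (y - x)" using n by (simp add: y_def circ_def)
    then have "w = norm z * circ n (y - x)"
      using cis_Arg[OF w(1)] w z by (simp add: sgn_div_norm scaleR_conv_of_real field_simps)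
    moreover have "z = w * circ n x" by (simp add: w_def mult.assoc flip: circ_add) (simp add: circ_def)
    moreover have "circ n y = circ n (y - x) * circ n x" by (simp flip: circ_add)
    ultimately have zy: "z = norm z * circ n y" by (metis mult.assoc)
    have "cos (2 * pi * h / n) * norm z < norm z * cos (2 * pi * (y - x) / n)"
      using a rot[of y] zy by (simp add: sector_def)
    then have "cos (2 * pi * h / n) < cos (2 * pi * (y - x) / n)" using z by (simp add: mult.commute)
    moreover have "2 * pi * (y - x) / n = Arg w" using n by (simp add: y_def)
    moreover have "\<bar>Arg w\<bar> \<le> pi" using Arg_bounded[of w] by linarith
    ultimately have "\<bar>Arg w\<bar> < 2 * pi * h / n" using cos_abs_less b by metis
    then have "\<bar>y - x\<bar> < h" using n by (simp add: y_def abs_mult field_simps)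
    then show "\<exists>y. \<bar>y - x\<bar> < h \<and> z \<noteq> 0 \<and> z = norm z * circ n y" using z zy by blast
  next
    assume "\<exists>y. \<bar>y - x\<bar> < h \<and> z \<noteq> 0 \<and> z = norm z * circ n y"
    then obtain y where y: "\<bar>y - x\<bar> < h" "z \<noteq> 0" "z = norm z * circ n y" by blast
    have s: "\<bar>2 * pi * (y - x) / n\<bar> < 2 * pi * h / n"
      using y n by (simp add: abs_mult divide_strict_right_mono)
    then have "cos (2 * pi * h / n) < cos (2 * pi * (y - x) / n)"
      using cos_abs_less[of "2 * pi * (y - x) / n" "2 * pi * h / n"] b s by linarith
    then have "cos (2 * pi * h / n) * norm z < norm z * cos (2 * pi * (y - x) / n)"
      using y(2) by (simp add: mult.commute)
    then show "z \<in> sector n x h" using rot[of y] y(3) by (simp add: sector_def)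
  qed
qed

section \<open>Two-dimensional complexes as quotients of discs\<close>

lemma openin_iff_closed_Diff:
  fixes T :: "'z::topological_space set"
  assumes "closed T" "A \<subseteq> T" shows "openin (top_of_set T) A \<longleftrightarrow> closed (T - A)"
  using assms by (simp add: openin_closedin_eq closedin_closed_eq)

lemma closedin_vimage_arc_cover:
  fixes C :: "'i \<Rightarrow> real set" and \<phi> :: "'i \<Rightarrow> real \<Rightarrow> complex"
  assumes "finite I" "\<And>i. i \<in> I \<Longrightarrow> compact (C i)" "\<And>i. i \<in> I \<Longrightarrow> continuous_on (C i) (\<phi> i)"
  shows "closed (\<Union>i\<in>I. \<phi> i ` C i)"
  using assms by (intro closed_UN ballI compact_imp_closed compact_continuous_image)

text \<open>Intervals and discs glued along words in edges: \<open>em\<close> and \<open>fm\<close>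
  are the characteristic maps, \<open>bd f\<close> is the attaching path. Several vertices are
  allowed because the locale serves both for the standard complex and for the coverings built from
  an action; injectivity is demanded on open cells only.\<close>

locale cell_quotient =
  fixes V :: "'p set" and E :: "'e set" and em :: "'e \<Rightarrow> real \<Rightarrow> 'p"
    and F :: "'f set" and fm :: "'f \<Rightarrow> complex \<Rightarrow> 'p" and bd :: "'f \<Rightarrow> ('e \<times> bool) list"
  assumes em_ends: "e \<in> E \<Longrightarrow> em e 0 \<in> V" "e \<in> E \<Longrightarrow> em e 1 \<in> V"
    and em_inj: "\<lbrakk>e \<in> E; e' \<in> E; 0 < t; t < 1; 0 < t'; t' < 1; em e t = em e' t'\<rbrakk> \<Longrightarrow> e = e' \<and> t = t'"
    and fm_inj: "\<lbrakk>f \<in> F; f' \<in> F; norm z < 1; norm z' < 1; fm f z = fm f' z'\<rbrakk> \<Longrightarrow> f = f' \<and> z = z'"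
    and em_notin_V: "\<lbrakk>e \<in> E; 0 < t; t < 1\<rbrakk> \<Longrightarrow> em e t \<notin> V"
    and fm_notin_V: "\<lbrakk>f \<in> F; norm z < 1\<rbrakk> \<Longrightarrow> fm f z \<notin> V"
    and em_neq_fm: "\<lbrakk>e \<in> E; 0 < t; t < 1; f \<in> F; norm z < 1\<rbrakk> \<Longrightarrow> em e t \<noteq> fm f z"
    and bd: "f \<in> F \<Longrightarrow> bd f \<noteq> []" "f \<in> F \<Longrightarrow> x \<in> set (bd f) \<Longrightarrow> fst x \<in> E"
    and fm_circ: "\<lbrakk>f \<in> F; i < length (bd f); 0 \<le> t; t \<le> 1\<rbrakk> \<Longrightarrow>
       fm f (circ (length (bd f)) (real i + t)) =
       em (fst (bd f ! i)) (if snd (bd f ! i) then t else 1 - t)"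
begin

definition skel :: "'p set" where
  "skel = V \<union> (\<Union>e\<in>E. em e ` {0<..<1})"

definition carrier :: "'p set" where
  "carrier = skel \<union> (\<Union>f\<in>F. fm f ` ball 0 1)"

definition qopen :: "'p set \<Rightarrow> bool" where
  "qopen U \<longleftrightarrow> U \<subseteq> carrier \<and>
     (\<forall>e\<in>E. openin (top_of_set {0..1}) ({0..1} \<inter> em e -` U)) \<and>
     (\<forall>f\<in>F. openin (top_of_set (cball 0 1)) (cball 0 1 \<inter> fm f -` U))"

definition Q :: "'p topology" where "Q = topology qopen"

definition CX :: "'p cell_complex" where
  "CX = \<lparr>space_of = Q, cells = (\<lambda>n. if n = 0 then (\<lambda>v. {v}) ` V
       else if n = 1 then (\<lambda>e. em e ` {0<..<1}) ` E
       else if n = 2 then (\<lambda>f. fm f ` ball 0 1) ` F else {})\<rparr>"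

lemma istopology_qopen: "istopology qopen"
  unfolding istopology_def
proof (intro conjI allI impI)
  fix S T assume "qopen S" "qopen T"
  then show "qopen (S \<inter> T)"
    unfolding qopen_def by (intro conjI ballI openin_preimage_Int) blast+
next
  fix \<K> assume "\<forall>S\<in>\<K>. qopen S"
  then show "qopen (\<Union>\<K>)"
    unfolding qopen_def by (intro conjI ballI openin_preimage_Union Union_least) blast+
qed

lemma openin_Q: "openin Q U \<longleftrightarrow> qopen U"
  by (simp add: Q_def istopology_qopen)

lemma em_in_skel: "e \<in> E \<Longrightarrow> 0 \<le> t \<Longrightarrow> t \<le> 1 \<Longrightarrow> em e t \<in> skel"
proof -
  assume e: "e \<in> E" "0 \<le> t" "t \<le> 1"
  then consider "t = 0" | "t = 1" | "t \<in> {0<..<1}" by force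
  then show ?thesis using em_ends[OF e(1)] e(1) unfolding skel_def by cases blast+
qed

lemma fm_sphere:
  assumes "f \<in> F" "norm z = 1"
  obtains i t where "i < length (bd f)" "0 \<le> t" "t < 1" "z = circ (length (bd f)) (real i + t)"
    "fm f z = em (fst (bd f ! i)) (if snd (bd f ! i) then t else 1 - t)" "fst (bd f ! i) \<in> E"
proof -
  have "length (bd f) > 0" using bd assms by simp
  from circ_surj[OF this assms(2)] obtain i t where
    "i < length (bd f)" "0 \<le> t" "t < 1" "z = circ (length (bd f)) (real i + t)" by blast
  then show thesis using that[of i t] fm_circ[of f i t] bd(2)[of f "bd f ! i"] assms by simp
qed

lemma fm_sphere_skel: "f \<in> F \<Longrightarrow> norm z = 1 \<Longrightarrow> fm f z \<in> skel"
  by (erule (1) fm_sphere) (auto intro!: em_in_skel)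

lemma skel_carrier: "skel \<subseteq> carrier"
  by (auto simp: carrier_def)

lemma fm_in_carrier: "f \<in> F \<Longrightarrow> norm z \<le> 1 \<Longrightarrow> fm f z \<in> carrier"
proof (cases "norm z = 1")
  assume "f \<in> F" "norm z \<le> 1" "norm z \<noteq> 1"
  then have "fm f z \<in> fm f ` ball 0 1" by auto
  then show ?thesis using \<open>f \<in> F\<close> by (auto simp: carrier_def)
qed (use fm_sphere_skel[of f z] in \<open>auto simp: carrier_def\<close>)

lemma fm_notin_skel: "f \<in> F \<Longrightarrow> norm z < 1 \<Longrightarrow> fm f z \<notin> skel"
  using fm_notin_V[of f z] em_neq_fm[of _ _ f z] by (fastforce simp: skel_def)

lemma qopen_carrier: "qopen carrier"
proof -
  have "{0..1} \<inter> em e -` carrier = {0..1}" if "e \<in> E" for e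
    using that em_in_skel skel_carrier by fastforce
  moreover have "cball 0 1 \<inter> fm f -` carrier = cball 0 1" if "f \<in> F" for f
    using that fm_in_carrier by fastforce
  ultimately show ?thesis by (auto simp: qopen_def)
qed

lemma topspace_Q: "topspace Q = carrier"
proof
  show "topspace Q \<subseteq> carrier" using openin_topspace[of Q] unfolding openin_Q by (simp add: qopen_def)
  show "carrier \<subseteq> topspace Q" using qopen_carrier openin_Q openin_subset by blast
qed

lemma closedin_Q: "closedin Q A \<longleftrightarrow> A \<subseteq> carrier \<and>
     (\<forall>e\<in>E. closed ({0..1} \<inter> em e -` A)) \<and> (\<forall>f\<in>F. closed (cball 0 1 \<inter> fm f -` A))"
proof -
  have *: "{0..1} \<inter> em e -` (carrier - A) = {0..1} - ({0..1} \<inter> em e -` A)" if "e \<in> E" for e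
    using that em_in_skel[of e] skel_carrier by fastforce
  have **: "cball 0 1 \<inter> fm f -` (carrier - A) = cball 0 1 - (cball 0 1 \<inter> fm f -` A)" if "f \<in> F" for f
    using that fm_in_carrier[of f] by auto
  have cl: "openin (top_of_set T) (T - T \<inter> B) \<longleftrightarrow> closed (T \<inter> B)" if "closed T" for T B :: "'z::euclidean_space set"
    using openin_iff_closed_Diff[OF that, of "T - T \<inter> B"] by (simp add: Diff_Diff_Int Int_absorb1)
  show ?thesis
    unfolding closedin_def topspace_Q openin_Q qopen_def using * ** cl[of "{0..1}"] cl[of "cball 0 1"]
    by (metis (no_types, lifting) closed_atLeastAtMost closed_cball Diff_subset)
qed

lemma continuous_em: "e \<in> E \<Longrightarrow> continuous_map (top_of_set {0..1}) Q (em e)"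
  unfolding continuous_map_alt openin_Q
  using em_in_skel[of e] skel_carrier
  by (auto simp: qopen_def topspace_Q Int_commute)

lemma continuous_fm: "f \<in> F \<Longrightarrow> continuous_map (top_of_set (cball 0 1)) Q (fm f)"
  unfolding continuous_map_alt openin_Q
  using fm_in_carrier[of f] by (auto simp: qopen_def topspace_Q Int_commute)

text \<open>Universal property of the quotient. The condition on \<open>V\<close> takes care of
  vertices that lie on no edge, where only the value has to be in the target.\<close>

lemma continuous_map_from_Q:
  assumes "g \<in> V \<rightarrow> topspace Z" and "\<And>e. e \<in> E \<Longrightarrow> continuous_map (top_of_set {0..1}) Z (g \<circ> em e)"
    and "\<And>f. f \<in> F \<Longrightarrow> continuous_map (top_of_set (cball 0 1)) Z (g \<circ> fm f)"
  shows "continuous_map Q Z g"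
proof -
  have gc: "g x \<in> topspace Z" if "x \<in> carrier" for x
    using that assms unfolding carrier_def skel_def continuous_map_def by fastforce
  have "qopen {x \<in> carrier. g x \<in> U}" if U: "openin Z U" for U
  proof -
    have "{0..1} \<inter> em e -` {x \<in> carrier. g x \<in> U} = {x \<in> {0..1}. (g \<circ> em e) x \<in> U}" if "e \<in> E" for e
      using em_in_skel[OF that] skel_carrier by auto
    moreover have "cball 0 1 \<inter> fm f -` {x \<in> carrier. g x \<in> U} = {x \<in> cball 0 1. (g \<circ> fm f) x \<in> U}" if "f \<in> F" for f
      using fm_in_carrier[OF that] by auto
    ultimately show ?thesis
      using assms(2,3) U unfolding qopen_def continuous_map_def by auto
  qed
  then show ?thesis unfolding continuous_map_def openin_Q topspace_Q using gc by auto
qed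

subsection \<open>Stars\<close>

definition gopen :: "'p set \<Rightarrow> bool" where
  "gopen B \<longleftrightarrow> B \<subseteq> skel \<and> (\<forall>e\<in>E. openin (top_of_set {0..1}) ({0..1} \<inter> em e -` B))"

text \<open>A part \<open>B\<close> of the 1-skeleton thickened radially: a face contributes its
  open radii that end in \<open>B\<close>, without the centre. This extends a set open in the
  1-skeleton to an open set of the complex with the same trace on \<open>skel\<close>, and keeps
  disjoint sets disjoint.\<close>

definition star :: "'p set \<Rightarrow> 'p set" where
  "star B = B \<union> (\<Union>f\<in>F. fm f ` {z. z \<noteq> 0 \<and> norm z < 1 \<and> fm f (sgn z) \<in> B})"

text \<open>The circle is covered by finitely many closed letters. On each of them the points that
  are not mapped into \<open>B\<close> are the image of a compact set of parameters, so altogether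
  they form a closed set.\<close>

lemma gopen_sphere:
  assumes "gopen B" "f \<in> F"
  shows "openin (top_of_set (sphere 0 1)) {z \<in> sphere 0 1. fm f z \<in> B}"
proof -
  let ?n = "length (bd f)"
  let ?\<sigma> = "\<lambda>i t::real. if snd (bd f ! i) then t else 1 - t"
  let ?C = "\<lambda>i. {0..1} \<inter> ?\<sigma> i -` ({0..1} - {0..1} \<inter> em (fst (bd f ! i)) -` B)"
  have cc: "compact (?C i)" if "i < ?n" for i
  proof -
    have "fst (bd f ! i) \<in> E" using that bd(2) assms by simp
    then have "openin (top_of_set {0..1}) ({0..1} \<inter> em (fst (bd f ! i)) -` B)"
      using assms by (simp add: gopen_def)
    then have "closed ({0..1} - {0..1} \<inter> em (fst (bd f ! i)) -` B)"
      by (subst (asm) openin_iff_closed_Diff) auto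
    moreover have "continuous_on {0..1} (?\<sigma> i)" by (cases "snd (bd f ! i)") (auto intro!: continuous_intros)
    ultimately have "closed (?C i)" by (intro continuous_closed_preimage) auto
    moreover have "bounded (?C i)" by (meson bounded_closed_interval bounded_subset inf_le1)
    ultimately show ?thesis by (simp add: compact_eq_bounded_closed)
  qed
  have eq: "{z \<in> sphere 0 1. fm f z \<notin> B} = (\<Union>i\<in>{..<?n}. (\<lambda>t. circ ?n (real i + t)) ` ?C i)"
  proof (intro equalityI subsetI)
    fix z assume "z \<in> {z \<in> sphere 0 1. fm f z \<notin> B}"
    then have z: "norm z = 1" "fm f z \<notin> B" by auto
    obtain i t where it: "i < ?n" "0 \<le> t" "t < 1" "z = circ ?n (real i + t)"
      "fm f z = em (fst (bd f ! i)) (?\<sigma> i t)" using fm_sphere[OF assms(2) z(1)] by metis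
    then have "t \<in> ?C i" using z(2) by auto
    then show "z \<in> (\<Union>i\<in>{..<?n}. (\<lambda>t. circ ?n (real i + t)) ` ?C i)" using it by blast
  next
    fix z assume "z \<in> (\<Union>i\<in>{..<?n}. (\<lambda>t. circ ?n (real i + t)) ` ?C i)"
    then obtain i t where it: "i < ?n" "t \<in> ?C i" "z = circ ?n (real i + t)" by blast
    then show "z \<in> {z \<in> sphere 0 1. fm f z \<notin> B}"
      using fm_circ[OF assms(2) it(1), of t] by auto
  qed
  have "closed {z \<in> sphere 0 1. fm f z \<notin> B}"
    unfolding eq by (intro closedin_vimage_arc_cover cc) (auto intro!: continuous_intros)
  moreover have "{z \<in> sphere 0 1. fm f z \<in> B} = sphere 0 1 - {z \<in> sphere 0 1. fm f z \<notin> B}" by auto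
  moreover have "sphere 0 1 - (sphere 0 1 - {z \<in> sphere 0 1. fm f z \<notin> B}) = {z \<in> sphere 0 1. fm f z \<notin> B}" by auto
  ultimately show ?thesis by (simp add: openin_iff_closed_Diff)
qed

text \<open>On the circle \<open>sgn\<close> is the identity; inside, \<open>fm f\<close> is
  injective and avoids \<open>skel\<close>. So a star pulls back to a cone, without its apex, over a
  subset of the circle.\<close>

lemma fm_vimage_star:
  assumes "B \<subseteq> skel" "f \<in> F"
  shows "cball 0 1 \<inter> fm f -` star B = {z \<in> cball 0 1. z \<noteq> 0 \<and> fm f (sgn z) \<in> B}"
proof (intro equalityI subsetI)
  fix z assume z: "z \<in> cball 0 1 \<inter> fm f -` star B"
  show "z \<in> {z \<in> cball 0 1. z \<noteq> 0 \<and> fm f (sgn z) \<in> B}"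
  proof (cases "norm z = 1")
    case True
    then have "fm f z \<in> B" using z fm_sphere_skel[OF assms(2) True] fm_notin_skel by (auto simp: star_def)
    moreover have "sgn z = z" using True by (simp add: sgn_div_norm)
    ultimately show ?thesis using z True by auto
  next
    case False
    then have n: "norm z < 1" using z by simp
    then have "fm f z \<notin> B" using fm_notin_skel assms by blast
    then show ?thesis using z fm_inj[OF assms(2) _ n] unfolding star_def by fastforce
  qed
next
  fix z assume z: "z \<in> {z \<in> cball 0 1. z \<noteq> 0 \<and> fm f (sgn z) \<in> B}"
  show "z \<in> cball 0 1 \<inter> fm f -` star B"
  proof (cases "norm z = 1")
    case True
    then have "sgn z = z" by (simp add: sgn_div_norm)
    then show ?thesis using z by (auto simp: star_def)
  next
    case False
    then have "fm f z \<in> fm f ` {z. z \<noteq> 0 \<and> norm z < 1 \<and> fm f (sgn z) \<in> B}" using z by auto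
    then show ?thesis using z assms(2) unfolding star_def by blast
  qed
qed

lemma star_skel: "B \<subseteq> skel \<Longrightarrow> star B \<inter> skel = B"
  using fm_notin_skel by (auto simp: star_def)

lemma open_star:
  assumes "gopen B" shows "openin Q (star B)"
  unfolding openin_Q qopen_def
proof (intro conjI ballI)
  have B: "B \<subseteq> skel" using assms by (simp add: gopen_def)
  then show "star B \<subseteq> carrier" using skel_carrier by (auto simp: star_def carrier_def)
  show "openin (top_of_set {0..1}) ({0..1} \<inter> em e -` star B)" if "e \<in> E" for e
  proof -
    have "{0..1} \<inter> em e -` star B = {0..1} \<inter> em e -` B"
      using star_skel[OF B] em_in_skel[OF that] by fastforce
    then show ?thesis using assms that by (simp add: gopen_def)
  qed
  show "openin (top_of_set (cball 0 1)) (cball 0 1 \<inter> fm f -` star B)" if f: "f \<in> F" for f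
  proof -
    have "continuous_on (cball 0 1 - {0}) (sgn :: complex \<Rightarrow> complex)"
      by (intro continuous_intros) auto
    moreover have "sgn \<in> (cball 0 1 - {0}) \<rightarrow> sphere (0::complex) 1" by (auto simp: norm_sgn)
    ultimately have "openin (top_of_set (cball 0 1 - {0})) ((cball 0 1 - {0}) \<inter> sgn -` {z \<in> sphere 0 1. fm f z \<in> B})"
      using gopen_sphere[OF assms f] continuous_openin_preimage by blast
    moreover have "openin (top_of_set (cball 0 1)) (cball 0 1 - {0::complex})"
      by (simp add: openin_delete)
    ultimately have "openin (top_of_set (cball 0 1)) ((cball 0 1 - {0}) \<inter> sgn -` {z \<in> sphere 0 1. fm f z \<in> B})"
      by (rule openin_trans)
    moreover have "(cball 0 1 - {0}) \<inter> sgn -` {z \<in> sphere 0 1. fm f z \<in> B} = cball 0 1 \<inter> fm f -` star B"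
      unfolding fm_vimage_star[OF B f] by (auto simp: norm_sgn)
    ultimately show ?thesis by simp
  qed
qed

lemma open_face_image:
  assumes "f \<in> F" "open W" "W \<subseteq> ball 0 1"
  shows "openin Q (fm f ` W)"
  unfolding openin_Q qopen_def
proof (intro conjI ballI)
  show "fm f ` W \<subseteq> carrier" using assms by (auto simp: carrier_def)
  fix e assume "e \<in> E"
  then have "{0..1} \<inter> em e -` fm f ` W = {}"
    using em_in_skel[of e] fm_notin_skel[OF assms(1)] assms(3) by fastforce
  then show "openin (top_of_set {0..1}) ({0..1} \<inter> em e -` fm f ` W)" by simp
next
  fix f' assume f': "f' \<in> F"
  have "cball 0 1 \<inter> fm f' -` fm f ` W = (if f = f' then W else {})"
  proof (intro equalityI subsetI)
    fix z assume z: "z \<in> cball 0 1 \<inter> fm f' -` fm f ` W"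
    then obtain w where w: "w \<in> W" "fm f' z = fm f w" "norm w < 1" using assms by auto
    have "norm z \<noteq> 1"
      using w fm_sphere_skel[OF f', of z] fm_notin_skel[OF assms(1) w(3)] by auto
    then have "norm z < 1" using z by simp
    then show "z \<in> (if f = f' then W else {})" using fm_inj[OF f' assms(1) _ w(3) w(2)] w by simp
  qed (use assms in \<open>auto split: if_splits\<close>)
  moreover have "W \<subseteq> cball 0 1" using assms(3) by auto
  then have "openin (top_of_set (cball 0 1)) W" using assms(2) open_subset by blast
  ultimately show "openin (top_of_set (cball 0 1)) (cball 0 1 \<inter> fm f' -` fm f ` W)" by simp
qed

lemma gopen_em:
  assumes "e \<in> E" "open W" "W \<subseteq> {0<..<1}"
  shows "gopen (em e ` W)"
  unfolding gopen_def
proof (intro conjI ballI)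
  show "em e ` W \<subseteq> skel" using assms by (auto simp: skel_def)
  fix e' assume e': "e' \<in> E"
  have "{0..1} \<inter> em e' -` em e ` W = (if e = e' then W else {})"
  proof (intro equalityI subsetI)
    fix t assume t: "t \<in> {0..1} \<inter> em e' -` em e ` W"
    then obtain w where w: "w \<in> W" "em e' t = em e w" "0 < w" "w < 1" using assms by auto
    then have "t \<noteq> 0" "t \<noteq> 1" using em_ends[OF e'] em_notin_V[OF assms(1), of w] by auto
    then have "0 < t" "t < 1" using t by auto
    then show "t \<in> (if e = e' then W else {})" using em_inj[OF e' assms(1) _ _ w(3,4,2)] w by simp
  qed (use assms in \<open>auto split: if_splits\<close>)
  moreover have "W \<subseteq> {0..1}" using assms(3) by auto
  then have "openin (top_of_set {0..1}) W" using assms(2) open_subset by blast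
  ultimately show "openin (top_of_set {0..1}) ({0..1} \<inter> em e' -` em e ` W)" by simp
qed

text \<open>The ends have length 1/3 so that the two ends of one edge stay disjoint; if the edge is
  a loop at \<open>v\<close>, both belong to this neighbourhood.\<close>

definition vertex_nbd :: "'p \<Rightarrow> 'p set" where
  "vertex_nbd v = {v} \<union> (\<Union>e\<in>E. em e ` ({t. 0 < t \<and> t < 1/3 \<and> em e 0 = v} \<union> {t. 2/3 < t \<and> t < 1 \<and> em e 1 = v}))"

lemma em_vimage_vertex_nbd:
  assumes "v \<in> V" "e \<in> E"
  shows "{0..1::real} \<inter> em e -` vertex_nbd v =
     {t \<in> {0..1}. t < 1/3 \<and> em e 0 = v} \<union> {t \<in> {0..1}. 2/3 < t \<and> em e 1 = v}"
proof (intro equalityI subsetI)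
  fix t :: real assume t: "t \<in> {0..1} \<inter> em e -` vertex_nbd v"
  then consider "t = 0" | "t = 1" | "0 < t" "t < 1" by force
  then show "t \<in> {t \<in> {0..1}. t < 1/3 \<and> em e 0 = v} \<union> {t \<in> {0..1}. 2/3 < t \<and> em e 1 = v}"
  proof cases
    case 1
    then have "em e 0 = v" using t em_notin_V em_ends(1)[OF assms(2)] by (fastforce simp: vertex_nbd_def)
    then show ?thesis using 1 by simp
  next
    case 2
    then have "em e 1 = v" using t em_notin_V em_ends(2)[OF assms(2)] by (fastforce simp: vertex_nbd_def)
    then show ?thesis using 2 by simp
  next
    case 3
    have "em e t \<noteq> v" using em_notin_V[OF assms(2) 3] assms(1) by auto
    then obtain e' t' where "e' \<in> E" "em e t = em e' t'" and t': "(0 < t' \<and> t' < 1/3 \<and> em e' 0 = v) \<or> (2/3 < t' \<and> t' < 1 \<and> em e' 1 = v)"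
      using t by (auto simp: vertex_nbd_def)
    then have "e = e'" "t = t'" using em_inj[of e e' t t'] assms 3 by auto
    then show ?thesis using t' 3 by auto
  qed
next
  fix t :: real assume t: "t \<in> {t \<in> {0..1}. t < 1/3 \<and> em e 0 = v} \<union> {t \<in> {0..1}. 2/3 < t \<and> em e 1 = v}"
  show "t \<in> {0..1} \<inter> em e -` vertex_nbd v"
  proof (cases "t = 0 \<or> t = 1")
    case True
    then show ?thesis using t by (auto simp: vertex_nbd_def)
  next
    case False
    then have "0 < t" "t < 1" using t by auto
    then show ?thesis using t assms(2) by (auto simp: vertex_nbd_def)
  qed
qed

lemma gopen_vertex_nbd:
  assumes "v \<in> V" shows "gopen (vertex_nbd v)"
  unfolding gopen_def
proof (intro conjI ballI)
  show "vertex_nbd v \<subseteq> skel" using assms by (auto simp: vertex_nbd_def skel_def)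
  fix e assume "e \<in> E"
  have "openin (top_of_set {0..1}) ({0..1} \<inter> ({t::real. t < 1/3 \<and> em e 0 = v} \<union> {t. 2/3 < t \<and> em e 1 = v}))"
    by (intro openin_open_Int open_Un open_Collect_conj open_Collect_const open_Collect_less continuous_intros)
  moreover have "{0..1} \<inter> ({t::real. t < 1/3 \<and> em e 0 = v} \<union> {t. 2/3 < t \<and> em e 1 = v})
    = {0..1} \<inter> em e -` vertex_nbd v"
    unfolding em_vimage_vertex_nbd[OF assms \<open>e \<in> E\<close>] by auto
  ultimately show "openin (top_of_set {0..1}) ({0..1} \<inter> em e -` vertex_nbd v)" by simp
qed

subsection \<open>The quotient is a CW-complex\<close>

lemma star_disjoint:
  assumes "B \<inter> B' = {}" "B \<subseteq> skel" "B' \<subseteq> skel" shows "star B \<inter> star B' = {}"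
proof (rule ccontr)
  assume "star B \<inter> star B' \<noteq> {}"
  then obtain x where x: "x \<in> star B" "x \<in> star B'" by blast
  then have "x \<notin> skel" using star_skel[OF assms(2)] star_skel[OF assms(3)] assms(1) by blast
  then have "x \<notin> B" "x \<notin> B'" using assms by blast+
  then obtain f z f' z' where fz: "f \<in> F" "x = fm f z" "norm z < 1" "fm f (sgn z) \<in> B"
    "f' \<in> F" "x = fm f' z'" "norm z' < 1" "fm f' (sgn z') \<in> B'"
    using x unfolding star_def by blast
  then have "f = f'" "z = z'" using fm_inj[of f f' z z'] by metis+
  then show False using fz assms(1) by blast
qed

lemma skel_separation:
  assumes "x \<in> skel" "y \<in> skel" "x \<noteq> y"
  shows "\<exists>B B'. gopen B \<and> gopen B' \<and> x \<in> B \<and> y \<in> B' \<and> B \<inter> B' = {}"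
proof -
  have ve: "\<exists>B B'. gopen B \<and> gopen B' \<and> v \<in> B \<and> em e t \<in> B' \<and> B \<inter> B' = {}"
    if v: "v \<in> V" and e: "e \<in> E" "0 < t" "t < 1" for v e and t :: real
  proof -
    \<comment> \<open>Half the distance from \<open>t\<close> to the nearer end of the interval: the
      vertex lies off the closed middle part of the edge, and \<open>em e t\<close> lies in the
      interior of that part.\<close>
    define d where "d = min t (1 - t) / 2"
    have d: "0 < d" "d < t" "t < 1 - d" "d \<le> 1/4" using e by (auto simp: d_def min_def field_simps)
    have "skel - em e ` {d..1-d} \<inter> skel = skel - em e ` {d..1-d}" by blast
    have sub: "em e ` {d..1-d} \<subseteq> skel" using d e by (auto simp: skel_def)
    have "gopen (skel - em e ` {d..1-d})"
      unfolding gopen_def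
    proof (intro conjI ballI)
      fix e' assume e': "e' \<in> E"
      have "{0..1} \<inter> em e' -` (skel - em e ` {d..1-d}) = {0..1} - (if e = e' then {d..1-d} else {})"
      proof (intro equalityI subsetI)
        fix s assume "s \<in> {0..1} \<inter> em e' -` (skel - em e ` {d..1-d})"
        then show "s \<in> {0..1} - (if e = e' then {d..1-d} else {})" by auto
      next
        fix s assume s: "s \<in> {0..1} - (if e = e' then {d..1-d} else {})"
        have "em e' s \<notin> em e ` {d..1-d}"
        proof
          assume "em e' s \<in> em e ` {d..1-d}"
          then obtain u where u: "d \<le> u" "u \<le> 1 - d" "em e' s = em e u" by (auto simp: image_iff)
          then have "s \<noteq> 0" "s \<noteq> 1" using em_ends[OF e'] em_notin_V[OF e(1), of u] d by auto
          then have "e' = e \<and> s = u" using s u d em_inj[OF e' e(1), of s u] by auto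
          then show False using s u by auto
        qed
        then show "s \<in> {0..1} \<inter> em e' -` (skel - em e ` {d..1-d})" using s em_in_skel[OF e', of s] by auto
      qed
      moreover have "openin (top_of_set {0..1}) ({0..1} - (if e = e' then {d..1-d} else {}))"
        by (subst openin_iff_closed_Diff) (auto simp: Diff_Diff_Int)
      ultimately show "openin (top_of_set {0..1}) ({0..1} \<inter> em e' -` (skel - em e ` {d..1-d}))" by simp
    qed blast
    moreover have "gopen (em e ` {d<..<1-d})" using d e by (intro gopen_em) auto
    moreover have "v \<in> skel - em e ` {d..1-d}" using v d em_notin_V[OF e(1)] by (auto simp: skel_def)
    moreover have "em e t \<in> em e ` {d<..<1-d}" using d by auto
    moreover have "(skel - em e ` {d..1-d}) \<inter> em e ` {d<..<1-d} = {}"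
      by auto
    ultimately show ?thesis by meson
  qed
  consider "x \<in> V" "y \<in> V" | "x \<in> V" "y \<notin> V" | "x \<notin> V" "y \<in> V" | "x \<notin> V" "y \<notin> V" by blast
  then show ?thesis
  proof cases
    case 1
    have "z \<notin> vertex_nbd y" if z: "z \<in> vertex_nbd x" for z
    proof
      assume zy: "z \<in> vertex_nbd y"
      show False
      proof (cases "z \<in> V")
        case True then show ?thesis using z zy assms em_notin_V by (fastforce simp: vertex_nbd_def)
      next
        case False
        then obtain e t where et: "e \<in> E" "z = em e t" "(0 < t \<and> t < 1/3 \<and> em e 0 = x) \<or> (2/3 < t \<and> t < 1 \<and> em e 1 = x)"
          using z False 1(1) unfolding vertex_nbd_def by (auto simp: image_iff)
        then have "t \<in> {0..1} \<inter> em e -` vertex_nbd y" using zy by auto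
        then show ?thesis unfolding em_vimage_vertex_nbd[OF 1(2) et(1)] using et assms by auto
      qed
    qed
    then show ?thesis using gopen_vertex_nbd[OF 1(1)] gopen_vertex_nbd[OF 1(2)]
      by (intro exI[of _ "vertex_nbd x"] exI[of _ "vertex_nbd y"]) (auto simp: vertex_nbd_def[of x] vertex_nbd_def[of y])
  next
    case 2
    then show ?thesis using assms ve[of x] by (auto simp: skel_def)
  next
    case 3
    then obtain e t where "e \<in> E" "x = em e t" "0 < t" "t < 1" using assms by (auto simp: skel_def)
    then show ?thesis using ve[OF 3(2)] by (metis Int_commute)
  next
    case 4
    then have "x \<in> (\<Union>e\<in>E. em e ` {0<..<1})" "y \<in> (\<Union>e\<in>E. em e ` {0<..<1})"
      using assms by (auto simp: skel_def)
    then obtain e t e' t' where et: "e \<in> E" "x = em e t" "0 < t" "t < 1" "e' \<in> E" "y = em e' t'" "0 < t'" "t' < 1"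
      by (auto simp: image_iff)
    obtain W W' where W: "open W" "open W'" "W \<subseteq> {0<..<1}" "W' \<subseteq> {0<..<1}" "t \<in> W" "t' \<in> W'" "e \<noteq> e' \<or> W \<inter> W' = {}"
    proof (cases "e = e'")
      case True
      then have "t \<noteq> t'" using et assms by auto
      then obtain U U' where "open U" "open U'" "t \<in> U" "t' \<in> U'" "U \<inter> U' = {}" using hausdorff by metis
      then show thesis using et by (intro that[of "U \<inter> {0<..<1}" "U' \<inter> {0<..<1}"]) auto
    next
      case False then show thesis using et by (intro that[of "{0<..<1}" "{0<..<1}"]) auto
    qed
    have "em e ` W \<inter> em e' ` W' = {}"
    proof -
      have "em e w \<noteq> em e' w'" if "w \<in> W" "w' \<in> W'" for w w'
        using that W em_inj[OF et(1,5), of w w'] by force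
      then show ?thesis by blast
    qed
    then show ?thesis using gopen_em[OF et(1) W(1,3)] gopen_em[OF et(5) W(2,4)] W et
      by (intro exI[of _ "em e ` W"] exI[of _ "em e' ` W'"]) auto
  qed
qed

text \<open>Two points of \<open>skel\<close> are separated by stars, whose disjointness comes from
  the 1-skeleton. A point inside a face is separated from points of the same open face within the
  disc, and from all others by an open concentric disc and the complement of the closed one.\<close>

lemma Hausdorff_Q: "Hausdorff_space Q"
  unfolding Hausdorff_space_def topspace_Q
proof (intro allI impI)
  fix x y assume xy: "x \<in> carrier \<and> y \<in> carrier \<and> x \<noteq> y"
  have face: "\<exists>U W. openin Q U \<and> openin Q W \<and> x \<in> U \<and> y \<in> W \<and> disjnt U W"
    if A: "x \<in> carrier" "y \<in> carrier" "x \<noteq> y" "x \<notin> skel" for x y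
  proof -
    obtain f z where fz: "f \<in> F" "x = fm f z" "norm z < 1"
      using A unfolding carrier_def by (auto simp: dist_norm)
    show ?thesis
    proof (cases "\<exists>w. norm w < 1 \<and> y = fm f w")
      case True
      then obtain w where w: "norm w < 1" "y = fm f w" by blast
      then have "z \<noteq> w" using fz A by auto
      then obtain U W where UW: "open U" "open W" "z \<in> U" "w \<in> W" "U \<inter> W = {}" using hausdorff by metis
      have "fm f u \<noteq> fm f w" if "u \<in> U" "w \<in> W" "norm u < 1" "norm w < 1" for u w
        using that UW fm_inj[OF fz(1) fz(1), of u w] by auto
      then have "disjnt (fm f ` (U \<inter> ball 0 1)) (fm f ` (W \<inter> ball 0 1))"
        unfolding disjnt_def by fastforce
      moreover have "openin Q (fm f ` (U \<inter> ball 0 1))" "openin Q (fm f ` (W \<inter> ball 0 1))"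
        using UW by (auto intro!: open_face_image fz)
      ultimately show ?thesis using UW fz w
        by (intro exI[of _ "fm f ` (U \<inter> ball 0 1)"] exI[of _ "fm f ` (W \<inter> ball 0 1)"]) auto
    next
      case False
      obtain \<rho> where \<rho>: "norm z < \<rho>" "\<rho> < 1" using fz dense by blast
      have cm: "compactin Q (fm f ` cball 0 \<rho>)"
      proof (rule image_compactin)
        show "compactin (top_of_set (cball 0 1)) (cball (0::complex) \<rho>)"
          using \<rho> by (auto simp: compactin_subtopology)
        show "continuous_map (top_of_set (cball 0 1)) Q (fm f)" by (rule continuous_fm[OF fz(1)])
      qed
      have "closedin Q (fm f ` cball 0 \<rho>)"
        unfolding closedin_Q
      proof (intro conjI ballI)
        show "fm f ` cball 0 \<rho> \<subseteq> carrier" using \<rho> fz by (auto simp: carrier_def)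
        show "closed ({0..1} \<inter> em e -` fm f ` cball 0 \<rho>)" if "e \<in> E" for e
        proof -
          have "{0..1} \<inter> em e -` fm f ` cball 0 \<rho> = {}"
            using em_in_skel[OF that] fm_notin_skel[OF fz(1)] \<rho> by fastforce
          then show ?thesis by simp
        qed
        show "closed (cball 0 1 \<inter> fm f' -` fm f ` cball 0 \<rho>)" if f': "f' \<in> F" for f'
        proof -
          have "cball 0 1 \<inter> fm f' -` fm f ` cball 0 \<rho> = (if f = f' then cball 0 \<rho> else {})"
          proof (intro equalityI subsetI)
            fix z assume z: "z \<in> cball 0 1 \<inter> fm f' -` fm f ` cball 0 \<rho>"
            then obtain w where w: "norm w \<le> \<rho>" "fm f' z = fm f w" "norm w < 1" using \<rho> by auto
            have "norm z \<noteq> 1"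
              using w fm_sphere_skel[OF f', of z] fm_notin_skel[OF fz(1) w(3)] by auto
            then have "norm z < 1" using z by simp
            then show "z \<in> (if f = f' then cball 0 \<rho> else {})" using fm_inj[OF f' fz(1) _ w(3) w(2)] w by simp
          qed (use \<rho> in \<open>auto split: if_splits\<close>)
          then show ?thesis by simp
        qed
      qed
      then have "openin Q (carrier - fm f ` cball 0 \<rho>)" by (metis closedin_def topspace_Q)
      moreover have "openin Q (fm f ` ball 0 \<rho>)" using \<rho> by (auto intro!: open_face_image fz)
      moreover have "y \<in> carrier - fm f ` cball 0 \<rho>" using False \<rho> A by force
      moreover have "disjnt (fm f ` ball 0 \<rho>) (carrier - fm f ` cball 0 \<rho>)"
        unfolding disjnt_def using ball_subset_cball by fastforce
      ultimately show ?thesis using fz \<rho>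
        by (intro exI[of _ "fm f ` ball 0 \<rho>"] exI[of _ "carrier - fm f ` cball 0 \<rho>"]) auto
    qed
  qed
  show "\<exists>U W. openin Q U \<and> openin Q W \<and> x \<in> U \<and> y \<in> W \<and> disjnt U W"
  proof (cases "x \<in> skel \<and> y \<in> skel")
    case True
    then obtain B B' where "gopen B" "gopen B'" "x \<in> B" "y \<in> B'" "B \<inter> B' = {}"
      using skel_separation[of x y] xy by blast
    moreover from this have "star B \<inter> star B' = {}"
      using star_disjoint[of B B'] unfolding gopen_def by blast
    moreover have "B \<subseteq> star B" "B' \<subseteq> star B'" unfolding star_def by blast+
    ultimately show ?thesis using open_star[of B] open_star[of B'] unfolding disjnt_def by blast
  next
    case False
    then consider "x \<notin> skel" | "y \<notin> skel" by blast
    then show ?thesis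
    proof cases
      case 1 then show ?thesis using face[of x y] xy by blast
    next
      case 2
      then obtain U W where "openin Q U" "openin Q W" "y \<in> U" "x \<in> W" "disjnt U W"
        using face[of y x] xy by blast
      then show ?thesis by (intro exI[of _ W] exI[of _ U]) (simp add: disjnt_sym)
    qed
  qed
qed

end

section \<open>The model discs of dimension 1 and 2 as the unit interval and the complex unit
  disc\<close>

lemma continuous_map_coordinate_disc:
  "continuous_map (closed_disc n) euclideanreal (\<lambda>x. x i)" "continuous_map (open_disc n) euclideanreal (\<lambda>x. x i)"
  unfolding closed_disc_def open_disc_def Euclidean_space_def
  by (intro continuous_map_from_subtopology continuous_map_product_projection; simp)+

lemma topspace_closed_disc: "topspace (closed_disc n) = {x. (\<forall>i\<ge>n. x i = 0) \<and> (\<Sum>i<n. (x i)\<^sup>2) \<le> 1}"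
  and topspace_open_disc: "topspace (open_disc n) = {x. (\<forall>i\<ge>n. x i = 0) \<and> (\<Sum>i<n. (x i)\<^sup>2) < 1}"
  by (auto simp: closed_disc_def open_disc_def topspace_Euclidean_space)

lemma continuous_map_into_open_disc:
  assumes "\<And>i. continuous_map X euclideanreal (\<lambda>x. g x i)" "\<And>x. x \<in> topspace X \<Longrightarrow> g x \<in> topspace (open_disc n)"
  shows "continuous_map X (open_disc n) g"
proof -
  have "continuous_map X (powertop_real UNIV) g"
    using assms(1) by (simp add: continuous_map_componentwise_UNIV)
  then show ?thesis
    using assms(2) unfolding open_disc_def Euclidean_space_def
    by (auto simp: continuous_map_in_subtopology)
qed

lemma disc1_closed: "continuous_map (closed_disc 1) (top_of_set {0..1}) (\<lambda>x. (x 0 + 1) / 2)"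
proof -
  have "-1 \<le> x 0 \<and> x 0 \<le> 1" if "x \<in> topspace (closed_disc 1)" for x
    using that by (auto simp: topspace_closed_disc abs_square_le_1 abs_le_iff)
  then have "(x 0 + 1) / 2 \<in> {0..1}" if "x \<in> topspace (closed_disc 1)" for x
    using that by fastforce
  then show ?thesis
    by (auto simp: continuous_map_in_subtopology
        intro!: continuous_intros continuous_map_coordinate_disc)
qed

lemma disc1_open: "homeomorphic_map (open_disc 1) (top_of_set {0<..<1}) (\<lambda>x. (x 0 + 1) / 2)"
  unfolding homeomorphic_map_maps homeomorphic_maps_def
proof (intro exI conjI ballI)
  let ?g = "\<lambda>t (i::nat). if i = 0 then 2 * t - 1 else (0::real)"
  have "-1 < x 0 \<and> x 0 < 1" if "x \<in> topspace (open_disc 1)" for x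
    using that by (auto simp: topspace_open_disc abs_square_less_1 abs_less_iff)
  then have "(x 0 + 1) / 2 \<in> {0<..<1}" if "x \<in> topspace (open_disc 1)" for x
    using that by fastforce
  then show "continuous_map (open_disc 1) (top_of_set {0<..<1}) (\<lambda>x. (x 0 + 1) / 2)"
    by (auto simp: continuous_map_in_subtopology
        intro!: continuous_intros continuous_map_coordinate_disc)
  show "continuous_map (top_of_set {0<..<1}) (open_disc 1) ?g"
  proof (rule continuous_map_into_open_disc)
    show "continuous_map (top_of_set {0<..<1}) euclideanreal (\<lambda>t. ?g t i)" for i
      by (cases "i = 0") (auto intro!: continuous_intros)
    show "?g t \<in> topspace (open_disc 1)" if "t \<in> topspace (top_of_set {0<..<1})" for t
    proof -
      have "\<bar>2 * t - 1\<bar> < 1" using that by auto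
      then show ?thesis by (simp add: topspace_open_disc abs_square_less_1)
    qed
  qed
  show "?g ((x 0 + 1) / 2) = x" if "x \<in> topspace (open_disc 1)" for x
  proof
    fix i show "?g ((x 0 + 1) / 2) i = x i"
      using that by (cases "i = 0") (auto simp: topspace_open_disc field_simps)
  qed
qed simp

lemma disc2_closed: "continuous_map (closed_disc 2) (top_of_set (cball 0 1)) (\<lambda>x. Complex (x 0) (x 1))"
proof -
  have "continuous_map (closed_disc 2) euclidean (\<lambda>x. complex_of_real (x 0) + \<i> * complex_of_real (x 1))"
  proof (rule continuous_map_add)
    have 1: "continuous_map euclideanreal euclidean complex_of_real"
      "continuous_map euclideanreal euclidean (\<lambda>t. \<i> * complex_of_real t)"
      by (auto intro!: continuous_intros)
    show "continuous_map (closed_disc 2) euclidean (\<lambda>x. complex_of_real (x 0))"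
      using continuous_map_compose[OF continuous_map_coordinate_disc(1) 1(1)] by (simp add: o_def)
    show "continuous_map (closed_disc 2) euclidean (\<lambda>x. \<i> * complex_of_real (x 1))"
      using continuous_map_compose[OF continuous_map_coordinate_disc(1) 1(2)] by (simp add: o_def)
  qed
  then have "continuous_map (closed_disc 2) euclidean (\<lambda>x. Complex (x 0) (x 1))"
    by (simp add: complex_eq_iff Complex_eq)
  moreover have "norm (Complex (x 0) (x 1)) \<le> 1" if "x \<in> topspace (closed_disc 2)" for x
    using that by (simp add: topspace_closed_disc cmod_def numeral_2_eq_2)
  ultimately show ?thesis by (auto simp: continuous_map_in_subtopology)
qed

lemma disc2_open: "homeomorphic_map (open_disc 2) (top_of_set (ball 0 1)) (\<lambda>x. Complex (x 0) (x 1))"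
  unfolding homeomorphic_map_maps homeomorphic_maps_def
proof (intro exI conjI ballI)
  let ?g = "\<lambda>z (i::nat). if i = 0 then Re z else if i = 1 then Im z else 0"
  have sub: "open_disc 2 = subtopology (closed_disc 2) (topspace (open_disc 2))"
  proof -
    have "{x::nat \<Rightarrow> real. (\<Sum>i<2. (x i)\<^sup>2) < 1} = {x. (\<Sum>i<2. (x i)\<^sup>2) \<le> 1} \<inter> {x. (\<Sum>i<2. (x i)\<^sup>2) < 1}" by auto
    then have "open_disc 2 = subtopology (closed_disc 2) {x. (\<Sum>i<2. (x i)\<^sup>2) < 1}"
      by (metis closed_disc_def open_disc_def subtopology_subtopology)
    then show ?thesis by (metis subtopology_restrict subtopology_topspace topspace_subtopology)
  qed
  have "continuous_map (open_disc 2) (top_of_set (cball 0 1)) (\<lambda>x. Complex (x 0) (x 1))"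
    by (subst sub) (rule continuous_map_from_subtopology[OF disc2_closed])
  moreover have "norm (Complex (x 0) (x 1)) < 1" if "x \<in> topspace (open_disc 2)" for x
    using that by (simp add: topspace_open_disc cmod_def numeral_2_eq_2)
  ultimately show "continuous_map (open_disc 2) (top_of_set (ball 0 1)) (\<lambda>x. Complex (x 0) (x 1))"
    by (auto simp: continuous_map_in_subtopology)
  show "continuous_map (top_of_set (ball 0 1)) (open_disc 2) ?g"
  proof (rule continuous_map_into_open_disc)
    show "continuous_map (top_of_set (ball 0 1)) euclideanreal (\<lambda>t. ?g t i)" for i
      by (cases "i = 0"; cases "i = 1") (auto intro!: continuous_intros)
    show "?g z \<in> topspace (open_disc 2)" if "z \<in> topspace (top_of_set (ball 0 1))" for z
      using that by (simp add: topspace_open_disc cmod_def numeral_2_eq_2)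
  qed
  show "?g (Complex (x 0) (x 1)) = x" if "x \<in> topspace (open_disc 2)" for x
    using that by (auto simp: topspace_open_disc fun_eq_iff numeral_2_eq_2 dest: le_neq_implies_less)
  show "Complex (?g z 0) (?g z 1) = z" if "z \<in> topspace (top_of_set (ball 0 1))" for z
    by simp
qed

text \<open>Recognises an open cell as embedded even when it is not open in the complex, as is the
  case for edges: each open subset of the cell only has to be the trace of some open set, for which
  stars are used.\<close>

lemma embedding_from_open_images:
  assumes "continuous_map (top_of_set T) X \<phi>" "S \<subseteq> T" "inj_on \<phi> S"
    and "\<And>W. openin (top_of_set S) W \<Longrightarrow> \<exists>U. openin X U \<and> U \<inter> \<phi> ` S = \<phi> ` W"
  shows "homeomorphic_map (top_of_set S) (subtopology X (\<phi> ` S)) \<phi>"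
proof (rule bijective_open_imp_homeomorphic_map)
  have "continuous_map (top_of_set S) X \<phi>"
    using assms(1,2) by (rule continuous_map_from_subtopology_mono)
  then show "continuous_map (top_of_set S) (subtopology X (\<phi> ` S)) \<phi>"
    by (auto simp: continuous_map_in_subtopology)
  have "\<phi> ` S \<subseteq> topspace X" using assms(1,2) by (auto simp: continuous_map_def)
  then show "\<phi> ` topspace (top_of_set S) = topspace (subtopology X (\<phi> ` S))" by auto
  show "open_map (top_of_set S) (subtopology X (\<phi> ` S)) \<phi>"
    unfolding open_map_def
  proof (intro allI impI)
    fix W assume "openin (top_of_set S) W"
    then show "openin (subtopology X (\<phi> ` S)) (\<phi> ` W)"
      using assms(4)[of W] unfolding openin_subtopology[of X] by metis
  qed
  show "inj_on \<phi> (topspace (top_of_set S))" using assms(3) by simp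
qed

context cell_quotient
begin

lemma CX_simps: "space_of CX = Q" "cells CX 0 = (\<lambda>v. {v}) ` V" "cells CX 1 = (\<lambda>e. em e ` {0<..<1}) ` E"
  "cells CX (Suc 0) = (\<lambda>e. em e ` {0<..<1}) ` E"
  "cells CX 2 = (\<lambda>f. fm f ` ball 0 1) ` F" "n > 2 \<Longrightarrow> cells CX n = {}"
  by (simp_all add: CX_def)

lemma cells_CX_cases:
  assumes "e \<in> cells CX n"
  obtains v where "n = 0" "v \<in> V" "e = {v}" | x where "n = 1" "x \<in> E" "e = em x ` {0<..<1}"
    | f where "n = 2" "f \<in> F" "e = fm f ` ball 0 1"
  using assms by (auto simp: CX_def split: if_splits)

lemma characteristic_vertex:
  assumes "v \<in> V" shows "characteristic_map CX 0 {v} (\<lambda>_. v)"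
  unfolding characteristic_map_def CX_simps
proof (intro conjI)
  have v: "v \<in> topspace Q" using assms skel_carrier by (auto simp: topspace_Q skel_def)
  then show "continuous_map (closed_disc 0) Q (\<lambda>_. v)" by simp
  have "{\<lambda>_. 0::real} = topspace (open_disc 0)" by (auto simp: topspace_open_disc)
  then show "homeomorphic_map (open_disc 0) (subtopology Q {v}) (\<lambda>_. v)"
  proof (intro bijective_open_imp_homeomorphic_map)
    show "open_map (open_disc 0) (subtopology Q {v}) (\<lambda>_. v)"
      unfolding open_map_def
    proof (intro allI impI)
      fix U :: "(nat \<Rightarrow> real) set"
      have "topspace (subtopology Q {v}) = {v}" using v by auto
      then have "openin (subtopology Q {v}) {v}" by (metis openin_topspace)
      moreover have "(\<lambda>_. v) ` U = {v}" if "U \<noteq> {}" using that by auto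
      ultimately show "openin (subtopology Q {v}) ((\<lambda>_. v) ` U)" by (cases "U = {}") simp_all
    qed
  qed (use v in \<open>auto simp flip: \<open>{\<lambda>_. 0::real} = _\<close>\<close>)
  have "boundary_sphere 0 = {}" by (auto simp: boundary_sphere_def)
  then show "\<exists>F. finite F \<and> F \<subseteq> (\<Union>m<0. cells CX m) \<and> (\<lambda>_. v) ` boundary_sphere 0 \<subseteq> \<Union> F"
    by auto
qed

lemma characteristic_edge:
  assumes e: "e \<in> E" shows "characteristic_map CX 1 (em e ` {0<..<1}) (em e \<circ> (\<lambda>x. (x 0 + 1) / 2))"
  unfolding characteristic_map_def CX_simps
proof (intro conjI)
  show "continuous_map (closed_disc 1) Q (em e \<circ> (\<lambda>x. (x 0 + 1) / 2))"
    using disc1_closed continuous_em[OF e] by (rule continuous_map_compose)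
  have "homeomorphic_map (top_of_set {0<..<1}) (subtopology Q (em e ` {0<..<1})) (em e)"
  proof (rule embedding_from_open_images[OF continuous_em[OF e]])
    show "inj_on (em e) {0<..<1}" using em_inj[OF e e] by (force simp: inj_on_def)
    fix W :: "real set" assume "openin (top_of_set {0<..<1}) W"
    then have W: "open W" "W \<subseteq> {0<..<1}" using openin_open_eq[of "{0<..<1::real}"] by auto
    have "em e ` {0<..<1} \<subseteq> skel" using e by (auto simp: skel_def)
    then have "star (em e ` W) \<inter> em e ` {0<..<1} = em e ` W"
      using star_skel[of "em e ` W"] W(2) by blast
    then show "\<exists>U. openin Q U \<and> U \<inter> em e ` {0<..<1} = em e ` W"
      using open_star[OF gopen_em[OF e W]] by blast
  qed auto
  then show "homeomorphic_map (open_disc 1) (subtopology Q (em e ` {0<..<1})) (em e \<circ> (\<lambda>x. (x 0 + 1) / 2))"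
    using disc1_open homeomorphic_map_compose by blast
  have "em e ((x 0 + 1) / 2) \<in> {em e 0, em e 1}" if "x \<in> boundary_sphere 1" for x
    using that by (auto simp: boundary_sphere_def power2_eq_1_iff)
  then show "\<exists>F. finite F \<and> F \<subseteq> (\<Union>m<1. cells CX m) \<and> (em e \<circ> (\<lambda>x. (x 0 + 1) / 2)) ` boundary_sphere 1 \<subseteq> \<Union> F"
    using em_ends[OF e] by (intro exI[of _ "{{em e 0}, {em e 1}}"]) (auto simp: CX_simps)
qed

lemma characteristic_face:
  assumes f: "f \<in> F" shows "characteristic_map CX 2 (fm f ` ball 0 1) (fm f \<circ> (\<lambda>x. Complex (x 0) (x 1)))"
  unfolding characteristic_map_def CX_simps
proof (intro conjI)
  show "continuous_map (closed_disc 2) Q (fm f \<circ> (\<lambda>x. Complex (x 0) (x 1)))"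
    using disc2_closed continuous_fm[OF f] by (rule continuous_map_compose)
  have "homeomorphic_map (top_of_set (ball 0 1)) (subtopology Q (fm f ` ball 0 1)) (fm f)"
  proof (rule embedding_from_open_images[OF continuous_fm[OF f]])
    show "inj_on (fm f) (ball 0 1)" using fm_inj[OF f f] by (auto simp: inj_on_def)
    fix W :: "complex set" assume "openin (top_of_set (ball 0 1)) W"
    then have W: "open W" "W \<subseteq> ball 0 1" using openin_open_eq[of "ball (0::complex) 1"] by auto
    then show "\<exists>U. openin Q U \<and> U \<inter> fm f ` ball 0 1 = fm f ` W"
      using open_face_image[OF f W] by blast
  qed auto
  then show "homeomorphic_map (open_disc 2) (subtopology Q (fm f ` ball 0 1)) (fm f \<circ> (\<lambda>x. Complex (x 0) (x 1)))"
    using disc2_open homeomorphic_map_compose by blast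
  let ?S = "fst ` set (bd f)"
  \<comment> \<open>Closure finiteness: the boundary word is finite, and each of its letters meets
    at most two vertices and one open edge.\<close>
  let ?F = "(\<lambda>e. {em e 0}) ` ?S \<union> (\<lambda>e. {em e 1}) ` ?S \<union> (\<lambda>e. em e ` {0<..<1}) ` ?S"
  have S: "?S \<subseteq> E" using bd(2)[OF f] by auto
  have "?F \<subseteq> (\<Union>m<2. cells CX m)"
  proof -
    have l: "{..<2} = {0, 1::nat}" by auto
    have c: "(\<Union>m<2. cells CX m) = (\<lambda>v. {v}) ` V \<union> (\<lambda>e. em e ` {0<..<1}) ` E"
      unfolding l by (simp add: CX_simps)
    show ?thesis
      unfolding c
    proof (intro Un_least)
      show "(\<lambda>e. {em e 0}) ` ?S \<subseteq> (\<lambda>v. {v}) ` V \<union> (\<lambda>e. em e ` {0<..<1}) ` E"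
        using S em_ends(1) by (intro le_supI1 image_subsetI imageI) blast
      show "(\<lambda>e. {em e 1}) ` ?S \<subseteq> (\<lambda>v. {v}) ` V \<union> (\<lambda>e. em e ` {0<..<1}) ` E"
        using S em_ends(2) by (intro le_supI1 image_subsetI imageI) blast
      show "(\<lambda>e. em e ` {0<..<1}) ` ?S \<subseteq> (\<lambda>v. {v}) ` V \<union> (\<lambda>e. em e ` {0<..<1}) ` E"
        using S by (intro le_supI2 image_mono)
    qed
  qed
  then obtain G where G: "G = ?F" "G \<subseteq> (\<Union>m<2. cells CX m)" by blast
  have "finite G" unfolding G by simp
  have mem: "{em e 0} \<in> G" "{em e 1} \<in> G" "em e ` {0<..<1} \<in> G" if "e \<in> ?S" for e
    using that unfolding G by (simp_all only: Un_iff) (blast intro: imageI)+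
  have "fm f (Complex (x 0) (x 1)) \<in> \<Union>G" if "x \<in> boundary_sphere 2" for x
  proof -
    have "norm (Complex (x 0) (x 1)) = 1" using that by (simp add: boundary_sphere_def cmod_def numeral_2_eq_2)
    then obtain i t where it: "i < length (bd f)" "0 \<le> t" "t < 1"
      "fm f (Complex (x 0) (x 1)) = em (fst (bd f ! i)) (if snd (bd f ! i) then t else 1 - t)"
      using fm_sphere[OF f] by metis
    define s where "s = (if snd (bd f ! i) then t else 1 - t)"
    define e where "e = fst (bd f ! i)"
    have e: "e \<in> ?S" using it by (auto simp: e_def)
    have "s = 0 \<or> s = 1 \<or> s \<in> {0<..<1}" using it by (auto simp: s_def)
    then have "em e s \<in> \<Union>G"
    proof (elim disjE)
      assume "s \<in> {0<..<1}"
      then show ?thesis using mem(3)[OF e] by (intro UnionI[of "em e ` {0<..<1}"] imageI)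
    next
      assume "s = 0" then show ?thesis using mem(1)[OF e] by (intro UnionI[of "{em e 0}"]) simp_all
    next
      assume "s = 1" then show ?thesis using mem(2)[OF e] by (intro UnionI[of "{em e 1}"]) simp_all
    qed
    then show ?thesis using it(4) by (simp add: s_def e_def)
  qed
  then have "(fm f \<circ> (\<lambda>x. Complex (x 0) (x 1))) ` boundary_sphere 2 \<subseteq> \<Union>G"
    by (intro image_subsetI) simp
  then show "\<exists>F'. finite F' \<and> F' \<subseteq> (\<Union>m<2. cells CX m) \<and>
      (fm f \<circ> (\<lambda>x. Complex (x 0) (x 1))) ` boundary_sphere 2 \<subseteq> \<Union> F'"
    using \<open>finite G\<close> G(2) by blast
qed

text \<open>The closure of an open cell contains the whole image of its closed interval or disc.
  Hence the trace of \<open>A\<close> on this closure has the same preimage in the interval or disc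
  as \<open>A\<close> itself.\<close>

lemma closed_cells_weak:
  assumes "A \<subseteq> carrier" "\<And>n e. e \<in> cells CX n \<Longrightarrow> closedin Q (A \<inter> Q closure_of e)"
  shows "closedin Q A"
  unfolding closedin_Q
proof (intro conjI ballI)
  fix e assume e: "e \<in> E"
  have "em e ` {0..1} \<subseteq> Q closure_of (em e ` {0<..<1})"
    using continuous_map_image_closure_subset[OF continuous_em[OF e], of "{0<..<1}"]
    by (simp add: closure_of_subtopology Int_absorb1 greaterThanLessThan_subseteq_atLeastAtMost_iff)
  then have "{0..1} \<inter> em e -` A = {0..1} \<inter> em e -` (A \<inter> Q closure_of (em e ` {0<..<1}))" by blast
  moreover have "closedin Q (A \<inter> Q closure_of (em e ` {0<..<1}))"
    using assms(2)[of "em e ` {0<..<1}" 1] e by (simp add: CX_simps)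
  ultimately show "closed ({0..1} \<inter> em e -` A)" using e unfolding closedin_Q by metis
next
  fix f assume f: "f \<in> F"
  have "fm f ` cball 0 1 \<subseteq> Q closure_of (fm f ` ball 0 1)"
    using continuous_map_image_closure_subset[OF continuous_fm[OF f], of "ball 0 1"]
    by (simp add: closure_of_subtopology Int_absorb1 ball_subset_cball)
  then have "cball 0 1 \<inter> fm f -` A = cball 0 1 \<inter> fm f -` (A \<inter> Q closure_of (fm f ` ball 0 1))" by blast
  moreover have "closedin Q (A \<inter> Q closure_of (fm f ` ball 0 1))"
    using assms(2)[of "fm f ` ball 0 1" 2] f by (simp add: CX_simps)
  ultimately show "closed (cball 0 1 \<inter> fm f -` A)" using f unfolding closedin_Q by metis
qed (rule assms)

lemma cells_disjoint:
  assumes "e \<in> cells CX m" "e' \<in> cells CX n" "(m, e) \<noteq> (n, e')"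
  shows "disjnt e e'"
proof -
  have ev: "disjnt {v} (em x ` {0<..<1})" if "v \<in> V" "x \<in> E" for v x
    using that em_notin_V by (auto simp: disjnt_def)
  have fv: "disjnt {v} (fm f ` ball 0 1)" if "v \<in> V" "f \<in> F" for v f
    using that fm_notin_V by (auto simp: disjnt_def)
  have ef: "disjnt (em x ` {0<..<1}) (fm f ` ball 0 1)" if "x \<in> E" "f \<in> F" for x f
    unfolding disjnt_iff using that em_neq_fm by fastforce
  have ee: "disjnt (em x ` {0<..<1}) (em y ` {0<..<1})" if "x \<in> E" "y \<in> E" "x \<noteq> y" for x y
    unfolding disjnt_iff using that em_inj[of x y] by force
  have ff: "disjnt (fm x ` ball 0 1) (fm y ` ball 0 1)" if "x \<in> F" "y \<in> F" "x \<noteq> y" for x y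
    unfolding disjnt_iff using that fm_inj[of x y] by force
  have sym: "disjnt A B" if "disjnt B A" for A B :: "'p set" using that by (rule disjnt_sym)
  from assms(1) show ?thesis
  proof (cases rule: cells_CX_cases)
    case a: (1 v)
    from assms(2) show ?thesis
    proof (cases rule: cells_CX_cases)
      case (1 w) then show ?thesis using a assms(3) by simp
    next
      case (2 y) then show ?thesis using a(2) ev unfolding a(3) 2(3) by blast
    next
      case (3 f) then show ?thesis using a(2) fv unfolding a(3) 3(3) by blast
    qed
  next
    case a: (2 x)
    from assms(2) show ?thesis
    proof (cases rule: cells_CX_cases)
      case (1 w) then show ?thesis using a(2) sym[OF ev] unfolding a(3) 1(3) by blast
    next
      case (2 y)
      then have "x \<noteq> y" using a assms(3) by blast
      then show ?thesis using a(2) 2(2) ee unfolding a(3) 2(3) by blast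
    next
      case (3 f) then show ?thesis using a(2) ef unfolding a(3) 3(3) by blast
    qed
  next
    case a: (3 f)
    from assms(2) show ?thesis
    proof (cases rule: cells_CX_cases)
      case (1 w) then show ?thesis using a(2) sym[OF fv] unfolding a(3) 1(3) by blast
    next
      case (2 y) then show ?thesis using a(2) sym[OF ef] unfolding a(3) 2(3) by blast
    next
      case (3 g)
      then have "f \<noteq> g" using a assms(3) by blast
      then show ?thesis using a(2) 3(2) ff unfolding a(3) 3(3) by blast
    qed
  qed
qed

theorem cw_complex_CX: "cw_complex CX"
  unfolding cw_complex_def CX_simps(1)
proof (intro conjI allI ballI impI)
  show "Hausdorff_space Q" by (rule Hausdorff_Q)
  show "(\<Union>n. \<Union> (cells CX n)) = topspace Q"
  proof
    show "(\<Union>n. \<Union> (cells CX n)) \<subseteq> topspace Q"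
    proof
      fix x assume "x \<in> (\<Union>n. \<Union> (cells CX n))"
      then obtain n e where "e \<in> cells CX n" "x \<in> e" by blast
      then show "x \<in> topspace Q" unfolding topspace_Q carrier_def skel_def
        by (cases rule: cells_CX_cases) blast+
    qed
    have "carrier = \<Union>(cells CX 0) \<union> \<Union>(cells CX 1) \<union> \<Union>(cells CX 2)"
      by (auto simp: CX_simps carrier_def skel_def)
    then show "topspace Q \<subseteq> (\<Union>n. \<Union> (cells CX n))" unfolding topspace_Q by blast
  qed
  show "disjnt e f" if "e \<in> cells CX m" "f \<in> cells CX n" "(m, e) \<noteq> (n, f)" for m n e f
    using that by (rule cells_disjoint)
  show "\<exists>\<phi>. characteristic_map CX n e \<phi>" if "e \<in> cells CX n" for n e
    using that characteristic_vertex characteristic_edge characteristic_face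
    by (cases rule: cells_CX_cases) blast+
  show "closedin Q A" if "A \<subseteq> topspace Q" "\<forall>n. \<forall>e\<in>cells CX n. closedin Q (A \<inter> Q closure_of e)" for A
    using that closed_cells_weak[of A] by (auto simp: topspace_Q)
qed

lemma finite_cells: "finite V \<Longrightarrow> finite E \<Longrightarrow> finite F \<Longrightarrow> finite (SIGMA n:UNIV. cells CX n)"
proof -
  assume fin: "finite V" "finite E" "finite F"
  have "(SIGMA n:UNIV. cells CX n) \<subseteq> {0,1,2} \<times> (cells CX 0 \<union> cells CX 1 \<union> cells CX 2)"
  proof
    fix x assume "x \<in> (SIGMA n:UNIV. cells CX n)"
    then obtain n e where x: "x = (n, e)" and e: "e \<in> cells CX n" by blast
    from e have "n = 0 \<or> n = 1 \<or> n = 2" by (cases rule: cells_CX_cases) simp_all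
    then show "x \<in> {0,1,2} \<times> (cells CX 0 \<union> cells CX 1 \<union> cells CX 2)" using x e by auto
  qed
  moreover have "finite ({0,1,2::nat} \<times> (cells CX 0 \<union> cells CX 1 \<union> cells CX 2))"
    unfolding CX_simps using fin by blast
  ultimately show ?thesis by (rule finite_subset)
qed

lemma skeleton_CX: "skeleton CX 0 = V" "n = 1 \<Longrightarrow> skeleton CX n = skel" "n \<ge> 2 \<Longrightarrow> skeleton CX n = carrier"
proof -
  have c0: "\<Union>(cells CX 0) = V" unfolding CX_simps by blast
  have c1: "\<Union>(cells CX 1) = (\<Union>e\<in>E. em e ` {0<..<1})" unfolding CX_simps by blast
  have c2: "\<Union>(cells CX 2) = (\<Union>f\<in>F. fm f ` ball 0 1)" unfolding CX_simps by blast
  have c3: "\<Union>(cells CX m) = {}" if "m \<notin> {0, 1, 2}" for m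
  proof -
    have "m > 2" using that by auto
    then show ?thesis by (simp add: CX_simps(6))
  qed
  have "{..0} = {0::nat}" "{..1} = {0, 1::nat}" by auto
  then show "skeleton CX 0 = V" "n = 1 \<Longrightarrow> skeleton CX n = skel"
    unfolding skeleton_def skel_def using c0 c1 by simp_all
  assume "n \<ge> 2"
  then have n: "{..n} = {0, 1, 2} \<union> {3..n}" by auto
  have "\<Union>(cells CX m) = {}" if "m \<in> {3..n}" for m using that by (intro c3) auto
  then have "(\<Union>m\<in>{3..n}. \<Union>(cells CX m)) = {}" by (metis (no_types, lifting) UN_empty2 SUP_cong)
  show "skeleton CX n = carrier"
    unfolding skeleton_def carrier_def skel_def n UN_Un \<open>(\<Union>m\<in>{3..n}. \<Union>(cells CX m)) = {}\<close>
    using c0 c1 c2 by (simp add: Un_assoc)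
qed

end

section \<open>The standard complex of a presentation as such a quotient\<close>

lemma cell_quotient_standard:
  assumes "\<And>r. r \<in> R \<Longrightarrow> r \<noteq> []" "\<And>r x. r \<in> R \<Longrightarrow> x \<in> set r \<Longrightarrow> fst x \<in> X"
  shows "cell_quotient {Vertex} X edge_map R face_map (\<lambda>r. r)"
  using assms by unfold_locales
    (simp_all add: face_map_circ edge_map_inner face_map_inner)

lemma standard_complex_CX:
  assumes "cell_quotient {Vertex} X edge_map R face_map (\<lambda>r. r)"
  shows "standard_complex X R = cell_quotient.CX {Vertex} X edge_map R face_map"
proof -
  interpret cell_quotient "{Vertex}" X edge_map R face_map "\<lambda>r. r" by (rule assms)
  have e: "edge_map g ` {0<..<1} = open_edge g" for g :: 'a
    unfolding open_edge_def by (rule image_cong) (simp_all add: edge_map_inner)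
  have f: "face_map r ` ball 0 1 = open_face r" for r :: "'a word"
    unfolding open_face_def by (rule image_cong) (simp_all add: face_map_inner)
  have "carrier = {Vertex} \<union> (\<Union>g\<in>X. open_edge g) \<union> (\<Union>r\<in>R. open_face r)"
    by (simp add: carrier_def skel_def e f)
  then have "qopen = standard_open X R"
    unfolding qopen_def standard_open_def by (intro ext) (simp only:)
  then have "Q = topology (standard_open X R)" unfolding Q_def by (rule arg_cong)
  moreover have "(\<lambda>v. {v}) ` {Vertex :: 'a point} = {{Vertex}}" by simp
  ultimately show ?thesis unfolding standard_complex_def CX_def e f by (simp only:)
qed

context cell_quotient begin
lemma vertex_nbd_iff: "x \<in> vertex_nbd v \<longleftrightarrow> x = v \<or> (\<exists>e\<in>E. \<exists>t. x = em e t \<and>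
    (0 < t \<and> t < 1/3 \<and> em e 0 = v \<or> 2/3 < t \<and> t < 1 \<and> em e 1 = v))"
  unfolding vertex_nbd_def by blast
end

section \<open>The covering of a standard complex given by an action of the group\<close>

text \<open>Pieces \<open>P j\<close>, given on closed letters and matching cyclically, agree with
  the single map that decodes a position by floor and fractional part. The matching enters at t = 1,
  where the floor has already moved to the next letter.\<close>

lemma piecewise_circ:
  fixes P :: "nat \<Rightarrow> real \<Rightarrow> 'p"
  assumes "i < n" "0 \<le> t" "t \<le> 1"
    and step: "\<And>j. Suc j < n \<Longrightarrow> P j 1 = P (Suc j) 0" and last: "\<And>j. Suc j = n \<Longrightarrow> P j 1 = P 0 0"
  shows "(let s = real n * (Arg2pi (circ n (real i + t)) / (2 * pi)) in P (nat \<lfloor>s\<rfloor>) (frac s)) = P i t"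
proof -
  have n: "n > 0" using assms by linarith
  have main: "(let s = real n * (Arg2pi (circ n (real j + u)) / (2 * pi)) in P (nat \<lfloor>s\<rfloor>) (frac s)) = P j u"
    if "j < n" "0 \<le> u" "u < 1" for j u
  proof -
    have l: "real j + u < real n" using that by linarith
    have "real n * (Arg2pi (circ n (real j + u)) / (2 * pi)) = real j + u"
      using Arg2pi_circ[OF n _ l] that n by simp
    moreover have "\<lfloor>real j + u\<rfloor> = int j" using that by linarith
    moreover have "frac (real j + u) = u" using that by (simp add: frac_def \<open>\<lfloor>real j + u\<rfloor> = int j\<close>)
    ultimately show ?thesis by simp
  qed
  show ?thesis
  proof (cases "t < 1")
    case True then show ?thesis using main assms by blast
  next
    case False
    then have t: "t = 1" using assms by simp
    define j where "j = (if Suc i < n then Suc i else 0)"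
    have "circ n (real i + t) = circ n (real j + 0)"
    proof (cases "Suc i < n")
      case False
      then have "real i + t = 0 + real n" using assms t by linarith
      then show ?thesis using circ_period[OF n, of 0] False by (simp add: j_def)
    qed (simp add: j_def t add.commute)
    then have "(let s = real n * (Arg2pi (circ n (real i + t)) / (2 * pi)) in P (nat \<lfloor>s\<rfloor>) (frac s)) = P j 0"
      using main[of j 0] n by (auto simp: j_def)
    also have "\<dots> = P i t"
      using step[of i] last[of i] assms(1) t by (cases "Suc i < n") (auto simp: j_def)
    finally show ?thesis .
  qed
qed

text \<open>A point of the covering is a pair of a sheet label and a point of the base, so that the
  projection is \<open>snd\<close>. Interior points of an edge carry the label of its initial
  vertex; the label changes only at the end point.\<close>

definition lift_edge :: "('g \<Rightarrow> 'v \<Rightarrow> 'v) \<Rightarrow> 'v \<times> 'g \<Rightarrow> real \<Rightarrow> 'v \<times> 'g point" where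
  "lift_edge act e t = (if t \<le> 0 then (fst e, Vertex)
     else if t < 1 then (fst e, Edge (snd e) t) else (act (snd e) (fst e), Vertex))"

text \<open>Words act from the right: the first letter is applied first, as in path lifting. Thus
  the conjugate of \<open>c\<close> by \<open>d\<close> acts as
  \<open>D (C (inv D x))\<close>.\<close>

definition wstep :: "('g \<Rightarrow> 'v \<Rightarrow> 'v) \<Rightarrow> 'v \<Rightarrow> 'g \<times> bool \<Rightarrow> 'v" where
  "wstep act v x = (if snd x then act (fst x) v else inv (act (fst x)) v)"

definition walk :: "('g \<Rightarrow> 'v \<Rightarrow> 'v) \<Rightarrow> 'v \<Rightarrow> 'g word \<Rightarrow> 'v" where
  "walk act v w = foldl (wstep act) v w"

text \<open>The oriented edges of the covering traversed by the lift of a word starting at \<open>v\<close>.\<close>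

primrec lift_word :: "('g \<Rightarrow> 'v \<Rightarrow> 'v) \<Rightarrow> 'v \<Rightarrow> 'g word \<Rightarrow> (('v \<times> 'g) \<times> bool) list" where
  "lift_word act v [] = []"
| "lift_word act v (x # w) =
     ((if snd x then v else wstep act v x, fst x), snd x) # lift_word act (wstep act v x) w"

definition lift_face :: "('g \<Rightarrow> 'v \<Rightarrow> 'v) \<Rightarrow> 'v \<times> 'g word \<Rightarrow> complex \<Rightarrow> 'v \<times> 'g point" where
  "lift_face act f z = (if norm z < 1 then (fst f, Face (snd f) z)
     else let s = real (length (snd f)) * (Arg2pi z / (2 * pi)); x = lift_word act (fst f) (snd f) ! nat \<lfloor>s\<rfloor>
          in lift_edge act (fst x) (if snd x then frac s else 1 - frac s))"

lemma length_lift_word [simp]: "length (lift_word act v w) = length w"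
  by (induction w arbitrary: v) auto

lemma lift_word_nth: "i < length w \<Longrightarrow> lift_word act v w ! i =
   ((if snd (w ! i) then walk act v (take i w) else walk act v (take (Suc i) w), fst (w ! i)), snd (w ! i))"
proof (induction w arbitrary: v i)
  case (Cons x w)
  then show ?case by (cases i) (auto simp: walk_def)
qed simp

lemma walk_Nil [simp]: "walk act v [] = v" and walk_Cons [simp]: "walk act v (x # w) = walk act (wstep act v x) w"
  by (simp_all add: walk_def)

lemma walk_Suc: "i < length w \<Longrightarrow> walk act v (take (Suc i) w) = wstep act (walk act v (take i w)) (w ! i)"
  by (simp add: walk_def take_Suc_conv_app_nth)

lemma UN_eq_Collect:
  assumes "\<And>v. G v \<subseteq> S" "\<And>x v. x \<in> G v \<Longrightarrow> f x \<in> B" "\<And>x. f x \<in> B \<Longrightarrow> \<exists>v. x \<in> G v"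
  shows "(\<Union>v. G v) = {x \<in> S. f x \<in> B}"
proof (intro equalityI subsetI)
  fix x assume "x \<in> (\<Union>v. G v)"
  then obtain v where v: "x \<in> G v" by blast
  from subsetD[OF assms(1) v] assms(2)[OF v] show "x \<in> {x \<in> S. f x \<in> B}" by simp
next
  fix x assume "x \<in> {x \<in> S. f x \<in> B}"
  then have "f x \<in> B" by simp
  from assms(3)[OF this] show "x \<in> (\<Union>v. G v)" by blast
qed

lemma ex1_bij: "bij f \<Longrightarrow> (\<exists>!v. P (f v)) \<longleftrightarrow> (\<exists>!u. P u)"
  unfolding bij_def inj_def surj_def by metis

text \<open>\<open>rel_trivial\<close> says that the permutations satisfy the relations: every lift
  of a relator is a closed path, so that a disc can be attached to it. The face is labelled by the
  vertex at which its boundary word starts.\<close>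

locale action_cover =
  fixes X :: "'g set" and R :: "'g word set" and act :: "'g \<Rightarrow> 'v \<Rightarrow> 'v"
  assumes bij_act: "g \<in> X \<Longrightarrow> bij (act g)"
    and rel_ne: "r \<in> R \<Longrightarrow> r \<noteq> []" and rel_letters: "r \<in> R \<Longrightarrow> x \<in> set r \<Longrightarrow> fst x \<in> X"
    and rel_trivial: "r \<in> R \<Longrightarrow> walk act v r = v"
begin

lemma act_inv: "g \<in> X \<Longrightarrow> act g (inv (act g) v) = v" "g \<in> X \<Longrightarrow> inv (act g) (act g v) = v"
  using bij_act[of g] by (simp_all add: bij_is_inj bij_is_surj surj_f_inv_f)

lemma bij_wstep: "fst x \<in> X \<Longrightarrow> bij (\<lambda>v. wstep act v x)"
  using bij_act[of "fst x"] bij_imp_bij_inv[of "act (fst x)"] unfolding wstep_def by (cases "snd x") simp_all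

lemma bij_walk: "(\<And>x. x \<in> set w \<Longrightarrow> fst x \<in> X) \<Longrightarrow> bij (\<lambda>v. walk act v w)"
proof (induction w)
  case Nil then show ?case using bij_id by (simp add: id_def)
next
  case (Cons x w)
  then have "bij ((\<lambda>v. walk act v w) \<circ> (\<lambda>v. wstep act v x))" by (intro bij_comp bij_wstep) auto
  then show ?case by (simp add: o_def)
qed

lemma lift_edge_simps: "lift_edge act e 0 = (fst e, Vertex)" "lift_edge act e 1 = (act (snd e) (fst e), Vertex)"
  "0 < t \<Longrightarrow> t < 1 \<Longrightarrow> lift_edge act e t = (fst e, Edge (snd e) t)"
  by (simp_all add: lift_edge_def)

lemma lift_word_start:
  assumes "r \<in> R" "i < length r"
  shows "lift_edge act (fst (lift_word act v r ! i)) (if snd (r ! i) then 0 else 1) = (walk act v (take i r), Vertex)"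
    and "lift_edge act (fst (lift_word act v r ! i)) (if snd (r ! i) then 1 else 0) = (walk act v (take (Suc i) r), Vertex)"
  using assms(2) rel_letters[OF assms(1), of "r ! i"]
  by (auto simp: lift_word_nth lift_edge_simps walk_Suc wstep_def act_inv)

lemma lift_face_circ:
  assumes "r \<in> R" "i < length r" "0 \<le> t" "t \<le> 1"
  shows "lift_face act (v, r) (circ (length r) (real i + t)) =
    lift_edge act (fst (lift_word act v r ! i)) (if snd (r ! i) then t else 1 - t)"
proof -
  define P where "P j u = (let x = lift_word act v r ! j in lift_edge act (fst x) (if snd x then u else 1 - u))" for j u
  have P0: "P j 0 = (walk act v (take j r), Vertex)" and P1: "P j 1 = (walk act v (take (Suc j) r), Vertex)"
    if "j < length r" for j
    using lift_word_start[OF assms(1) that, of v] that by (auto simp: P_def Let_def lift_word_nth split: if_splits)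
  have "(let s = real (length r) * (Arg2pi (circ (length r) (real i + t)) / (2 * pi)) in P (nat \<lfloor>s\<rfloor>) (frac s)) = P i t"
  proof (rule piecewise_circ[OF assms(2-4)])
    show "P j 1 = P (Suc j) 0" if "Suc j < length r" for j using that P0 P1 by simp
    \<comment> \<open>The last letter ends where the first one begins: here the triviality of the
      relator closes the lifted path.\<close>
    show "P j 1 = P 0 0" if "Suc j = length r" for j
      using P1[of j] P0[of 0] that rel_trivial[OF assms(1), of v] rel_ne[OF assms(1)] by simp
  qed
  then show ?thesis
    using assms(2) by (simp add: lift_face_def P_def Let_def lift_word_nth)
qed

sublocale base: cell_quotient "{Vertex}" X edge_map R face_map "\<lambda>r. r"
  by (rule cell_quotient_standard) (use rel_ne rel_letters in auto)

sublocale cov: cell_quotient "UNIV \<times> {Vertex}" "UNIV \<times> X" "lift_edge act" "UNIV \<times> R" "lift_face act"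
  "\<lambda>f. lift_word act (fst f) (snd f)"
proof unfold_locales
  fix f i t assume f: "f \<in> UNIV \<times> R" "i < length (lift_word act (fst f) (snd f))" "0 \<le> t" "t \<le> (1::real)"
  show "lift_face act f (circ (length (lift_word act (fst f) (snd f))) (real i + t)) =
    lift_edge act (fst (lift_word act (fst f) (snd f) ! i)) (if snd (lift_word act (fst f) (snd f) ! i) then t else 1 - t)"
    using lift_face_circ[of "snd f" i t "fst f"] f by (auto simp: lift_word_nth)
next
  fix f x assume "f \<in> (UNIV :: 'v set) \<times> R" "x \<in> set (lift_word act (fst f) (snd f))"
  then obtain i where "i < length (snd f)" "x = lift_word act (fst f) (snd f) ! i" "snd f \<in> R"
    by (auto simp: in_set_conv_nth)
  then show "fst x \<in> UNIV \<times> X" using rel_letters[of "snd f" "snd f ! i"] by (simp add: lift_word_nth)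
next
  fix f assume "f \<in> (UNIV :: 'v set) \<times> R"
  then show "lift_word act (fst f) (snd f) \<noteq> []" using rel_ne by (metis length_0_conv length_lift_word mem_Times_iff)
qed (auto simp: lift_edge_def lift_face_def prod_eq_iff)

lemma snd_lift_edge: "0 \<le> t \<Longrightarrow> t \<le> 1 \<Longrightarrow> snd (lift_edge act e t) = edge_map (snd e) t"
  by (auto simp: lift_edge_def edge_map_def)

lemma snd_lift_face:
  assumes "r \<in> R" "norm z \<le> 1" shows "snd (lift_face act (v, r) z) = face_map r z"
proof (cases "norm z < 1")
  case True then show ?thesis by (simp add: lift_face_def face_map_inner)
next
  case False
  then have z1: "norm z = 1" using assms by simp
  have "length r > 0" using rel_ne assms by simp
  from circ_surj[OF this z1] obtain i t where it: "i < length r" "0 \<le> t" "t < 1" "z = circ (length r) (real i + t)" .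
  have "snd (lift_edge act (fst (lift_word act v r ! i)) (if snd (r ! i) then t else 1 - t)) =
      edge_map (fst (r ! i)) (if snd (r ! i) then t else 1 - t)"
    using it by (subst snd_lift_edge) (auto simp: lift_word_nth)
  then show ?thesis using it lift_face_circ[OF assms(1) it(1,2), of v] face_map_circ[OF it(1,2)] by simp
qed

text \<open>In the interior of an edge the label is that of the point itself. At t = 1 the point
  carries the label of the end, and the edge is found by inverting \<open>act g\<close>.\<close>

lemma fibre_edge:
  assumes "g \<in> X" "0 \<le> t" "t \<le> 1" "snd x = edge_map g t"
  shows "\<exists>!v. lift_edge act (v, g) t = x"
proof -
  consider "t = 0" | "t = 1" | "0 < t" "t < 1" using assms by linarith
  then show ?thesis
  proof cases
    case 1 then show ?thesis using assms by (intro ex1I[of _ "fst x"]) (auto simp: lift_edge_simps prod_eq_iff)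
  next
    case 2
    then have "lift_edge act (v, g) t = x \<longleftrightarrow> act g v = fst x" for v
      using assms by (auto simp: lift_edge_simps prod_eq_iff)
    then show ?thesis using act_inv[OF assms(1)] by metis
  next
    case 3 then show ?thesis using assms
      by (intro ex1I[of _ "fst x"]) (auto simp: lift_edge_simps edge_map_inner prod_eq_iff)
  qed
qed

lemma fibre_face:
  assumes "r \<in> R" "norm z \<le> 1" "snd x = face_map r z"
  shows "\<exists>!v. lift_face act (v, r) z = x"
proof (cases "norm z < 1")
  case True
  then show ?thesis using assms
    by (intro ex1I[of _ "fst x"]) (auto simp: lift_face_def face_map_inner prod_eq_iff)
next
  case False
  then have z1: "norm z = 1" using assms by simp
  have "length r > 0" using rel_ne assms by simp
  from circ_surj[OF this z1] obtain i t where it: "i < length r" "0 \<le> t" "t < 1" "z = circ (length r) (real i + t)" .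
  define s where "s = (if snd (r ! i) then t else 1 - t)"
  \<comment> \<open>The part of the relator that leads to the initial vertex of the edge at
    \<open>z\<close>. For an inverse letter that letter is included, since its edge starts at the
    vertex reached after it.\<close>
  define w where "w = (if snd (r ! i) then take i r else take (Suc i) r)"
  have g: "fst (r ! i) \<in> X" using rel_letters[OF assms(1), of "r ! i"] it by simp
  have "bij (\<lambda>v. walk act v w)"
  proof (rule bij_walk)
    fix x assume "x \<in> set w"
    then have "x \<in> set r" unfolding w_def by (metis in_set_takeD)
    then show "fst x \<in> X" using rel_letters assms by blast
  qed
  moreover have "lift_face act (v, r) z = lift_edge act (walk act v w, fst (r ! i)) s" for v
    using it lift_face_circ[OF assms(1) it(1,2), of v] by (simp add: lift_word_nth s_def w_def)
  moreover have "snd x = edge_map (fst (r ! i)) s"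
    using assms(3) it face_map_circ[OF it(1,2)] by (simp add: s_def)
  then have "\<exists>!u. lift_edge act (u, fst (r ! i)) s = x"
    using it by (intro fibre_edge g) (auto simp: s_def)
  ultimately show ?thesis
    using ex1_bij[of "\<lambda>v. walk act v w" "\<lambda>u. lift_edge act (u, fst (r ! i)) s = x"] by simp
qed

lemma snd_carrier:
  assumes "x \<in> cov.carrier" shows "snd x \<in> base.carrier" "snd x \<in> base.skel \<longleftrightarrow> x \<in> cov.skel"
proof -
  have a: "snd x \<in> base.skel" if x: "x \<in> cov.skel" for x :: "'v \<times> 'g point"
  proof -
    consider "snd x = Vertex" | e t where "e \<in> UNIV \<times> X" "0 < t" "t < 1" "x = lift_edge act e t"
      using x unfolding cov.skel_def by force
    then show ?thesis
    proof cases
      case 1 then show ?thesis by (simp add: base.skel_def)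
    next
      case 2 then show ?thesis using snd_lift_edge[of t e] base.em_in_skel[of "snd e" t] by auto
    qed
  qed
  have "snd x \<in> base.carrier \<and> (snd x \<in> base.skel \<longleftrightarrow> x \<in> cov.skel)"
  proof (cases "x \<in> cov.skel")
    case True then show ?thesis using a base.skel_carrier by blast
  next
    case False
    then obtain v r z where "r \<in> R" "norm z < 1" "x = lift_face act (v, r) z"
      using assms unfolding cov.carrier_def by auto
    then show ?thesis using False snd_lift_face[of r z v] base.fm_notin_skel[of r z] base.fm_in_carrier[of r z] by simp
  qed
  then show "snd x \<in> base.carrier" "snd x \<in> base.skel \<longleftrightarrow> x \<in> cov.skel" by auto
qed

lemma continuous_snd: "continuous_map cov.Q base.Q snd"
proof (rule cov.continuous_map_from_Q)
  show "snd \<in> UNIV \<times> {Vertex} \<rightarrow> topspace base.Q"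
    using base.skel_carrier by (auto simp: base.topspace_Q base.skel_def)
  show "continuous_map (top_of_set {0..1}) base.Q (snd \<circ> lift_edge act e)" if "e \<in> UNIV \<times> X" for e
  proof (rule continuous_map_eq)
    show "continuous_map (top_of_set {0..1}) base.Q (edge_map (snd e))"
      using that by (intro base.continuous_em) auto
  qed (simp add: snd_lift_edge)
  show "continuous_map (top_of_set (cball 0 1)) base.Q (snd \<circ> lift_face act f)" if "f \<in> UNIV \<times> R" for f
  proof (rule continuous_map_eq)
    show "continuous_map (top_of_set (cball 0 1)) base.Q (face_map (snd f))"
      using that by (intro base.continuous_fm) auto
  qed (use that snd_lift_face in auto)
qed

text \<open>By \<open>fibre_edge\<close> and \<open>fibre_face\<close>, the preimage of the
  projection of \<open>U\<close> in an interval or disc is the union, over all labels, of the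
  preimages of \<open>U\<close> under the lifted maps.\<close>

lemma open_map_snd: "open_map cov.Q base.Q snd"
  unfolding open_map_def
proof (intro allI impI)
  fix U assume "openin cov.Q U"
  then have U: "U \<subseteq> cov.carrier" "\<And>v g. g \<in> X \<Longrightarrow> openin (top_of_set {0..1}) ({0..1} \<inter> lift_edge act (v, g) -` U)"
    "\<And>v r. r \<in> R \<Longrightarrow> openin (top_of_set (cball 0 1)) (cball 0 1 \<inter> lift_face act (v, r) -` U)"
    unfolding cov.openin_Q cov.qopen_def by auto
  show "openin base.Q (snd ` U)"
    unfolding base.openin_Q base.qopen_def
  proof (intro conjI ballI)
    show "snd ` U \<subseteq> base.carrier" using U(1) snd_carrier(1) by blast
    fix g assume g: "g \<in> X"
    have "{0..1} \<inter> edge_map g -` snd ` U = (\<Union>v. {0..1} \<inter> lift_edge act (v, g) -` U)"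
    proof (intro equalityI subsetI)
      fix t assume "t \<in> {0..1} \<inter> edge_map g -` snd ` U"
      then obtain x where x: "x \<in> U" "snd x = edge_map g t" "0 \<le> t" "t \<le> 1" by auto
      then show "t \<in> (\<Union>v. {0..1} \<inter> lift_edge act (v, g) -` U)" using fibre_edge[OF g, of t x] by auto
    next
      fix t assume "t \<in> (\<Union>v. {0..1} \<inter> lift_edge act (v, g) -` U)"
      then obtain v where "lift_edge act (v, g) t \<in> U" "0 \<le> t" "t \<le> 1" by auto
      then show "t \<in> {0..1} \<inter> edge_map g -` snd ` U" using snd_lift_edge[of t "(v, g)"] by force
    qed
    then show "openin (top_of_set {0..1}) ({0..1} \<inter> edge_map g -` snd ` U)" using U(2)[OF g] by (metis (no_types, lifting) imageE openin_Union)
  next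
    fix r assume r: "r \<in> R"
    have "cball 0 1 \<inter> face_map r -` snd ` U = (\<Union>v. cball 0 1 \<inter> lift_face act (v, r) -` U)"
    proof (intro equalityI subsetI)
      fix t assume "t \<in> cball 0 1 \<inter> face_map r -` snd ` U"
      then obtain x where x: "x \<in> U" "snd x = face_map r t" "norm t \<le> 1" by auto
      then show "t \<in> (\<Union>v. cball 0 1 \<inter> lift_face act (v, r) -` U)" using fibre_face[OF r, of t x] by auto
    next
      fix t assume "t \<in> (\<Union>v. cball 0 1 \<inter> lift_face act (v, r) -` U)"
      then obtain v where "lift_face act (v, r) t \<in> U" "norm t \<le> 1" by auto
      then show "t \<in> cball 0 1 \<inter> face_map r -` snd ` U" using snd_lift_face[OF r, of t v] by force
    qed
    then show "openin (top_of_set (cball 0 1)) (cball 0 1 \<inter> face_map r -` snd ` U)" using U(3)[OF r] by (metis (no_types, lifting) imageE openin_Union)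
  qed
qed

lemma sheet_homeomorphism:
  assumes "openin cov.Q U" "inj_on snd U" "snd ` U = T"
  shows "homeomorphic_map (subtopology cov.Q U) (subtopology base.Q T) snd"
proof (rule bijective_open_imp_homeomorphic_map)
  have U: "U \<subseteq> topspace cov.Q" using assms(1) by (rule openin_subset)
  have T: "T \<subseteq> topspace base.Q" using assms(3) U continuous_snd by (auto simp: continuous_map_def)
  show "continuous_map (subtopology cov.Q U) (subtopology base.Q T) snd"
    using continuous_snd assms(3) by (auto simp: continuous_map_in_subtopology continuous_map_from_subtopology)
  show "snd ` topspace (subtopology cov.Q U) = topspace (subtopology base.Q T)"
    unfolding topspace_subtopology using U T assms(3) by (metis inf.absorb2)
  show "inj_on snd (topspace (subtopology cov.Q U))" using assms(2) by (simp add: inj_on_def)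
  show "open_map (subtopology cov.Q U) (subtopology base.Q T) snd"
    unfolding open_map_def
  proof (intro allI impI)
    fix W assume "openin (subtopology cov.Q U) W"
    then have W: "openin cov.Q W" "W \<subseteq> U" using assms(1) by (auto simp: openin_open_subtopology)
    then have "openin base.Q (snd ` W)" using open_map_snd by (simp add: open_map_def)
    then show "openin (subtopology base.Q T) (snd ` W)"
      unfolding openin_subtopology using W(2) assms(3) by (intro exI[of _ "snd ` W"]) blast
  qed
qed

text \<open>Reduces the even covering of a star to the 1-skeleton: a point inside a face is in the
  star over \<open>G v\<close> exactly if the end of its radius is in \<open>G v\<close>, and by
  \<open>fibre_face\<close> that end determines the lift.\<close>

lemma star_sheets:
  assumes B: "base.gopen B" and G: "\<And>v::'v. cov.gopen (G v)"
    and U: "(\<Union>v. G v) = {x \<in> cov.skel. snd x \<in> B}"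
    and D: "\<And>v w. v \<noteq> w \<Longrightarrow> G v \<inter> G w = {}"
    and inj: "\<And>v. inj_on snd (G v)" and surj: "\<And>v. B \<subseteq> snd ` G v"
  shows "\<Union>(range (\<lambda>v. cov.star (G v))) = {x \<in> topspace cov.Q. snd x \<in> base.star B} \<and>
      (\<forall>U\<in>range (\<lambda>v. cov.star (G v)). openin cov.Q U) \<and>
      pairwise disjnt (range (\<lambda>v. cov.star (G v))) \<and>
      (\<forall>U\<in>range (\<lambda>v. cov.star (G v)). homeomorphic_map (subtopology cov.Q U) (subtopology base.Q (base.star B)) snd)"
proof -
  have Bs: "B \<subseteq> base.skel" and Gs: "G v \<subseteq> cov.skel" for v
    using B G by (auto simp: base.gopen_def cov.gopen_def)
  have GB: "snd x \<in> B" if "x \<in> G v" for x v using that U by blast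
  have face: "(w, Face r z) \<in> cov.star (G v) \<longleftrightarrow> z \<noteq> 0 \<and> lift_face act (w, r) (sgn z) \<in> G v"
    if "r \<in> R" "norm z < 1" for w r z v
  proof -
    have "(w, Face r z) = lift_face act (w, r) z" using that by (simp add: lift_face_def)
    moreover have "z \<in> cball 0 1 \<inter> lift_face act (w, r) -` cov.star (G v) \<longleftrightarrow>
        z \<in> {z \<in> cball 0 1. z \<noteq> 0 \<and> lift_face act (w, r) (sgn z) \<in> G v}"
      using that by (subst cov.fm_vimage_star[OF Gs]) auto
    ultimately show ?thesis using that by simp
  qed
  have bface: "Face r z \<in> base.star B \<longleftrightarrow> z \<noteq> 0 \<and> face_map r (sgn z) \<in> B"
    if "r \<in> R" "norm z < 1" for r z
  proof -
    have "Face r z = face_map r z" using that by (simp add: face_map_inner)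
    moreover have "z \<in> cball 0 1 \<inter> face_map r -` base.star B \<longleftrightarrow>
        z \<in> {z \<in> cball 0 1. z \<noteq> 0 \<and> face_map r (sgn z) \<in> B}"
      using that by (subst base.fm_vimage_star[OF Bs]) auto
    ultimately show ?thesis using that by simp
  qed
  have sgn1: "z \<noteq> 0 \<Longrightarrow> norm (sgn z) \<le> 1" for z :: complex by (simp add: norm_sgn)
  have nonskel: "\<exists>w r z. r \<in> R \<and> norm z < 1 \<and> x = (w, Face r z)" if x: "x \<in> cov.carrier" "x \<notin> cov.skel" for x
  proof -
    obtain w r z where "r \<in> R" "norm z < 1" "x = lift_face act (w, r) z"
      using x unfolding cov.carrier_def by auto
    then show ?thesis by (auto simp: lift_face_def)
  qed
  have carr: "cov.star (G v) \<subseteq> cov.carrier" for v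
    using cov.open_star[OF G] openin_subset cov.topspace_Q by blast
  have inj': "inj_on snd (cov.star (G v))" for v
  proof (rule inj_onI)
    fix x y assume xy: "x \<in> cov.star (G v)" "y \<in> cov.star (G v)" "snd x = snd y"
    then have c: "x \<in> cov.carrier" "y \<in> cov.carrier" using carr by blast+
    show "x = y"
    proof (cases "x \<in> cov.skel")
      case True
      then have "y \<in> cov.skel" using snd_carrier(2)[OF c(1)] snd_carrier(2)[OF c(2)] xy(3) by simp
      then have "x \<in> G v" "y \<in> G v" using True xy cov.star_skel[OF Gs] by blast+
      then show ?thesis using inj xy(3) by (meson inj_onD)
    next
      case False
      then have "y \<notin> cov.skel" using snd_carrier(2)[OF c(1)] snd_carrier(2)[OF c(2)] xy(3) by simp
      then obtain w r z w' where w: "r \<in> R" "norm z < 1" "x = (w, Face r z)" "y = (w', Face r z)"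
        using nonskel[OF c(1) False] nonskel[OF c(2)] xy(3) by auto
      then have z: "z \<noteq> 0" "lift_face act (w, r) (sgn z) \<in> G v" "lift_face act (w', r) (sgn z) \<in> G v"
        using face xy by auto
      have s: "snd (lift_face act (u, r) (sgn z)) = face_map r (sgn z)" for u
        using snd_lift_face w(1) sgn1 z(1) by blast
      then have "lift_face act (w, r) (sgn z) = lift_face act (w', r) (sgn z)"
        using inj z by (metis inj_onD)
      then have "w = w'" using fibre_face[OF w(1) sgn1[OF z(1)] s[of w]] by metis
      then show ?thesis using w by simp
    qed
  qed
  have surj': "snd ` cov.star (G v) = base.star B" for v
  proof (intro equalityI subsetI)
    fix y assume "y \<in> snd ` cov.star (G v)"
    then obtain x where x: "x \<in> cov.star (G v)" "y = snd x" by blast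
    show "y \<in> base.star B"
    proof (cases "x \<in> cov.skel")
      case True
      then have "x \<in> G v" using x cov.star_skel[OF Gs, of v] by blast
      then show ?thesis using GB[of x v] x(2) unfolding base.star_def by simp
    next
      case False
      then obtain w r z where w: "r \<in> R" "norm z < 1" "x = (w, Face r z)"
        using nonskel[OF subsetD[OF carr x(1)]] by blast
      then have z: "z \<noteq> 0" "lift_face act (w, r) (sgn z) \<in> G v" using face[OF w(1,2), of w v] x by auto
      then have "face_map r (sgn z) \<in> B" using GB[OF z(2)] snd_lift_face[OF w(1) sgn1[OF z(1)], of w] by simp
      then show ?thesis using bface[OF w(1,2)] z w x by simp
    qed
  next
    fix y assume y: "y \<in> base.star B"
    show "y \<in> snd ` cov.star (G v)"
    proof (cases "y \<in> base.skel")
      case True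
      then have "y \<in> B" using y base.star_skel[OF Bs] by blast
      then obtain b where "b \<in> G v" "y = snd b" using surj[of v] by blast
      then show ?thesis unfolding cov.star_def by blast
    next
      case False
      then obtain r z where rz: "r \<in> R" "norm z < 1" "y = Face r z" "z \<noteq> 0" "face_map r (sgn z) \<in> B"
      proof -
        have "y \<notin> B" using False Bs by blast
        then obtain r z where "r \<in> R" "norm z < 1" "y = face_map r z" "z \<noteq> 0" "face_map r (sgn z) \<in> B"
          using y unfolding base.star_def by blast
        then show thesis using that[of r z] by (simp add: face_map_inner)
      qed
      obtain b where b: "b \<in> G v" "snd b = face_map r (sgn z)" using surj[of v] rz(5) by (metis imageE subsetD)
      obtain w where "lift_face act (w, r) (sgn z) = b" using fibre_face[OF rz(1) sgn1[OF rz(4)] b(2)] by blast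
      then have "(w, Face r z) \<in> cov.star (G v)" using face[OF rz(1,2), of w v] rz(4) b by simp
      then show ?thesis using rz(3) by (metis imageI snd_conv)
    qed
  qed
  have "\<Union>(range (\<lambda>v. cov.star (G v))) = {x \<in> topspace cov.Q. snd x \<in> base.star B}"
  proof (intro equalityI subsetI)
    fix x assume "x \<in> \<Union>(range (\<lambda>v. cov.star (G v)))"
    then obtain v where v: "x \<in> cov.star (G v)" by blast
    then have "snd x \<in> base.star B" using surj'[of v] by blast
    then show "x \<in> {x \<in> topspace cov.Q. snd x \<in> base.star B}"
      using subsetD[OF carr v] by (simp add: cov.topspace_Q)
  next
    fix x assume "x \<in> {x \<in> topspace cov.Q. snd x \<in> base.star B}"
    then have x: "x \<in> cov.carrier" "snd x \<in> base.star B" by (auto simp: cov.topspace_Q)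
    show "x \<in> \<Union>(range (\<lambda>v. cov.star (G v)))"
    proof (cases "x \<in> cov.skel")
      case True
      then have "snd x \<in> B" using x snd_carrier(2)[OF x(1)] base.star_skel[OF Bs] by blast
      then have "x \<in> (\<Union>v. G v)" unfolding U using True by simp
      then show ?thesis unfolding cov.star_def by blast
    next
      case False
      then obtain w r z where w: "r \<in> R" "norm z < 1" "x = (w, Face r z)" using nonskel[OF x(1)] by blast
      then have z: "z \<noteq> 0" "face_map r (sgn z) \<in> B" using bface[OF w(1,2)] x by auto
      have "lift_face act (w, r) (sgn z) \<in> cov.skel"
        using cov.fm_sphere_skel[of "(w, r)" "sgn z"] w z by (simp add: norm_sgn)
      moreover have "snd (lift_face act (w, r) (sgn z)) \<in> B" using z snd_lift_face[OF w(1) sgn1[OF z(1)]] by simp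
      ultimately have "lift_face act (w, r) (sgn z) \<in> (\<Union>v. G v)" unfolding U by simp
      then obtain v where "lift_face act (w, r) (sgn z) \<in> G v" by blast
      then have "x \<in> cov.star (G v)" using face[OF w(1,2), of w v] w z by simp
      then show ?thesis by blast
    qed
  qed
  moreover have "pairwise disjnt (range (\<lambda>v. cov.star (G v)))"
  proof (rule pairwiseI)
    fix A B assume "A \<in> range (\<lambda>v. cov.star (G v))" "B \<in> range (\<lambda>v. cov.star (G v))" "A \<noteq> B"
    then obtain v w where "A = cov.star (G v)" "B = cov.star (G w)" "v \<noteq> w" by blast
    then show "disjnt A B" using cov.star_disjoint[OF D Gs Gs] by (simp add: disjnt_def)
  qed
  ultimately show ?thesis
    using cov.open_star[OF G] sheet_homeomorphism[OF cov.open_star[OF G] inj' surj'] by (intro conjI ballI) auto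
qed

text \<open>The evenly covered sets are the star of a neighbourhood of the vertex, the stars of the
  open edges, and the open faces; the sheets over each of them are labelled by the points of the
  fibre.\<close>

theorem covering_map_snd: "covering_map cov.Q base.Q snd"
  unfolding covering_map_def
proof (intro conjI ballI)
  show "continuous_map cov.Q base.Q snd" by (rule continuous_snd)
  have "y \<in> snd ` topspace cov.Q" if y: "y \<in> base.carrier" for y
  proof -
    consider "y = Vertex" | g t where "g \<in> X" "0 < t" "t < 1" "y = edge_map g t"
      | r z where "r \<in> R" "norm z < 1" "y = face_map r z"
      using y unfolding base.carrier_def base.skel_def by auto
    then show ?thesis
    proof cases
      case 1
      then have "(undefined, y) \<in> cov.carrier" by (simp add: cov.carrier_def cov.skel_def)
      then show ?thesis unfolding cov.topspace_Q by force
    next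
      case 2
      then show ?thesis using cov.em_in_skel[of "(undefined, g)" t] cov.skel_carrier snd_lift_edge[of t "(undefined, g)"]
        unfolding cov.topspace_Q by force
    next
      case 3
      then show ?thesis using cov.fm_in_carrier[of "(undefined, r)" z] snd_lift_face[of r z undefined]
        unfolding cov.topspace_Q by force
    qed
  qed
  then show "snd ` topspace cov.Q = topspace base.Q"
    using snd_carrier(1) unfolding cov.topspace_Q base.topspace_Q by blast
  fix y assume "y \<in> topspace base.Q"
  then have "y \<in> base.carrier" by (simp add: base.topspace_Q)
  then consider "y = Vertex" | g t where "g \<in> X" "0 < t" "t < 1" "y = edge_map g t"
      | r z where "r \<in> R" "norm z < 1" "y = face_map r z"
    unfolding base.carrier_def base.skel_def by auto
  then show "\<exists>T. y \<in> T \<and> openin base.Q T \<and> (\<exists>\<V>. \<Union> \<V> = {x \<in> topspace cov.Q. snd x \<in> T} \<and>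
     (\<forall>U\<in>\<V>. openin cov.Q U) \<and> pairwise disjnt \<V> \<and>
     (\<forall>U\<in>\<V>. homeomorphic_map (subtopology cov.Q U) (subtopology base.Q T) snd))"
  proof cases
    case 1
    let ?B = "base.vertex_nbd Vertex" and ?G = "\<lambda>v. cov.vertex_nbd (v, Vertex)"
    have lv: "lift_edge act e t = (fst e, Edge (snd e) t)" if "0 < t \<and> t < 1/3 \<or> 2/3 < t \<and> t < 1" for e t
      using that by (auto simp: lift_edge_simps)
    have mem: "x \<in> ?G v \<longleftrightarrow> x = (v, Vertex) \<or> (\<exists>u g t. g \<in> X \<and> x = (u, Edge g t) \<and>
        (0 < t \<and> t < 1/3 \<and> u = v \<or> 2/3 < t \<and> t < 1 \<and> act g u = v))" for x v
    proof -
      have "x \<in> ?G v \<longleftrightarrow> x = (v, Vertex) \<or> (\<exists>u g t. g \<in> X \<and> x = lift_edge act (u, g) t \<and>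
        (0 < t \<and> t < 1/3 \<and> u = v \<or> 2/3 < t \<and> t < 1 \<and> act g u = v))"
        unfolding cov.vertex_nbd_iff by (simp add: lift_edge_simps Bex_def)
      also have "\<dots> \<longleftrightarrow> x = (v, Vertex) \<or> (\<exists>u g t. g \<in> X \<and> x = (u, Edge g t) \<and>
        (0 < t \<and> t < 1/3 \<and> u = v \<or> 2/3 < t \<and> t < 1 \<and> act g u = v))"
      proof -
        have "(g \<in> X \<and> x = lift_edge act (u, g) t \<and> (0 < t \<and> t < 1/3 \<and> u = v \<or> 2/3 < t \<and> t < 1 \<and> act g u = v)) \<longleftrightarrow>
          (g \<in> X \<and> x = (u, Edge g t) \<and> (0 < t \<and> t < 1/3 \<and> u = v \<or> 2/3 < t \<and> t < 1 \<and> act g u = v))" for u g t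
          using lv[of t "(u, g)"] by auto
        then show ?thesis by (simp only:)
      qed
      finally show ?thesis .
    qed
    have bmem: "y \<in> ?B \<longleftrightarrow> y = Vertex \<or> (\<exists>g t. g \<in> X \<and> y = Edge g t \<and> (0 < t \<and> t < 1/3 \<or> 2/3 < t \<and> t < 1))" for y
    proof -
      have ev: "edge_map g t = Edge g t" if "0 < t \<and> t < 1/3 \<or> 2/3 < t \<and> t < 1" for g :: 'g and t
        using that by (auto simp: edge_map_inner)
      have "y \<in> ?B \<longleftrightarrow> y = Vertex \<or> (\<exists>g t. g \<in> X \<and> y = edge_map g t \<and> (0 < t \<and> t < 1/3 \<or> 2/3 < t \<and> t < 1))"
        unfolding base.vertex_nbd_iff by (simp add: Bex_def)
      also have "\<dots> \<longleftrightarrow> y = Vertex \<or> (\<exists>g t. g \<in> X \<and> y = Edge g t \<and> (0 < t \<and> t < 1/3 \<or> 2/3 < t \<and> t < 1))"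
      proof -
        have "(g \<in> X \<and> y = edge_map g t \<and> (0 < t \<and> t < 1/3 \<or> 2/3 < t \<and> t < 1)) \<longleftrightarrow>
          (g \<in> X \<and> y = Edge g t \<and> (0 < t \<and> t < 1/3 \<or> 2/3 < t \<and> t < 1))" for g t
          using ev[of t g] by auto
        then show ?thesis by (simp only:)
      qed
      finally show ?thesis .
    qed
    have "y \<in> base.star ?B" using 1 by (simp add: base.star_def bmem)
    moreover have "openin base.Q (base.star ?B)" by (intro base.open_star base.gopen_vertex_nbd) simp
    moreover have "\<Union>(range (\<lambda>v. cov.star (?G v))) = {x \<in> topspace cov.Q. snd x \<in> base.star ?B} \<and>
      (\<forall>U\<in>range (\<lambda>v. cov.star (?G v)). openin cov.Q U) \<and>
      pairwise disjnt (range (\<lambda>v. cov.star (?G v))) \<and>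
      (\<forall>U\<in>range (\<lambda>v. cov.star (?G v)). homeomorphic_map (subtopology cov.Q U) (subtopology base.Q (base.star ?B)) snd)"
    proof (rule star_sheets)
      show "base.gopen ?B" by (intro base.gopen_vertex_nbd) simp
      show "cov.gopen (?G v)" for v by (intro cov.gopen_vertex_nbd) simp
      have "?G v \<subseteq> cov.skel" for v
        using cov.gopen_vertex_nbd[of "(v, Vertex)"] by (simp add: cov.gopen_def)
      moreover have "snd x \<in> ?B" if "x \<in> ?G v" for x v using that unfolding mem bmem by auto
      moreover have "\<exists>v. x \<in> ?G v" if xB: "snd x \<in> ?B" for x
      proof -
        consider "snd x = Vertex" | g t where "g \<in> X" "snd x = Edge g t" "0 < t" "t < 1/3"
          | g t where "g \<in> X" "snd x = Edge g t" "2/3 < t" "t < 1" using xB unfolding bmem by blast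
        then show ?thesis
        proof cases
          case 1 then have "x \<in> ?G (fst x)" by (simp add: mem prod_eq_iff)
          then show ?thesis by blast
        next
          case 2 then have "x \<in> ?G (fst x)" by (simp add: mem prod_eq_iff)
          then show ?thesis by blast
        next
          case 3 then have "x \<in> ?G (act g (fst x))" by (simp add: mem prod_eq_iff)
          then show ?thesis by blast
        qed
      qed
      ultimately show "(\<Union>v. ?G v) = {x \<in> cov.skel. snd x \<in> ?B}" by (rule UN_eq_Collect)
      show "?G v \<inter> ?G w = {}" if "v \<noteq> w" for v w using that unfolding disjoint_iff mem by auto
      show "inj_on snd (?G v)" for v
      proof (rule inj_onI)
        fix x y assume xy: "x \<in> ?G v" "y \<in> ?G v" "snd x = snd y"
        have "fst x = fst y"
        proof -
          have i: "act g u = act g u' \<longleftrightarrow> u = u'" if "g \<in> X" for g u u' using act_inv(2)[OF that] by metis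
          have m: "snd x = Vertex \<and> fst x = v \<or> (\<exists>g t. g \<in> X \<and> snd x = Edge g t \<and>
              (t < 1/3 \<and> fst x = v \<or> 2/3 < t \<and> act g (fst x) = v))" if "x \<in> ?G v" for x
            using that unfolding mem by (elim disjE exE conjE) simp_all
          show ?thesis
          proof (cases "snd x")
            case (Edge g t)
            then have "g \<in> X" "t < 1/3 \<and> fst x = v \<or> 2/3 < t \<and> act g (fst x) = v"
              "t < 1/3 \<and> fst y = v \<or> 2/3 < t \<and> act g (fst y) = v"
              using m[OF xy(1)] m[OF xy(2)] xy(3) by auto
            then show ?thesis by (elim disjE conjE) (simp_all, metis i)
          qed (use m[OF xy(1)] m[OF xy(2)] xy(3) in auto)
        qed
        then show "x = y" using xy(3) by (simp add: prod_eq_iff)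
      qed
      show "?B \<subseteq> snd ` ?G v" for v
      proof
        fix y assume "y \<in> ?B"
        then consider "y = Vertex" | g t where "g \<in> X" "y = Edge g t" "0 < t" "t < 1/3"
          | g t where "g \<in> X" "y = Edge g t" "2/3 < t" "t < 1" unfolding bmem by blast
        then have "\<exists>u. (u, y) \<in> ?G v"
        proof cases
          case 1 then have "(v, y) \<in> ?G v" by (simp add: mem)
          then show ?thesis by blast
        next
          case 2 then have "(v, y) \<in> ?G v" by (simp add: mem)
          then show ?thesis by blast
        next
          \<comment> \<open>The last third of an edge is near its end point, so the edge whose final
            part belongs to the sheet of \<open>v\<close> starts at the preimage of
            \<open>v\<close>.\<close>
          case 3 then have "(inv (act g) v, y) \<in> ?G v" by (simp add: mem act_inv)
          then show ?thesis by blast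
        qed
        then show "y \<in> snd ` ?G v" by (metis imageI snd_conv)
      qed
    qed
    ultimately show ?thesis by (intro exI[of _ "base.star ?B"] conjI[of "_ \<in> _"] conjI[of "openin _ _"] exI[of _ "range (\<lambda>v. cov.star (?G v))"])
  next
    case (2 g t)
    let ?B = "edge_map g ` {0<..<1}" and ?G = "\<lambda>v. lift_edge act (v, g) ` {0<..<1}"
    have mem: "x \<in> ?G v \<longleftrightarrow> (\<exists>t. 0 < t \<and> t < 1 \<and> x = (v, Edge g t))" for x v
      by (auto simp: lift_edge_simps)
    have bmem: "y \<in> ?B \<longleftrightarrow> (\<exists>t. 0 < t \<and> t < 1 \<and> y = Edge g t)" for y
      by (auto simp: edge_map_inner)
    have "y \<in> base.star ?B" using 2 by (auto simp: base.star_def)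
    moreover have "openin base.Q (base.star ?B)" by (intro base.open_star base.gopen_em) (use 2 in auto)
    moreover have "\<Union>(range (\<lambda>v. cov.star (?G v))) = {x \<in> topspace cov.Q. snd x \<in> base.star ?B} \<and>
      (\<forall>U\<in>range (\<lambda>v. cov.star (?G v)). openin cov.Q U) \<and>
      pairwise disjnt (range (\<lambda>v. cov.star (?G v))) \<and>
      (\<forall>U\<in>range (\<lambda>v. cov.star (?G v)). homeomorphic_map (subtopology cov.Q U) (subtopology base.Q (base.star ?B)) snd)"
    proof (rule star_sheets)
      show "base.gopen ?B" by (intro base.gopen_em) (use 2 in auto)
      show "cov.gopen (?G v)" for v by (intro cov.gopen_em) (use 2 in auto)
      then have "?G v \<subseteq> cov.skel" for v by (simp add: cov.gopen_def)
      moreover have "snd x \<in> ?B" if "x \<in> ?G v" for x v using that unfolding mem bmem by auto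
      moreover have "\<exists>v. x \<in> ?G v" if "snd x \<in> ?B" for x
        using that unfolding mem bmem by (cases x) auto
      ultimately show "(\<Union>v. ?G v) = {x \<in> cov.skel. snd x \<in> ?B}" by (rule UN_eq_Collect)
      show "?G v \<inter> ?G w = {}" if "v \<noteq> w" for v w using that unfolding disjoint_iff mem by auto
      have fv: "fst x = v" if "x \<in> ?G v" for x v using that unfolding mem by auto
      show "inj_on snd (?G v)" for v
        by (rule inj_onI, rule prod_eqI) (simp_all only: fv)
      show "?B \<subseteq> snd ` ?G v" for v
      proof
        fix y assume "y \<in> ?B"
        then have "(v, y) \<in> ?G v" unfolding mem bmem by auto
        then show "y \<in> snd ` ?G v" by (metis imageI snd_conv)
      qed
    qed
    ultimately show ?thesis by (intro exI[of _ "base.star ?B"] conjI[of "_ \<in> _"] conjI[of "openin _ _"] exI[of _ "range (\<lambda>v. cov.star (?G v))"])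
  next
    case (3 r z)
    let ?T = "face_map r ` ball 0 1" and ?G = "\<lambda>v. lift_face act (v, r) ` ball 0 1"
    have mem: "x \<in> ?G v \<longleftrightarrow> (\<exists>z. norm z < 1 \<and> x = (v, Face r z))" for x v
      by (auto simp: lift_face_def)
    have bmem: "y \<in> ?T \<longleftrightarrow> (\<exists>z. norm z < 1 \<and> y = Face r z)" for y
      by (auto simp: face_map_inner)
    have fv: "fst x = v" if "x \<in> ?G v" for x v using that unfolding mem by auto
    have op: "openin cov.Q (?G v)" for v using 3 by (intro cov.open_face_image) auto
    have "y \<in> ?T" using 3 by auto
    moreover have "openin base.Q ?T" using 3 by (intro base.open_face_image) auto
    moreover have "\<Union>(range ?G) = {x \<in> topspace cov.Q. snd x \<in> ?T}"
    proof -
      have "?G v \<subseteq> topspace cov.Q" for v using openin_subset[OF op] .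
      moreover have "snd x \<in> ?T" if "x \<in> ?G v" for x v using that unfolding mem bmem by auto
      moreover have "\<exists>v. x \<in> ?G v" if "snd x \<in> ?T" for x
        using that unfolding mem bmem by (cases x) auto
      ultimately show ?thesis by (rule UN_eq_Collect)
    qed
    moreover have "pairwise disjnt (range ?G)"
    proof (rule pairwiseI)
      fix A B assume "A \<in> range ?G" "B \<in> range ?G" "A \<noteq> B"
      then obtain v w where vw: "A = ?G v" "B = ?G w" "v \<noteq> w" by blast
      show "disjnt A B" unfolding vw disjnt_iff using fv vw(3) by metis
    qed
    moreover have "homeomorphic_map (subtopology cov.Q (?G v)) (subtopology base.Q ?T) snd" for v
    proof (rule sheet_homeomorphism[OF op])
      show "inj_on snd (?G v)"
        by (rule inj_onI, rule prod_eqI) (simp_all only: fv)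
      have "(v, y) \<in> ?G v" if "y \<in> ?T" for y using that unfolding mem bmem by auto
      moreover have "snd x \<in> ?T" if "x \<in> ?G v" for x using that unfolding mem bmem by auto
      ultimately show "snd ` ?G v = ?T" by (metis (no_types, lifting) image_subsetI snd_conv imageI subsetI subset_antisym)
    qed
    moreover have "\<forall>U\<in>range ?G. openin cov.Q U" using op by blast
    ultimately have "\<Union>(range ?G) = {x \<in> topspace cov.Q. snd x \<in> ?T} \<and> (\<forall>U\<in>range ?G. openin cov.Q U) \<and>
      pairwise disjnt (range ?G) \<and> (\<forall>U\<in>range ?G. homeomorphic_map (subtopology cov.Q U) (subtopology base.Q ?T) snd)"
      by (intro conjI ballI) auto
    then show ?thesis using \<open>y \<in> ?T\<close> \<open>openin base.Q ?T\<close>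
      by (intro exI[of _ ?T] conjI[of "_ \<in> _"] conjI[of "openin _ _"] exI[of _ "range ?G"])
  qed
qed

lemma snd_skeleton: "snd ` skeleton cov.CX n \<subseteq> skeleton base.CX n"
proof -
  consider "n = 0" | "n = 1" | "n \<ge> 2" by linarith
  then show ?thesis
  proof cases
    case 1 then show ?thesis by (simp add: cov.skeleton_CX(1) base.skeleton_CX(1))
  next
    case 2
    have "snd x \<in> base.skel" if "x \<in> cov.skel" for x
      using snd_carrier(2)[of x] subsetD[OF cov.skel_carrier that] that by simp
    then show ?thesis
      unfolding cov.skeleton_CX(2)[OF 2] base.skeleton_CX(2)[OF 2] by (rule image_subsetI)
  next
    case 3
    show ?thesis
      unfolding cov.skeleton_CX(3)[OF 3] base.skeleton_CX(3)[OF 3]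
      by (intro image_subsetI snd_carrier(1))
  qed
qed

end

section \<open>Coverings composed with homeomorphisms\<close>

lemma covering_map_sheets:
  assumes "covering_map X Y p" "y \<in> topspace Y"
  obtains T \<V> where "y \<in> T" "openin Y T" "\<Union>\<V> = {x \<in> topspace X. p x \<in> T}" "\<forall>U\<in>\<V>. openin X U"
    "pairwise disjnt \<V>" "\<forall>U\<in>\<V>. homeomorphic_map (subtopology X U) (subtopology Y T) p"
proof -
  from assms(1)[unfolded covering_map_def, THEN conjunct2, THEN conjunct2, THEN bspec, OF assms(2)]
  show thesis by (elim exE conjE) (rule that)
qed

lemma covering_map_compose_homeomorphism:
  assumes "covering_map X Y p" and h: "homeomorphic_map Z X h"
  shows "covering_map Z Y (p \<circ> h)"
  unfolding covering_map_def
proof (intro conjI ballI)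
  have c: "continuous_map X Y p" "p ` topspace X = topspace Y" using assms(1) by (auto simp: covering_map_def)
  have hc: "continuous_map Z X h" "h ` topspace Z = topspace X"
    using h homeomorphic_imp_continuous_map homeomorphic_imp_surjective_map by blast+
  show "continuous_map Z Y (p \<circ> h)" using hc(1) c(1) by (rule continuous_map_compose)
  show "(p \<circ> h) ` topspace Z = topspace Y" 
  proof -
    have "(p \<circ> h) ` topspace Z = p ` h ` topspace Z" by (rule image_comp[symmetric])
    then show ?thesis by (simp only: hc(2) c(2))
  qed
  fix y assume "y \<in> topspace Y"
  from covering_map_sheets[OF assms(1) this] obtain T \<V> where T: "y \<in> T" "openin Y T"
    and V: "\<Union>\<V> = {x \<in> topspace X. p x \<in> T}" "\<forall>U\<in>\<V>. openin X U" "pairwise disjnt \<V>"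
      "\<forall>U\<in>\<V>. homeomorphic_map (subtopology X U) (subtopology Y T) p" .
  define g where "g U = {z \<in> topspace Z. h z \<in> U}" for U
  have "\<Union>(g ` \<V>) = {z \<in> topspace Z. (p \<circ> h) z \<in> T}"
  proof -
    have "h z \<in> topspace X" if "z \<in> topspace Z" for z using that hc by blast
    moreover have "\<Union>(g ` \<V>) = {z \<in> topspace Z. h z \<in> \<Union>\<V>}" unfolding g_def by blast
    ultimately show ?thesis unfolding V(1) by auto
  qed
  moreover have "openin Z (g U)" if "U \<in> \<V>" for U
    unfolding g_def using hc(1) bspec[OF V(2) that] by (simp add: continuous_map_def)
  moreover have "pairwise disjnt (g ` \<V>)"
  proof (rule pairwiseI)
    fix A B assume "A \<in> g ` \<V>" "B \<in> g ` \<V>" "A \<noteq> B"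
    then obtain U W where "A = g U" "B = g W" "U \<in> \<V>" "W \<in> \<V>" "U \<noteq> W" by blast
    moreover from this have "disjnt U W" using pairwiseD[OF V(3)] by blast
    ultimately show "disjnt A B" unfolding g_def disjnt_iff by blast
  qed
  moreover have "homeomorphic_map (subtopology Z (g U)) (subtopology Y T) (p \<circ> h)" if "U \<in> \<V>" for U
  proof (rule homeomorphic_map_compose[OF _ bspec[OF V(4) that]])
    have "U \<subseteq> topspace X" by (rule openin_subset[OF bspec[OF V(2) that]])
    have "h ` (topspace Z \<inter> g U) = topspace X \<inter> U"
    proof (intro equalityI subsetI)
      fix x assume "x \<in> h ` (topspace Z \<inter> g U)"
      then show "x \<in> topspace X \<inter> U" using \<open>U \<subseteq> topspace X\<close> unfolding g_def by auto
    next
      fix x assume "x \<in> topspace X \<inter> U"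
      moreover from this obtain z where "z \<in> topspace Z" "x = h z" using hc(2) by (metis IntD1 imageE)
      ultimately show "x \<in> h ` (topspace Z \<inter> g U)" unfolding g_def by auto
    qed
    then show "homeomorphic_map (subtopology Z (g U)) (subtopology X U) h"
      by (rule homeomorphic_map_subtopologies[OF h])
  qed
  ultimately show "\<exists>T. y \<in> T \<and> openin Y T \<and> (\<exists>\<V>. \<Union>\<V> = {x \<in> topspace Z. (p \<circ> h) x \<in> T} \<and>
             (\<forall>U\<in>\<V>. openin Z U) \<and> pairwise disjnt \<V> \<and>
             (\<forall>U\<in>\<V>. homeomorphic_map (subtopology Z U) (subtopology Y T) (p \<circ> h)))"
    using T by (intro exI[of _ T] conjI[of "_ \<in> _"] conjI[of "openin _ _"] exI[of _ "g ` \<V>"]) simp_all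
qed

section \<open>The relators of \<open>H\<^sub>\<epsilon>\<close>\<close>

text \<open>The commutator \<open>[c\<^sup>d, c]\<close>.\<close>

definition hword :: "gen word" where
  "hword = [(Gen_d, False), (Gen_c, False), (Gen_d, True), (Gen_c, False),
      (Gen_d, False), (Gen_c, True), (Gen_d, True), (Gen_c, True)]"

text \<open>The last letter is \<open>a\<^sup>-\<^sup>\<epsilon>\<close>, so \<open>False\<close> stands for \<open>\<epsilon> = 1\<close>.\<close>

definition relA :: "bool \<Rightarrow> gen word" where
  "relA b = [(Gen_c, False), (Gen_d, False), (Gen_c, False), (Gen_d, True),
      (Gen_c, True), (Gen_d, False), (Gen_c, True), (Gen_d, True)] @ [(Gen_a, True)] @ hword @ [(Gen_a, b)]"

definition relB :: "gen word" where
  "relB = [(Gen_d, False), (Gen_c, True), (Gen_c, True), (Gen_c, True), (Gen_d, True),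
      (Gen_c, False), (Gen_c, False), (Gen_c, False), (Gen_c, False), (Gen_c, False)]"

lemma H_relators_eq: "H_relators 1 = {relA False, relB}" "H_relators (- 1) = {relA True, relB}"
  by (simp_all add: H_relators_def wcomm_def Let_def relA_def relB_def hword_def relator_def
      wconj_def wpow_def winv_def letter_def numeral_eq_Suc)

lemma length_rel [simp]: "length (relA b) = 18" "length relB = 10"
  by (simp_all add: relA_def relB_def hword_def)

lemma rel_distinct: "relA b \<noteq> relB" "relB \<noteq> relA b" "relA b = relA b' \<longleftrightarrow> b = b'"
  by (auto simp: relA_def relB_def hword_def)

definition gens :: "gen set" where "gens = {Gen_a, Gen_c, Gen_d}"

lemma in_gens [simp]: "g \<in> gens"
  by (cases g) (auto simp: gens_def)

section \<open>A common covering\<close>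

text \<open>\<open>U\<close> is the action of the conjugate of \<open>c\<close> by \<open>d\<close>,
  and \<open>DC\<close> says so without inverses. The commutator takes \<open>U (C x)\<close> to
  \<open>C (U x)\<close>; so \<open>twist\<close> makes \<open>s\<close> a colouring that alternates
  along its cycles, which can exist only if none of them is odd.\<close>

locale twisted_action =
  fixes C D U :: "'v \<Rightarrow> 'v" and s :: "'v \<Rightarrow> bool"
  assumes bij: "bij C" "bij D" and DC: "D (C x) = U (D x)" and U3: "U (U (U x)) = C (C (C (C (C x))))"
    and twist: "s (C (U x)) \<longleftrightarrow> \<not> s (U (C x))"
begin

definition act :: "gen \<Rightarrow> 'v \<Rightarrow> 'v" where
  "act g = (case g of Gen_a \<Rightarrow> (\<lambda>v. v) | Gen_c \<Rightarrow> C | Gen_d \<Rightarrow> D)"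

lemma act_simps [simp]: "act Gen_a v = v" "act Gen_c = C" "act Gen_d = D" "inv (act Gen_a) v = v"
proof -
  have "act Gen_a = id" by (auto simp: act_def)
  then show "act Gen_a v = v" "inv (act Gen_a) v = v" by simp_all
qed (simp_all add: act_def)

lemma inv_simps [simp]: "C (inv C x) = x" "inv C (C x) = x" "D (inv D x) = x" "inv D (D x) = x"
  using bij by (simp_all add: bij_is_inj bij_is_surj surj_f_inv_f)

lemma U_eq: "U x = D (C (inv D x))"
  by (metis DC inv_simps(3))

lemma twist_inv: "s (C (D (C (inv D (inv C (D (inv C (inv D x)))))))) \<longleftrightarrow> \<not> s x"
  using twist[of "inv C (D (inv C (inv D x)))"] by (simp add: U_eq)

text \<open>The point on the left is reached from \<open>x\<close> along the first eight letters of
  \<open>relA\<close>, the inverse of \<open>hword\<close>. So the two letters \<open>a\<close> of a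
  lifted face run along loops at points of opposite colour.\<close>

lemma twist_hword: "s (D (C (inv D (C (D (inv C (inv D (inv C x)))))))) \<longleftrightarrow> \<not> s x"
  using twist_inv[of "D (C (inv D (C (D (inv C (inv D (inv C x)))))))"] by simp

lemma act_bij: "bij (act g)"
  using bij bij_id by (cases g) (simp_all add: act_def id_def)

lemma walk_relA: "walk act v (relA b) = v"
  by (simp add: relA_def hword_def wstep_def)

lemma walk_relB: "walk act v relB = v"
proof -
  have "D (C (C (C w))) = C (C (C (C (C (D w)))))" for w by (simp add: DC U3)
  then show ?thesis by (simp add: relB_def wstep_def)
qed

lemma action_cover_rel: "action_cover gens {relA b, relB} act"
proof
  show "r \<noteq> []" if "r \<in> {relA b, relB}" for r using that by (auto simp: relA_def relB_def)
  show "walk act v r = v" if "r \<in> {relA b, relB}" for r v using that walk_relA walk_relB by blast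
qed (simp_all add: act_bij)

definition flip_letter :: "('v \<times> gen) \<times> bool \<Rightarrow> ('v \<times> gen) \<times> bool" where
  "flip_letter x = (fst x, snd x \<noteq> (snd (fst x) = Gen_a \<and> s (fst (fst x))))"

definition neg_letter :: "('v \<times> gen) \<times> bool \<Rightarrow> ('v \<times> gen) \<times> bool" where
  "neg_letter x = (fst x, \<not> snd x)"

text \<open>If \<open>s w\<close>, the loop at \<open>w\<close>, read by the last letter, is
  reversed, and the loop at the other end of \<open>hword\<close> is kept. The sign of the last
  letter changes, and this is the difference between the two relators.\<close>

lemma lift_word_relA_flip:
  "s w \<Longrightarrow> map flip_letter (lift_word act w (relA b)) = lift_word act w (relA (\<not> b))"
  using twist_hword[of w]
  by (cases b) (simp_all add: relA_def hword_def wstep_def flip_letter_def)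

text \<open>If \<open>s w\<close> fails, the reversed loop is the one in the middle. Reading the
  first 17 letters backwards with inverted signs restores it and exchanges the two copies of
  \<open>hword\<close>; the last letter stays in place and only changes its sign.\<close>

lemma lift_word_relA_flip_neg:
  "\<not> s w \<Longrightarrow> rev (map (neg_letter \<circ> flip_letter) (butlast (lift_word act w (relA b)))) @
     [neg_letter (flip_letter (last (lift_word act w (relA b))))] = lift_word act w (relA (\<not> b))"
  using twist_hword[of w]
  by (cases b) (simp_all add: relA_def hword_def wstep_def flip_letter_def neg_letter_def)

text \<open>Reversing the boundary of the face of \<open>relA b\<close> by the reflection that sends the position \<open>x\<close> to
  \<open>17 - x\<close> exchanges the two copies of \<open>[c\<^sup>d, c]\<close> and preserves both letters \<open>a\<close>.\<close>

definition reflect :: "complex \<Rightarrow> complex" where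
  "reflect z = circ 18 17 * cnj z"

lemma norm_reflect [simp]: "norm (reflect z) = norm z"
  by (simp add: reflect_def norm_mult)

lemma reflect_reflect [simp]: "reflect (reflect z) = z"
  by (simp add: reflect_def cnj_circ flip: mult.assoc circ_add) (simp add: circ_def)

lemma reflect_circ: "reflect (circ 18 x) = circ 18 (17 - x)"
  by (simp add: reflect_def cnj_circ flip: circ_add)

text \<open>Exchanges the faces of the two relators in both directions, so that one involution is
  the homeomorphism and its own inverse. Whether the disc is kept or reflected depends on which of
  the two loops \<open>a\<close> on its boundary is reversed.\<close>

primrec flip_point :: "'v \<Rightarrow> gen point \<Rightarrow> gen point" where
  "flip_point v Vertex = Vertex"
| "flip_point v (Edge g t) = Edge g (if g = Gen_a \<and> s v then 1 - t else t)"
| "flip_point v (Face r z) =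
     (if r = relA False then Face (relA True) (if s v then z else reflect z)
      else if r = relA True then Face (relA False) (if s v then z else reflect z)
      else Face r z)"

definition flip :: "'v \<times> gen point \<Rightarrow> 'v \<times> gen point" where
  "flip x = (fst x, flip_point (fst x) (snd x))"

lemma flip_flip [simp]: "flip (flip x) = x"
proof -
  have "flip_point v (flip_point v y) = y" for v y by (cases y) (auto simp: rel_distinct)
  then show ?thesis by (simp add: flip_def)
qed

lemma flip_lift_edge:
  assumes "0 \<le> t" "t \<le> 1"
  shows "flip (lift_edge act e t) = lift_edge act e (if snd e = Gen_a \<and> s (fst e) then 1 - t else t)"
  using assms by (auto simp: flip_def lift_edge_def)

lemma flip_lift_letter:
  assumes "0 \<le> t" "t \<le> 1"
  shows "flip (lift_edge act (fst x) (if snd x then t else 1 - t)) =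
    lift_edge act (fst (flip_letter x)) (if snd (flip_letter x) then t else 1 - t)"
  using assms by (subst flip_lift_edge) (auto simp: flip_letter_def)

lemma lift_face_relA_circ:
  assumes "i < 18" "0 \<le> t" "t \<le> 1"
  shows "lift_face act (w, relA b) (circ 18 (real i + t)) =
    lift_edge act (fst (lift_word act w (relA b) ! i)) (if snd (lift_word act w (relA b) ! i) then t else 1 - t)"
proof -
  interpret action_cover gens "{relA b, relB}" act by (rule action_cover_rel)
  show ?thesis using lift_face_circ[of "relA b" i t w] assms by (simp add: lift_word_nth)
qed

lemma flip_lift_face:
  assumes "norm z \<le> 1"
  shows "flip (lift_face act (w, relA b) z) = lift_face act (w, relA (\<not> b)) (if s w then z else reflect z)"
proof (cases "norm z < 1")
  case True
  then show ?thesis by (cases b) (auto simp: lift_face_def flip_def rel_distinct)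
next
  case False
  then have z1: "norm z = 1" using assms by simp
  let ?L = "lift_word act w (relA b)" and ?L' = "lift_word act w (relA (\<not> b))"
  from circ_surj[of 18, OF _ z1] obtain i t where it: "i < 18" "0 \<le> t" "t < 1" "z = circ 18 (real i + t)"
    by auto
  define y where "y = flip_letter (?L ! i)"
  have f: "flip (lift_face act (w, relA b) z) = lift_edge act (fst y) (if snd y then t else 1 - t)"
    using it flip_lift_letter[of t "?L ! i"] lift_face_relA_circ[of i t w b] by (simp add: y_def)
  show ?thesis
  proof (cases "s w")
    case True
    have "?L' ! i = y"
      unfolding lift_word_relA_flip[OF True, of b, symmetric] y_def using it by simp
    then show ?thesis using f it lift_face_relA_circ[of i t w "\<not> b"] True by simp
  next
    case False
    \<comment> \<open>The reflection sends the position x to 17 - x, hence the letter [i, i + 1] to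
      [16 - i, 17 - i]. For i = 17 this is [-1, 0], which is the letter 17 again.\<close>
    define j where "j = (if i = 17 then 17 else 16 - i)"
    have "?L' ! j = neg_letter y"
    proof (cases "i = 17")
      case True
      then show ?thesis
        unfolding lift_word_relA_flip_neg[OF False, of b, symmetric] y_def j_def
        by (simp add: nth_append last_conv_nth flip: length_0_conv)
    next
      case i: False
      then have "i < 17" "16 - i < 17" using it by simp_all
      then show ?thesis
        unfolding lift_word_relA_flip_neg[OF False, of b, symmetric] y_def j_def using i
        by (simp add: nth_append rev_nth nth_butlast)
    qed
    moreover have "reflect z = circ 18 (real j + (1 - t))"
    proof (cases "i = 17")
      case True
      then have "real j + (1 - t) = (17 - (real i + t)) + real 18" by (simp add: j_def)
      then show ?thesis using circ_period[of 18 "17 - (real i + t)"] it(4) by (simp add: reflect_circ)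
    next
      case i: False
      then have "real j + (1 - t) = 17 - (real i + t)" using it by (simp add: j_def of_nat_diff)
      then show ?thesis unfolding it(4) reflect_circ by (simp only:)
    qed
    moreover have "j < 18" by (auto simp: j_def intro: le_less_trans[OF diff_le_self])
    ultimately have "lift_face act (w, relA (\<not> b)) (reflect z) =
        lift_edge act (fst (neg_letter y)) (if snd (neg_letter y) then 1 - t else 1 - (1 - t))"
      using lift_face_relA_circ[of j "1 - t" w "\<not> b"] it by simp
    then show ?thesis using f False by (auto simp: neg_letter_def)
  qed
qed

lemma continuous_flip:
  "continuous_map (cell_quotient.Q (UNIV \<times> {Vertex}) (UNIV \<times> gens) (lift_edge act) (UNIV \<times> {relA b, relB}) (lift_face act))
     (cell_quotient.Q (UNIV \<times> {Vertex}) (UNIV \<times> gens) (lift_edge act) (UNIV \<times> {relA (\<not> b), relB}) (lift_face act)) flip"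
proof -
  interpret P: action_cover gens "{relA b, relB}" act by (rule action_cover_rel)
  interpret N: action_cover gens "{relA (\<not> b), relB}" act by (rule action_cover_rel)
  show ?thesis
  proof (rule P.cov.continuous_map_from_Q)
    show "flip \<in> UNIV \<times> {Vertex} \<rightarrow> topspace N.cov.Q"
      by (auto simp: N.cov.topspace_Q N.cov.carrier_def N.cov.skel_def flip_def)
    show "continuous_map (top_of_set {0..1}) N.cov.Q (flip \<circ> lift_edge act e)" if e: "e \<in> UNIV \<times> gens" for e
    proof -
      define \<sigma> where "\<sigma> t = (if snd e = Gen_a \<and> s (fst e) then 1 - t else t)" for t :: real
      have "continuous_map (top_of_set {0..1}) (top_of_set {0..1}) \<sigma>"
        unfolding \<sigma>_def by (cases "snd e = Gen_a \<and> s (fst e)") (auto simp: continuous_map_in_subtopology intro!: continuous_intros)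
      from continuous_map_compose[OF this N.cov.continuous_em[OF e]]
      show ?thesis by (rule continuous_map_eq) (simp add: \<sigma>_def flip_lift_edge)
    qed
    show "continuous_map (top_of_set (cball 0 1)) N.cov.Q (flip \<circ> lift_face act f)" if f: "f \<in> UNIV \<times> {relA b, relB}" for f
    proof (cases "snd f = relB")
      case True
      then have "f \<in> UNIV \<times> {relA (\<not> b), relB}" by (simp add: mem_Times_iff)
      from N.cov.continuous_fm[OF this] show ?thesis
      proof (rule continuous_map_eq)
        fix z :: complex assume "z \<in> topspace (top_of_set (cball 0 1))"
        then have z: "norm z \<le> 1" by simp
        show "lift_face act f z = (flip \<circ> lift_face act f) z"
        proof (cases "norm z < 1")
          case True then show ?thesis using \<open>snd f = relB\<close> by (simp add: lift_face_def flip_def rel_distinct)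
        next
          case False
          then have z1: "norm z = 1" using z by simp
          from circ_surj[of 10, OF _ z1] obtain i t where it: "i < 10" "0 \<le> t" "t < 1" "z = circ 10 (real i + t)" by auto
          \<comment> \<open>No letter of \<open>relB\<close> is \<open>a\<close>, so the map fixes
            the lifted boundaries of these faces pointwise.\<close>
          have "i \<in> {0,1,2,3,4,5,6,7,8,9}" using it(1) by auto
          then have "fst (relB ! i) \<noteq> Gen_a" by (auto simp: relB_def)
          moreover have "lift_face act f z = lift_edge act (fst (lift_word act (fst f) relB ! i)) (if snd (relB ! i) then t else 1 - t)"
            using P.lift_face_circ[of relB i t "fst f"] it True by (metis insertCI length_rel(2) less_imp_le prod.collapse)
          ultimately show ?thesis using it by (simp add: flip_lift_edge lift_word_nth)
        qed
      qed
    next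
      case False
      then obtain w where w: "f = (w, relA b)" using f by auto
      define \<rho> where "\<rho> z = (if s w then z else reflect z)" for z
      have "continuous_map (top_of_set (cball 0 1)) (top_of_set (cball 0 1)) \<rho>"
        unfolding \<rho>_def by (cases "s w") (auto simp: continuous_map_in_subtopology reflect_def norm_mult intro!: continuous_intros)
      moreover have "(w, relA (\<not> b)) \<in> UNIV \<times> {relA (\<not> b), relB}" by simp
      ultimately have "continuous_map (top_of_set (cball 0 1)) N.cov.Q (lift_face act (w, relA (\<not> b)) \<circ> \<rho>)"
        using N.cov.continuous_fm continuous_map_compose by blast
      then show ?thesis by (rule continuous_map_eq) (simp add: w \<rho>_def flip_lift_face)
    qed
  qed
qed

theorem common_covering_exists:
  "\<exists>K :: ('v \<times> gen point) cell_complex. common_covering K (K_complex 1) (K_complex (- 1))"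
proof -
  interpret P: action_cover gens "{relA False, relB}" act by (rule action_cover_rel)
  interpret N: action_cover gens "{relA True, relB}" act by (rule action_cover_rel)
  have K: "K_complex 1 = P.base.CX" "K_complex (- 1) = N.base.CX"
    unfolding K_complex_def H_relators_eq gens_def[symmetric]
    by (rule standard_complex_CX; unfold_locales)+
  have h: "homeomorphic_map P.cov.Q N.cov.Q flip"
    unfolding homeomorphic_map_maps homeomorphic_maps_def
    using continuous_flip[of False] continuous_flip[of True] by (intro exI[of _ flip]) simp
  have skel: "P.cov.skel = N.cov.skel" by (simp add: P.cov.skel_def N.cov.skel_def)
  have fs: "flip ` skeleton P.cov.CX n \<subseteq> skeleton N.cov.CX n" for n
  proof -
    consider "n = 0" | "n = 1" | "n \<ge> 2" by linarith
    then show ?thesis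
    proof cases
      case 1 then show ?thesis by (auto simp: P.cov.skeleton_CX(1) N.cov.skeleton_CX(1) flip_def)
    next
      case 2
      have "flip x \<in> N.cov.skel" if x: "x \<in> P.cov.skel" for x
      proof -
        consider "x \<in> UNIV \<times> {Vertex}" | e t where "e \<in> UNIV \<times> gens" "x = lift_edge act e t" "0 < t" "t < 1"
          using x unfolding P.cov.skel_def by force
        then show ?thesis
        proof cases
          case 1 then show ?thesis by (auto simp: N.cov.skel_def flip_def)
        next
          case 2
          then show ?thesis using N.cov.em_in_skel[OF 2(1)] by (simp add: flip_lift_edge)
        qed
      qed
      then show ?thesis unfolding P.cov.skeleton_CX(2)[OF 2] N.cov.skeleton_CX(2)[OF 2] by (rule image_subsetI)
    next
      case 3
      show ?thesis
        using homeomorphic_imp_surjective_map[OF h]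
        unfolding P.cov.skeleton_CX(3)[OF 3] N.cov.skeleton_CX(3)[OF 3] P.cov.topspace_Q N.cov.topspace_Q by simp
    qed
  qed
  have "common_covering P.cov.CX P.base.CX N.base.CX"
    unfolding common_covering_def
  proof (intro conjI exI)
    show "cw_complex P.cov.CX" by (rule P.cov.cw_complex_CX)
    show "topspace (space_of P.cov.CX) \<noteq> {}"
      by (auto simp: P.cov.CX_simps(1) P.cov.topspace_Q P.cov.carrier_def P.cov.skel_def)
    show "covering_map (space_of P.cov.CX) (space_of P.base.CX) snd"
      unfolding P.cov.CX_simps(1) P.base.CX_simps(1) by (rule P.covering_map_snd)
    show "cellular_map P.cov.CX P.base.CX snd"
      unfolding cellular_map_def P.cov.CX_simps(1) P.base.CX_simps(1)
      using P.continuous_snd P.snd_skeleton by blast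
    show "covering_map (space_of P.cov.CX) (space_of N.base.CX) (snd \<circ> flip)"
      unfolding P.cov.CX_simps(1) N.base.CX_simps(1)
      by (rule covering_map_compose_homeomorphism[OF N.covering_map_snd h])
    show "cellular_map P.cov.CX N.base.CX (snd \<circ> flip)"
      unfolding cellular_map_def P.cov.CX_simps(1) N.base.CX_simps(1)
    proof (intro conjI allI)
      show "continuous_map P.cov.Q N.base.Q (snd \<circ> flip)"
        using homeomorphic_imp_continuous_map[OF h] N.continuous_snd by (rule continuous_map_compose)
      show "(snd \<circ> flip) ` skeleton P.cov.CX n \<subseteq> skeleton N.base.CX n" for n
        using image_mono[OF fs[of n], of snd] N.snd_skeleton[of n] by (simp add: image_comp)
    qed
  qed
  then show ?thesis unfolding K by blast
qed

end

section \<open>An infinite action whose commutator has even cycles only\<close>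

lemma funpow_mod_Suc:
  assumes "f ^^ q = id" "q > 0"
  shows "(f ^^ nat ((n + 1) mod int q)) k = f ((f ^^ nat (n mod int q)) k)"
proof -
  have b: "0 \<le> n mod int q" "n mod int q < int q" using assms(2) by simp_all
  have e: "(n + 1) mod int q = (n mod int q + 1) mod int q" by (simp add: mod_add_left_eq)
  show ?thesis
  proof (cases "n mod int q = int q - 1")
    case True
    then have "(n + 1) mod int q = 0" using e by simp
    moreover have "Suc (nat (n mod int q)) = q" using True assms(2) by simp
    then have "f ((f ^^ nat (n mod int q)) k) = (f ^^ q) k" by (metis funpow.simps(2) o_apply)
    ultimately show ?thesis using assms(1) by simp
  next
    case False
    then have "(n mod int q + 1) mod int q = n mod int q + 1" using b by (intro mod_pos_pos_trivial) linarith+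
    then have "nat ((n + 1) mod int q) = Suc (nat (n mod int q))" using b e by simp
    then show ?thesis by simp
  qed
qed

text \<open>For \<open>f\<close> of finite order, \<open>(m, k) \<mapsto> (m + p, f k)\<close> is conjugate to the shift of the first component.\<close>

definition unroll :: "nat \<Rightarrow> nat \<Rightarrow> (nat \<Rightarrow> nat) \<Rightarrow> int \<times> nat \<Rightarrow> int \<times> nat" where
  "unroll p q f x = (int p * fst x + int (snd x mod p), (f ^^ nat (fst x mod int q)) (snd x div p))"

lemma unroll_shift:
  assumes "f ^^ q = id" "q > 0"
  shows "unroll p q f (n + 1, N) = (fst (unroll p q f (n, N)) + int p, f (snd (unroll p q f (n, N))))"
  using funpow_mod_Suc[OF assms, of n "N div p"] by (simp add: unroll_def algebra_simps)

text \<open>Each orbit of the map (m, k) to (m + p, f k) has exactly one point (j, k) with 0 \<le> j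
  < p. The natural number p k + j encodes this point, and the integer counts the steps from
  it.\<close>

lemma bij_unroll:
  assumes "p > 0" "bij f"
  shows "bij (unroll p q f)"
proof (rule bijI)
  have b: "bij (f ^^ n)" for n using assms(2) by (rule bij_fn)
  show "inj (unroll p q f)"
  proof (rule injI)
    fix x y assume e: "unroll p q f x = unroll p q f y"
    have d: "(int p * a + int (b mod p)) div int p = a" "(int p * a + int (b mod p)) mod int p = int (b mod p)" for a b
      using assms(1) by simp_all
    have e1: "int p * fst x + int (snd x mod p) = int p * fst y + int (snd y mod p)"
      using e by (simp add: unroll_def)
    have f1: "fst x = fst y" using d(1)[of "fst x" "snd x"] d(1)[of "fst y" "snd y"] e1 by simp
    then have m: "snd x mod p = snd y mod p" using e1 by simp
    have "snd x div p = snd y div p"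
      using e f1 bij_is_inj[OF b] by (simp add: unroll_def inj_eq)
    then have "snd x = snd y" using m by (metis div_mult_mod_eq)
    with f1 show "x = y" by (simp add: prod_eq_iff)
  qed
  show "surj (unroll p q f)"
  proof (rule surjI)
    fix y :: "int \<times> nat"
    define n where "n = fst y div int p"
    define j where "j = nat (fst y mod int p)"
    have j: "j < p" using assms(1) by (simp add: j_def nat_less_iff)
    define k where "k = inv (f ^^ nat (n mod int q)) (snd y)"
    have k: "(f ^^ nat (n mod int q)) k = snd y"
      using bij_is_surj[OF b] by (simp add: k_def surj_f_inv_f)
    show "unroll p q f (fst y div int p, p * inv (f ^^ nat ((fst y div int p) mod int q)) (snd y) + nat (fst y mod int p)) = y"
      using j k assms(1) unfolding n_def[symmetric] j_def[symmetric] k_def[symmetric]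
      by (simp add: unroll_def prod_eq_iff) (simp add: n_def j_def)
  qed
qed

text \<open>Infinitely many copies of a permutation of ten points, in order to equalise the numbers
  of cycles: over a single block the shifts by 3 and by 5 would have 30 and 50 cycles and could not
  be conjugate.\<close>

definition block_perm :: "nat list \<Rightarrow> nat \<Rightarrow> nat" where
  "block_perm p k = 10 * (k div 10) + p ! (k mod 10)"

text \<open>In cycles, (0 1 2 3 4)(5 6 7 8 9) for \<open>perm_c\<close> and (0 5 6)(1 2 8)(3 7 4)
  for \<open>perm_u\<close>. A single 5-cycle would not do: five points cannot be filled by even
  cycles of the commutator.\<close>

definition perm_c :: "nat list" where "perm_c = [1, 2, 3, 4, 0, 6, 7, 8, 9, 5]"
definition perm_u :: "nat list" where "perm_u = [5, 2, 8, 7, 3, 6, 0, 4, 1, 9]"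

lemma less_ten_cases: "(n::nat) < 10 \<longleftrightarrow> n \<in> {0,1,2,3,4,5,6,7,8,9}"
  by auto

lemma perm_bounds: "n < 10 \<Longrightarrow> perm_c ! n < 10" "n < 10 \<Longrightarrow> perm_u ! n < 10"
  unfolding less_ten_cases perm_c_def perm_u_def by auto

lemma block_perm_mod: "n < 10 \<Longrightarrow> p ! n < 10 \<Longrightarrow> block_perm p (10 * a + n) = 10 * a + p ! n"
  by (simp add: block_perm_def)

lemma block_induct: "(\<And>a n. n < 10 \<Longrightarrow> P (10 * a + n)) \<Longrightarrow> P (k::nat)"
  by (metis div_mult_mod_eq mult.commute mod_less_divisor zero_less_numeral)

lemma block_c: "n < 10 \<Longrightarrow> block_perm perm_c (10 * a + n) = 10 * a + perm_c ! n"
  and block_u: "n < 10 \<Longrightarrow> block_perm perm_u (10 * a + n) = 10 * a + perm_u ! n"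
  using block_perm_mod perm_bounds by simp_all

lemma funpow_numerals: "(f ^^ 5) x = f (f (f (f (f x))))" "(f ^^ 3) x = f (f (f x))" for f :: "'a \<Rightarrow> 'a"
  by (simp_all add: numeral_eq_Suc)

lemma block_perm_c5: "block_perm perm_c ^^ 5 = id"
proof
  fix k show "(block_perm perm_c ^^ 5) k = id k"
  proof (induction k rule: block_induct)
    fix a n :: nat assume n: "n < 10"
    have "perm_c ! (perm_c ! (perm_c ! (perm_c ! (perm_c ! n)))) = n"
      using n unfolding less_ten_cases perm_c_def by auto
    then show "(block_perm perm_c ^^ 5) (10 * a + n) = id (10 * a + n)"
      using n perm_bounds(1) by (simp add: funpow_numerals block_c)
  qed
qed

lemma block_perm_u3: "block_perm perm_u ^^ 3 = id"
proof
  fix k show "(block_perm perm_u ^^ 3) k = id k"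
  proof (induction k rule: block_induct)
    fix a n :: nat assume n: "n < 10"
    have "perm_u ! (perm_u ! (perm_u ! n)) = n"
      using n unfolding less_ten_cases perm_u_def by auto
    then show "(block_perm perm_u ^^ 3) (10 * a + n) = id (10 * a + n)"
      using n perm_bounds(2) by (simp add: funpow_numerals block_u)
  qed
qed

lemma bij_of_finite_order: "f ^^ Suc n = id \<Longrightarrow> bij f"
  by (rule o_bij[of "f ^^ n"]) (simp_all add: funpow_swap1 fun_eq_iff)

text \<open>A two-colouring of the cycles of the commutator of \<open>perm_u\<close> and \<open>perm_c\<close>, which have lengths 8 and 2.\<close>

definition colour :: "nat \<Rightarrow> bool" where
  "colour k \<longleftrightarrow> k mod 10 \<in> {0, 3, 4, 6, 9}"

lemma colour_twist:
  "colour (block_perm perm_c (block_perm perm_u k)) \<longleftrightarrow> \<not> colour (block_perm perm_u (block_perm perm_c k))"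
proof (induction k rule: block_induct)
  fix a n :: nat assume n: "n < 10"
  have "colour (10 * a + perm_c ! (perm_u ! n)) \<longleftrightarrow> \<not> colour (10 * a + perm_u ! (perm_c ! n))"
    using n unfolding less_ten_cases perm_c_def perm_u_def colour_def by auto
  then show "colour (block_perm perm_c (block_perm perm_u (10 * a + n))) \<longleftrightarrow>
      \<not> colour (block_perm perm_u (block_perm perm_c (10 * a + n)))"
    using n perm_bounds by (simp add: block_c block_u)
qed

text \<open>The steps 3 and 5 are crossed with the orders 5 and 3: five steps of
  \<open>shift_c\<close> and three of \<open>shift_u\<close> both add 15 and fix the second
  component. In the commutator the integer steps cancel.\<close>

definition shift_c :: "int \<times> nat \<Rightarrow> int \<times> nat" where "shift_c x = (fst x + 3, block_perm perm_c (snd x))"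
definition shift_u :: "int \<times> nat \<Rightarrow> int \<times> nat" where "shift_u x = (fst x + 5, block_perm perm_u (snd x))"

text \<open>Since \<open>c\<^sup>5 = u\<^sup>3\<close> and \<open>c\<close>, \<open>u\<close> are conjugate, this is an action of the Baumslag--Solitar group in which
  \<open>[u, c]\<close> has no odd cycle.\<close>

lemma twisted_permutations:
  obtains C D U :: "nat \<Rightarrow> nat" and s :: "nat \<Rightarrow> bool" where
    "bij C" "bij D" "\<And>x. D (C x) = U (D x)" "\<And>x. U (U (U x)) = C (C (C (C (C x))))"
    "\<And>x. s (C (U x)) \<longleftrightarrow> \<not> s (U (C x))"
proof -
  let ?c = "block_perm perm_c" and ?u = "block_perm perm_u"
  have c5: "?c (?c (?c (?c (?c k)))) = k" for k using fun_cong[OF block_perm_c5, of k] by (simp add: funpow_numerals)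
  have u3: "?u (?u (?u k)) = k" for k using fun_cong[OF block_perm_u3, of k] by (simp add: funpow_numerals)
  have bc: "bij ?c" using bij_of_finite_order[where f="?c" and n=4] block_perm_c5 by simp
  have bu: "bij ?u" using bij_of_finite_order[where f="?u" and n=2] block_perm_u3 by (simp add: numeral_3_eq_3)
  define A where "A = unroll 3 5 ?c"
  define B where "B = unroll 5 3 ?u"
  have bA: "bij A" and bB: "bij B" unfolding A_def B_def using bc bu by (simp_all add: bij_unroll)
  have Ash: "A (fst x + 1, snd x) = shift_c (A x)" and Bsh: "B (fst x + 1, snd x) = shift_u (B x)" for x
    using unroll_shift[OF block_perm_c5, of 3 "fst x" "snd x"] unroll_shift[OF block_perm_u3, of 5 "fst x" "snd x"]
    by (simp_all add: A_def B_def shift_c_def shift_u_def)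
  \<comment> \<open>\<open>A\<close> and \<open>B\<close> turn the unit shift into
    \<open>shift_c\<close> and \<open>shift_u\<close>. Going back along \<open>A\<close> and forth
    along \<open>B\<close> conjugates the first into the second; this is the action of
    \<open>d\<close>.\<close>
  define d where "d = B \<circ> inv A"
  have bd: "bij d" unfolding d_def using bA bB by (intro bij_comp bij_imp_bij_inv)
  have dc: "d (shift_c x) = shift_u (d x)" for x
  proof -
    define y where "y = inv A x"
    have x: "x = A y" using bA by (simp add: y_def bij_is_surj surj_f_inv_f)
    have "inv A (shift_c x) = (fst y + 1, snd y)"
      unfolding x Ash[symmetric] using bA by (simp add: bij_is_inj)
    then show ?thesis by (simp add: d_def Bsh flip: y_def)
  qed
  have bsc: "bij shift_c"
  proof (rule o_bij)
    let ?g = "\<lambda>x. (fst x - 3, inv ?c (snd x))"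
    show "?g \<circ> shift_c = id" "shift_c \<circ> ?g = id"
      using bc by (auto simp: shift_c_def fun_eq_iff bij_is_inj bij_is_surj surj_f_inv_f)
  qed
  \<comment> \<open>A change of names: pairs of an integer and a natural number are coded by natural
    numbers, the fibre that occurs in the final statement.\<close>
  define e where "e = prod_encode \<circ> map_prod int_encode id"
  have be: "bij e"
    unfolding e_def
  proof (rule bij_comp)
    show "bij (map_prod int_encode id)"
      using bij_betw_map_prod[of int_encode UNIV UNIV id UNIV UNIV] bij_int_encode by (simp add: UNIV_Times_UNIV)
  qed (rule bij_prod_encode)
  have ie: "inv e (e x) = x" for x using be by (simp add: bij_is_inj)
  show thesis
  proof (rule that[of "e \<circ> shift_c \<circ> inv e" "e \<circ> d \<circ> inv e" "e \<circ> shift_u \<circ> inv e" "colour \<circ> snd \<circ> inv e"])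
    show "bij (e \<circ> shift_c \<circ> inv e)" "bij (e \<circ> d \<circ> inv e)"
      using be bsc bd by (intro bij_comp bij_imp_bij_inv; simp)+
    fix x
    show "(e \<circ> d \<circ> inv e) ((e \<circ> shift_c \<circ> inv e) x) = (e \<circ> shift_u \<circ> inv e) ((e \<circ> d \<circ> inv e) x)"
      by (simp add: ie dc)
  qed (simp_all add: ie shift_c_def shift_u_def c5 u3 colour_twist)
qed

section \<open>Recognising branch points\<close>

definition local_homeo :: "'a topology \<Rightarrow> 'b topology \<Rightarrow> ('a \<Rightarrow> 'b) \<Rightarrow> bool" where
  "local_homeo X Y p \<longleftrightarrow> continuous_map X Y p \<and> (\<forall>x\<in>topspace X. \<exists>U T. openin X U \<and> x \<in> U \<and> openin Y T \<and>
     homeomorphic_map (subtopology X U) (subtopology Y T) p)"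

lemma local_homeoE:
  assumes "local_homeo X Y p" "x \<in> topspace X"
  obtains U T where "openin X U" "x \<in> U" "openin Y T" "homeomorphic_map (subtopology X U) (subtopology Y T) p"
proof -
  from assms(1)[unfolded local_homeo_def, THEN conjunct2, THEN bspec, OF assms(2)]
  show thesis by (elim exE conjE) (rule that)
qed

lemma covering_map_local_homeo:
  assumes "covering_map X Y p" shows "local_homeo X Y p"
  unfolding local_homeo_def
proof (intro conjI ballI)
  have c: "continuous_map X Y p" "p ` topspace X = topspace Y" using assms by (auto simp: covering_map_def)
  show "continuous_map X Y p" by (rule c)
  fix x assume x: "x \<in> topspace X"
  then have "p x \<in> topspace Y" using c(2) by blast
  from covering_map_sheets[OF assms this] obtain T \<V> where T: "p x \<in> T" "openin Y T"
    and V: "\<Union>\<V> = {x \<in> topspace X. p x \<in> T}" "\<forall>U\<in>\<V>. openin X U" "pairwise disjnt \<V>"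
      "\<forall>U\<in>\<V>. homeomorphic_map (subtopology X U) (subtopology Y T) p" .
  have "x \<in> \<Union>\<V>" unfolding V(1) using x T by simp
  then obtain U where "U \<in> \<V>" "x \<in> U" by blast
  then show "\<exists>U T. openin X U \<and> x \<in> U \<and> openin Y T \<and> homeomorphic_map (subtopology X U) (subtopology Y T) p"
    using bspec[OF V(2)] bspec[OF V(4)] T(2) by (intro exI[of _ U] exI[of _ T]) simp
qed

lemma homeomorphic_map_open_subs:
  assumes "homeomorphic_map (subtopology X U) (subtopology Y T) p" "openin X U" "openin Y T"
  shows "inj_on p U" "p ` U = T" "\<And>N. openin X N \<Longrightarrow> N \<subseteq> U \<Longrightarrow> openin Y (p ` N)"
proof -
  have U: "topspace (subtopology X U) = U" "topspace (subtopology Y T) = T"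
    by (intro topspace_subtopology_subset openin_subset assms(2,3))+
  show "inj_on p U" using homeomorphic_imp_injective_map[OF assms(1)] U by simp
  show "p ` U = T" using homeomorphic_imp_surjective_map[OF assms(1)] U by simp
  fix N assume N: "openin X N" "N \<subseteq> U"
  then have "openin (subtopology X U) N" using assms(2) by (simp add: openin_open_subtopology)
  then have "openin (subtopology Y T) (p ` N)"
    using homeomorphic_imp_open_map[OF assms(1)] by (simp add: open_map_def)
  then show "openin Y (p ` N)" using assms(3) by (simp add: openin_open_subtopology)
qed

text \<open>Serves to study the preimage of the graph as a space of its own: the restricted map is
  again a local homeomorphism, so one-dimensional branching can be transported too.\<close>

lemma local_homeo_restrict:
  assumes "local_homeo X Y p"
  shows "local_homeo (subtopology X {x \<in> topspace X. p x \<in> G}) (subtopology Y G) p"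
  unfolding local_homeo_def
proof (intro conjI ballI)
  define P where "P = {x \<in> topspace X. p x \<in> G}"
  have c: "continuous_map X Y p" using assms by (simp add: local_homeo_def)
  show "continuous_map (subtopology X {x \<in> topspace X. p x \<in> G}) (subtopology Y G) p"
    using c by (auto simp: continuous_map_in_subtopology continuous_map_from_subtopology)
  fix x assume "x \<in> topspace (subtopology X {x \<in> topspace X. p x \<in> G})"
  then have x: "x \<in> topspace X" "x \<in> P" by (auto simp: P_def)
  from local_homeoE[OF assms x(1)] obtain U T where UT: "openin X U" "x \<in> U" "openin Y T"
    "homeomorphic_map (subtopology X U) (subtopology Y T) p" .
  have UX: "U \<subseteq> topspace X" "T \<subseteq> topspace Y" using UT openin_subset by auto
  have pU: "p ` U = T" using homeomorphic_map_open_subs(2)[OF UT(4,1,3)] .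
  have "p ` (topspace (subtopology X U) \<inter> (P \<inter> U)) = topspace (subtopology Y T) \<inter> (G \<inter> T)"
  proof -
    have "topspace (subtopology X U) \<inter> (P \<inter> U) = {z \<in> U. p z \<in> G}" using UX by (auto simp: P_def)
    moreover have "topspace (subtopology Y T) \<inter> (G \<inter> T) = T \<inter> G" using UX by auto
    moreover have "p ` {z \<in> U. p z \<in> G} = T \<inter> G" unfolding pU[symmetric] by auto
    ultimately show ?thesis by simp
  qed
  from homeomorphic_map_subtopologies[OF UT(4) this]
  have "homeomorphic_map (subtopology X (P \<inter> U)) (subtopology Y (G \<inter> T)) p"
    by (simp add: subtopology_subtopology Int_absorb1 Int_absorb2 inf_commute inf_left_commute)
  then have h: "homeomorphic_map (subtopology (subtopology X P) (P \<inter> U)) (subtopology (subtopology Y G) (G \<inter> T)) p"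
    by (simp add: subtopology_subtopology)
  have "openin (subtopology X P) (P \<inter> U)" "openin (subtopology Y G) (G \<inter> T)"
    using UT(1,3) openin_subtopology_Int2 by auto
  then show "\<exists>U T. openin (subtopology X {x \<in> topspace X. p x \<in> G}) U \<and> x \<in> U \<and> openin (subtopology Y G) T \<and>
      homeomorphic_map (subtopology (subtopology X {x \<in> topspace X. p x \<in> G}) U) (subtopology (subtopology Y G) T) p"
    using h x UT(2) unfolding P_def[symmetric] by (intro exI[of _ "P \<inter> U"] exI[of _ "G \<inter> T"]) simp
qed

text \<open>A continuous injection of a neighbourhood is asked for; invariance of domain will supply
  the rest. The type argument fixes the dimension: \<open>complex\<close> for the whole space,
  \<open>real\<close> for its graph.\<close>

definition euclidean_at :: "'e::euclidean_space itself \<Rightarrow> 'a topology \<Rightarrow> 'a \<Rightarrow> bool" where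
  "euclidean_at E X x \<longleftrightarrow> (\<exists>U (h :: 'a \<Rightarrow> 'e). openin X U \<and> x \<in> U \<and>
     continuous_map (subtopology X U) euclidean h \<and> inj_on h U)"

text \<open>A positive witness against being Euclidean: a copy of an open set of the Euclidean space
  passes through \<open>x\<close>, yet points outside this copy accumulate at
  \<open>x\<close>.\<close>

definition branches_at :: "'e::euclidean_space itself \<Rightarrow> 'a topology \<Rightarrow> 'a \<Rightarrow> bool" where
  "branches_at E X x \<longleftrightarrow> (\<exists>S (e :: 'e \<Rightarrow> 'a) w. open S \<and> w \<in> S \<and> continuous_map (top_of_set S) X e \<and> inj_on e S \<and>
     e w = x \<and> x \<in> X closure_of (topspace X - e ` S))"

lemma euclidean_atE:
  assumes "euclidean_at TYPE('e::euclidean_space) X x"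
  obtains U and h :: "'a \<Rightarrow> 'e::euclidean_space" where "openin X U" "x \<in> U" "continuous_map (subtopology X U) euclidean h" "inj_on h U"
  using assms unfolding euclidean_at_def by (elim exE conjE) (rule that)

lemma branches_atE:
  assumes "branches_at TYPE('e::euclidean_space) X x"
  obtains S and e :: "'e::euclidean_space \<Rightarrow> 'a" and w where "open S" "w \<in> S" "continuous_map (top_of_set S) X e" "inj_on e S"
    "e w = x" "x \<in> X closure_of (topspace X - e ` S)"
  using assms unfolding branches_at_def by (elim exE conjE) (rule that)

text \<open>With a chart \<open>h\<close> the composite \<open>h \<circ> e\<close> is a continuous
  injection between sets of the same dimension, hence open by invariance of domain. The copy then
  fills a neighbourhood of \<open>x\<close>, and nothing outside it accumulates there.\<close>

lemma euclidean_not_branches: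
  assumes "euclidean_at TYPE('e::euclidean_space) X x" shows "\<not> branches_at TYPE('e) X x"
proof
  assume "branches_at TYPE('e) X x"
  then obtain S and e :: "'e \<Rightarrow> 'a" and w where e: "open S" "w \<in> S" "continuous_map (top_of_set S) X e" "inj_on e S"
    "e w = x" "x \<in> X closure_of (topspace X - e ` S)" by (rule branches_atE)
  from assms obtain U and h :: "'a \<Rightarrow> 'e" where h: "openin X U" "x \<in> U"
    "continuous_map (subtopology X U) euclidean h" "inj_on h U" by (rule euclidean_atE)
  define W where "W = {w \<in> S. e w \<in> U}"
  have "openin (top_of_set S) W" using openin_continuous_map_preimage[OF e(3) h(1)] by (simp add: W_def)
  then have oW: "open W" using e(1) by (simp add: openin_open_eq)
  have "continuous_map (top_of_set W) (subtopology X U) e"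
    using e(3) by (auto simp: continuous_map_in_subtopology W_def intro: continuous_map_from_subtopology_mono)
  then have "continuous_map (top_of_set W) euclidean (h \<circ> e)" using h(3) by (rule continuous_map_compose)
  then have "continuous_on W (h \<circ> e)" by simp
  moreover have "inj_on (h \<circ> e) W"
    by (rule comp_inj_on) (use e(4) h(4) in \<open>auto simp: W_def inj_on_def\<close>)
  ultimately have "open ((h \<circ> e) ` W)" using oW by (intro invariance_of_domain)
  then have "openin (subtopology X U) {u \<in> topspace (subtopology X U). h u \<in> (h \<circ> e) ` W}"
    using h(3) by (intro openin_continuous_map_preimage) auto
  then have o: "openin X {u \<in> U. h u \<in> (h \<circ> e) ` W}"
    unfolding topspace_subtopology_subset[OF openin_subset[OF h(1)]]
    using openin_open_subtopology[OF h(1)] by blast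
  have sub: "{u \<in> U. h u \<in> (h \<circ> e) ` W} \<subseteq> e ` S"
  proof
    fix u assume "u \<in> {u \<in> U. h u \<in> (h \<circ> e) ` W}"
    then obtain w where "u \<in> U" "w \<in> W" "h u = h (e w)" by auto
    then have "u = e w" using h(4) by (auto simp: W_def inj_on_def)
    then show "u \<in> e ` S" using \<open>w \<in> W\<close> by (simp add: W_def)
  qed
  have "x \<in> {u \<in> U. h u \<in> (h \<circ> e) ` W}" using h(2) e(2,5) by (auto simp: W_def)
  then obtain y where "y \<in> topspace X - e ` S" "y \<in> {u \<in> U. h u \<in> (h \<circ> e) ` W}"
    using e(6) o unfolding in_closure_of by metis
  then show False using sub by blast
qed

lemma euclidean_at_local_homeo:
  assumes "local_homeo X Y p" "x \<in> topspace X" "euclidean_at TYPE('e::euclidean_space) Y (p x)"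
  shows "euclidean_at TYPE('e) X x"
proof -
  from local_homeoE[OF assms(1,2)] obtain U T where UT: "openin X U" "x \<in> U" "openin Y T"
    "homeomorphic_map (subtopology X U) (subtopology Y T) p" .
  from assms(3) obtain V and h :: "'b \<Rightarrow> 'e" where h: "openin Y V" "p x \<in> V"
    "continuous_map (subtopology Y V) euclidean h" "inj_on h V" by (rule euclidean_atE)
  have c: "continuous_map X Y p" using assms(1) by (simp add: local_homeo_def)
  define N where "N = U \<inter> {z \<in> topspace X. p z \<in> V}"
  have "openin X N" unfolding N_def using UT(1) openin_continuous_map_preimage[OF c h(1)] by (rule openin_Int)
  moreover have "x \<in> N" using UT(2) assms(2) h(2) by (simp add: N_def)
  moreover have "continuous_map (subtopology X N) (subtopology Y V) p"
    using c by (auto simp: continuous_map_in_subtopology N_def intro: continuous_map_from_subtopology)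
  then have "continuous_map (subtopology X N) euclidean (h \<circ> p)" using h(3) by (rule continuous_map_compose)
  moreover have "inj_on (h \<circ> p) N"
    using homeomorphic_map_open_subs(1)[OF UT(4,1,3)] h(4) by (auto simp: N_def inj_on_def)
  ultimately show ?thesis unfolding euclidean_at_def by blast
qed

lemma branches_at_local_homeo:
  assumes "local_homeo X Y p" "x \<in> topspace X" "branches_at TYPE('e::euclidean_space) Y (p x)"
  shows "branches_at TYPE('e) X x"
proof -
  from local_homeoE[OF assms(1,2)] obtain U T where UT: "openin X U" "x \<in> U" "openin Y T"
    "homeomorphic_map (subtopology X U) (subtopology Y T) p" .
  have UX: "topspace (subtopology X U) = U" "topspace (subtopology Y T) = T"
    by (intro topspace_subtopology_subset openin_subset UT)+
  obtain g where "homeomorphic_maps (subtopology X U) (subtopology Y T) p g"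
    using UT(4) by (auto simp: homeomorphic_map_maps)
  then have g: "continuous_map (subtopology Y T) (subtopology X U) g" "\<And>u. u \<in> U \<Longrightarrow> g (p u) = u" "\<And>t. t \<in> T \<Longrightarrow> p (g t) = t"
    using UX by (simp_all add: homeomorphic_maps_def)
  from assms(3) obtain S and e :: "'e \<Rightarrow> 'b" and w where e: "open S" "w \<in> S" "continuous_map (top_of_set S) Y e" "inj_on e S"
    "e w = p x" "p x \<in> Y closure_of (topspace Y - e ` S)" by (rule branches_atE)
  define S' where "S' = {w \<in> S. e w \<in> T}"
  have "openin (top_of_set S) S'" using openin_continuous_map_preimage[OF e(3) UT(3)] by (simp add: S'_def)
  then have "open S'" using e(1) by (simp add: openin_open_eq)
  moreover have pxT: "p x \<in> T" using homeomorphic_map_open_subs(2)[OF UT(4,1,3)] UT(2) by blast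
  then have "w \<in> S'" using e(2,5) by (simp add: S'_def)
  moreover have "continuous_map (top_of_set S') X (g \<circ> e)"
  proof -
    have "continuous_map (top_of_set S') (subtopology Y T) e"
      using e(3) by (auto simp: continuous_map_in_subtopology S'_def intro: continuous_map_from_subtopology_mono)
    from continuous_map_compose[OF this g(1)] show ?thesis by (simp add: continuous_map_in_subtopology)
  qed
  moreover have "inj_on (g \<circ> e) S'"
  proof (rule inj_onI)
    fix a b assume ab: "a \<in> S'" "b \<in> S'" "(g \<circ> e) a = (g \<circ> e) b"
    have "p (g (e a)) = e a" "p (g (e b)) = e b" using ab(1,2) g(3) by (simp_all add: S'_def)
    then have "e a = e b" using ab(3) by (metis comp_apply)
    then show "a = b" using inj_onD[OF e(4)] ab by (simp add: S'_def)
  qed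
  moreover have "(g \<circ> e) w = x" using e(5) g(2)[OF UT(2)] by simp
  moreover have "x \<in> X closure_of (topspace X - (g \<circ> e) ` S')"
    unfolding in_closure_of
  proof (intro conjI allI impI)
    fix N assume N: "x \<in> N \<and> openin X N"
    have "openin X (N \<inter> U)" using N UT(1) by blast
    then have "openin Y (p ` (N \<inter> U))" using homeomorphic_map_open_subs(3)[OF UT(4,1,3)] by blast
    moreover have "p x \<in> p ` (N \<inter> U)" using N UT(2) by blast
    ultimately obtain y where "y \<in> topspace Y - e ` S" "y \<in> p ` (N \<inter> U)" using e(6) unfolding in_closure_of by metis
    then obtain z where z: "z \<in> N" "z \<in> U" "p z \<notin> e ` S" by blast
    have "z \<notin> (g \<circ> e) ` S'"
    proof
      assume "z \<in> (g \<circ> e) ` S'"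
      then obtain a where "a \<in> S'" "z = g (e a)" by auto
      then have "p z = e a" using g(3) by (simp add: S'_def)
      then show False using z(3) \<open>a \<in> S'\<close> by (simp add: S'_def)
    qed
    moreover have "z \<in> topspace X" using z(2) openin_subset[OF UT(1)] by blast
    ultimately show "\<exists>y. y \<in> topspace X - (g \<circ> e) ` S' \<and> y \<in> N" using z(1) by blast
  qed (rule assms(2))
  ultimately show ?thesis unfolding branches_at_def by blast
qed

section \<open>Lifting discs\<close>

lemma unique_lift:
  fixes S :: "'z::topological_space set"
  assumes cov: "local_homeo X Y p" "Hausdorff_space X" and "connected S"
    and f: "continuous_map (top_of_set S) X f" and g: "continuous_map (top_of_set S) X g"
    and eq: "\<And>s. s \<in> S \<Longrightarrow> p (f s) = p (g s)" and a: "a \<in> S" "f a = g a" and s: "s \<in> S"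
  shows "f s = g s"
proof -
  define A where "A = {s \<in> S. f s = g s}"
  have "closedin (top_of_set S) A"
    using closedin_continuous_maps_eq[OF cov(2) f g] by (simp add: A_def)
  moreover have "openin (top_of_set S) A"
  proof (subst openin_subopen, intro ballI)
    fix b assume b: "b \<in> A"
    then have bS: "b \<in> S" "f b = g b" by (auto simp: A_def)
    have "f b \<in> topspace X" using f bS(1) by (auto simp: continuous_map_def)
    from local_homeoE[OF cov(1) this] obtain U T where UT: "openin X U" "f b \<in> U" "openin Y T"
      "homeomorphic_map (subtopology X U) (subtopology Y T) p" .
    define N where "N = {s \<in> S. f s \<in> U} \<inter> {s \<in> S. g s \<in> U}"
    have "openin (top_of_set S) N"
      unfolding N_def using openin_continuous_map_preimage[OF f UT(1)] openin_continuous_map_preimage[OF g UT(1)]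
      by (simp add: openin_Int)
    moreover have "b \<in> N" using bS UT(2) by (simp add: N_def)
    moreover have "N \<subseteq> A"
      using eq inj_onD[OF homeomorphic_map_open_subs(1)[OF UT(4,1,3)]] unfolding N_def A_def by blast
    ultimately show "\<exists>T. openin (top_of_set S) T \<and> b \<in> T \<and> T \<subseteq> A" by blast
  qed
  ultimately have "A = {} \<or> A = S" using \<open>connected S\<close> by (simp add: connected_clopen)
  moreover have "a \<in> A" using a by (simp add: A_def)
  ultimately show ?thesis using s by (auto simp: A_def)
qed

text \<open>The start \<open>a\<close> is an arbitrary point of \<open>S\<close> rather than a fixed
  one: then two sets can be glued wherever the lift begins, and restriction to subsets is
  immediate.\<close>

definition liftable :: "'a topology \<Rightarrow> ('a \<Rightarrow> 'b) \<Rightarrow> ('z::topological_space \<Rightarrow> 'b) \<Rightarrow> 'z set \<Rightarrow> bool" where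
  "liftable X p f S \<longleftrightarrow> (\<forall>a\<in>S. \<forall>x\<in>topspace X. p x = f a \<longrightarrow>
     (\<exists>g. continuous_map (top_of_set S) X g \<and> (\<forall>s\<in>S. p (g s) = f s) \<and> g a = x))"

lemma liftable_subset: "liftable X p f S \<Longrightarrow> S' \<subseteq> S \<Longrightarrow> liftable X p f S'"
  unfolding liftable_def by (meson continuous_map_from_subtopology_mono subsetD)

lemma liftable_small:
  assumes "covering_map X Y p" "continuous_map euclidean Y f"
  shows "\<exists>N. open N \<and> w \<in> N \<and> liftable X p f N"
proof -
  have "f w \<in> topspace Y" using assms(2) by (auto simp: continuous_map_def)
  from covering_map_sheets[OF assms(1) this] obtain T \<V> where T: "f w \<in> T" "openin Y T"
    and V: "\<Union>\<V> = {x \<in> topspace X. p x \<in> T}" "\<forall>U\<in>\<V>. openin X U" "pairwise disjnt \<V>"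
      "\<forall>U\<in>\<V>. homeomorphic_map (subtopology X U) (subtopology Y T) p" .
  define N where "N = {z. f z \<in> T}"
  have "open N" using openin_continuous_map_preimage[OF assms(2) T(2)] by (simp add: N_def)
  moreover have "liftable X p f N"
    unfolding liftable_def
  proof (intro ballI impI)
    fix a x assume ax: "a \<in> N" "x \<in> topspace X" "p x = f a"
    then have "x \<in> \<Union>\<V>" unfolding V(1) by (simp add: N_def)
    then obtain U where U: "U \<in> \<V>" "x \<in> U" by blast
    have h: "homeomorphic_map (subtopology X U) (subtopology Y T) p" "openin X U"
      using bspec[OF V(4) U(1)] bspec[OF V(2) U(1)] .
    have UX: "topspace (subtopology X U) = U" "topspace (subtopology Y T) = T"
      by (intro topspace_subtopology_subset openin_subset h(2) T(2))+
    obtain q where "homeomorphic_maps (subtopology X U) (subtopology Y T) p q"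
      using h(1) by (auto simp: homeomorphic_map_maps)
    then have q: "continuous_map (subtopology Y T) (subtopology X U) q" "\<And>u. u \<in> U \<Longrightarrow> q (p u) = u" "\<And>t. t \<in> T \<Longrightarrow> p (q t) = t"
      using UX by (simp_all add: homeomorphic_maps_def)
    have "continuous_map (top_of_set N) (subtopology Y T) f"
      using assms(2) by (auto simp: continuous_map_in_subtopology N_def intro: continuous_map_from_subtopology)
    from continuous_map_compose[OF this q(1)] have "continuous_map (top_of_set N) X (q \<circ> f)"
      by (simp add: continuous_map_in_subtopology)
    moreover have "p ((q \<circ> f) s) = f s" if "s \<in> N" for s using that q(3) by (simp add: N_def)
    moreover have "(q \<circ> f) a = x" using q(2)[OF U(2)] ax(3) by simp
    ultimately show "\<exists>g. continuous_map (top_of_set N) X g \<and> (\<forall>s\<in>N. p (g s) = f s) \<and> g a = x" by blast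
  qed
  moreover have "w \<in> N" using T(1) by (simp add: N_def)
  ultimately show ?thesis by blast
qed

text \<open>The lift over one set is continued over the other from the common point
  \<open>b\<close>. On the overlap the two agree because it is connected, and closedness of both
  sets makes the combined map continuous.\<close>

lemma liftable_Un:
  fixes S1 S2 :: "'z::topological_space set"
  assumes cov: "local_homeo X Y p" "Hausdorff_space X"
    and l: "liftable X p f S1" "liftable X p f S2" and cl: "closed S1" "closed S2"
    and conn: "connected (S1 \<inter> S2)" and b: "b \<in> S1 \<inter> S2"
  shows "liftable X p f (S1 \<union> S2)"
proof -
  have main: "\<exists>g. continuous_map (top_of_set (S \<union> S')) X g \<and> (\<forall>s\<in>S \<union> S'. p (g s) = f s) \<and> g a = x"
    if L: "liftable X p f S" "liftable X p f S'" "closed S" "closed S'" "connected (S \<inter> S')" "b \<in> S \<inter> S'"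
      and a: "a \<in> S" "x \<in> topspace X" "p x = f a" for S S' a x
  proof -
    obtain g1 where g1: "continuous_map (top_of_set S) X g1" "\<forall>s\<in>S. p (g1 s) = f s" "g1 a = x"
      using L(1) a unfolding liftable_def by blast
    have "g1 b \<in> topspace X" "p (g1 b) = f b" using g1 L(6) by (auto simp: continuous_map_def)
    then obtain g2 where g2: "continuous_map (top_of_set S') X g2" "\<forall>s\<in>S'. p (g2 s) = f s" "g2 b = g1 b"
      using L(2,6) unfolding liftable_def by blast
    have same: "g1 s = g2 s" if "s \<in> S \<inter> S'" for s
    proof (rule unique_lift[OF cov L(5)])
      show "continuous_map (top_of_set (S \<inter> S')) X g1" "continuous_map (top_of_set (S \<inter> S')) X g2"
        using g1(1) g2(1) by (auto intro: continuous_map_from_subtopology_mono)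
    qed (use g1 g2 L(6) that in auto)
    define g where "g s = (if s \<in> S then g1 s else g2 s)" for s
    have "continuous_map (top_of_set (S \<union> S')) X g"
    proof -
      have "closedin (top_of_set (S \<union> S')) (g -` C \<inter> (S \<union> S'))" if C: "closedin X C" for C
      proof -
        have "g -` C \<inter> (S \<union> S') = {s \<in> S. g1 s \<in> C} \<union> {s \<in> S'. g2 s \<in> C}"
          using same unfolding g_def by (auto split: if_splits)
        moreover have "closed {s \<in> S. g1 s \<in> C}" "closed {s \<in> S'. g2 s \<in> C}"
          using closedin_continuous_map_preimage[OF g1(1) C] closedin_continuous_map_preimage[OF g2(1) C] L(3,4)
          by (auto intro: closedin_closed_trans)
        ultimately show ?thesis by (auto intro!: closed_subset closed_Un)
      qed
      moreover have "g s \<in> topspace X" if "s \<in> S \<union> S'" for s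
        using that g1(1) g2(1) by (auto simp: g_def continuous_map_def)
      ultimately show ?thesis by (auto simp: continuous_map_closedin vimage_def Int_def conj_commute)
    qed
    moreover have "\<forall>s\<in>S \<union> S'. p (g s) = f s" using g1(2) g2(2) by (auto simp: g_def)
    moreover have "g a = x" using a g1(3) by (simp add: g_def)
    ultimately show ?thesis by blast
  qed
  show ?thesis
    unfolding liftable_def
  proof (intro ballI impI)
    fix a x assume a: "a \<in> S1 \<union> S2" "x \<in> topspace X" "p x = f a"
    show "\<exists>g. continuous_map (top_of_set (S1 \<union> S2)) X g \<and> (\<forall>s\<in>S1 \<union> S2. p (g s) = f s) \<and> g a = x"
    proof (cases "a \<in> S1")
      case True show ?thesis by (rule main[OF l cl conn b True a(2,3)])
    next
      case False
      then have "a \<in> S2" using a(1) by blast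
      from main[OF l(2,1) cl(2,1) _ _ this a(2,3)] show ?thesis using conn b by (simp add: Un_commute Int_commute)
    qed
  qed
qed

definition rect :: "real \<Rightarrow> real \<Rightarrow> real \<Rightarrow> real \<Rightarrow> complex set" where
  "rect a b c d = cbox (Complex a c) (Complex b d)"

lemma mem_rect: "z \<in> rect a b c d \<longleftrightarrow> a \<le> Re z \<and> Re z \<le> b \<and> c \<le> Im z \<and> Im z \<le> d"
  by (auto simp: rect_def in_cbox_complex_iff)

text \<open>Bisection (\<open>Bolzano\<close>) is used twice: on the height it gives a liftable
  strip of some positive width about each vertical line, on the width it joins such strips. Adjacent
  rectangles meet in a segment, which is connected.\<close>

lemma liftable_rect:
  assumes cov: "covering_map X Y p" "Hausdorff_space X" and f: "continuous_map euclidean Y f"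
    and ab: "a \<le> b" "c \<le> d"
  shows "liftable X p f (rect a b c d)"
proof -
  note lh = covering_map_local_homeo[OF cov(1)]
  have glue: "liftable X p f (R \<union> R')" if "liftable X p f R" "liftable X p f R'" "R = rect a1 b1 c1 d1" "R' = rect a2 b2 c2 d2"
    "R \<inter> R' = rect a3 b3 c3 d3" "a3 \<le> b3" "c3 \<le> d3" for R R' a1 b1 c1 d1 a2 b2 c2 d2 a3 b3 c3 d3
  proof (rule liftable_Un[OF lh cov(2) that(1,2)])
    show "closed R" "closed R'" unfolding that rect_def by (simp_all add: closed_cbox)
    show "connected (R \<inter> R')" unfolding that(5) rect_def by (simp add: convex_connected)
    show "Complex a3 c3 \<in> R \<inter> R'" unfolding that(5) by (simp add: mem_rect that)
  qed
  have strip: "\<exists>\<delta>>0. liftable X p f (rect (x - \<delta>) (x + \<delta>) c d)" for x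
  proof (rule Bolzano[OF ab(2)])
    fix u v w :: real assume uvw: "u \<le> v" "v \<le> w"
      and "\<exists>\<delta>>0. liftable X p f (rect (x - \<delta>) (x + \<delta>) u v)"
      and "\<exists>\<delta>>0. liftable X p f (rect (x - \<delta>) (x + \<delta>) v w)"
    then obtain d1 d2 where d: "d1 > 0" "liftable X p f (rect (x - d1) (x + d1) u v)"
      "d2 > 0" "liftable X p f (rect (x - d2) (x + d2) v w)" by blast
    define \<delta> where "\<delta> = min d1 d2"
    have \<delta>: "\<delta> > 0" "\<delta> \<le> d1" "\<delta> \<le> d2" using d by (auto simp: \<delta>_def)
    have "liftable X p f (rect (x - \<delta>) (x + \<delta>) u v)" "liftable X p f (rect (x - \<delta>) (x + \<delta>) v w)"
      using d \<delta> by (auto intro: liftable_subset simp: mem_rect subset_iff)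
    then have "liftable X p f (rect (x - \<delta>) (x + \<delta>) u v \<union> rect (x - \<delta>) (x + \<delta>) v w)"
      by (rule glue[where ?a3.0="x - \<delta>" and ?b3.0="x + \<delta>" and ?c3.0=v and ?d3.0=v]) (use uvw \<delta> in \<open>auto simp: mem_rect\<close>)
    moreover have "rect (x - \<delta>) (x + \<delta>) u v \<union> rect (x - \<delta>) (x + \<delta>) v w = rect (x - \<delta>) (x + \<delta>) u w"
      using uvw by (auto simp: mem_rect)
    ultimately show "\<exists>\<delta>>0. liftable X p f (rect (x - \<delta>) (x + \<delta>) u w)" using \<delta>(1) by auto
  next
    fix y
    obtain N where N: "open N" "Complex x y \<in> N" "liftable X p f N" using liftable_small[OF cov(1) f] by blast
    obtain e where e: "e > 0" "ball (Complex x y) e \<subseteq> N" using N(1,2) open_contains_ball by blast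
    have "rect (x - e/3) (x + e/3) u v \<subseteq> N" if uv: "u \<le> y \<and> y \<le> v \<and> v - u < e / 3" for u v
    proof
      fix z assume z: "z \<in> rect (x - e/3) (x + e/3) u v"
      have "dist (Complex x y) z \<le> \<bar>Re (Complex x y - z)\<bar> + \<bar>Im (Complex x y - z)\<bar>"
        unfolding dist_norm by (rule cmod_le)
      also have "\<dots> < e" using z uv e(1) unfolding mem_rect by (auto simp: abs_if)
      finally show "z \<in> N" using e(2) by auto
    qed
    then have "liftable X p f (rect (x - e/3) (x + e/3) u v)" if "u \<le> y \<and> y \<le> v \<and> v - u < e / 3" for u v
      using that liftable_subset[OF N(3)] by blast
    then show "\<exists>d>0. \<forall>u v. u \<le> y \<and> y \<le> v \<and> v - u < d \<longrightarrow> (\<exists>\<delta>>0. liftable X p f (rect (x - \<delta>) (x + \<delta>) u v))"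
      using e(1) by (intro exI[of _ "e/3"] conjI allI impI) auto
  qed
  show ?thesis
  proof (rule Bolzano[OF ab(1)])
    fix u v w :: real assume uvw: "u \<le> v" "v \<le> w"
      and "liftable X p f (rect u v c d)" "liftable X p f (rect v w c d)"
    then have "liftable X p f (rect u v c d \<union> rect v w c d)"
      by (intro glue[where ?a3.0=v and ?b3.0=v and ?c3.0=c and ?d3.0=d]) (use uvw ab in \<open>auto simp: mem_rect\<close>)
    moreover have "rect u v c d \<union> rect v w c d = rect u w c d" using uvw by (auto simp: mem_rect)
    ultimately show "liftable X p f (rect u w c d)" by simp
  next
    fix x
    obtain \<delta> where \<delta>: "\<delta> > 0" "liftable X p f (rect (x - \<delta>) (x + \<delta>) c d)" using strip by blast
    have "liftable X p f (rect u v c d)" if "u \<le> x \<and> x \<le> v \<and> v - u < \<delta>" for u v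
      by (rule liftable_subset[OF \<delta>(2)]) (use that in \<open>auto simp: mem_rect\<close>)
    then show "\<exists>e>0. \<forall>u v. u \<le> x \<and> x \<le> v \<and> v - u < e \<longrightarrow> liftable X p f (rect u v c d)"
      using \<delta>(1) by blast
  qed
qed

lemma lift_disc:
  assumes cov: "covering_map X Y p" "Hausdorff_space X" and f: "continuous_map (top_of_set (cball 0 1)) Y f"
    and a: "norm (a::complex) \<le> 1" and x: "x \<in> topspace X" "p x = f a"
  shows "\<exists>g. continuous_map (top_of_set (cball 0 1)) X g \<and> (\<forall>s\<in>cball 0 1. p (g s) = f s) \<and> g a = x"
proof -
  \<comment> \<open>The radial retraction onto the disc extends \<open>f\<close> to the whole plane,
    as \<open>liftable_rect\<close> requires, and changes nothing on the disc.\<close>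
  define r where "r z = z / of_real (max 1 (norm z))" for z :: complex
  have r: "norm (r z) \<le> 1" "norm z \<le> 1 \<Longrightarrow> r z = z" for z
    by (auto simp: r_def norm_divide max_def divide_simps)
  have "continuous_on UNIV r" unfolding r_def by (intro continuous_intros) (auto simp: max_def)
  then have "continuous_map euclidean (top_of_set (cball 0 1)) r" using r(1) by (auto simp: continuous_map_in_subtopology)
  then have "continuous_map euclidean Y (f \<circ> r)" using f by (rule continuous_map_compose)
  then have l: "liftable X p (f \<circ> r) (rect (-1) 1 (-1) 1)" by (intro liftable_rect[OF cov]) auto
  have "cball 0 1 \<subseteq> rect (-1) 1 (-1) 1"
  proof
    fix z :: complex assume "z \<in> cball 0 1"
    then show "z \<in> rect (-1) 1 (-1) 1" using abs_Re_le_cmod[of z] abs_Im_le_cmod[of z] by (auto simp: mem_rect abs_le_iff)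
  qed
  from liftable_subset[OF l this] a x r(2)
  obtain g where "continuous_map (top_of_set (cball 0 1)) X g" "\<forall>s\<in>cball 0 1. p (g s) = (f \<circ> r) s" "g a = x"
    unfolding liftable_def by (metis comp_apply mem_cball_0)
  then show ?thesis using r(2) by auto
qed

lemma lift_path:
  assumes cov: "covering_map X Y p" "Hausdorff_space X" and f: "continuous_map (top_of_set {0..1}) Y f"
    and a: "0 \<le> a" "a \<le> (1::real)" and x: "x \<in> topspace X" "p x = f a"
  shows "\<exists>g. continuous_map (top_of_set {0..1}) X g \<and> (\<forall>s\<in>{0..1}. p (g s) = f s) \<and> g a = x"
proof -
  \<comment> \<open>A path becomes a map of the plane by clamping the real part to [0, 1] and
    forgetting the imaginary part.\<close>
  define r where "r z = max 0 (min 1 (Re z))" for z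
  have "continuous_on UNIV r" unfolding r_def by (intro continuous_intros)
  then have "continuous_map euclidean (top_of_set {0..1}) r" by (auto simp: continuous_map_in_subtopology r_def)
  then have "continuous_map euclidean Y (f \<circ> r)" using f by (rule continuous_map_compose)
  then have l: "liftable X p (f \<circ> r) (rect 0 1 0 1)" by (intro liftable_rect[OF cov]) auto
  have mem: "complex_of_real s \<in> rect 0 1 0 1" if "s \<in> {0..1}" for s using that by (simp add: mem_rect)
  have "p x = (f \<circ> r) (complex_of_real a)" using a x by (simp add: r_def)
  with l mem[of a] a x obtain g where g: "continuous_map (top_of_set (rect 0 1 0 1)) X g"
    "\<forall>s\<in>rect 0 1 0 1. p (g s) = (f \<circ> r) s" "g (complex_of_real a) = x"
    unfolding liftable_def by (metis atLeastAtMost_iff)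
  have "continuous_map (top_of_set {0..1}) (top_of_set (rect 0 1 0 1)) complex_of_real"
    using mem by (auto simp: continuous_map_in_subtopology intro!: continuous_intros)
  then have "continuous_map (top_of_set {0..1}) X (g \<circ> complex_of_real)" using g(1) by (rule continuous_map_compose)
  moreover have "\<forall>s\<in>{0..1}. p ((g \<circ> complex_of_real) s) = f s" using g(2) mem by (auto simp: r_def)
  ultimately show ?thesis using g(3) by (intro exI[of _ "g \<circ> complex_of_real"]) simp
qed

section \<open>Local structure of \<open>K\<^sub>\<epsilon>\<close>\<close>

lemma sector_letter:
  assumes "i < n" "j < n" "0 \<le> t" "t < 1" "z \<noteq> 0" "z = norm z * circ n (real i + t)"
  shows "z \<in> sector n (real j + 1/2) (1/2) \<longleftrightarrow> i = j \<and> 0 < t"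
proof -
  have n: "n > 0" "(1/2::real) \<le> real n / 2" using assms(1) by auto
  have iff: "z \<in> sector n (real j + 1/2) (1/2) \<longleftrightarrow> (\<exists>y. \<bar>y - (real j + 1/2)\<bar> < 1/2 \<and> z \<noteq> 0 \<and> z = norm z * circ n y)"
    by (rule sector_polar) (use n in auto)
  show ?thesis
  proof
    assume "z \<in> sector n (real j + 1/2) (1/2)"
    then obtain y where y: "\<bar>y - (real j + 1/2)\<bar> < 1/2" "z = norm z * circ n y" using iff by blast
    have "norm z * circ n y = norm z * circ n (real i + t)" using y(2) assms(6) by metis
    then have c: "circ n (real j + (y - real j)) = circ n (real i + t)" using assms(5) by simp
    have b: "0 < y - real j" "y - real j < 1" using y(1) by (simp_all only: abs_less_iff) linarith+
    from circ_letter_unique[OF assms(2,1) _ b(2) assms(3,4) c] b show "i = j \<and> 0 < t" by simp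
  next
    assume "i = j \<and> 0 < t"
    then have "real i + t - (real j + 1/2) < 1/2" "- (real i + t - (real j + 1/2)) < 1/2" using assms(4) by auto
    then have "\<bar>(real i + t) - (real j + 1/2)\<bar> < 1/2" by (simp only: abs_less_iff)
    then show "z \<in> sector n (real j + 1/2) (1/2)" using iff assms(5,6) by blast
  qed
qed

definition graph :: "gen point set" where
  "graph = insert Vertex (edge_map Gen_c ` {0<..<1} \<union> edge_map Gen_d ` {0<..<1})"

lemma Vertex_in_graph [simp]: "Vertex \<in> graph" and Face_notin_graph [simp]: "Face r z \<notin> graph"
  and Edge_in_graph [simp]: "Edge g t \<in> graph \<longleftrightarrow> g \<noteq> Gen_a \<and> 0 < t \<and> t < 1"
proof -
  show "Vertex \<in> graph" by (simp add: graph_def)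
  show "Face r z \<notin> graph" by (auto simp: graph_def edge_map_def)
  show "Edge g t \<in> graph \<longleftrightarrow> g \<noteq> Gen_a \<and> 0 < t \<and> t < 1"
    by (cases g) (auto simp: graph_def edge_map_def image_iff)
qed

lemma edge_map_in_graph: "g \<noteq> Gen_a \<Longrightarrow> edge_map g t \<in> graph"
  by (simp add: edge_map_def)

lemma graph_cases:
  assumes "x \<in> graph" "x \<noteq> Vertex"
  obtains g t where "g = Gen_c \<or> g = Gen_d" "0 < t" "t < 1" "x = edge_map g t"
proof -
  consider t where "t \<in> {0<..<1}" "x = edge_map Gen_c t" | t where "t \<in> {0<..<1}" "x = edge_map Gen_d t"
    using assms unfolding graph_def by blast
  then show thesis by cases (use that in auto)
qed

lemma circ_0 [simp]: "circ n 0 = 1"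
  by (simp add: circ_def)

lemma inverse_circ: "inverse (circ n x) = circ n (- x)"
  by (rule inverse_unique) (simp flip: circ_add)

locale K_eps =
  fixes b :: bool
begin

sublocale base: cell_quotient "{Vertex}" gens edge_map "{relA b, relB}" face_map "\<lambda>r. r"
  by (rule cell_quotient_standard) (auto simp: relA_def relB_def)

abbreviation "rA \<equiv> relA b"

text \<open>Pages are the neighbourhoods, in the faces, of an open edge; \<open>w\<close> runs through a sector
  around \<open>1\<close> and the parameter of the edge is read off from its argument.\<close>

definition page :: "nat \<Rightarrow> complex \<Rightarrow> gen point" where
  "page i w = face_map rA ((if snd (rA ! i) then w else cnj w) * circ 18 (real i + 1/2))"

lemma page_arg:
  "(if c then \<rho> * circ 18 (t - 1/2) else cnj (\<rho> * circ 18 (t - 1/2))) * circ 18 (real i + 1/2)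
     = of_real \<rho> * circ 18 (real i + (if c then t else 1 - t))"
  by (simp add: cnj_circ mult.assoc flip: circ_add) (simp add: algebra_simps)

lemma page_polar: "page i (of_real \<rho> * circ 18 (t - 1/2)) =
    face_map rA (of_real \<rho> * circ 18 (real i + (if snd (rA ! i) then t else 1 - t)))"
  unfolding page_def using page_arg[of "snd (rA ! i)" \<rho> t i] by simp

lemma page_edge: "i < 18 \<Longrightarrow> 0 \<le> t \<Longrightarrow> t \<le> 1 \<Longrightarrow> page i (circ 18 (t - 1/2)) = edge_map (fst (rA ! i)) t"
  using page_polar[of i 1 t] face_map_circ[of i rA "if snd (rA ! i) then t else 1 - t"] by simp

lemma page_face: "0 < \<rho> \<Longrightarrow> \<rho> < 1 \<Longrightarrow> page i (of_real \<rho> * circ 18 (t - 1/2)) =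
    Face rA (of_real \<rho> * circ 18 (real i + (if snd (rA ! i) then t else 1 - t)))"
  by (simp add: page_polar face_map_inner norm_mult)

lemma continuous_page: "continuous_map (top_of_set (cball 0 1)) base.Q (page i)"
proof -
  define m where "m w = (if snd (rA ! i) then w else cnj w) * circ 18 (real i + 1/2)" for w
  have "continuous_map (top_of_set (cball 0 1)) (top_of_set (cball 0 1)) m"
    unfolding m_def by (cases "snd (rA ! i)") (auto simp: continuous_map_in_subtopology norm_mult intro!: continuous_intros)
  moreover have "continuous_map (top_of_set (cball 0 1)) base.Q (face_map rA)" by (rule base.continuous_fm) simp
  ultimately have "continuous_map (top_of_set (cball 0 1)) base.Q (face_map rA \<circ> m)" by (rule continuous_map_compose)
  moreover have "face_map rA \<circ> m = page i" by (simp add: fun_eq_iff page_def m_def)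
  ultimately show ?thesis by simp
qed

lemma radial_approx:
  assumes "openin base.Q N" "r \<in> {relA b, relB}" "norm \<zeta> = 1" "face_map r \<zeta> \<in> N"
  obtains \<rho> where "0 < \<rho>" "\<rho> < 1" "face_map r (of_real \<rho> * \<zeta>) \<in> N"
proof -
  have "openin (top_of_set (cball 0 1)) (cball 0 1 \<inter> face_map r -` N)"
    using assms(1,2) unfolding base.openin_Q base.qopen_def by blast
  moreover have "\<zeta> \<in> cball 0 1 \<inter> face_map r -` N" using assms by simp
  ultimately obtain e where e: "e > 0" "ball \<zeta> e \<inter> cball 0 1 \<subseteq> cball 0 1 \<inter> face_map r -` N"
    unfolding openin_contains_ball by metis
  define \<rho> where "\<rho> = 1 - min (e/2) (1/2)"
  have \<rho>: "0 < \<rho>" "\<rho> < 1" "1 - \<rho> < e" using e(1) by (auto simp: \<rho>_def min_def)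
  have "\<zeta> - of_real \<rho> * \<zeta> = of_real (1 - \<rho>) * \<zeta>" by (simp add: algebra_simps)
  then have "dist \<zeta> (of_real \<rho> * \<zeta>) = \<bar>1 - \<rho>\<bar> * norm \<zeta>" unfolding dist_norm by (simp only: norm_mult norm_of_real)
  then have "of_real \<rho> * \<zeta> \<in> ball \<zeta> e \<inter> cball 0 1" using \<rho> assms(3) by (simp add: norm_mult)
  then show thesis using that[OF \<rho>(1,2)] e(2) by blast
qed

lemma sector0_polar:
  assumes "w \<in> sector 18 0 (1/2)"
  obtains \<rho> t where "0 < \<rho>" "0 < t" "t < 1" "w = of_real \<rho> * circ 18 (t - 1/2)" "norm w = \<rho>"
proof -
  obtain y where y: "\<bar>y - 0\<bar> < 1/2" "w \<noteq> 0" "w = norm w * circ 18 y"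
    using sector_polar[of 18 "1/2" w 0] assms by auto
  show thesis
    by (rule that[of "norm w" "y + 1/2"]) (use y in \<open>auto simp: abs_less_iff\<close>)
qed

text \<open>Three letters on the boundary of \<open>rA\<close> read the same edge. The pages at
  \<open>i\<close> and \<open>j\<close> are glued along it to an open surface through the point, and
  the page at \<open>k\<close> accumulates there without being part of it.\<close>

lemma branches_at_edge:
  assumes ijk: "i < 18" "j < 18" "k < 18" "i \<noteq> j" "i \<noteq> k" "j \<noteq> k"
    and g: "fst (rA ! i) = g" "fst (rA ! j) = g" "fst (rA ! k) = g" and t0: "0 < t0" "t0 < 1"
  shows "branches_at TYPE(complex) base.Q (edge_map g t0)"
proof -
  define S where "S = sector 18 0 (1/2)"
  \<comment> \<open>The page \<open>j\<close> is transplanted to the outside of the unit circle by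
    the inversion \<open>inverse (cnj w)\<close>, which fixes the circle.\<close>
  define e where "e w = (if norm w \<le> 1 then page i w else page j (inverse (cnj w)))" for w
  have inv: "inverse (cnj (of_real \<rho> * circ 18 y)) = of_real (inverse \<rho>) * circ 18 y" if "\<rho> > 0" for \<rho> y
    by (simp add: cnj_circ inverse_circ inverse_mult_distrib)
  have e_in: "e (of_real \<rho> * circ 18 (t - 1/2)) = Face rA (of_real \<rho> * circ 18 (real i + (if snd (rA ! i) then t else 1 - t)))"
    if "0 < \<rho>" "\<rho> < 1" for \<rho> t using that page_face[of \<rho> i t] by (simp add: e_def norm_mult)
  have e_out: "e (of_real \<rho> * circ 18 (t - 1/2)) =
      Face rA (of_real (inverse \<rho>) * circ 18 (real j + (if snd (rA ! j) then t else 1 - t)))"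
    if "1 < \<rho>" for \<rho> t
    using that page_face[of "inverse \<rho>" j t] inv[of \<rho> "t - 1/2"] by (simp add: e_def norm_mult inverse_less_1_iff)
  have e_on: "e (circ 18 (t - 1/2)) = Edge g t" if "0 < t" "t < 1" for t
    using that page_edge[OF ijk(1), of t] g by (simp add: e_def edge_map_inner)
  have cont: "continuous_map (top_of_set S) base.Q e"
    unfolding e_def
  proof (rule continuous_map_cases_le)
    show "continuous_map (subtopology (top_of_set S) {x \<in> topspace (top_of_set S). norm x \<le> 1}) base.Q (page i)"
      unfolding subtopology_subtopology
      by (rule continuous_map_from_subtopology_mono[OF continuous_page]) auto
    have "continuous_map (top_of_set (S \<inter> {x \<in> S. 1 \<le> norm x})) (top_of_set (cball 0 1)) (\<lambda>w. inverse (cnj w))"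
    proof -
      have "w \<noteq> 0" if "1 \<le> norm w" for w :: complex using that by auto
      then have "continuous_on (S \<inter> {x \<in> S. 1 \<le> norm x}) (\<lambda>w. inverse (cnj w))"
        by (intro continuous_intros) auto
      moreover have "norm (inverse (cnj w)) \<le> 1" if "1 \<le> norm w" for w :: complex
        using that by (simp add: norm_inverse inverse_le_1_iff)
      ultimately show ?thesis by (auto simp: continuous_map_in_subtopology)
    qed
    from continuous_map_compose[OF this continuous_page[of j]]
    show "continuous_map (subtopology (top_of_set S) {x \<in> topspace (top_of_set S). 1 \<le> norm x}) base.Q
        (\<lambda>w. page j (inverse (cnj w)))"
      unfolding subtopology_subtopology by (simp add: o_def)
    fix x assume x: "x \<in> topspace (top_of_set S)" "norm x = 1"
    then obtain \<rho> t where p: "0 < \<rho>" "0 < t" "t < 1" "x = of_real \<rho> * circ 18 (t - 1/2)" "norm x = \<rho>"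
      by (auto simp: S_def elim: sector0_polar)
    then have x1: "x = circ 18 (t - 1/2)" using x(2) by simp
    have "inverse (cnj x) = x" using inv[of 1 "t - 1/2"] x1 by simp
    then show "page i x = page j (inverse (cnj x))"
      using page_edge[OF ijk(1), of t] page_edge[OF ijk(2), of t] p g x1 by simp
  qed (auto intro!: continuous_intros)
  have face_ne: "Face rA (of_real \<rho> * circ 18 (real i' + (if c then t else 1 - t))) \<noteq>
      Face rA (of_real \<rho>' * circ 18 (real j' + (if c' then t' else 1 - t')))"
    if "i' < 18" "j' < 18" "i' \<noteq> j'" "0 < t" "t < 1" "0 < t'" "t' < 1" "\<rho> > 0" "\<rho>' > 0" for i' j' \<rho> \<rho>' t t' c c'
  proof
    let ?u = "if c then t else 1 - t" and ?u' = "if c' then t' else 1 - t'"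
    assume "Face rA (of_real \<rho> * circ 18 (real i' + ?u)) = Face rA (of_real \<rho>' * circ 18 (real j' + ?u'))"
    then have eq: "of_real \<rho> * circ 18 (real i' + ?u) = of_real \<rho>' * circ 18 (real j' + ?u')" by simp
    from arg_cong[OF eq, of norm] have "\<rho> = \<rho>'" using that by (simp add: norm_mult)
    then have "circ 18 (real i' + ?u) = circ 18 (real j' + ?u')" using eq that by simp
    moreover have "0 \<le> ?u" "?u < 1" "0 \<le> ?u'" "?u' < 1" using that by (cases c; cases c'; simp)+
    ultimately have "i' = j'" by (intro circ_letter_unique(1)[OF that(1,2)])
    then show False using that(3) by blast
  qed
  have face_eq: "\<rho> = \<rho>' \<and> t = t'"
    if "Face rA (of_real \<rho> * circ 18 (real i' + (if c then t else 1 - t))) =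
      Face rA (of_real \<rho>' * circ 18 (real i' + (if c then t' else 1 - t')))"
      "i' < 18" "0 < t" "t < 1" "0 < t'" "t' < 1" "\<rho> > 0" "\<rho>' > 0" for i' \<rho> \<rho>' t t' c
  proof -
    let ?u = "if c then t else 1 - t" and ?u' = "if c then t' else 1 - t'"
    from that(1) have eq: "of_real \<rho> * circ 18 (real i' + ?u) = of_real \<rho>' * circ 18 (real i' + ?u')" by simp
    from arg_cong[OF eq, of norm] have r: "\<rho> = \<rho>'" using that by (simp add: norm_mult)
    then have "circ 18 (real i' + ?u) = circ 18 (real i' + ?u')" using eq that by simp
    moreover have "0 \<le> ?u" "?u < 1" "0 \<le> ?u'" "?u' < 1" using that by (cases c; simp)+
    ultimately have "?u = ?u'" by (intro circ_letter_unique(2)[OF that(2,2)])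
    then show ?thesis using r by (cases c) auto
  qed
  have cases: "\<exists>\<rho> t. 0 < t \<and> t < 1 \<and> w = of_real \<rho> * circ 18 (t - 1/2) \<and>
     (0 < \<rho> \<and> \<rho> < 1 \<and> e w = Face rA (of_real \<rho> * circ 18 (real i + (if snd (rA ! i) then t else 1 - t))) \<or>
      \<rho> = 1 \<and> e w = Edge g t \<or>
      1 < \<rho> \<and> e w = Face rA (of_real (inverse \<rho>) * circ 18 (real j + (if snd (rA ! j) then t else 1 - t))))"
    if w: "w \<in> S" for w
  proof -
    obtain \<rho> t where p: "0 < \<rho>" "0 < t" "t < 1" "w = of_real \<rho> * circ 18 (t - 1/2)"
      using w unfolding S_def by (elim sector0_polar)
    consider "\<rho> < 1" | "\<rho> = 1" | "1 < \<rho>" by linarith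
    then show ?thesis
      by cases (use p e_in[of \<rho> t] e_on[of t] e_out[of \<rho> t] in \<open>intro exI[of _ \<rho>] exI[of _ t], simp\<close>)+
  qed
  have inj: "inj_on e S"
  proof (rule inj_onI)
    fix w w' assume ww: "w \<in> S" "w' \<in> S" "e w = e w'"
    obtain \<rho> t where p: "0 < t" "t < 1" "w = of_real \<rho> * circ 18 (t - 1/2)" and
     p': "(0 < \<rho> \<and> \<rho> < 1 \<and> e w = Face rA (of_real \<rho> * circ 18 (real i + (if snd (rA ! i) then t else 1 - t))) \<or>
      \<rho> = 1 \<and> e w = Edge g t \<or>
      1 < \<rho> \<and> e w = Face rA (of_real (inverse \<rho>) * circ 18 (real j + (if snd (rA ! j) then t else 1 - t))))"
      using cases[OF ww(1)] by (elim exE conjE) (rule that; assumption)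
    obtain \<rho>' t' where q: "0 < t'" "t' < 1" "w' = of_real \<rho>' * circ 18 (t' - 1/2)" and
     q': "(0 < \<rho>' \<and> \<rho>' < 1 \<and> e w' = Face rA (of_real \<rho>' * circ 18 (real i + (if snd (rA ! i) then t' else 1 - t'))) \<or>
      \<rho>' = 1 \<and> e w' = Edge g t' \<or>
      1 < \<rho>' \<and> e w' = Face rA (of_real (inverse \<rho>') * circ 18 (real j + (if snd (rA ! j) then t' else 1 - t'))))"
      using cases[OF ww(2)] by (elim exE conjE) (rule that; assumption)
    have "\<rho> = \<rho>' \<and> t = t'"
      using p'
    proof (elim disjE conjE)
      assume A: "0 < \<rho>" "\<rho> < 1" "e w = Face rA (of_real \<rho> * circ 18 (real i + (if snd (rA ! i) then t else 1 - t)))"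
      show ?thesis using q'
      proof (elim disjE conjE)
        assume B: "0 < \<rho>'" "e w' = Face rA (of_real \<rho>' * circ 18 (real i + (if snd (rA ! i) then t' else 1 - t')))"
        show ?thesis
          by (rule face_eq[OF trans[OF A(3)[symmetric] trans[OF ww(3) B(2)]] ijk(1) p(1,2) q(1,2) A(1) B(1)])
      next
        assume B: "e w' = Edge g t'" then show ?thesis using A(3) ww(3) by simp
      next
        assume B: "1 < \<rho>'" "e w' = Face rA (of_real (inverse \<rho>') * circ 18 (real j + (if snd (rA ! j) then t' else 1 - t')))"
        have "inverse \<rho>' > 0" using B(1) by simp
        from notE[OF face_ne[OF ijk(1,2,4) p(1,2) q(1,2) A(1) this] trans[OF A(3)[symmetric] trans[OF ww(3) B(2)]]]
        show ?thesis .
      qed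
    next
      assume A: "\<rho> = 1" "e w = Edge g t"
      show ?thesis using q'
      proof (elim disjE conjE)
        assume B: "\<rho>' = 1" "e w' = Edge g t'" then show ?thesis using A ww(3) by simp
      qed (use A(2) ww(3) in simp_all)
    next
      assume A: "1 < \<rho>" "e w = Face rA (of_real (inverse \<rho>) * circ 18 (real j + (if snd (rA ! j) then t else 1 - t)))"
      have A': "inverse \<rho> > 0" using A(1) by simp
      show ?thesis using q'
      proof (elim disjE conjE)
        assume B: "0 < \<rho>'" "e w' = Face rA (of_real \<rho>' * circ 18 (real i + (if snd (rA ! i) then t' else 1 - t')))"
        from notE[OF face_ne[OF ijk(1,2,4) q(1,2) p(1,2) B(1) A'] trans[OF B(2)[symmetric] trans[OF ww(3)[symmetric] A(2)]]]
        show ?thesis .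
      next
        assume B: "e w' = Edge g t'" then show ?thesis using A(2) ww(3) by simp
      next
        assume B: "1 < \<rho>'" "e w' = Face rA (of_real (inverse \<rho>') * circ 18 (real j + (if snd (rA ! j) then t' else 1 - t')))"
        have B': "inverse \<rho>' > 0" using B(1) by simp
        have "inverse \<rho> = inverse \<rho>' \<and> t = t'"
          by (rule face_eq[OF trans[OF A(2)[symmetric] trans[OF ww(3) B(2)]] ijk(2) p(1,2) q(1,2) A' B'])
        then show ?thesis by simp
      qed
    qed
    then show "w = w'" using p(3) q(3) by simp
  qed
  have "edge_map g t0 \<in> base.Q closure_of (topspace base.Q - e ` S)"
    unfolding in_closure_of
  proof (intro conjI allI impI)
    show "edge_map g t0 \<in> topspace base.Q"
      using base.em_in_skel[of g t0] base.skel_carrier t0 by (auto simp: base.topspace_Q)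
    fix N assume N: "edge_map g t0 \<in> N \<and> openin base.Q N"
    \<comment> \<open>The position of the given point within the letter \<open>k\<close>, counted
      backwards for an inverse letter. Points on the radius towards it come arbitrarily close and
      lie on neither of the other two pages.\<close>
    define u where "u = (if snd (rA ! k) then t0 else 1 - t0)"
    have u: "0 < u" "u < 1" using t0 by (auto simp: u_def)
    have "face_map rA (circ 18 (real k + u)) = edge_map g t0"
      using face_map_circ[of k rA u] ijk(3) u g(3) by (simp add: u_def)
    then obtain \<rho> where \<rho>: "0 < \<rho>" "\<rho> < 1" "face_map rA (of_real \<rho> * circ 18 (real k + u)) \<in> N"
      using radial_approx[of N rA "circ 18 (real k + u)"] N by auto
    define y where "y = Face rA (of_real \<rho> * circ 18 (real k + u))"
    have y: "face_map rA (of_real \<rho> * circ 18 (real k + u)) = y"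
      using \<rho> by (simp add: y_def face_map_inner norm_mult)
    have "y \<notin> e ` S"
    proof
      assume "y \<in> e ` S"
      then obtain w where w: "w \<in> S" "y = e w" by blast
      obtain \<rho>' t' where q: "0 < t'" "t' < 1" and
        q': "(0 < \<rho>' \<and> \<rho>' < 1 \<and> e w = Face rA (of_real \<rho>' * circ 18 (real i + (if snd (rA ! i) then t' else 1 - t'))) \<or>
        \<rho>' = 1 \<and> e w = Edge g t' \<or>
        1 < \<rho>' \<and> e w = Face rA (of_real (inverse \<rho>') * circ 18 (real j + (if snd (rA ! j) then t' else 1 - t'))))"
        using cases[OF w(1)] by (elim exE conjE) (rule that; assumption)
      from q' show False
      proof (elim disjE conjE)
        assume B: "0 < \<rho>'" "e w = Face rA (of_real \<rho>' * circ 18 (real i + (if snd (rA ! i) then t' else 1 - t')))"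
        from notE[OF face_ne[OF ijk(1,3,5) q t0 B(1) \<rho>(1)] trans[OF B(2)[symmetric] trans[OF w(2)[symmetric] y_def[unfolded u_def]]]]
        show False .
      next
        assume B: "1 < \<rho>'" "e w = Face rA (of_real (inverse \<rho>') * circ 18 (real j + (if snd (rA ! j) then t' else 1 - t')))"
        have "inverse \<rho>' > 0" using B(1) by simp
        from notE[OF face_ne[OF ijk(2,3,6) q t0 this \<rho>(1)] trans[OF B(2)[symmetric] trans[OF w(2)[symmetric] y_def[unfolded u_def]]]]
        show False .
      qed (use w(2) in \<open>simp add: y_def\<close>)
    qed
    moreover have "y \<in> topspace base.Q"
      unfolding y[symmetric] base.topspace_Q using \<rho> by (intro base.fm_in_carrier) (auto simp: norm_mult)
    ultimately show "\<exists>y. y \<in> topspace base.Q - e ` S \<and> y \<in> N" using \<rho>(3) y by auto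
  qed
  moreover have "circ 18 (t0 - 1/2) \<in> S"
  proof -
    have "\<bar>t0 - 1/2\<bar> < 1/2" unfolding abs_less_iff using t0 by linarith
    then have "\<exists>y. \<bar>y - 0\<bar> < 1/2 \<and> circ 18 (t0 - 1/2) \<noteq> 0 \<and> circ 18 (t0 - 1/2) = norm (circ 18 (t0 - 1/2)) * circ 18 y"
      by (intro exI[of _ "t0 - 1/2"]) simp
    then show ?thesis unfolding S_def by (subst sector_polar) simp_all
  qed
  moreover have "e (circ 18 (t0 - 1/2)) = edge_map g t0" using e_on[OF t0] t0 by (simp add: edge_map_inner)
  ultimately show ?thesis
    unfolding branches_at_def using cont inj open_sector[of 18 0 "1/2"] unfolding S_def[symmetric]
    by (intro exI[of _ S] exI[of _ e] exI[of _ "circ 18 (t0 - 1/2)"] conjI)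
qed

lemma branches_at_graph:
  assumes "x \<in> graph" "x \<noteq> Vertex" shows "branches_at TYPE(complex) base.Q x"
proof -
  from graph_cases[OF assms] obtain g t where g: "g = Gen_c \<or> g = Gen_d" "0 < t" "t < 1" "x = edge_map g t" .
  \<comment> \<open>The first six letters of \<open>relA\<close> alternate between \<open>c\<close>
    and \<open>d\<close>, whatever the sign of the last letter, so each of them is read at least
    three times.\<close>
  from g(1) show ?thesis
  proof
    assume "g = Gen_c"
    then show ?thesis unfolding g(4)
      by (intro branches_at_edge[of 0 2 4]) (use g in \<open>simp_all add: relA_def\<close>)
  next
    assume "g = Gen_d"
    then show ?thesis unfolding g(4)
      by (intro branches_at_edge[of 1 3 5]) (use g in \<open>simp_all add: relA_def\<close>)
  qed
qed

lemma euclidean_at_edge_in_graph: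
  assumes "x \<in> graph" "x \<noteq> Vertex" shows "euclidean_at TYPE(real) (subtopology base.Q graph) x"
proof -
  from graph_cases[OF assms] obtain g t where g: "g \<noteq> Gen_a" "0 < t" "t < 1" "x = edge_map g t" by (metis gen.distinct(1,3))
  define U where "U = edge_map g ` {0<..<1}"
  define h where "h y = (case y of Edge _ t \<Rightarrow> t | _ \<Rightarrow> 0)" for y :: "gen point"
  have h: "h (edge_map g s) = s" if "0 < s" "s < 1" for s using that by (simp add: h_def edge_map_inner)
  have gs: "graph \<subseteq> base.skel" by (auto simp: graph_def base.skel_def)
  have Ug: "U \<subseteq> graph" using g(1) unfolding U_def by (auto intro: edge_map_in_graph)
  have op: "openin (subtopology base.Q graph) (edge_map g ` W)" if "open W" "W \<subseteq> {0<..<1}" for W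
  proof -
    have "edge_map g ` W \<subseteq> graph" using Ug that unfolding U_def by blast
    then have "base.star (edge_map g ` W) \<inter> graph = edge_map g ` W"
      using base.star_skel[of "edge_map g ` W"] gs by blast
    then show ?thesis using base.open_star[OF base.gopen_em[OF _ that]] unfolding openin_subtopology
      by (intro exI[of _ "base.star (edge_map g ` W)"]) simp
  qed
  have UQ: "U \<subseteq> topspace (subtopology base.Q graph)"
    using Ug gs base.skel_carrier by (auto simp: base.topspace_Q)
  have "continuous_map (subtopology (subtopology base.Q graph) U) euclideanreal h"
  proof -
    have "openin (subtopology (subtopology base.Q graph) U) {x \<in> U. h x \<in> W}" if "open W" for W
    proof -
      have eq: "{x \<in> U. h x \<in> W} = edge_map g ` (W \<inter> {0<..<1})" unfolding U_def by (auto simp: h)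
      moreover have "openin (subtopology base.Q graph) (edge_map g ` (W \<inter> {0<..<1}))" using that by (intro op) auto
      ultimately have "openin (subtopology base.Q graph) {x \<in> U. h x \<in> W}" by simp
      then show ?thesis unfolding openin_subtopology[of _ U] by (intro exI[of _ "{x \<in> U. h x \<in> W}"]) auto
    qed
    then show ?thesis unfolding continuous_map_def topspace_subtopology_subset[OF UQ] by simp
  qed
  moreover have "inj_on h U" unfolding U_def by (rule inj_onI) (auto simp: h)
  moreover have "x \<in> U" unfolding U_def g(4) using g(2,3) by (intro imageI) simp
  moreover have "openin (subtopology base.Q graph) U" unfolding U_def by (rule op) auto
  ultimately show ?thesis unfolding euclidean_at_def by (intro exI[of _ U] exI[of _ h] conjI)
qed

text \<open>The beginnings of the loops \<open>c\<close> and \<open>d\<close> form an open interval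
  through the vertex. Only the first halves of the loops are used, so the end of the loop
  \<open>c\<close> remains as a further branch.\<close>

lemma branches_at_Vertex: "branches_at TYPE(real) (subtopology base.Q graph) Vertex"
proof -
  define S where "S = {-1/2<..<1/2::real}"
  define e where "e y = (if 0 \<le> y then edge_map Gen_c y else edge_map Gen_d (- y))" for y
  have "graph \<subseteq> base.skel" by (auto simp: graph_def base.skel_def)
  then have gQ: "graph \<subseteq> topspace base.Q" using base.skel_carrier by (simp add: base.topspace_Q)
  have cont: "continuous_map (top_of_set S) base.Q e"
    unfolding e_def
  proof (rule continuous_map_cases_le)
    show "continuous_map (subtopology (top_of_set S) {x \<in> topspace (top_of_set S). 0 \<le> x}) base.Q (edge_map Gen_c)"
      unfolding subtopology_subtopology
      by (rule continuous_map_from_subtopology_mono[OF base.continuous_em[of Gen_c]]) (auto simp: S_def)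
    have "continuous_map (top_of_set (S \<inter> {x \<in> S. x \<le> 0})) (top_of_set {0..1}) (\<lambda>x. - x)"
      by (auto simp: continuous_map_in_subtopology S_def intro!: continuous_intros)
    from continuous_map_compose[OF this base.continuous_em[of Gen_d]]
    show "continuous_map (subtopology (top_of_set S) {x \<in> topspace (top_of_set S). x \<le> 0}) base.Q (\<lambda>y. edge_map Gen_d (- y))"
      unfolding subtopology_subtopology by (simp add: o_def)
  qed (auto intro!: continuous_intros)
  have eg: "e y \<in> graph" for y by (simp add: e_def edge_map_in_graph)
  define f where "f x = (case x of Edge g t \<Rightarrow> (if g = Gen_c then t else - t) | _ \<Rightarrow> 0)" for x :: "gen point"
  have f: "f (e y) = y" if "y \<in> S" for y
    using that by (auto simp: f_def e_def S_def edge_map_def)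
  have e_0: "e 0 = Vertex" by (simp add: e_def)
  have "continuous_map (top_of_set S) (subtopology base.Q graph) e"
    using cont eg by (auto simp: continuous_map_in_subtopology)
  moreover have "inj_on e S" by (rule inj_on_inverseI[where g=f]) (rule f)
  moreover have "Vertex \<in> subtopology base.Q graph closure_of (topspace (subtopology base.Q graph) - e ` S)"
    unfolding in_closure_of
  proof (intro conjI allI impI)
    show "Vertex \<in> topspace (subtopology base.Q graph)" using gQ by auto
    fix N assume N: "Vertex \<in> N \<and> openin (subtopology base.Q graph) N"
    then obtain N' where N': "openin base.Q N'" "N = N' \<inter> graph" unfolding openin_subtopology by blast
    then have "openin (top_of_set {0..1}) ({0..1} \<inter> edge_map Gen_c -` N')"
      unfolding base.openin_Q base.qopen_def by simp
    moreover have "1 \<in> {0..1} \<inter> edge_map Gen_c -` N'" using N N' by simp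
    ultimately obtain d where d: "d > 0" "ball 1 d \<inter> {0..1} \<subseteq> {0..1} \<inter> edge_map Gen_c -` N'"
      unfolding openin_contains_ball by metis
    define s where "s = 1 - min (d/2) (1/4)"
    have s: "1/2 < s" "s < 1" "1 - s < d" using d(1) by (auto simp: s_def min_def)
    then have "s \<in> ball 1 d \<inter> {0..1}" by (auto simp: dist_real_def)
    then have "Edge Gen_c s \<in> N" using d(2) s N' by (auto simp: edge_map_inner)
    moreover have "Edge Gen_c s \<notin> e ` S"
    proof
      assume "Edge Gen_c s \<in> e ` S"
      then obtain y where y: "y \<in> S" "Edge Gen_c s = e y" by (rule imageE) 
      have "s = y" using f[OF y(1)] unfolding y(2)[symmetric] by (simp add: f_def)
      then show False using y(1) s by (simp add: S_def)
    qed
    moreover have "Edge Gen_c s \<in> topspace (subtopology base.Q graph)" using s gQ by (auto simp: subset_iff)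
    ultimately show "\<exists>y. y \<in> topspace (subtopology base.Q graph) - e ` S \<and> y \<in> N" by blast
  qed
  moreover have "open S" "0 \<in> S" by (auto simp: S_def)
  ultimately show ?thesis unfolding branches_at_def using e_0
    by (intro exI[of _ S] exI[of _ e] exI[of _ 0] conjI)
qed

lemma Vertex_closure_edges:
  assumes "openin base.Q N" "Vertex \<in> N" obtains t where "0 < t" "t < 1" "Edge Gen_c t \<in> N"
proof -
  have "openin (top_of_set {0..1}) ({0..1} \<inter> edge_map Gen_c -` N)"
    using assms(1) unfolding base.openin_Q base.qopen_def by simp
  moreover have "0 \<in> {0..1} \<inter> edge_map Gen_c -` N" using assms by simp
  ultimately obtain d where d: "d > 0" "ball 0 d \<inter> {0..1} \<subseteq> {0..1} \<inter> edge_map Gen_c -` N"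
    unfolding openin_contains_ball by metis
  define s where "s = min (d/2) (1/4)"
  have s: "0 < s" "s < 1" "s < d" using d(1) by (auto simp: s_def min_def)
  then have "s \<in> ball 0 d \<inter> {0..1}" by (auto simp: dist_real_def)
  then have "edge_map Gen_c s \<in> N" using d(2) by blast
  then have "Edge Gen_c s \<in> N" using s by (simp add: edge_map_inner)
  then show thesis using that s by blast
qed

end

section \<open>Planar neighbourhoods of the points off the graph\<close>

context K_eps
begin

lemma polar18:
  assumes "z \<noteq> 0"
  obtains i t where "i < 18" "0 \<le> t" "t < 1" "z = norm z * circ 18 (real i + t)"
  using polar_circ[of 18 z] assms by auto

lemma fst_rA: "i < 18 \<Longrightarrow> fst (rA ! i) = Gen_a \<longleftrightarrow> i = 8 \<or> i = 17"
proof -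
  assume "i < 18"
  then have "i = 0 \<or> i = 1 \<or> i = 2 \<or> i = 3 \<or> i = 4 \<or> i = 5 \<or> i = 6 \<or> i = 7 \<or> i = 8 \<or> i = 9 \<or> i = 10 \<or>
      i = 11 \<or> i = 12 \<or> i = 13 \<or> i = 14 \<or> i = 15 \<or> i = 16 \<or> i = 17" by presburger
  then show ?thesis by (elim disjE) (simp_all add: relA_def hword_def)
qed

lemma snd_rA: "snd (rA ! 8)" "snd (rA ! 17) = b"
  by (simp_all add: relA_def hword_def)

lemma fst_relB: "i < 10 \<Longrightarrow> fst (relB ! i) \<noteq> Gen_a"
proof -
  assume "i < 10"
  then have "i \<in> {0,1,2,3,4,5,6,7,8,9}" by auto
  then show ?thesis by (elim insertE emptyE) (simp_all add: relB_def)
qed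

lemma face_relB_boundary:
  assumes "norm z = 1" shows "face_map relB z \<in> graph"
proof -
  from circ_surj[of 10, OF _ assms] obtain i t where it: "i < 10" "0 \<le> t" "t < 1" "z = circ 10 (real i + t)" by auto
  then show ?thesis using face_map_circ[of i relB t] fst_relB[OF it(1)] by (simp add: edge_map_in_graph)
qed

lemma circ18_in_arc:
  assumes "0 \<le> y" "y < 18" "0 \<le> u" "v < 18"
  shows "circ 18 y \<in> circ 18 ` {u..v} \<longleftrightarrow> u \<le> y \<and> y \<le> v"
proof
  assume "circ 18 y \<in> circ 18 ` {u..v}"
  then obtain y' where y': "u \<le> y'" "y' \<le> v" "circ 18 y = circ 18 y'" by auto
  then have "y = y'" using circ_eq_iff[of 18 y y'] assms by auto
  then show "u \<le> y \<and> y \<le> v" using y' by simp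
qed auto

lemma face_rA_boundary:
  assumes "i < 18" "0 \<le> t" "t < 1"
  shows "face_map rA (circ 18 (real i + t)) \<in> graph \<longleftrightarrow> \<not> ((i = 8 \<or> i = 17) \<and> 0 < t)"
proof -
  have f: "face_map rA (circ 18 (real i + t)) = edge_map (fst (rA ! i)) (if snd (rA ! i) then t else 1 - t)"
    using face_map_circ[of i rA t] assms by simp
  show ?thesis
  proof (cases "i = 8 \<or> i = 17")
    case True
    then have "fst (rA ! i) = Gen_a" using fst_rA assms by blast
    then show ?thesis using True assms unfolding f by (auto simp: edge_map_def)
  next
    case False
    then have "fst (rA ! i) \<noteq> Gen_a" using fst_rA assms by blast
    then show ?thesis using False unfolding f by (simp add: edge_map_in_graph)
  qed
qed

lemma face_rA_in_graph:
  assumes "norm z \<le> 1"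
  shows "face_map rA z \<in> graph \<longleftrightarrow> z \<in> circ 18 ` {0..8} \<union> circ 18 ` {9..17}"
proof (cases "norm z < 1")
  case True
  then have "z \<notin> circ 18 ` {0..8} \<union> circ 18 ` {9..17}" by auto
  then show ?thesis using True by (simp add: face_map_inner)
next
  case False
  then have n: "norm z = 1" using assms by simp
  from circ_surj[of 18, OF _ n] obtain i t where it: "i < 18" "0 \<le> t" "t < 1" "z = circ 18 (real i + t)" by auto
  have y: "0 \<le> real i + t" "real i + t < 18" using it by linarith+
  have "z \<in> circ 18 ` {0..8} \<union> circ 18 ` {9..17} \<longleftrightarrow> real i + t \<le> 8 \<or> 9 \<le> real i + t \<and> real i + t \<le> 17"
    unfolding it(4) Un_iff using circ18_in_arc[OF y, of 0 8] circ18_in_arc[OF y, of 9 17] y by auto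
  also have "\<dots> \<longleftrightarrow> \<not> ((i = 8 \<or> i = 17) \<and> 0 < t)"
  proof -
    consider "i < 8" | "i = 8" | "9 \<le> i" "i < 17" | "i = 17" using it(1) by linarith
    then show ?thesis
    proof cases
      case 1
      then have "real i \<le> 7" by simp
      then show ?thesis using it 1 by auto
    next
      case 3
      then have "9 \<le> real i" "real i \<le> 16" by simp_all
      then show ?thesis using it 3 by auto
    qed (use it in auto)
  qed
  finally show ?thesis using face_rA_boundary[OF it(1-3)] it(4) by simp
qed

lemma nongraph_cases:
  assumes "x \<in> base.carrier" "x \<notin> graph"
  obtains t where "0 < t" "t < 1" "x = edge_map Gen_a t" | r z where "r \<in> {rA, relB}" "norm z < 1" "x = face_map r z"
proof -
  have "x \<in> {Vertex} \<union> (\<Union>g\<in>gens. edge_map g ` {0<..<1}) \<union> (\<Union>r\<in>{rA, relB}. face_map r ` ball 0 1)"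
    using assms(1) by (simp only: base.carrier_def base.skel_def)
  then show thesis
  proof (elim UnE UN_E imageE)
    assume "x \<in> {Vertex}" then show thesis using assms by simp
  next
    fix g t assume gt: "t \<in> {0<..<1}" "x = edge_map g t"
    then have "g = Gen_a" using assms(2) edge_map_in_graph by blast
    then show thesis using that(1)[of t] gt by simp
  next
    fix r z assume "r \<in> {rA, relB}" "z \<in> ball 0 1" "x = face_map r z"
    then show thesis using that(2)[of r z] by simp
  qed
qed

lemma edge_a_face: "0 \<le> t \<Longrightarrow> t \<le> 1 \<Longrightarrow> edge_map Gen_a t = face_map rA (circ 18 (8 + t))"
  using face_map_circ[of 8 rA t] fst_rA[of 8] snd_rA by simp

lemma nongraph_face:
  assumes "x \<in> base.carrier" "x \<notin> graph"
  obtains r z where "r \<in> {rA, relB}" "norm z \<le> 1" "x = face_map r z"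
  using assms
proof (cases rule: nongraph_cases)
  case (1 t)
  then show ?thesis using that[of rA "circ 18 (8 + t)"] edge_a_face[of t] by simp
next
  case (2 r z) then show ?thesis using that[of r z] by simp
qed

lemma closedin_graph: "closedin base.Q graph"
proof -
  have "compactin base.Q (edge_map g ` {0..1})" for g
    by (rule image_compactin[OF _ base.continuous_em[of g]]) (simp_all add: compactin_subtopology)
  then have "closedin base.Q (edge_map Gen_c ` {0..1} \<union> edge_map Gen_d ` {0..1})"
    using compactin_imp_closedin[OF base.Hausdorff_Q] by blast
  moreover have "edge_map Gen_c ` {0..1} \<union> edge_map Gen_d ` {0..1} = graph"
  proof
    show "edge_map Gen_c ` {0..1} \<union> edge_map Gen_d ` {0..1} \<subseteq> graph" by (auto intro: edge_map_in_graph)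
    have "Vertex \<in> edge_map Gen_c ` {0..1}" by (rule image_eqI[of _ _ 0]) auto
    then show "graph \<subseteq> edge_map Gen_c ` {0..1} \<union> edge_map Gen_d ` {0..1}"
      unfolding graph_def by auto
  qed
  ultimately show ?thesis by simp
qed

definition star_a :: "gen point set" where
  "star_a = base.star (edge_map Gen_a ` {0<..<1})"

lemma open_star_a: "openin base.Q star_a"
  unfolding star_a_def by (intro base.open_star base.gopen_em) auto

lemma edge_in_star_a:
  assumes "0 \<le> t" "t \<le> 1" shows "edge_map g t \<in> star_a \<longleftrightarrow> g = Gen_a \<and> 0 < t \<and> t < 1"
proof -
  have B: "edge_map Gen_a ` {0<..<1} \<subseteq> base.skel" by (auto simp: base.skel_def)
  have "edge_map g t \<in> star_a \<longleftrightarrow> edge_map g t \<in> edge_map Gen_a ` {0<..<1}"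
    unfolding star_a_def using base.star_skel[OF B] base.em_in_skel[of g t] assms by auto
  also have "\<dots> \<longleftrightarrow> g = Gen_a \<and> 0 < t \<and> t < 1" by (auto simp: edge_map_def)
  finally show ?thesis .
qed

text \<open>The sectors are centred at 17/2 and 35/2, the midpoints of the letters 8 and 17, which
  are the two occurrences of \<open>a\<close>. Half-width 1/2 gives precisely the radii that end in
  these open letters.\<close>

lemma face_in_star_a:
  assumes "norm z \<le> 1"
  shows "face_map rA z \<in> star_a \<longleftrightarrow> z \<in> sector 18 (17/2) (1/2) \<union> sector 18 (35/2) (1/2)"
    and "face_map relB z \<notin> star_a"
proof -
  have B: "edge_map Gen_a ` {0<..<1} \<subseteq> base.skel" by (auto simp: base.skel_def)
  have s: "face_map r z \<in> star_a \<longleftrightarrow> z \<noteq> 0 \<and> face_map r (sgn z) \<in> edge_map Gen_a ` {0<..<1}" if "r \<in> {rA, relB}" for r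
  proof -
    have "z \<in> cball 0 1 \<inter> face_map r -` star_a \<longleftrightarrow> z \<in> {z \<in> cball 0 1. z \<noteq> 0 \<and> face_map r (sgn z) \<in> edge_map Gen_a ` {0<..<1}}"
      unfolding star_a_def by (subst base.fm_vimage_star[OF B that]) (rule refl)
    then show ?thesis using assms by simp
  qed
  have g: "edge_map Gen_a ` {0<..<1} \<inter> graph = {}" by (auto simp: edge_map_def)
  show "face_map relB z \<notin> star_a"
  proof
    assume "face_map relB z \<in> star_a"
    then have "z \<noteq> 0" "face_map relB (sgn z) \<in> edge_map Gen_a ` {0<..<1}" using s by blast+
    moreover from this have "face_map relB (sgn z) \<in> graph" by (intro face_relB_boundary) (simp add: norm_sgn)
    ultimately show False using g by blast
  qed
  show "face_map rA z \<in> star_a \<longleftrightarrow> z \<in> sector 18 (17/2) (1/2) \<union> sector 18 (35/2) (1/2)"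
  proof (cases "z = 0")
    case True then show ?thesis using s by (simp add: sector_def)
  next
    case False
    then obtain i t where it: "i < 18" "0 \<le> t" "t < 1" "z = norm z * circ 18 (real i + t)" by (rule polar18)
    have "sgn z = circ 18 (real i + t)"
    proof -
      have "sgn z = sgn (complex_of_real (norm z) * circ 18 (real i + t))" using it(4) by metis
      then show ?thesis using False by (simp add: sgn_mult sgn_of_real)
    qed
    then have "face_map rA z \<in> star_a \<longleftrightarrow> face_map rA (circ 18 (real i + t)) \<in> edge_map Gen_a ` {0<..<1}"
      using s[of rA] False by simp
    also have "\<dots> \<longleftrightarrow> (i = 8 \<or> i = 17) \<and> 0 < t"
    proof
      assume "face_map rA (circ 18 (real i + t)) \<in> edge_map Gen_a ` {0<..<1}"
      then have "face_map rA (circ 18 (real i + t)) \<notin> graph" using g by blast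
      then show "(i = 8 \<or> i = 17) \<and> 0 < t" using face_rA_boundary[OF it(1-3)] by blast
    next
      assume a: "(i = 8 \<or> i = 17) \<and> 0 < t"
      then have "fst (rA ! i) = Gen_a" using fst_rA[OF it(1)] by blast
      then have "face_map rA (circ 18 (real i + t)) = edge_map Gen_a (if snd (rA ! i) then t else 1 - t)"
        using face_map_circ[of i rA t] it by simp
      then show "face_map rA (circ 18 (real i + t)) \<in> edge_map Gen_a ` {0<..<1}" using a it by auto
    qed
    also have "\<dots> \<longleftrightarrow> z \<in> sector 18 (17/2) (1/2) \<union> sector 18 (35/2) (1/2)"
      using sector_letter[of i 18 8 t z] sector_letter[of i 18 17 t z] it False by auto
    finally show ?thesis .
  qed
qed

text \<open>The midpoints of the two letters \<open>a\<close> are nine letters apart, hence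
  antipodal, so the sign of this one real part tells the two sectors apart.\<close>

lemma Re_sector:
  assumes "z \<in> sector 18 (17/2) (1/2)" shows "0 < Re (z * circ 18 (- (17/2)))"
proof -
  have "0 \<le> cos (2 * pi * (1/2) / real 18)" by (intro cos_ge_zero) (auto simp: field_simps)
  then have "0 \<le> cos (2 * pi * (1/2) / real 18) * norm z" by (intro mult_nonneg_nonneg norm_ge_zero)
  also have "\<dots> < Re (z * circ 18 (- (17/2)))" using assms by (simp only: sector_def mem_Collect_eq)
  finally show ?thesis .
qed

lemma Re_sector':
  assumes "z \<in> sector 18 (35/2) (1/2)" shows "Re (z * circ 18 (- (17/2))) < 0"
proof -
  have "0 \<le> cos (2 * pi * (1/2) / real 18)" by (intro cos_ge_zero) (auto simp: field_simps)
  then have "0 \<le> cos (2 * pi * (1/2) / real 18) * norm z" by (intro mult_nonneg_nonneg norm_ge_zero)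
  also have "\<dots> < Re (z * circ 18 (- (35/2)))" using assms by (simp only: sector_def mem_Collect_eq)
  finally have "0 < Re (z * circ 18 (- (35/2)))" .
  moreover have "circ 18 (- (17/2)) = - circ 18 (- (35/2))"
  proof -
    have "circ 18 9 = - 1" by (simp add: circ_def)
    then show ?thesis using circ_add[of 18 "- (35/2)" 9] by simp
  qed
  ultimately show ?thesis by simp
qed

text \<open>Inverse of the gluing of the pages 8 and 17 along the unit circle, with the second page
  inverted to the outside. Letter 17 reads \<open>a\<close> forwards or backwards according to
  \<open>b\<close>, hence the conjugation in one case. The value 0 at the vertex is a default, as
  the vertex is not in \<open>star_a\<close>.\<close>

definition chart_a :: "gen point \<Rightarrow> complex" where
  "chart_a x = (case x of Vertex \<Rightarrow> 0 | Edge g t \<Rightarrow> circ 18 (t - 1/2)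
     | Face r z \<Rightarrow> if 0 < Re (z * circ 18 (- (17/2))) then z * circ 18 (- (17/2))
         else if b then inverse (cnj (z * circ 18 (- (35/2)))) else inverse (z * circ 18 (- (35/2))))"

lemma chart_a_sector:
  assumes "norm z \<le> 1"
  shows "z \<in> sector 18 (17/2) (1/2) \<Longrightarrow> chart_a (face_map rA z) = z * circ 18 (- (17/2))"
    and "z \<in> sector 18 (35/2) (1/2) \<Longrightarrow> chart_a (face_map rA z) =
      (if b then inverse (cnj (z * circ 18 (- (35/2)))) else inverse (z * circ 18 (- (35/2))))"
proof -
  have z0: "z \<noteq> 0" if "z \<in> sector 18 x h" for x h using that by (auto simp: sector_def)
  have inner: "chart_a (face_map rA z) = (if 0 < Re (z * circ 18 (- (17/2))) then z * circ 18 (- (17/2))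
         else if b then inverse (cnj (z * circ 18 (- (35/2)))) else inverse (z * circ 18 (- (35/2))))" if "norm z < 1"
    using that by (simp add: face_map_inner chart_a_def)
  have bd: "\<exists>t. 0 < t \<and> t < 1 \<and> z = circ 18 (real j + t)"
    if "norm z = 1" "z \<in> sector 18 (real j + 1/2) (1/2)" "j < 18" for j
  proof -
    from circ_surj[of 18, OF _ that(1)] obtain i t where it: "i < 18" "0 \<le> t" "t < 1" "z = circ 18 (real i + t)" by auto
    have "i = j \<and> 0 < t" using sector_letter[OF it(1) that(3) it(2,3) z0[OF that(2)]] that it by simp
    then show ?thesis using it by blast
  qed
  show "chart_a (face_map rA z) = z * circ 18 (- (17/2))" if s: "z \<in> sector 18 (17/2) (1/2)"
  proof (cases "norm z < 1")
    case True then show ?thesis using inner Re_sector[OF s] by simp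
  next
    case False
    then have "norm z = 1" using assms by simp
    then obtain t where t: "0 < t" "t < 1" "z = circ 18 (8 + t)" using bd[of 8] s by auto
    then have "chart_a (face_map rA z) = circ 18 (t - 1/2)"
      using edge_a_face[of t] by (simp add: edge_map_inner chart_a_def flip: edge_a_face)
    then show ?thesis using t(3) by (simp flip: circ_add)
  qed
  show "chart_a (face_map rA z) = (if b then inverse (cnj (z * circ 18 (- (35/2)))) else inverse (z * circ 18 (- (35/2))))"
    if s: "z \<in> sector 18 (35/2) (1/2)"
  proof (cases "norm z < 1")
    case True then show ?thesis using inner Re_sector'[OF s] by simp
  next
    case False
    then have "norm z = 1" using assms by simp
    then obtain t where t: "0 < t" "t < 1" "z = circ 18 (17 + t)" using bd[of 17] s by auto
    have "face_map rA z = edge_map Gen_a (if b then t else 1 - t)"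
      using face_map_circ[of 17 rA t] t fst_rA[of 17] snd_rA by simp
    then have "chart_a (face_map rA z) = circ 18 ((if b then t else 1 - t) - 1/2)"
      using t by (simp add: edge_map_inner chart_a_def)
    moreover have "z * circ 18 (- (35/2)) = circ 18 (t - 1/2)" unfolding t(3) by (simp flip: circ_add)
    ultimately show ?thesis by (simp add: cnj_circ inverse_circ)
  qed
qed

text \<open>Just two letters of the relators read \<open>a\<close>, so two pages meet along this
  edge, and \<open>chart_a\<close> flattens them. Inside a face the disc itself is the
  chart.\<close>

lemma euclidean_at_nongraph:
  assumes "x \<in> base.carrier" "x \<notin> graph" shows "euclidean_at TYPE(complex) base.Q x"
  using assms
proof (cases rule: nongraph_cases)
  case (1 t0)
  have SQ: "star_a \<subseteq> topspace base.Q" by (rule openin_subset[OF open_star_a])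
  have "continuous_map (subtopology base.Q star_a) euclidean chart_a"
  proof -
    have "openin base.Q {x \<in> star_a. chart_a x \<in> W}" if W: "open W" for W
      unfolding base.openin_Q base.qopen_def
    proof (intro conjI ballI)
      show "{x \<in> star_a. chart_a x \<in> W} \<subseteq> base.carrier" using SQ by (auto simp: base.topspace_Q)
      fix g :: gen
      have "{0..1} \<inter> edge_map g -` {x \<in> star_a. chart_a x \<in> W} =
          (if g = Gen_a then {0<..<1} \<inter> (\<lambda>t. circ 18 (t - 1/2)) -` W else {})"
      proof -
        have "chart_a (edge_map Gen_a t) = circ 18 (t - 1/2)" if "0 < t" "t < 1" for t
          using that by (simp add: edge_map_inner chart_a_def)
        then show ?thesis using edge_in_star_a[of _ g] by (auto simp del: Edge_in_graph)
      qed
      moreover have "open ({0<..<1} \<inter> (\<lambda>t. circ 18 (t - 1/2)) -` W)"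
        by (intro continuous_open_preimage W) (auto intro!: continuous_intros)
      moreover have "{0<..<1} \<inter> (\<lambda>t. circ 18 (t - 1/2)) -` W \<subseteq> {0..1}" by auto
      ultimately show "openin (top_of_set {0..1}) ({0..1} \<inter> edge_map g -` {x \<in> star_a. chart_a x \<in> W})"
        by (simp add: open_subset)
    next
      fix r assume "r \<in> {relA b, relB}"
      then show "openin (top_of_set (cball 0 1)) (cball 0 1 \<inter> face_map r -` {x \<in> star_a. chart_a x \<in> W})"
      proof (elim insertE emptyE)
        assume r: "r = relB"
        have "cball 0 1 \<inter> face_map r -` {x \<in> star_a. chart_a x \<in> W} = {}"
          unfolding r using face_in_star_a(2) by auto
        then show ?thesis by simp
      next
        assume r: "r = rA"
        define k where "k z = (if b then inverse (cnj (z * circ 18 (- (35/2)))) else inverse (z * circ 18 (- (35/2))))" for z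
        let ?S = "sector 18 (17/2) (1/2) \<inter> (\<lambda>z. z * circ 18 (- (17/2))) -` W \<union> sector 18 (35/2) (1/2) \<inter> k -` W"
        have "cball 0 1 \<inter> face_map r -` {x \<in> star_a. chart_a x \<in> W} = cball 0 1 \<inter> ?S"
        proof -
          have sf: "face_map rA z \<in> star_a \<and> chart_a (face_map rA z) \<in> W \<longleftrightarrow> z \<in> ?S" if "norm z \<le> 1" for z
            using face_in_star_a(1)[OF that] chart_a_sector[OF that] Re_sector[of z] Re_sector'[of z] unfolding k_def
            by (auto simp del: minus_divide_left)
          show ?thesis
          proof (rule set_eqI)
            fix z
            show "z \<in> cball 0 1 \<inter> face_map r -` {x \<in> star_a. chart_a x \<in> W} \<longleftrightarrow> z \<in> cball 0 1 \<inter> ?S"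
              unfolding r using sf[of z] by (cases "norm z \<le> 1") (simp_all only: Int_iff vimage_eq mem_Collect_eq mem_cball_0 simp_thms)
          qed
        qed
        moreover have "open ?S"
        proof (intro open_Un continuous_open_preimage open_sector W)
          show "continuous_on (sector 18 (35/2) (1/2)) k"
            unfolding k_def by (cases b) (auto intro!: continuous_intros simp: sector_def)
        qed (auto intro!: continuous_intros)
        ultimately show ?thesis by (simp add: openin_open_Int)
      qed
    qed
    then have "openin (subtopology base.Q star_a) {x \<in> star_a. chart_a x \<in> W}" if "open W" for W
      using that unfolding openin_subtopology by (intro exI[of _ "{x \<in> star_a. chart_a x \<in> W}"]) auto
    then show ?thesis unfolding continuous_map_def topspace_subtopology_subset[OF SQ] by simp
  qed
  moreover have "inj_on chart_a star_a"
  proof (rule inj_on_inverseI[where g="\<lambda>w. if norm w \<le> 1 then page 8 w else page 17 (inverse (cnj w))"])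
    fix x assume x: "x \<in> star_a"
    then have "x \<in> base.carrier" "x \<notin> graph"
    proof -
      show "x \<in> base.carrier" using x SQ by (auto simp: base.topspace_Q)
      have "edge_map Gen_a ` {0<..<1} \<inter> graph = {}" by (auto simp: edge_map_def)
      moreover have "base.star (edge_map Gen_a ` {0<..<1}) \<inter> base.skel = edge_map Gen_a ` {0<..<1}"
        by (rule base.star_skel) (auto simp: base.skel_def)
      moreover have "graph \<subseteq> base.skel" by (auto simp: graph_def base.skel_def)
      ultimately show "x \<notin> graph" using x unfolding star_a_def by blast
    qed
    then show "(if norm (chart_a x) \<le> 1 then page 8 (chart_a x) else page 17 (inverse (cnj (chart_a x)))) = x"
    proof (cases rule: nongraph_cases)
      case (1 t)
      then show ?thesis using page_edge[of 8 t] fst_rA[of 8] by (simp add: edge_map_inner chart_a_def)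
    next
      case (2 r z)
      then have "r \<noteq> relB" using x face_in_star_a(2)[of z] by auto
      then have r: "r = rA" using 2(1) by simp
      have z: "norm z \<le> 1" using 2 by simp
      have "z \<in> sector 18 (17/2) (1/2) \<union> sector 18 (35/2) (1/2)" using face_in_star_a(1)[OF z] x 2(3) r by simp
      then show ?thesis
      proof
        assume "z \<in> sector 18 (17/2) (1/2)"
        then have c: "chart_a x = z * circ 18 (- (17/2))" using chart_a_sector(1)[OF z] 2(3) r by simp
        have "page 8 (z * circ 18 (- (17/2))) = face_map rA z"
          unfolding page_def using snd_rA by (simp add: mult.assoc flip: circ_add)
        then show ?thesis using c z 2(3) r by (simp add: norm_mult)
      next
        assume s: "z \<in> sector 18 (35/2) (1/2)"
        then have c: "chart_a x = (if b then inverse (cnj (z * circ 18 (- (35/2)))) else inverse (z * circ 18 (- (35/2))))"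
          using chart_a_sector(2)[OF z] 2(3) r by simp
        have z0: "z \<noteq> 0" using s by (auto simp: sector_def)
        then have "norm (chart_a x) = inverse (norm z)" unfolding c by (simp add: norm_inverse norm_mult)
        then have "\<not> norm (chart_a x) \<le> 1" using 2(2) z0 by (simp add: inverse_le_1_iff)
        moreover have "page 17 (inverse (cnj (chart_a x))) = face_map rA z"
          unfolding page_def c using snd_rA by (cases b) (simp_all add: mult.assoc flip: circ_add)
        ultimately show ?thesis using 2(3) r by simp
      qed
    qed
  qed
  moreover have "x \<in> star_a" using 1 edge_in_star_a[of t0 Gen_a] by simp
  ultimately show ?thesis unfolding euclidean_at_def using open_star_a
    by (intro exI[of _ star_a] exI[of _ chart_a] conjI)
next
  case (2 r z)
  define h where "h x = (case x of Face _ z \<Rightarrow> z | _ \<Rightarrow> 0)" for x :: "gen point"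
  have h: "h (face_map r w) = w" if "norm w < 1" for w using that by (simp add: h_def face_map_inner)
  let ?U = "face_map r ` ball 0 1"
  have op: "openin base.Q (face_map r ` W)" if "open W" "W \<subseteq> ball 0 1" for W
    using base.open_face_image[OF 2(1) that] .
  have UQ: "?U \<subseteq> topspace base.Q" by (rule openin_subset[OF op]) auto
  have "openin (subtopology base.Q ?U) {x \<in> ?U. h x \<in> W}" if "open W" for W
  proof -
    have "{x \<in> ?U. h x \<in> W} = face_map r ` (W \<inter> ball 0 1)" by (auto simp: h)
    then have "openin base.Q {x \<in> ?U. h x \<in> W}" using op[of "W \<inter> ball 0 1"] that by auto
    then show ?thesis unfolding openin_subtopology by (intro exI[of _ "{x \<in> ?U. h x \<in> W}"]) auto
  qed
  then have "continuous_map (subtopology base.Q ?U) euclidean h"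
    unfolding continuous_map_def topspace_subtopology_subset[OF UQ] by simp
  moreover have "inj_on h ?U" by (rule inj_onI) (auto simp: h)
  moreover have "x \<in> ?U" using 2 by auto
  moreover have "openin base.Q ?U" by (rule op) auto
  ultimately show ?thesis unfolding euclidean_at_def by (intro exI[of _ ?U] exI[of _ h] conjI)
qed

section \<open>Cutting the faces near the graph\<close>

text \<open>The line through the midpoints of the two letters \<open>a\<close> cuts the face \<open>rA\<close> into two halves, each
  of which contains one copy of \<open>[c\<^sup>d, c]\<close> in its boundary.\<close>

definition side :: "complex \<Rightarrow> real" where
  "side z = Im (z * circ 18 (- (17/2)))"

lemma side_circ:
  assumes "0 \<le> y" "y < 18"
  shows "side (circ 18 y) < 0 \<longleftrightarrow> y < 17/2 \<or> 35/2 < y" "0 < side (circ 18 y) \<longleftrightarrow> 17/2 < y \<and> y < 35/2"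
proof -
  define u where "u = (y - 17/2) / 9"
  define x where "x = pi * u"
  \<comment> \<open>Eighteen letters make a full turn, so \<open>side\<close> is the sine of the
    angle measured from the midpoint 17/2, with nine letters to pi.\<close>
  have s: "side (circ 18 y) = sin x"
    unfolding side_def circ_add[symmetric] by (simp add: circ_def x_def u_def)
  have u: "- 1 < u" "u < 2" "u < 0 \<longleftrightarrow> y < 17/2" "u = 0 \<longleftrightarrow> y = 17/2" "u < 1 \<longleftrightarrow> y < 35/2" "u = 1 \<longleftrightarrow> y = 35/2"
    using assms by (auto simp: u_def field_simps)
  have x: "x < 0 \<longleftrightarrow> y < 17/2" "x = 0 \<longleftrightarrow> y = 17/2" "x < pi \<longleftrightarrow> y < 35/2" "x = pi \<longleftrightarrow> y = 35/2" "- pi < x" "x < 2 * pi"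
    using u mult_strict_left_mono[of "- 1" u pi] mult_strict_left_mono[of u 2 pi]
    by (auto simp: x_def mult_less_0_iff mult.commute[of 2])
  consider "x < 0" | "x = 0" | "0 < x" "x < pi" | "x = pi" | "pi < x" by linarith
  then have "(side (circ 18 y) < 0 \<longleftrightarrow> y < 17/2 \<or> 35/2 < y) \<and> (0 < side (circ 18 y) \<longleftrightarrow> 17/2 < y \<and> y < 35/2)"
  proof cases
    case 1
    then have "sin x < 0" using x(5) sin_gt_zero[of "- x"] by simp
    then show ?thesis using 1 x s by auto
  next
    case 2 then show ?thesis using x s by auto
  next
    case 3
    then have "sin x > 0" by (rule sin_gt_zero)
    then show ?thesis using 3 x s by auto
  next
    case 4 then show ?thesis using x s by auto
  next
    case 5
    then have "sin x < 0" using x(6) by (intro sin_lt_zero)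
    then show ?thesis using 5 x s by auto
  qed
  then show "side (circ 18 y) < 0 \<longleftrightarrow> y < 17/2 \<or> 35/2 < y" "0 < side (circ 18 y) \<longleftrightarrow> 17/2 < y \<and> y < 35/2" by auto
qed

lemma continuous_side [continuous_intros]: "continuous_on S side"
  unfolding side_def by (intro continuous_intros)

lemma side_scale: "side (of_real \<rho> * z) = \<rho> * side z"
  by (simp add: side_def mult.assoc)

text \<open>The removed chord and centre form a compact set that misses the graph: the chord meets
  the circle only at 17/2 and 35/2, inside the letters \<open>a\<close>. So an open neighbourhood of
  the graph remains.\<close>

definition uncut :: "gen point set" where
  "uncut = base.carrier - (face_map rA ` {z \<in> cball 0 1. side z = 0} \<union> {face_map relB 0})"

lemma open_uncut: "openin base.Q uncut"
proof -
  have "compact {z \<in> cball 0 1. side z = 0}"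
  proof -
    have "closed (cball 0 1 \<inter> side -` {0})" by (intro continuous_closed_preimage) (auto intro!: continuous_intros)
    moreover have "{z \<in> cball 0 1. side z = 0} = cball 0 1 \<inter> side -` {0}" by auto
    ultimately show ?thesis by (metis bounded_Int bounded_cball compact_eq_bounded_closed)
  qed
  then have "compactin base.Q (face_map rA ` {z \<in> cball 0 1. side z = 0})"
    by (intro image_compactin[OF _ base.continuous_fm[of rA]]) (auto simp: compactin_subtopology)
  moreover have "compactin base.Q {face_map relB 0}"
    using base.fm_in_carrier[of relB 0] by (simp add: base.topspace_Q)
  ultimately have "closedin base.Q (face_map rA ` {z \<in> cball 0 1. side z = 0} \<union> {face_map relB 0})"
    using compactin_imp_closedin[OF base.Hausdorff_Q] by blast
  then show ?thesis unfolding uncut_def base.topspace_Q[symmetric] by blast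
qed

text \<open>\<open>True\<close> is the half with the positions [0, 8], \<open>False\<close> the one
  with [9, 17]. The chord halves the edge \<open>a\<close> as well, and each half edge goes to the
  half face that reaches it through letter 8.\<close>

definition half :: "bool \<Rightarrow> gen point set" where
  "half c = edge_map Gen_a ` (if c then {0<..<1/2} else {1/2<..<1}) \<union>
     face_map rA ` {z. norm z < 1 \<and> (if c then side z < 0 else 0 < side z)}"

definition punctured :: "gen point set" where
  "punctured = face_map relB ` (ball 0 1 - {0})"

lemma open_punctured: "openin base.Q punctured"
  unfolding punctured_def by (rule base.open_face_image) auto

lemma graph_uncut: "graph \<subseteq> uncut"
proof
  fix x assume x: "x \<in> graph"
  have "x \<in> base.carrier" using x closedin_subset[OF closedin_graph] by (auto simp: base.topspace_Q)
  moreover have "x \<noteq> face_map relB 0" using x by (auto simp: face_map_inner)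
  moreover have "x \<noteq> face_map rA z" if z: "norm z \<le> 1" "side z = 0" for z
  proof
    assume xz: "x = face_map rA z"
    then have "z \<in> circ 18 ` {0..8} \<union> circ 18 ` {9..17}" using face_rA_in_graph[OF z(1)] x by simp
    then have "z \<in> circ 18 ` ({0..8} \<union> {9..17})" by (simp only: image_Un)
    then obtain y where "y \<in> {0..8} \<union> {9..17}" and zy: "z = circ 18 y" by (rule imageE)
    then have y: "0 \<le> y \<and> y \<le> 8 \<or> 9 \<le> y \<and> y \<le> 17" by auto
    then have "0 \<le> y" "y < 18" by auto
    from side_circ[OF this] y z(2) zy show False by auto
  qed
  ultimately show "x \<in> uncut" unfolding uncut_def by auto
qed

lemma uncut_nongraph: "uncut - graph \<subseteq> half True \<union> half False \<union> punctured"
proof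
  fix x assume x: "x \<in> uncut - graph"
  then have c: "x \<in> base.carrier" "x \<notin> graph" by (auto simp: uncut_def)
  then show "x \<in> half True \<union> half False \<union> punctured"
  proof (cases rule: nongraph_cases)
    case (1 t)
    have "t \<noteq> 1/2"
    proof
      assume t: "t = 1/2"
      have "side (circ 18 (8 + 1/2)) = 0" using side_circ[of "8 + 1/2"] by auto
      then have "circ 18 (8 + 1/2) \<in> {z \<in> cball 0 1. side z = 0}" by simp
      moreover have "x = face_map rA (circ 18 (8 + 1/2))" using 1 t edge_a_face[of "1/2"] by simp
      ultimately show False using x unfolding uncut_def by blast
    qed
    then consider "t < 1/2" | "1/2 < t" by linarith
    then have "x \<in> half True \<or> x \<in> half False"
      by cases (use 1 in \<open>simp_all add: half_def\<close>)
    then show ?thesis by blast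
  next
    case (2 r z)
    show ?thesis
    proof (cases "r = relB")
      case True
      then have "z \<noteq> 0" using x 2 unfolding uncut_def by blast
      then show ?thesis using 2 True by (auto simp: punctured_def)
    next
      case False
      then have r: "r = rA" using 2 by simp
      have "side z \<noteq> 0"
      proof
        assume "side z = 0"
        then have "z \<in> {z \<in> cball 0 1. side z = 0}" using 2(2) by simp
        then show False using x 2(3) r unfolding uncut_def by blast
      qed
      then have "x \<in> half True \<or> x \<in> half False" using 2 r unfolding half_def by (cases "side z < 0") auto
      then show ?thesis by blast
    qed
  qed
qed

lemma half_face:
  assumes "\<not> b" "norm z \<le> 1"
  shows "face_map rA z \<in> half c \<longleftrightarrow>
    (if c then side z < 0 \<and> z \<notin> circ 18 ` {0..8} else 0 < side z \<and> z \<notin> circ 18 ` {9..17})"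
proof (cases "norm z < 1")
  case True
  have n: "z \<notin> circ 18 ` {0..8}" "z \<notin> circ 18 ` {9..17}" using True by auto
  have "Face rA z \<notin> edge_map Gen_a ` W" for W by (auto simp: edge_map_def)
  then show ?thesis using True n by (auto simp: half_def face_map_inner)
next
  case False
  then have n1: "norm z = 1" using assms by simp
  from circ_surj[of 18, OF _ n1] obtain i t where it: "i < 18" "0 \<le> t" "t < 1" "z = circ 18 (real i + t)" by auto
  have y: "0 \<le> real i + t" "real i + t < 18" using it by linarith+
  have arcs: "z \<in> circ 18 ` {0..8} \<longleftrightarrow> real i + t \<le> 8" "z \<in> circ 18 ` {9..17} \<longleftrightarrow> 9 \<le> real i + t \<and> real i + t \<le> 17"
    unfolding it(4) using circ18_in_arc[OF y, of 0 8] circ18_in_arc[OF y, of 9 17] y by auto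
  have sides: "side z < 0 \<longleftrightarrow> real i + t < 17/2 \<or> 35/2 < real i + t" "0 < side z \<longleftrightarrow> 17/2 < real i + t \<and> real i + t < 35/2"
    unfolding it(4) using side_circ[OF y] by auto
  have sk: "face_map rA z \<in> base.skel" using base.fm_sphere_skel[of rA z] n1 by simp
  have "face_map rA z \<in> half c \<longleftrightarrow> face_map rA z \<in> edge_map Gen_a ` (if c then {0<..<1/2} else {1/2<..<1})"
    using sk base.fm_notin_skel[of rA] unfolding half_def by auto
  also have "\<dots> \<longleftrightarrow> (if c then i = 8 \<and> 0 < t \<and> t < 1/2 \<or> i = 17 \<and> 1/2 < t else i = 8 \<and> 1/2 < t \<or> i = 17 \<and> 0 < t \<and> t < 1/2)"
  proof -
    have f: "face_map rA z = edge_map (fst (rA ! i)) (if snd (rA ! i) then t else 1 - t)"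
      using face_map_circ[of i rA t] it by simp
    consider "i = 8" | "i = 17" | "i \<noteq> 8" "i \<noteq> 17" by blast
    then show ?thesis
    proof cases
      case 1
      then have "face_map rA z = edge_map Gen_a t" using f snd_rA fst_rA[of 8] by simp
      then show ?thesis using 1 it by (auto simp: edge_map_def)
    next
      case 2
      then have "face_map rA z = edge_map Gen_a (1 - t)" using f snd_rA fst_rA[of 17] assms(1) by simp
      then show ?thesis using 2 it by (auto simp: edge_map_def)
    next
      case 3
      then have "fst (rA ! i) \<noteq> Gen_a" using fst_rA it by blast
      then show ?thesis using f 3 by (auto simp: edge_map_def)
    qed
  qed
  also have "\<dots> \<longleftrightarrow> (if c then side z < 0 \<and> z \<notin> circ 18 ` {0..8} else 0 < side z \<and> z \<notin> circ 18 ` {9..17})"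
  proof -
    consider "i < 8" | "i = 8" | "9 \<le> i" "i < 17" | "i = 17" using it(1) by linarith
    then show ?thesis
    proof cases
      case 1
      then have "real i \<le> 7" by simp
      then show ?thesis unfolding arcs sides using it 1 by auto
    next
      case 3
      then have "9 \<le> real i" "real i \<le> 16" by simp_all
      then show ?thesis unfolding arcs sides using it 3 by auto
    next
      case 2 then show ?thesis unfolding arcs sides using it(2,3) by auto
    next
      case 4 then show ?thesis unfolding arcs sides using it(2,3) by auto
    qed
  qed
  finally show ?thesis .
qed

text \<open>For \<open>b\<close> false the letter 17 reads \<open>a\<close> backwards, so both
  letters put the same half edge on the same side of the chord. With the other sign letter 17 would
  put it on the opposite side, and \<open>half c\<close> would not be open.\<close>

lemma open_half:
  assumes "\<not> b" shows "openin base.Q (half c)"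
  unfolding base.openin_Q base.qopen_def
proof (intro conjI ballI)
  have sk: "edge_map Gen_a t \<in> base.skel" if "0 \<le> t" "t \<le> 1" for t using base.em_in_skel[of Gen_a t] that by simp
  have ns: "face_map rA z \<notin> base.skel" if "norm z < 1" for z using base.fm_notin_skel[of rA z] that by simp
  show "half c \<subseteq> base.carrier"
    unfolding half_def using sk base.skel_carrier base.fm_in_carrier[of rA] by (auto split: if_splits)
  fix g :: gen
  define W :: "real set" where "W = (if c then {0<..<1/2} else {1/2<..<1})"
  have W: "open W" "W \<subseteq> {0<..<1}" by (auto simp: W_def)
  have "edge_map g t \<in> half c \<longleftrightarrow> g = Gen_a \<and> t \<in> W" if t: "t \<in> {0..1}" for t
  proof -
    have "edge_map g t \<in> base.skel" using base.em_in_skel[of g t] t by simp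
    then have "edge_map g t \<in> half c \<longleftrightarrow> edge_map g t \<in> edge_map Gen_a ` W"
      unfolding half_def W_def[symmetric] using ns by auto
    also have "\<dots> \<longleftrightarrow> g = Gen_a \<and> t \<in> W" using W(2) t by (force simp: edge_map_def image_iff)
    finally show ?thesis .
  qed
  then have "{0..1} \<inter> edge_map g -` half c = (if g = Gen_a then W else {})" using W(2) by auto
  moreover have "W \<subseteq> {0..1}" using W(2) by auto
  ultimately show "openin (top_of_set {0..1}) ({0..1} \<inter> edge_map g -` half c)" using W(1) by (simp add: open_subset)
next
  fix r assume "r \<in> {relA b, relB}"
  then show "openin (top_of_set (cball 0 1)) (cball 0 1 \<inter> face_map r -` half c)"
  proof (elim insertE emptyE)
    assume r: "r = relB"
    have "face_map relB z \<notin> half c" if "norm z \<le> 1" for z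
    proof (cases "norm z < 1")
      case True
      then show ?thesis by (auto simp: half_def face_map_inner edge_map_def rel_distinct)
    next
      case False
      then have "face_map relB z \<in> graph" using face_relB_boundary that by simp
      moreover have "half c \<inter> graph = {}" by (auto simp: half_def face_map_inner edge_map_def)
      ultimately show ?thesis by blast
    qed
    then have "cball 0 1 \<inter> face_map r -` half c = {}" unfolding r by auto
    then show ?thesis by simp
  next
    assume r: "r = rA"
    define A where "A = (if c then circ 18 ` {0..8} else circ 18 ` {9..17})"
    have "closed A" unfolding A_def
      by (auto intro!: compact_imp_closed compact_continuous_image continuous_intros)
    have "cball 0 1 \<inter> face_map r -` half c = cball 0 1 \<inter> ({z. if c then side z < 0 else 0 < side z} - A)"
      unfolding r A_def using half_face[OF assms, of _ c] by auto
    moreover have "open ({z. if c then side z < 0 else 0 < side z} - A)"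
    proof (rule open_Diff[OF _ \<open>closed A\<close>])
      show "open {z. if c then side z < 0 else 0 < side z}"
        by (cases c) (auto intro!: open_Collect_less continuous_intros)
    qed
    ultimately show ?thesis by (simp add: openin_open_Int)
  qed
qed

end

section \<open>Finite coverings of \<open>K\<^sub>\<epsilon>\<close>\<close>

text \<open>A finite-order argument: the relation makes \<open>3\<close> coprime to the order of \<open>C\<close>, so \<open>C\<close> is a power of
  \<open>C\<^sup>3\<close> and its conjugate by \<open>D\<close> is a power of \<open>C\<^sup>5\<close>.\<close>

lemma finite_Baumslag_Solitar_commute:
  fixes C D :: "'v \<Rightarrow> 'v"
  assumes fin: "finite S" and C: "C permutes S" and D: "D permutes S"
    and rel: "\<And>x. D (C (C (C x))) = C (C (C (C (C (D x)))))" and xy: "D y = C (D x)"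
  shows "D (C y) = C (D (C x))"
proof -
  have it: "D ((C ^^ (3 * k)) x) = (C ^^ (5 * k)) (D x)" for k x
  proof (induction k arbitrary: x)
    case (Suc k)
    have "3 * Suc k = Suc (Suc (Suc (3 * k)))" "5 * Suc k = Suc (Suc (Suc (Suc (Suc (5 * k)))))" by simp_all
    then show ?case by (simp only: funpow.simps o_apply rel Suc.IH)
  qed simp
  from permutation_is_nilpotent[OF permutes_imp_permutation[OF fin C]]
  obtain n0 where n0: "C ^^ n0 = id \<and> n0 > 0" by blast
  define N where "N = (LEAST n. C ^^ n = id \<and> n > 0)"
  have N: "C ^^ N = id" "N > 0" using LeastI[where P="\<lambda>n. C ^^ n = id \<and> n > 0", OF n0] by (simp_all add: N_def)
  have least: "N \<le> n" if "C ^^ n = id" "n > 0" for n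
    unfolding N_def using that by (intro Least_le) simp
  have "\<exists>k. C ^^ (3 * k) = C"
  proof -
    have mult: "C ^^ (j * N) = id" for j using N(1) by (simp add: mult.commute[of j] funpow_mult[symmetric])
    have red: "C ^^ (j * N + 1) = C" for j using mult[of j] by (simp add: fun_eq_iff)
    consider m where "N = 3 * m" | m where "N = 3 * m + 1" | m where "N = 3 * m + 2"
    proof -
      have "N = 3 * (N div 3) + N mod 3" "N mod 3 < 3" by simp_all
      then have "N = 3 * (N div 3) \<or> N = 3 * (N div 3) + 1 \<or> N = 3 * (N div 3) + 2" by linarith
      then show thesis using that by blast
    qed
    then show ?thesis
    proof cases
      \<comment> \<open>If 3 divides the order, the relation turns \<open>C ^^ (3 * m) = id\<close>
        into \<open>C ^^ (5 * m) = id\<close>. Together with \<open>C ^^ (6 * m) = id\<close> this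
        gives \<open>C ^^ m = id\<close>, against the minimality of N = 3m.\<close>
      case (1 m)
      have "(C ^^ (5 * m)) (D x) = D x" for x using it[of m x] N(1) 1 by simp
      then have "(C ^^ (5 * m)) z = z" for z using permutes_surj[OF D] by (metis surjD)
      moreover have "(C ^^ (6 * m)) z = z" for z using mult[of 2] 1 by (simp add: mult.assoc)
      moreover have "(C ^^ (6 * m)) z = (C ^^ m) ((C ^^ (5 * m)) z)" for z
      proof -
        have "6 * m = m + 5 * m" by simp
        then show ?thesis by (simp only: funpow_add o_apply)
      qed
      ultimately have "C ^^ m = id" by (auto simp: fun_eq_iff)
      moreover have "m > 0" "m < N" using 1 N(2) by auto
      ultimately show ?thesis using least[of m] by simp
    next
      case (2 m)
      then have "3 * (2 * m + 1) = 2 * N + 1" by simp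
      then have "C ^^ (3 * (2 * m + 1)) = C" using red[of 2] by (simp only:)
      then show ?thesis by blast
    next
      case (3 m)
      then have "3 * (m + 1) = 1 * N + 1" by simp
      then have "C ^^ (3 * (m + 1)) = C" using red[of 1] by (simp only:)
      then show ?thesis by blast
    qed
  qed
  then obtain k where k: "C ^^ (3 * k) = C" by blast
  \<comment> \<open>The conjugate of \<open>C\<close> by \<open>D\<close> is a power of
    \<open>C\<close>, so it commutes with \<open>C\<close>.\<close>
  have DC: "D (C z) = (C ^^ (5 * k)) (D z)" for z using it[of k z] k by simp
  have "D (C y) = (C ^^ (5 * k)) (C (D x))" using DC xy by simp
  also have "\<dots> = C ((C ^^ (5 * k)) (D x))" by (simp add: funpow_swap1)
  also have "\<dots> = C (D (C x))" using DC by simp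
  finally show ?thesis .
qed

text \<open>Of a finite CW-complex the compactness and the Hausdorff property are retained. The
  fibre, the lifts of edges and faces, and the action on the fibre are built from the covering
  map.\<close>

locale compact_cover = K_eps b for b :: bool +
  fixes X :: "'a topology" and p :: "'a \<Rightarrow> gen point"
  assumes cov: "covering_map X base.Q p" and haus: "Hausdorff_space X" and comp: "compact_space X"
begin

lemma lh: "local_homeo X base.Q p"
  by (rule covering_map_local_homeo[OF cov])

lemma continuous_p: "continuous_map X base.Q p"
  using lh by (simp add: local_homeo_def)

lemma p_carrier: "x \<in> topspace X \<Longrightarrow> p x \<in> base.carrier"
  using continuous_p by (auto simp: continuous_map_def base.topspace_Q)

definition fib :: "'a set" where "fib = {x \<in> topspace X. p x = Vertex}"

definition graphX :: "'a set" where "graphX = {x \<in> topspace X. p x \<in> graph}"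

text \<open>Each point has a neighbourhood on which \<open>p\<close> is injective and which
  therefore meets the fibre at most once; finitely many of these cover \<open>X\<close>.\<close>

lemma finite_fib: "finite fib"
proof -
  define \<U> where "\<U> = {U. openin X U \<and> finite (U \<inter> fib)}"
  have "\<exists>U\<in>\<U>. x \<in> U" if x: "x \<in> topspace X" for x
  proof -
    from local_homeoE[OF lh x] obtain U T where UT: "openin X U" "x \<in> U" "openin base.Q T"
      "homeomorphic_map (subtopology X U) (subtopology base.Q T) p" .
    have inj: "inj_on p U" by (rule homeomorphic_map_open_subs(1)[OF UT(4,1,3)])
    have "finite (p ` (U \<inter> fib))" by (rule finite_subset[of _ "{Vertex}"]) (auto simp: fib_def)
    then have "finite (U \<inter> fib)" using inj by (meson finite_imageD inj_on_subset inf_le1)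
    then show ?thesis using UT by (auto simp: \<U>_def)
  qed
  then have "topspace X \<subseteq> \<Union>\<U>" by blast
  moreover have "\<forall>U\<in>\<U>. openin X U" by (simp add: \<U>_def)
  ultimately obtain \<F> where F: "finite \<F>" "\<F> \<subseteq> \<U>" "topspace X \<subseteq> \<Union>\<F>"
    using comp unfolding compact_space_alt by meson
  have "fib \<subseteq> (\<Union>U\<in>\<F>. U \<inter> fib)" using F(3) by (auto simp: fib_def)
  moreover have "finite (\<Union>U\<in>\<F>. U \<inter> fib)"
  proof (rule finite_UN_I[OF F(1)])
    show "finite (U \<inter> fib)" if "U \<in> \<F>" for U using subsetD[OF F(2) that] by (simp add: \<U>_def)
  qed
  ultimately show ?thesis by (rule finite_subset)
qed

subsection \<open>Lifted faces and edges\<close>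

definition lifts_face :: "gen word \<Rightarrow> (complex \<Rightarrow> 'a) \<Rightarrow> bool" where
  "lifts_face r g \<longleftrightarrow> continuous_map (top_of_set (cball 0 1)) X g \<and> (\<forall>s\<in>cball 0 1. p (g s) = face_map r s)"

text \<open>A lift is named by its value at 1, which is position 0 of the boundary word. By
  \<open>lifts_face_unique\<close> it is determined on the closed disc by this value.\<close>

definition lface :: "'a \<Rightarrow> gen word \<Rightarrow> complex \<Rightarrow> 'a" where
  "lface w r = (SOME g. lifts_face r g \<and> g 1 = w)"

lemma face_map_1: "r \<in> {rA, relB} \<Longrightarrow> face_map r 1 = Vertex"
  using face_map_circ[of 0 r 0] by (auto simp: relA_def relB_def)

lemma lface: 
  assumes "w \<in> fib" "r \<in> {rA, relB}"
  shows "lifts_face r (lface w r)" "lface w r 1 = w"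
proof -
  have "\<exists>g. continuous_map (top_of_set (cball 0 1)) X g \<and> (\<forall>s\<in>cball 0 1. p (g s) = face_map r s) \<and> g 1 = w"
    using assms face_map_1[OF assms(2)]
    by (intro lift_disc[OF cov haus base.continuous_fm]) (auto simp: fib_def)
  then have "\<exists>g. lifts_face r g \<and> g 1 = w" unfolding lifts_face_def by blast
  then have "lifts_face r (lface w r) \<and> lface w r 1 = w" unfolding lface_def by (rule someI_ex)
  then show "lifts_face r (lface w r)" "lface w r 1 = w" by auto
qed

lemma lface_p: "w \<in> fib \<Longrightarrow> r \<in> {rA, relB} \<Longrightarrow> norm z \<le> 1 \<Longrightarrow> p (lface w r z) = face_map r z"
  using lface(1)[of w r] by (simp add: lifts_face_def)

lemma lface_continuous: "w \<in> fib \<Longrightarrow> r \<in> {rA, relB} \<Longrightarrow> continuous_map (top_of_set (cball 0 1)) X (lface w r)"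
  using lface(1)[of w r] by (simp add: lifts_face_def)

lemma lface_topspace: "w \<in> fib \<Longrightarrow> r \<in> {rA, relB} \<Longrightarrow> norm z \<le> 1 \<Longrightarrow> lface w r z \<in> topspace X"
  using lface_continuous[of w r] by (auto simp: continuous_map_def)

lemma lifts_face_unique:
  assumes "lifts_face r g" "lifts_face r h" "norm z \<le> 1" "g z = h z" "norm s \<le> 1"
  shows "g s = h s"
  by (rule unique_lift[OF lh haus, of "cball 0 1" g h z s])
    (use assms in \<open>auto simp: lifts_face_def convex_connected\<close>)

lemma lface_inj:
  assumes "w \<in> fib" "w' \<in> fib" "r \<in> {rA, relB}" "norm z \<le> 1" "lface w r z = lface w' r z"
  shows "w = w'"
  using lifts_face_unique[OF lface(1)[OF assms(1,3)] lface(1)[OF assms(2,3)] assms(4,5), of 1]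
    lface(2)[OF assms(1,3)] lface(2)[OF assms(2,3)] by simp

lemma lface_through:
  assumes "r \<in> {rA, relB}" "x \<in> topspace X" "norm z \<le> 1" "p x = face_map r z"
  obtains w where "w \<in> fib" "lface w r z = x"
proof -
  have "\<exists>g. continuous_map (top_of_set (cball 0 1)) X g \<and> (\<forall>s\<in>cball 0 1. p (g s) = face_map r s) \<and> g z = x"
    using assms by (intro lift_disc[OF cov haus base.continuous_fm]) auto
  then obtain g where g: "lifts_face r g" "g z = x" unfolding lifts_face_def by blast
  have g1: "g 1 \<in> fib"
    using g(1) face_map_1[OF assms(1)] unfolding lifts_face_def fib_def continuous_map_def by auto
  have "lface (g 1) r z = g z"
    by (rule lifts_face_unique[OF lface(1)[OF g1 assms(1)] g(1), of 1]) (use lface(2)[OF g1 assms(1)] assms in auto)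
  then show thesis using that[OF g1] g(2) by simp
qed

definition lifts_edge :: "gen \<Rightarrow> (real \<Rightarrow> 'a) \<Rightarrow> bool" where
  "lifts_edge e g \<longleftrightarrow> continuous_map (top_of_set {0..1}) X g \<and> (\<forall>s\<in>{0..1}. p (g s) = edge_map e s)"

text \<open>The monodromy of the loop \<open>e\<close>; outside the fibre it is the identity, as
  \<open>permutes\<close> requires.\<close>

definition act :: "gen \<Rightarrow> 'a \<Rightarrow> 'a" where
  "act e w = (if w \<in> fib then (SOME g. lifts_edge e g \<and> g 0 = w) 1 else w)"

lemma lifts_edge_unique:
  assumes "lifts_edge e g" "lifts_edge e h" "0 \<le> z" "z \<le> 1" "g z = h z" "0 \<le> s" "s \<le> 1"
  shows "g s = h s"
  by (rule unique_lift[OF lh haus, of "{0..1}" g h z s])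
    (use assms in \<open>auto simp: lifts_edge_def\<close>)

lemma lifts_edge_ends: "lifts_edge e g \<Longrightarrow> g 0 \<in> fib \<and> g 1 \<in> fib"
  by (auto simp: lifts_edge_def fib_def continuous_map_def)

lemma act_eq:
  assumes "lifts_edge e g" shows "act e (g 0) = g 1"
proof -
  define h where "h = (SOME h. lifts_edge e h \<and> h 0 = g 0)"
  have "\<exists>h. lifts_edge e h \<and> h 0 = g 0" using assms by blast
  then have h: "lifts_edge e h \<and> h 0 = g 0" unfolding h_def by (rule someI_ex)
  then have "h 1 = g 1" using lifts_edge_unique[of e h g 0 1] assms by simp
  then show ?thesis using lifts_edge_ends[OF assms] by (simp add: act_def h_def)
qed

lemma lift_edge_from:
  assumes "w \<in> fib" obtains g where "lifts_edge e g" "g 0 = w"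
proof -
  have "\<exists>g. continuous_map (top_of_set {0..1}) X g \<and> (\<forall>s\<in>{0..1}. p (g s) = edge_map e s) \<and> g 0 = w"
    using assms by (intro lift_path[OF cov haus base.continuous_em]) (auto simp: fib_def)
  then show thesis using that unfolding lifts_edge_def by blast
qed

lemma act_permutes: "act e permutes fib"
proof (rule bij_imp_permutes)
  have img: "act e ` fib \<subseteq> fib"
  proof
    fix y assume "y \<in> act e ` fib"
    then obtain w where w: "w \<in> fib" "y = act e w" by blast
    obtain g where "lifts_edge e g" "g 0 = w" using lift_edge_from[OF w(1)] by blast
    then show "y \<in> fib" using w(2) act_eq[of e g] lifts_edge_ends[of e g] by simp
  qed
  have inj: "inj_on (act e) fib"
  proof (rule inj_onI)
    fix w w' assume w: "w \<in> fib" "w' \<in> fib" "act e w = act e w'"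
    obtain g where g: "lifts_edge e g" "g 0 = w" using lift_edge_from[OF w(1)] by blast
    obtain h where h: "lifts_edge e h" "h 0 = w'" using lift_edge_from[OF w(2)] by blast
    have "g 1 = h 1" using act_eq[OF g(1)] act_eq[OF h(1)] g(2) h(2) w(3) by simp
    then show "w = w'" using lifts_edge_unique[OF g(1) h(1), of 1 0] g(2) h(2) by simp
  qed
  show "bij_betw (act e) fib fib"
    using inj endo_inj_surj[OF finite_fib img inj] by (simp add: bij_betw_def)
qed (simp add: act_def)

text \<open>For an inverse letter the boundary is run through backwards, so that the path lifts the
  edge in its own direction and can be compared with \<open>act\<close>.\<close>

lemma lface_edge:
  assumes "w \<in> fib" "r \<in> {rA, relB}" "i < length r"
  shows "lifts_edge (fst (r ! i)) (\<lambda>t. lface w r (circ (length r) (real i + (if snd (r ! i) then t else 1 - t))))"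
  unfolding lifts_edge_def
proof (intro conjI ballI)
  define k where "k t = circ (length r) (real i + (if snd (r ! i) then t else 1 - t))" for t
  have "continuous_map (top_of_set {0..1}) (top_of_set (cball 0 1)) k"
    unfolding k_def by (cases "snd (r ! i)") (auto simp: continuous_map_in_subtopology intro!: continuous_intros)
  from continuous_map_compose[OF this lface_continuous[OF assms(1,2)]]
  show "continuous_map (top_of_set {0..1}) X (\<lambda>t. lface w r (circ (length r) (real i + (if snd (r ! i) then t else 1 - t))))"
    by (simp add: o_def k_def)
  fix t :: real assume t: "t \<in> {0..1}"
  define u where "u = (if snd (r ! i) then t else 1 - t)"
  have "p (lface w r (circ (length r) (real i + u))) = face_map r (circ (length r) (real i + u))"
    by (rule lface_p[OF assms(1,2)]) simp
  also have "\<dots> = edge_map (fst (r ! i)) (if snd (r ! i) then u else 1 - u)"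
    using t by (intro face_map_circ[OF assms(3)]) (auto simp: u_def)
  also have "(if snd (r ! i) then u else 1 - u) = t" by (simp add: u_def)
  finally show "p (lface w r (circ (length r) (real i + (if snd (r ! i) then t else 1 - t)))) = edge_map (fst (r ! i)) t"
    by (simp add: u_def)
qed

definition corner :: "'a \<Rightarrow> gen word \<Rightarrow> nat \<Rightarrow> 'a" where
  "corner w r i = lface w r (circ (length r) (real i))"

lemma corner_step:
  assumes "w \<in> fib" "r \<in> {rA, relB}" "i < length r"
  shows "snd (r ! i) \<Longrightarrow> act (fst (r ! i)) (corner w r i) = corner w r (Suc i)"
    and "\<not> snd (r ! i) \<Longrightarrow> act (fst (r ! i)) (corner w r (Suc i)) = corner w r i"
  using act_eq[OF lface_edge[OF assms]] by (simp_all add: corner_def add.commute)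

lemma corner_ends:
  assumes "w \<in> fib" "r \<in> {rA, relB}" shows "corner w r 0 = w" "corner w r (length r) = w"
proof -
  have "length r = 18 \<or> length r = 10" using assms(2) by auto
  then have "length r > 0" by linarith
  then have "circ (length r) (real (length r)) = 1" using circ_period[of "length r" 0] by simp
  then show "corner w r 0 = w" "corner w r (length r) = w" using lface(2)[OF assms] by (simp_all add: corner_def)
qed

lemma relation_relB: "act Gen_d (act Gen_c (act Gen_c (act Gen_c x))) =
    act Gen_c (act Gen_c (act Gen_c (act Gen_c (act Gen_c (act Gen_d x)))))"
proof (cases "x \<in> fib")
  case True
  \<comment> \<open>\<open>relB\<close> begins with an inverse letter \<open>d\<close>; starting the
    face at the image of \<open>x\<close> under \<open>d\<close> makes \<open>x\<close> its corner
    1.\<close>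
  define w where "w = act Gen_d x"
  have w: "w \<in> fib" using True permutes_in_image[OF act_permutes] by (simp add: w_def)
  have relB: "relB \<in> {rA, relB}" by simp
  note st = corner_step[OF w relB]
  have c: "act Gen_d (corner w relB 1) = corner w relB 0" "act Gen_c (corner w relB 1) = corner w relB 2"
    "act Gen_c (corner w relB 2) = corner w relB 3" "act Gen_c (corner w relB 3) = corner w relB 4"
    "act Gen_d (corner w relB 4) = corner w relB 5"
    "act Gen_c (corner w relB 6) = corner w relB 5" "act Gen_c (corner w relB 7) = corner w relB 6"
    "act Gen_c (corner w relB 8) = corner w relB 7" "act Gen_c (corner w relB 9) = corner w relB 8"
    "act Gen_c (corner w relB 10) = corner w relB 9"
    using st[of 0] st[of 1] st[of 2] st[of 3] st[of 4] st[of 5] st[of 6] st[of 7] st[of 8] st[of 9]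
    by (simp_all add: relB_def eval_nat_numeral)
  have e: "corner w relB 0 = w" "corner w relB 10 = w" using corner_ends[OF w relB] by simp_all
  have "corner w relB 1 = x"
    using c(1) e(1) permutes_inj[OF act_permutes] unfolding w_def by (metis injD)
  then show ?thesis using c e unfolding w_def by metis
next
  case False then show ?thesis by (simp add: act_def)
qed

lemma hword_trivial:
  assumes w: "w \<in> fib" shows "corner w rA 8 = w"
proof -
  have rA: "rA \<in> {rA, relB}" by simp
  note st = corner_step[OF w rA]
  have c: "act Gen_c (corner w rA 1) = corner w rA 0" "act Gen_d (corner w rA 2) = corner w rA 1"
    "act Gen_c (corner w rA 3) = corner w rA 2" "act Gen_d (corner w rA 3) = corner w rA 4"
    "act Gen_c (corner w rA 4) = corner w rA 5" "act Gen_d (corner w rA 6) = corner w rA 5"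
    "act Gen_c (corner w rA 6) = corner w rA 7" "act Gen_d (corner w rA 7) = corner w rA 8"
    using st[of 0] st[of 1] st[of 2] st[of 3] st[of 4] st[of 5] st[of 6] st[of 7]
    by (simp_all add: relA_def hword_def eval_nat_numeral)
  \<comment> \<open>Corners 3 and 6 play the parts of \<open>x\<close> and \<open>y\<close>: the
    letters 3 to 5 give the hypothesis. In the conclusion the letters 6 and 7 lead to corner 8, the
    letters 2, 1 and 0 to corner 0.\<close>
  have "act Gen_d (corner w rA 6) = act Gen_c (act Gen_d (corner w rA 3))" using c by metis
  from finite_Baumslag_Solitar_commute[OF finite_fib act_permutes act_permutes relation_relB this]
  have "corner w rA 8 = corner w rA 0" using c by metis
  then show ?thesis using corner_ends[OF w rA] by simp
qed

end

text \<open>The two collars of the face \<open>rA\<close> run along the copies of \<open>[c\<^sup>d, c]\<close>, which occupy the positions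
  \<open>[0, 8]\<close> and \<open>[9, 17]\<close>.\<close>

definition collar :: "real \<Rightarrow> real \<Rightarrow> complex set" where
  "collar x t = {z. 1 - t < norm z \<and> norm z \<le> 1} \<inter> sector 18 x (4 + t)"

definition arc :: "real \<Rightarrow> complex set" where "arc x = circ 18 ` {x - 4..x + 4}"

lemma collar_polar:
  assumes "0 < t" "t < 1/2"
  shows "z \<in> collar x t \<longleftrightarrow> (\<exists>\<rho> y. z = of_real \<rho> * circ 18 y \<and> norm z = \<rho> \<and> 1 - t < \<rho> \<and> \<rho> \<le> 1 \<and> \<bar>y - x\<bar> < 4 + t)"
proof -
  have "z \<in> sector 18 x (4 + t) \<longleftrightarrow> (\<exists>y. \<bar>y - x\<bar> < 4 + t \<and> z \<noteq> 0 \<and> z = norm z * circ 18 y)"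
    by (rule sector_polar) (use assms in auto)
  moreover have "z \<noteq> 0" if "1 - t < norm z" using that assms by auto
  ultimately show ?thesis unfolding collar_def by auto
qed

lemma arc_collar: "0 < t \<Longrightarrow> t < 1/2 \<Longrightarrow> arc x \<subseteq> collar x t"
proof
  fix z assume t: "0 < t" "t < 1/2" and "z \<in> arc x"
  then obtain y where y: "x - 4 \<le> y" "y \<le> x + 4" "z = circ 18 y" by (auto simp: arc_def)
  have "\<bar>y - x\<bar> < 4 + t" using y t unfolding abs_less_iff by linarith
  then show "z \<in> collar x t" unfolding collar_polar[OF t] using y t by (intro exI[of _ 1] exI[of _ y]) simp
qed

lemma open_collar: "\<exists>W. open W \<and> collar x t = cball 0 1 \<inter> W"
proof (intro exI conjI)
  show "open ({z. 1 - t < norm z} \<inter> sector 18 x (4 + t))"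
    by (intro open_Int open_sector open_Collect_less continuous_intros)
qed (auto simp: collar_def)

text \<open>The part strictly inside the disc is the image of a rectangle in polar coordinates. The
  remaining points lie on the circle beyond the arc, in the closure of that image, and adding points
  of the closure keeps a set connected.\<close>

lemma connected_collar:
  assumes t: "0 < t" "t < 1/2" shows "connected (collar x t - arc x)"
proof (rule connected_intermediate_closure)
  let ?f = "\<lambda>q::real \<times> real. of_real (fst q) * circ 18 (snd q)"
  let ?S = "?f ` ({1 - t<..<1} \<times> {x - (4 + t)<..<x + (4 + t)})"
  show "connected ?S"
    by (intro connected_continuous_image connected_Times continuous_intros) auto
  have pol: "z \<in> ?S \<longleftrightarrow> (\<exists>\<rho> y. z = of_real \<rho> * circ 18 y \<and> 1 - t < \<rho> \<and> \<rho> < 1 \<and> \<bar>y - x\<bar> < 4 + t)" for z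
  proof -
    have iv: "y \<in> {x - (4 + t)<..<x + (4 + t)} \<longleftrightarrow> \<bar>y - x\<bar> < 4 + t" for y
      unfolding abs_less_iff greaterThanLessThan_iff by linarith
    show ?thesis
    proof
      assume "z \<in> ?S"
      then obtain q where q: "z = ?f q" "q \<in> {1 - t<..<1} \<times> {x - (4 + t)<..<x + (4 + t)}" by (rule imageE)
      then have "1 - t < fst q" "fst q < 1" "\<bar>snd q - x\<bar> < 4 + t" using iv[of "snd q"] by auto
      then show "\<exists>\<rho> y. z = of_real \<rho> * circ 18 y \<and> 1 - t < \<rho> \<and> \<rho> < 1 \<and> \<bar>y - x\<bar> < 4 + t" using q(1) by blast
    next
      assume "\<exists>\<rho> y. z = of_real \<rho> * circ 18 y \<and> 1 - t < \<rho> \<and> \<rho> < 1 \<and> \<bar>y - x\<bar> < 4 + t"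
      then obtain \<rho> y where q: "z = of_real \<rho> * circ 18 y" "1 - t < \<rho>" "\<rho> < 1" "\<bar>y - x\<bar> < 4 + t" by blast
      show "z \<in> ?S"
      proof (rule image_eqI[of _ _ "(\<rho>, y)"])
        show "z = ?f (\<rho>, y)" using q(1) by simp
        show "(\<rho>, y) \<in> {1 - t<..<1} \<times> {x - (4 + t)<..<x + (4 + t)}"
          unfolding mem_Sigma_iff iv using q by simp
      qed
    qed
  qed
  show "?S \<subseteq> collar x t - arc x"
  proof
    fix z assume "z \<in> ?S"
    then obtain \<rho> y where z: "z = of_real \<rho> * circ 18 y" "1 - t < \<rho>" "\<rho> < 1" "\<bar>y - x\<bar> < 4 + t" using pol by blast
    have n: "norm z = \<rho>" using z t by (simp add: norm_mult)
    then have "z \<notin> arc x" using z(3) by (auto simp: arc_def)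
    moreover have "z \<in> collar x t" unfolding collar_polar[OF t] using z n by (intro exI[of _ \<rho>] exI[of _ y]) simp
    ultimately show "z \<in> collar x t - arc x" by blast
  qed
  show "collar x t - arc x \<subseteq> closure ?S"
  proof
    fix z assume "z \<in> collar x t - arc x"
    then obtain \<rho> y where z: "z = of_real \<rho> * circ 18 y" "norm z = \<rho>" "1 - t < \<rho>" "\<rho> \<le> 1" "\<bar>y - x\<bar> < 4 + t"
      using collar_polar[OF t] by blast
    show "z \<in> closure ?S"
      unfolding closure_approachable
    proof (intro allI impI)
      fix e :: real assume e: "e > 0"
      define \<delta> where "\<delta> = min (e/2) ((\<rho> - (1 - t))/2)"
      have \<delta>: "0 < \<delta>" "\<delta> < e" "1 - t < \<rho> - \<delta>" using e z by (auto simp: \<delta>_def min_def field_simps)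
      have "of_real (\<rho> - \<delta>) * circ 18 y \<in> ?S" unfolding pol using z \<delta> by (intro exI[of _ "\<rho> - \<delta>"] exI[of _ y]) simp
      moreover have "dist (of_real (\<rho> - \<delta>) * circ 18 y) z = \<delta>"
      proof -
        have "of_real (\<rho> - \<delta>) * circ 18 y - z = of_real (- \<delta>) * circ 18 y" unfolding z(1) by (simp add: algebra_simps)
        then show ?thesis unfolding dist_norm by (simp only: norm_mult norm_of_real norm_circ) (use \<delta> in simp)
      qed
      ultimately show "\<exists>y\<in>?S. dist y z < e" using \<delta>(2) by metis
    qed
  qed
qed

text \<open>In polar coordinates the arc is a compact segment, and an open set about it contains all
  points within some distance \<open>e\<close>. The points of a thin collar are at distance at most
  2t.\<close>

lemma collar_small:
  assumes W: "openin (top_of_set (cball 0 1)) W" "arc x \<subseteq> W"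
  shows "\<forall>\<^sub>F t in at_right 0. collar x t \<subseteq> W"
proof -
  from W(1) obtain W' where W': "open W'" "W = cball 0 1 \<inter> W'" by (auto simp: openin_open)
  let ?f = "\<lambda>q::real \<times> real. of_real (fst q) * circ 18 (snd q)"
  have o: "open (?f -` W')" by (intro open_vimage W') (auto intro!: continuous_intros)
  have s: "{1} \<times> {x - 4..x + 4} \<subseteq> ?f -` W'" using W(2) W' by (auto simp: arc_def)
  have c: "compact ({1::real} \<times> {x - 4..x + 4})" by (intro compact_Times) auto
  have ne: "{1::real} \<times> {x - 4..x + 4} \<noteq> {}" by auto
  from compact_in_open_separated[OF ne c o s]
  obtain e where e: "e > 0" "{q. infdist q ({1} \<times> {x - 4..x + 4}) \<le> e} \<subseteq> ?f -` W'" .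
  have "collar x t \<subseteq> W" if t: "0 < t" "t < min (1/2) (e/2)" for t
  proof
    fix z assume z: "z \<in> collar x t"
    have t': "0 < t" "t < 1/2" using t by auto
    from z obtain \<rho> y where q: "z = of_real \<rho> * circ 18 y" "norm z = \<rho>" "1 - t < \<rho>" "\<rho> \<le> 1" "\<bar>y - x\<bar> < 4 + t"
      using collar_polar[OF t'] by blast
    define y' where "y' = max (x - 4) (min (x + 4) y)"
    have y': "y' \<in> {x - 4..x + 4}" "\<bar>y - y'\<bar> \<le> t" using q(5) t' by (auto simp: y'_def max_def min_def abs_if)
    have "infdist (\<rho>, y) ({1} \<times> {x - 4..x + 4}) \<le> dist (\<rho>, y) (1, y')" by (rule infdist_le) (use y' in auto)
    also have "\<dots> \<le> \<bar>dist \<rho> 1\<bar> + \<bar>dist y y'\<bar>" unfolding dist_Pair_Pair by (rule sqrt_sum_squares_le_sum_abs)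
    also have "\<dots> \<le> t + t" using q(3,4) y'(2) by (intro add_mono) (auto simp: dist_real_def)
    also have "\<dots> \<le> e" using t by auto
    finally have "?f (\<rho>, y) \<in> W'" using e(2) by blast
    then show "z \<in> W" using W'(2) q by simp
  qed
  then show ?thesis unfolding eventually_at_right_field using e(1) by (intro exI[of _ "min (1/2) (e/2)"]) simp
qed

lemma annulus_small:
  assumes W: "openin (top_of_set (cball 0 1)) W" "sphere 0 1 \<subseteq> W"
  shows "\<forall>\<^sub>F t in at_right 0. {z::complex. 1 - t < norm z \<and> norm z \<le> 1} \<subseteq> W"
proof -
  from W(1) obtain W' where W': "open W'" "W = cball 0 1 \<inter> W'" by (auto simp: openin_open)
  have ne: "sphere (0::complex) 1 \<noteq> {}" by (simp add: sphere_eq_empty)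
  have s: "sphere 0 1 \<subseteq> W'" using W(2) W'(2) by simp
  from compact_in_open_separated[OF ne compact_sphere W'(1) s]
  obtain e where e: "e > 0" "{q. infdist q (sphere (0::complex) 1) \<le> e} \<subseteq> W'" .
  have "{z::complex. 1 - t < norm z \<and> norm z \<le> 1} \<subseteq> W" if t: "0 < t" "t < min 1 e" for t
  proof
    fix z :: complex assume "z \<in> {z. 1 - t < norm z \<and> norm z \<le> 1}"
    then have z: "1 - t < norm z" "norm z \<le> 1" by auto
    then have z0: "z \<noteq> 0" using t by auto
    have "infdist z (sphere 0 1) \<le> dist z (sgn z)" by (rule infdist_le) (simp add: norm_sgn z0)
    also have "dist z (sgn z) = \<bar>norm z - 1\<bar>"
    proof -
      have "z - sgn z = of_real (norm z - 1) * sgn z" using z0 by (simp add: sgn_eq field_simps)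
      then show ?thesis unfolding dist_norm by (simp only: norm_mult norm_of_real norm_sgn) (simp add: z0)
    qed
    also have "\<dots> \<le> e" using z t by auto
    finally have "z \<in> W'" using e(2) by blast
    then show "z \<in> W" using W'(2) z by simp
  qed
  then show ?thesis unfolding eventually_at_right_field using e(1) by (intro exI[of _ "min 1 e"]) simp
qed

section \<open>Intrinsic description of the graph and the vertices in a covering\<close>

context compact_cover
begin

lemma local_homeo_graph: "local_homeo (subtopology X graphX) (subtopology base.Q graph) p"
  using local_homeo_restrict[OF lh, of graph] by (simp add: graphX_def)

lemma graphX_topspace: "graphX \<subseteq> topspace X" and fib_graphX: "fib \<subseteq> graphX"
  by (auto simp: graphX_def fib_def)

lemma branches_at_graphX: "x \<in> graphX \<Longrightarrow> x \<notin> fib \<Longrightarrow> branches_at TYPE(complex) X x"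
  using branches_at_local_homeo[OF lh, of x] branches_at_graph[of "p x"] by (auto simp: graphX_def fib_def)

lemma euclidean_at_off_graphX: "x \<in> topspace X \<Longrightarrow> x \<notin> graphX \<Longrightarrow> euclidean_at TYPE(complex) X x"
  using euclidean_at_local_homeo[OF lh, of x] euclidean_at_nongraph[of "p x"] p_carrier[of x] by (auto simp: graphX_def)

lemma euclidean_at_in_graphX: "x \<in> graphX \<Longrightarrow> x \<notin> fib \<Longrightarrow> euclidean_at TYPE(real) (subtopology X graphX) x"
  using euclidean_at_local_homeo[OF local_homeo_graph, of x] euclidean_at_edge_in_graph[of "p x"]
  by (auto simp: graphX_def fib_def)

lemma branches_at_fib: "x \<in> fib \<Longrightarrow> branches_at TYPE(real) (subtopology X graphX) x"
  using branches_at_local_homeo[OF local_homeo_graph, of x] branches_at_Vertex by (auto simp: graphX_def fib_def)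

lemma closedin_graphX: "closedin X graphX"
  using closedin_continuous_map_preimage[OF continuous_p closedin_graph] by (simp add: graphX_def)

text \<open>The planar branching criterion is available on open edges; vertices are reached as
  limits of points on lifted open edges.\<close>

lemma fib_closure:
  assumes "x \<in> fib" "openin X N" "x \<in> N" obtains y where "y \<in> N" "y \<in> graphX" "y \<notin> fib"
proof -
  have x: "x \<in> topspace X" using assms(1) by (simp add: fib_def)
  from local_homeoE[OF lh x] obtain U T where UT: "openin X U" "x \<in> U" "openin base.Q T"
    "homeomorphic_map (subtopology X U) (subtopology base.Q T) p" .
  have "openin X (N \<inter> U)" using assms(2) UT(1) by blast
  then have "openin base.Q (p ` (N \<inter> U))" using homeomorphic_map_open_subs(3)[OF UT(4,1,3)] by blast
  moreover have "Vertex \<in> p ` (N \<inter> U)"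
    by (rule image_eqI[of _ _ x]) (use assms UT(2) in \<open>auto simp: fib_def\<close>)
  ultimately obtain t where t: "0 < t" "t < 1" "Edge Gen_c t \<in> p ` (N \<inter> U)" by (rule Vertex_closure_edges)
  then obtain y where y: "y \<in> N" "p y = Edge Gen_c t" by auto
  have "y \<in> topspace X" using y(1) openin_subset[OF assms(2)] by blast
  then show thesis using that[OF y(1)] y(2) t by (simp add: graphX_def fib_def)
qed

lemma lface_vimage:
  assumes "w \<in> fib" "r \<in> {rA, relB}" "openin X N"
  shows "openin (top_of_set (cball 0 1)) {z \<in> cball 0 1. lface w r z \<in> N}"
  using openin_continuous_map_preimage[OF lface_continuous[OF assms(1,2)] assms(3)] by simp

lemma lface_radial:
  assumes w: "w \<in> fib" "r \<in> {rA, relB}" and N: "openin X N" "graphX \<subseteq> N" and z: "norm z = 1" "face_map r z \<in> graph"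
  obtains \<rho> where "0 < \<rho>" "\<rho> < 1" "lface w r (of_real \<rho> * z) \<in> N"
proof -
  have "lface w r z \<in> graphX" using lface_topspace[OF w, of z] lface_p[OF w, of z] z by (simp add: graphX_def)
  then have "z \<in> {z \<in> cball 0 1. lface w r z \<in> N}" using N(2) z by auto
  then obtain e where e: "e > 0" "ball z e \<inter> cball 0 1 \<subseteq> {z \<in> cball 0 1. lface w r z \<in> N}"
    using bspec[OF conjunct2[OF lface_vimage[OF w N(1), unfolded openin_contains_ball]]] by blast
  define \<rho> where "\<rho> = 1 - min (e/2) (1/2)"
  have \<rho>: "0 < \<rho>" "\<rho> < 1" "1 - \<rho> < e" using e(1) by (auto simp: \<rho>_def min_def)
  have "z - of_real \<rho> * z = of_real (1 - \<rho>) * z" by (simp add: algebra_simps)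
  then have "dist z (of_real \<rho> * z) = \<bar>1 - \<rho>\<bar> * norm z" unfolding dist_norm by (simp only: norm_mult norm_of_real)
  then have "of_real \<rho> * z \<in> ball z e \<inter> cball 0 1" using \<rho> z(1) by (simp add: norm_mult)
  then show thesis using that[OF \<rho>(1,2)] e(2) by blast
qed

text \<open>Rather than as the image of one lift, whose openness is not evident, the sheet is formed
  from the preimage of \<open>T\<close> by removing the images of all other lifts. These are
  finitely many compact sets, so the sheet is open.\<close>

definition sheet :: "gen point set \<Rightarrow> gen word \<Rightarrow> complex set \<Rightarrow> 'a \<Rightarrow> 'a set" where
  "sheet T r H w = {x \<in> topspace X. p x \<in> T} - (\<Union>w'\<in>fib - {w}. lface w' r ` H)"

lemma compactin_lface:
  assumes "w \<in> fib" "r \<in> {rA, relB}" "compact H" "H \<subseteq> cball 0 1"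
  shows "closedin X (lface w r ` H)"
proof (rule compactin_imp_closedin[OF haus])
  show "compactin X (lface w r ` H)"
    by (rule image_compactin[OF _ lface_continuous[OF assms(1,2)]]) (use assms in \<open>auto simp: compactin_subtopology\<close>)
qed

lemma open_sheet:
  assumes "openin base.Q T" "r \<in> {rA, relB}" "compact H" "H \<subseteq> cball 0 1"
  shows "openin X (sheet T r H w)"
  unfolding sheet_def
proof (rule openin_diff)
  show "openin X {x \<in> topspace X. p x \<in> T}" by (rule openin_continuous_map_preimage[OF continuous_p assms(1)])
  show "closedin X (\<Union>w'\<in>fib - {w}. lface w' r ` H)"
    using finite_fib compactin_lface[OF _ assms(2-4)] by (intro closedin_Union) auto
qed

text \<open>\<open>uniq\<close> says that lifts from different vertices do not meet over
  \<open>T\<close>. Each point over \<open>T\<close> then lies in the lift from exactly one vertex,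
  and the sheets partition the preimage.\<close>

lemma sheet_cover:
  assumes r: "r \<in> {rA, relB}" and H: "H \<subseteq> cball 0 1" "T \<subseteq> face_map r ` H"
    and uniq: "\<And>w w' z z'. \<lbrakk>w \<in> fib; w' \<in> fib; z \<in> H; z' \<in> H; lface w r z = lface w' r z'; face_map r z \<in> T\<rbrakk> \<Longrightarrow> w = w'"
  shows "(\<Union>w\<in>fib. sheet T r H w) = {x \<in> topspace X. p x \<in> T}"
    and "\<And>w w'. w \<noteq> w' \<Longrightarrow> sheet T r H w \<inter> sheet T r H w' = {}"
    and "\<And>w z. w \<in> fib \<Longrightarrow> z \<in> H \<Longrightarrow> face_map r z \<in> T \<Longrightarrow> lface w r z \<in> sheet T r H w"
proof -
  have thr: "\<exists>w z. w \<in> fib \<and> z \<in> H \<and> x = lface w r z \<and> face_map r z \<in> T" if x: "x \<in> topspace X" "p x \<in> T" for x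
  proof -
    obtain z where z: "z \<in> H" "p x = face_map r z" using x(2) H(2) by blast
    have "norm z \<le> 1" using z(1) H(1) by auto
    from lface_through[OF r x(1) this z(2)] obtain w where "w \<in> fib" "lface w r z = x" .
    then show ?thesis using z x(2) by auto
  qed
  show mem: "lface w r z \<in> sheet T r H w" if w: "w \<in> fib" "z \<in> H" "face_map r z \<in> T" for w z
  proof -
    have n: "norm z \<le> 1" using w(2) H(1) by auto
    have "lface w r z \<notin> lface w' r ` H" if "w' \<in> fib - {w}" for w'
      using uniq[OF w(1) _ w(2) _ _ w(3), of w'] that by blast
    then show ?thesis using lface_topspace[OF w(1) r n] lface_p[OF w(1) r n] w(3) by (simp add: sheet_def)
  qed
  show "(\<Union>w\<in>fib. sheet T r H w) = {x \<in> topspace X. p x \<in> T}"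
  proof
    show "(\<Union>w\<in>fib. sheet T r H w) \<subseteq> {x \<in> topspace X. p x \<in> T}" by (auto simp: sheet_def)
    show "{x \<in> topspace X. p x \<in> T} \<subseteq> (\<Union>w\<in>fib. sheet T r H w)" using thr mem by fastforce
  qed
  show "sheet T r H w \<inter> sheet T r H w' = {}" if "w \<noteq> w'" for w w'
  proof (rule ccontr)
    assume "sheet T r H w \<inter> sheet T r H w' \<noteq> {}"
    then obtain x where x: "x \<in> sheet T r H w" "x \<in> sheet T r H w'" by blast
    then have "x \<in> topspace X" "p x \<in> T" by (auto simp: sheet_def)
    from thr[OF this] obtain u z where "u \<in> fib" "z \<in> H" "x = lface u r z" by blast
    then show False using x that unfolding sheet_def by blast
  qed
qed

definition half_disc :: "bool \<Rightarrow> complex set" where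
  "half_disc c = {z \<in> cball 0 1. if c then side z \<le> 0 else 0 \<le> side z}"

lemma compact_half_disc: "compact (half_disc c)"
proof -
  have "closed (cball 0 1 \<inter> side -` (if c then {..0} else {0..}))"
    by (intro continuous_closed_preimage) (auto intro!: continuous_intros)
  moreover have "half_disc c = cball 0 1 \<inter> side -` (if c then {..0} else {0..})" by (auto simp: half_disc_def)
  ultimately show ?thesis by (metis bounded_Int bounded_cball compact_eq_bounded_closed)
qed

lemma half_subset:
  assumes "\<not> b" shows "half c \<subseteq> face_map rA ` half_disc c"
proof
  fix x assume x: "x \<in> half c"
  then consider t where "t \<in> (if c then {0<..<1/2} else {1/2<..<1})" "x = edge_map Gen_a t"
    | z where "norm z < 1" "if c then side z < 0 else 0 < side z" "x = face_map rA z"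
    unfolding half_def by blast
  then show "x \<in> face_map rA ` half_disc c"
  proof cases
    case (1 t)
    then have t: "0 < t" "t < 1" by (auto split: if_splits)
    have x': "x = face_map rA (circ 18 (8 + t))" using 1 edge_a_face[of t] t by simp
    then have "if c then side (circ 18 (8 + t)) < 0 else 0 < side (circ 18 (8 + t))"
      using half_face[OF assms, of "circ 18 (8 + t)" c] x by (simp split: if_splits)
    then show ?thesis using x' by (intro image_eqI[of _ _ "circ 18 (8 + t)"]) (auto simp: half_disc_def split: if_splits)
  next
    case (2 z)
    then show ?thesis by (intro image_eqI[of _ _ z]) (auto simp: half_disc_def split: if_splits)
  qed
qed

text \<open>For \<open>\<epsilon> = 1\<close> the two letters \<open>a\<close> of a lifted face are the same edge, because \<open>[c\<^sup>d, c]\<close> acts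
  trivially on the fibre: the lifted faces close up to annuli.\<close>

lemma lface_half_unique:
  assumes nb: "\<not> b" and w: "w \<in> fib" "w' \<in> fib" and z: "norm z \<le> 1" "norm z' \<le> 1"
    and eq: "lface w rA z = lface w' rA z'" and half: "face_map rA z \<in> half c"
  shows "w = w'"
proof -
  have rA: "rA \<in> {rA, relB}" by simp
  have fe: "face_map rA z = face_map rA z'" using lface_p[OF w(1) rA z(1)] lface_p[OF w(2) rA z(2)] eq by simp
  show ?thesis
  proof (cases "z = z'")
    case True then show ?thesis using lface_inj[OF w rA z(1)] eq by simp
  next
    case False
    \<comment> \<open>If the lift of \<open>a\<close> along letter 8 of one face and that along
      letter 17 of the other share a point, they are equal. They start at the corners 8 and 18,
      which are \<open>u\<close>, by \<open>hword_trivial\<close>, and \<open>u'\<close>.\<close>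
    have glue: "u = u'" if u: "u \<in> fib" "u' \<in> fib" and t: "0 \<le> t" "t \<le> 1"
      and e: "lface u rA (circ 18 (8 + t)) = lface u' rA (circ 18 (17 + (1 - t)))" for u u' t
    proof -
      have a: "fst (rA ! 8) = Gen_a" "fst (rA ! 17) = Gen_a" using fst_rA by auto
      have l: "lifts_edge Gen_a (\<lambda>t. lface u rA (circ 18 (8 + t)))"
        using lface_edge[OF u(1) rA, of 8] snd_rA a by simp
      have l': "lifts_edge Gen_a (\<lambda>t. lface u' rA (circ 18 (17 + (1 - t))))"
        using lface_edge[OF u(2) rA, of 17] snd_rA a nb by simp
      have "lface u rA (circ 18 (8 + 0)) = lface u' rA (circ 18 (17 + (1 - 0)))"
        using lifts_edge_unique[OF l l' t e, of 0] by simp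
      moreover have "lface u rA (circ 18 (8 + 0)) = u" using hword_trivial[OF u(1)] by (simp add: corner_def)
      moreover have "lface u' rA (circ 18 (17 + (1 - 0))) = u'" using corner_ends(2)[OF u(2) rA] by (simp add: corner_def)
      ultimately show ?thesis by simp
    qed
    have "\<not> norm z < 1"
    proof
      assume n: "norm z < 1"
      show False
      proof (cases "norm z' < 1")
        case True then show False using fe n False by (simp add: face_map_inner)
      next
        case False
        then have "face_map rA z' \<in> base.skel" using z by (intro base.fm_sphere_skel) auto
        then show False using fe base.fm_notin_skel[of rA z] n by simp
      qed
    qed
    then have n: "norm z = 1" using z by simp
    have "\<not> norm z' < 1" using fe base.fm_notin_skel[of rA z'] base.fm_sphere_skel[of rA z] n by auto
    then have n': "norm z' = 1" using z by simp
    have ng: "face_map rA z \<notin> graph" using half by (auto simp: half_def face_map_inner edge_map_def split: if_splits)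
    from circ_surj[of 18, OF _ n] obtain i t where it: "i < 18" "0 \<le> t" "t < 1" "z = circ 18 (real i + t)" by auto
    from circ_surj[of 18, OF _ n'] obtain j s where js: "j < 18" "0 \<le> s" "s < 1" "z' = circ 18 (real j + s)" by auto
    have i: "i = 8 \<or> i = 17" "0 < t" using face_rA_boundary[OF it(1-3)] it(4) ng by auto
    have j: "j = 8 \<or> j = 17" "0 < s" using face_rA_boundary[OF js(1-3)] js(4) ng fe by auto
    have f8: "face_map rA (circ 18 (8 + u)) = Edge Gen_a u" if "0 < u" "u < 1" for u
      using edge_a_face[of u] that by (simp add: edge_map_inner)
    have f17: "face_map rA (circ 18 (17 + u)) = Edge Gen_a (1 - u)" if "0 < u" "u < 1" for u
      using face_map_circ[of 17 rA u] fst_rA[of 17] snd_rA nb that by (simp add: edge_map_inner)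
    consider "i = 8" "j = 8" | "i = 17" "j = 17" | "i = 8" "j = 17" | "i = 17" "j = 8" using i j by blast
    then show ?thesis
    proof cases
      case 1
      then have "t = s" using fe it js f8[OF i(2) it(3)] f8[OF j(2) js(3)] by simp
      then show ?thesis using 1 it js False by simp
    next
      case 2
      then have "t = s" using fe it js f17[OF i(2) it(3)] f17[OF j(2) js(3)] by simp
      then show ?thesis using 2 it js False by simp
    next
      case 3
      then have "t = 1 - s" using fe it js f8[OF i(2) it(3)] f17[OF j(2) js(3)] by simp
      then have s: "s = 1 - t" by simp
      show ?thesis by (rule glue[OF w, of t]) (use eq it js 3 s in simp_all)
    next
      case 4
      then have "1 - t = s" using fe it js f17[OF i(2) it(3)] f8[OF j(2) js(3)] by simp
      then have s: "t = 1 - s" by simp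
      show ?thesis by (rule glue[OF w(2,1), of s, symmetric]) (use eq it js 4 s in simp_all)
    qed
  qed
qed

end

section \<open>Open pieces for one sign and connected collars for the other\<close>

context compact_cover
begin

text \<open>The label type has three elements, so that pieces per vertex are counted by
  \<open>fib \<times> UNIV\<close>. The connected sets of the other covering are labelled by
  \<open>bool\<close> in the same way.\<close>

fun piece :: "bool option \<Rightarrow> gen point set" where
  "piece None = punctured"
| "piece (Some c) = half c"

fun piece_sheet :: "'a \<times> bool option \<Rightarrow> 'a set" where
  "piece_sheet (w, None) = sheet punctured relB (cball 0 1) w"
| "piece_sheet (w, Some c) = sheet (half c) rA (half_disc c) w"

lemma piece_nongraph: "piece \<kappa> \<inter> graph = {}"
  by (cases \<kappa>) (auto simp: half_def punctured_def face_map_inner edge_map_inner graph_def split: if_splits)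

lemma piece_disjoint: "\<kappa> \<noteq> \<kappa>' \<Longrightarrow> piece \<kappa> \<inter> piece \<kappa>' = {}"
proof -
  have hp: "half c \<inter> punctured = {}" for c
    using rel_distinct by (auto simp: half_def punctured_def face_map_inner edge_map_inner split: if_splits)
  have "half True \<inter> half False = {}"
    by (auto simp: half_def face_map_inner edge_map_inner split: if_splits)
  then show "\<kappa> \<noteq> \<kappa>' \<Longrightarrow> piece \<kappa> \<inter> piece \<kappa>' = {}"
    using hp by (cases \<kappa>; cases \<kappa>') (auto, (metis (full_types) IntI empty_iff)+)
qed

lemma lface_punctured_unique:
  assumes w: "w \<in> fib" "w' \<in> fib" and z: "norm z \<le> 1" "norm z' \<le> 1"
    and eq: "lface w relB z = lface w' relB z'" and pt: "face_map relB z \<in> punctured"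
  shows "w = w'"
proof -
  have r: "relB \<in> {rA, relB}" by simp
  have fe: "face_map relB z = face_map relB z'" using lface_p[OF w(1) r z(1)] lface_p[OF w(2) r z(2)] eq by simp
  have "face_map relB z \<notin> graph" using pt piece_nongraph[of None] by auto
  then have "norm z < 1" "norm z' < 1" using face_relB_boundary[of z] face_relB_boundary[of z'] z fe by (auto simp: less_le)
  then have "z = z'" using fe by (simp add: face_map_inner)
  then show ?thesis using lface_inj[OF w r z(1)] eq by simp
qed

lemma piece_sheet_p: "x \<in> piece_sheet (w, \<kappa>) \<Longrightarrow> x \<in> topspace X \<and> p x \<in> piece \<kappa>"
  by (cases \<kappa>) (auto simp: sheet_def)

lemma
  assumes nb: "\<not> b"
  shows open_piece_sheet: "openin X (piece_sheet k)"
    and disjoint_piece_sheet: "k \<noteq> k' \<Longrightarrow> piece_sheet k \<inter> piece_sheet k' = {}"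
    and piece_sheet_Union: "(\<Union>w\<in>fib. piece_sheet (w, \<kappa>)) = {x \<in> topspace X. p x \<in> piece \<kappa>}"
    and lface_relB_piece: "w \<in> fib \<Longrightarrow> norm z < 1 \<Longrightarrow> z \<noteq> 0 \<Longrightarrow> lface w relB z \<in> piece_sheet (w, None)"
    and lface_rA_piece: "w \<in> fib \<Longrightarrow> norm z < 1 \<Longrightarrow> (if c then side z < 0 else 0 < side z) \<Longrightarrow>
      lface w rA z \<in> piece_sheet (w, Some c)"
proof -
  have rA: "rA \<in> {rA, relB}" and rB: "relB \<in> {rA, relB}" by simp_all
  have hd: "half_disc c \<subseteq> cball 0 1" for c by (auto simp: half_disc_def)
  have ps: "punctured \<subseteq> face_map relB ` cball 0 1" by (auto simp: punctured_def)
  note P = sheet_cover[OF rB order_refl ps]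
  have uP: "w = w'" if "w \<in> fib" "w' \<in> fib" "z \<in> cball 0 1" "z' \<in> cball 0 1" "lface w relB z = lface w' relB z'"
    "face_map relB z \<in> punctured" for w w' z z'
    by (rule lface_punctured_unique[OF that(1,2) _ _ that(5,6)]) (use that in auto)
  have uH: "w = w'" if "w \<in> fib" "w' \<in> fib" "z \<in> half_disc c" "z' \<in> half_disc c" "lface w rA z = lface w' rA z'"
    "face_map rA z \<in> half c" for w w' z z' c
    by (rule lface_half_unique[OF nb that(1,2) _ _ that(5,6)]) (use that in \<open>auto simp: half_disc_def\<close>)
  \<comment> \<open>Disjointness of the lifts over a piece is supplied here; for the halves it
    expresses that the lifted faces close up to annuli.\<close>
  note SP = sheet_cover[OF rB order_refl ps uP] and SH = sheet_cover[OF rA hd half_subset[OF nb] uH]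
  have "openin X (piece_sheet (w, \<kappa>))" for w \<kappa>
    using open_sheet[OF open_punctured rB compact_cball order_refl, of w]
      open_sheet[OF open_half[OF nb] rA compact_half_disc hd, where w = w] by (cases \<kappa>) simp_all
  then show "openin X (piece_sheet k)" by (cases k) simp
  have d1: "piece_sheet (w, \<kappa>) \<inter> piece_sheet (w', \<kappa>) = {}" if "w \<noteq> w'" for w w' \<kappa>
    using SP(2)[OF _ _ _ _ _ _ that] SH(2)[OF _ _ _ _ _ _ that] by (cases \<kappa>) simp_all
  have d2: "piece_sheet (w, \<kappa>) \<inter> piece_sheet (w', \<kappa>') = {}" if "\<kappa> \<noteq> \<kappa>'" for w w' \<kappa> \<kappa>'
    using piece_disjoint[OF that] piece_sheet_p[of _ w \<kappa>] piece_sheet_p[of _ w' \<kappa>'] by blast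
  show "piece_sheet k \<inter> piece_sheet k' = {}" if "k \<noteq> k'"
  proof (cases "snd k = snd k'")
    case True
    then have "fst k \<noteq> fst k'" using that by (simp add: prod_eq_iff)
    from d1[OF this, of "snd k"] show ?thesis unfolding prod.collapse by (simp add: True)
  next
    case False
    from d2[OF this, of "fst k" "fst k'"] show ?thesis by simp
  qed
  show "(\<Union>w\<in>fib. piece_sheet (w, \<kappa>)) = {x \<in> topspace X. p x \<in> piece \<kappa>}"
    using SP(1) SH(1) by (cases \<kappa>) simp_all
  show "lface w relB z \<in> piece_sheet (w, None)" if w: "w \<in> fib" and z: "norm z < 1" "z \<noteq> 0"
  proof -
    have "face_map relB z \<in> punctured" using z by (auto simp: punctured_def)
    then show ?thesis using SP(3)[OF _ _ _ _ _ _ w] z by simp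
  qed
  show "lface w rA z \<in> piece_sheet (w, Some c)"
    if w: "w \<in> fib" and z: "norm z < 1" "if c then side z < 0 else 0 < side z"
  proof -
    have "face_map rA z \<in> half c" using z by (auto simp: half_def)
    moreover have "z \<in> half_disc c" using z by (auto simp: half_disc_def split: if_splits)
    ultimately show ?thesis using SH(3)[OF _ _ _ _ _ _ w] by simp
  qed
qed

definition uncutX :: "'a set" where "uncutX = {x \<in> topspace X. p x \<in> uncut}"

lemma open_uncutX: "openin X uncutX"
  unfolding uncutX_def by (rule openin_continuous_map_preimage[OF continuous_p open_uncut])

lemma graphX_uncutX: "graphX \<subseteq> uncutX"
  using graph_uncut by (auto simp: graphX_def uncutX_def)

lemma uncutX_pieces:
  assumes "\<not> b" shows "uncutX - graphX \<subseteq> (\<Union>k\<in>fib \<times> UNIV. piece_sheet k)"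
proof
  fix x assume x: "x \<in> uncutX - graphX"
  then have "p x \<in> uncut - graph" by (auto simp: uncutX_def graphX_def)
  then have "p x \<in> half True \<union> half False \<union> punctured" using uncut_nongraph by blast
  then have "p x \<in> piece (Some True) \<or> p x \<in> piece (Some False) \<or> p x \<in> piece None" by simp
  then obtain \<kappa> where "p x \<in> piece \<kappa>" by metis
  then have "x \<in> (\<Union>w\<in>fib. piece_sheet (w, \<kappa>))" unfolding piece_sheet_Union[OF assms] using x by (simp add: uncutX_def)
  then show "x \<in> (\<Union>k\<in>fib \<times> UNIV. piece_sheet k)" by blast
qed

lemma piece_sheet_meets:
  assumes nb: "\<not> b" and k: "k \<in> fib \<times> UNIV" and N: "openin X N" "graphX \<subseteq> N"
  obtains x where "x \<in> piece_sheet k" "x \<in> N" "x \<notin> graphX"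
proof -
  obtain w \<kappa> where w: "k = (w, \<kappa>)" "w \<in> fib" using k by blast
  have rA: "rA \<in> {rA, relB}" and rB: "relB \<in> {rA, relB}" by simp_all
  have "\<exists>x. x \<in> piece_sheet (w, \<kappa>) \<and> x \<in> N"
  proof (cases \<kappa>)
    case None
    have g: "face_map relB 1 \<in> graph" using face_relB_boundary[of 1] by simp
    from lface_radial[OF w(2) rB N _ g] obtain \<rho> where \<rho>: "0 < \<rho>" "\<rho> < 1" "lface w relB (of_real \<rho> * 1) \<in> N" by auto
    have "lface w relB (of_real \<rho> * 1) \<in> piece_sheet (w, None)" by (rule lface_relB_piece[OF nb w(2)]) (use \<rho> in auto)
    then show ?thesis using \<rho>(3) None by blast
  next
    case (Some c)
    \<comment> \<open>The midpoints of the two copies [0, 8] and [9, 17]: the radii towards them run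
      inside the respective halves.\<close>
    define y :: real where "y = (if c then 4 else 13)"
    have "circ 18 y \<in> circ 18 ` {0..8} \<union> circ 18 ` {9..17}"
      by (cases c) (auto simp: y_def intro!: imageI)
    then have g: "face_map rA (circ 18 y) \<in> graph" using face_rA_in_graph[of "circ 18 y"] by simp
    have s: "if c then side (circ 18 y) < 0 else 0 < side (circ 18 y)" using side_circ[of 4] side_circ[of 13] by (simp add: y_def)
    from lface_radial[OF w(2) rA N _ g] obtain \<rho> where \<rho>: "0 < \<rho>" "\<rho> < 1" "lface w rA (of_real \<rho> * circ 18 y) \<in> N" by auto
    have "lface w rA (of_real \<rho> * circ 18 y) \<in> piece_sheet (w, Some c)"
      by (rule lface_rA_piece[OF nb w(2)])
        (use \<rho> s in \<open>auto simp: side_scale norm_mult mult_pos_neg split: if_splits\<close>)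
    then show ?thesis using \<rho>(3) Some by blast
  qed
  then obtain x where x: "x \<in> piece_sheet k" "x \<in> N" using w by blast
  have "p x \<in> piece \<kappa>" using x(1) piece_sheet_p w(1) by blast
  then have "x \<notin> graphX" using piece_nongraph[of \<kappa>] by (auto simp: graphX_def)
  then show thesis using that x by blast
qed


lemma collar_nongraph:
  assumes t: "0 < t" "t < 1/2" and x: "x = 4 \<or> x = 13" and z: "z \<in> collar x t - arc x"
  shows "face_map rA z \<notin> graph"
proof
  assume g: "face_map rA z \<in> graph"
  from z obtain \<rho> y where y: "z = of_real \<rho> * circ 18 y" "norm z = \<rho>" "\<rho> \<le> 1" "\<bar>y - x\<bar> < 4 + t"
    using collar_polar[OF t] by blast
  have "\<not> \<rho> < 1" using g y(2) by (auto simp: face_map_inner)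
  then have zy: "z = circ 18 y" "norm z = 1" using y by simp_all
  have y': "x - (4 + t) < y" "y < x + (4 + t)" using y(4) unfolding abs_less_iff by linarith+
  have arcs: "arc 4 = circ 18 ` {0..8}" "arc 13 = circ 18 ` {9..17}" by (simp_all add: arc_def)
  have "z \<in> arc 4 \<union> arc 13" using g face_rA_in_graph[of z] zy(2) arcs by simp
  then have "(x = 4 \<and> z \<in> circ 18 ` {9..17}) \<or> (x = 13 \<and> z \<in> circ 18 ` {0..8})" using x z arcs by auto
  then show False
  proof
    assume a: "x = 4 \<and> z \<in> circ 18 ` {9..17}"
    \<comment> \<open>The collar about 4 begins before position 0; a full turn is added to compare
      it with the other arc.\<close>
    define y1 where "y1 = (if y < 0 then y + 18 else y)"
    have "z = circ 18 y1" using circ_period[of 18 y] zy by (simp add: y1_def)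
    moreover have "0 \<le> y1" "y1 < 18" "\<not> (9 \<le> y1 \<and> y1 \<le> 17)" using y' a t by (auto simp: y1_def)
    ultimately show False using circ18_in_arc[of y1 9 17] a by simp
  next
    assume a: "x = 13 \<and> z \<in> circ 18 ` {0..8}"
    then have "0 \<le> y" "y < 18" "8 < y" using y' t by auto
    then show False using circ18_in_arc[of y 0 8] a zy by simp
  qed
qed

lemma lface_connected:
  assumes "w \<in> fib" "r \<in> {rA, relB}" "connected S" "S \<subseteq> cball 0 1"
  shows "connectedin X (lface w r ` S)"
  by (rule connectedin_continuous_map_image[OF lface_continuous[OF assms(1,2)]])
    (use assms in \<open>simp add: connectedin_subtopology connectedin_iff_connected\<close>)

text \<open>The neighbourhood \<open>G\<close> is a parameter because the connected sets must later
  lie inside a region that is cut according to the other covering. Making all collars thin achieves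
  this.\<close>

lemma connected_collars:
  assumes b: b and G: "openin X G" "graphX \<subseteq> G"
  obtains N Y where "openin X N" "graphX \<subseteq> N" "\<And>k. k \<in> fib \<times> (UNIV :: bool set) \<Longrightarrow> connectedin X (Y k) \<and> Y k \<subseteq> G - graphX"
    "N - graphX \<subseteq> (\<Union>k\<in>fib \<times> UNIV. Y k)"
proof -
  have rA: "rA \<in> {rA, relB}" and rB: "relB \<in> {rA, relB}" by simp_all
  define W where "W w r = {z \<in> cball 0 1. lface w r z \<in> G}" for w r
  have oW: "openin (top_of_set (cball 0 1)) (W w r)" if "w \<in> fib" "r \<in> {rA, relB}" for w r
    unfolding W_def by (rule lface_vimage[OF that G(1)])
  have inW: "z \<in> W w r" if "w \<in> fib" "r \<in> {rA, relB}" "norm z \<le> 1" "face_map r z \<in> graph" for w r z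
    using lface_topspace[OF that(1-3)] lface_p[OF that(1-3)] that G(2) by (auto simp: W_def graphX_def)
  have arcs: "arc 4 = circ 18 ` {0..8}" "arc 13 = circ 18 ` {9..17}" by (simp_all add: arc_def)
  have arc_graph: "face_map rA z \<in> graph" "norm z \<le> 1" if "z \<in> arc 4 \<union> arc 13" for z
  proof -
    show "norm z \<le> 1" using that by (auto simp: arc_def)
    then show "face_map rA z \<in> graph" using face_rA_in_graph[of z] that unfolding arcs by simp
  qed
  have arcW: "arc x \<subseteq> W w rA" if "w \<in> fib" "x = 4 \<or> x = 13" for w x
    using arc_graph inW[OF that(1) rA] that(2) by blast
  have sphW: "sphere 0 1 \<subseteq> W w relB" if "w \<in> fib" for w
    using face_relB_boundary inW[OF that rB] by auto
  have "\<forall>\<^sub>F t in at_right 0. \<forall>w\<in>fib. collar 4 t \<subseteq> W w rA \<and> collar 13 t \<subseteq> W w rA \<and>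
      {z. 1 - t < norm z \<and> norm z \<le> 1} \<subseteq> W w relB"
    unfolding eventually_ball_finite_distrib[OF finite_fib]
    by (intro ballI eventually_conj collar_small annulus_small oW arcW sphW) auto
  moreover have "\<forall>\<^sub>F t :: real in at_right 0. 0 < t \<and> t < 1/2" by (rule eventually_at_rightI[of 0 "1/2"]) auto
  ultimately have "\<forall>\<^sub>F t in at_right 0. (\<forall>w\<in>fib. collar 4 t \<subseteq> W w rA \<and> collar 13 t \<subseteq> W w rA \<and>
      {z. 1 - t < norm z \<and> norm z \<le> 1} \<subseteq> W w relB) \<and> (0 < t \<and> t < 1/2)"
    by (rule eventually_conj)
  \<comment> \<open>One width \<open>t\<close> serves all vertices, since the fibre is
    finite.\<close>
  then obtain t where tW: "\<And>w. w \<in> fib \<Longrightarrow> collar 4 t \<subseteq> W w rA \<and> collar 13 t \<subseteq> W w rA \<and>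
      {z. 1 - t < norm z \<and> norm z \<le> 1} \<subseteq> W w relB" and t: "0 < t" "t < 1/2"
    using eventually_happens'[of "at_right (0::real)"] trivial_limit_at_right_real[of 0] by (smt (verit))
  \<comment> \<open>Both letters \<open>a\<close> are now read forwards, so the position t/2 in
    letter 17 is glued to the position t/2 in letter 8 of some lifted face, whose vertex becomes
    \<open>\<sigma> w'\<close>.\<close>
  have "\<exists>w\<in>fib. lface w rA (circ 18 (8 + t/2)) = lface w' rA (circ 18 (17 + t/2))" if w': "w' \<in> fib" for w'
  proof -
    have "face_map rA (circ 18 (17 + t/2)) = edge_map Gen_a (t/2)"
      using face_map_circ[of 17 rA "t/2"] fst_rA[of 17] snd_rA b t by simp
    also have "\<dots> = face_map rA (circ 18 (8 + t/2))" using edge_a_face[of "t/2"] t by simp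
    finally have "p (lface w' rA (circ 18 (17 + t/2))) = face_map rA (circ 18 (8 + t/2))"
      using lface_p[OF w' rA, of "circ 18 (17 + t/2)"] by simp
    from lface_through[OF rA lface_topspace[OF w' rA] _ this] show ?thesis by (metis norm_circ order_refl)
  qed
  then obtain \<sigma> where \<sigma>: "\<And>w. w \<in> fib \<Longrightarrow> \<sigma> w \<in> fib"
    "\<And>w. w \<in> fib \<Longrightarrow> lface (\<sigma> w) rA (circ 18 (8 + t/2)) = lface w rA (circ 18 (17 + t/2))" by metis
  define A where "A x = collar x t - arc x" for x
  define B where "B = {z::complex. 1 - t < norm z \<and> norm z < 1}"
  have A1: "A x \<subseteq> cball 0 1" for x by (auto simp: A_def collar_def)
  have B1: "B \<subseteq> cball 0 1" by (auto simp: B_def)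
  \<comment> \<open>The first collar at \<open>w\<close> together with all second collars glued to
    it. Each member contains the common point at position 8 + t/2 of the first collar, which makes
    the union connected.\<close>
  define \<Y> where "\<Y> w = insert (lface w rA ` A 4) {lface w' rA ` A 13 | w'. w' \<in> fib \<and> \<sigma> w' = w}" for w
  define Y where "Y k = (if snd k then lface (fst k) relB ` B else \<Union>(\<Y> (fst k)))" for k
  \<comment> \<open>What remains after removing, from finitely many lifted discs, the compact parts
    off the collars and off the annulus.\<close>
  define N where "N = topspace X - ((\<Union>w\<in>fib. lface w rA ` (cball 0 1 - (collar 4 t \<union> collar 13 t))) \<union>
     (\<Union>w\<in>fib. lface w relB ` cball 0 (1 - t)))"
  show thesis
  proof (rule that[of N Y])
    have "compact (cball 0 1 - (collar 4 t \<union> collar 13 t))"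
    proof -
      obtain U1 U2 where U: "open U1" "collar 4 t = cball 0 1 \<inter> U1" "open U2" "collar 13 t = cball 0 1 \<inter> U2"
        using open_collar[of 4 t] open_collar[of 13 t] by blast
      have "cball 0 1 - (collar 4 t \<union> collar 13 t) = cball 0 1 - (U1 \<union> U2)" using U by auto
      then show ?thesis using compact_diff[OF compact_cball open_Un[OF U(1,3)], of 0 1] by simp
    qed
    then have "closedin X (lface w rA ` (cball 0 1 - (collar 4 t \<union> collar 13 t)))" if "w \<in> fib" for w
      by (rule compactin_lface[OF that rA]) auto
    moreover have "closedin X (lface w relB ` cball 0 (1 - t))" if "w \<in> fib" for w
      by (rule compactin_lface[OF that rB compact_cball]) (use t in auto)
    ultimately show "openin X N" unfolding N_def using finite_fib
      by (intro openin_diff openin_topspace closedin_Un closedin_Union) auto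
    show "graphX \<subseteq> N"
    proof
      fix x assume x: "x \<in> graphX"
      have "x \<noteq> lface w rA z" if w: "w \<in> fib" and z: "z \<in> cball 0 1 - (collar 4 t \<union> collar 13 t)" for w z
      proof
        assume e: "x = lface w rA z"
        have n: "norm z \<le> 1" using z by simp
        have "face_map rA z \<in> graph" using x lface_p[OF w rA n] e by (simp add: graphX_def)
        then have "z \<in> arc 4 \<union> arc 13" using face_rA_in_graph[OF n] unfolding arcs by simp
        then show False using arc_collar[OF t, of 4] arc_collar[OF t, of 13] z by blast
      qed
      moreover have "x \<noteq> lface w relB z" if w: "w \<in> fib" and z: "z \<in> cball 0 (1 - t)" for w z
      proof
        assume e: "x = lface w relB z"
        have n: "norm z < 1" using z t by simp
        have "face_map relB z \<in> graph" using x lface_p[OF w rB, of z] n e by (simp add: graphX_def)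
        then show False using n by (simp add: face_map_inner)
      qed
      ultimately show "x \<in> N" using x graphX_topspace unfolding N_def by blast
    qed
    have ng: "lface w rA ` A x \<subseteq> G - graphX" if "w \<in> fib" "x = 4 \<or> x = 13" for w x
    proof
      fix y assume "y \<in> lface w rA ` A x"
      then obtain z where z: "z \<in> A x" "y = lface w rA z" by blast
      have n: "norm z \<le> 1" using z(1) A1[of x] by auto
      have "y \<in> G" using tW[OF that(1)] that(2) z by (auto simp: A_def W_def)
      moreover have "face_map rA z \<notin> graph" using collar_nongraph[OF t that(2)] z(1) by (simp add: A_def)
      ultimately show "y \<in> G - graphX" using lface_p[OF that(1) rA n] z(2) by (simp add: graphX_def)
    qed
    have ngB: "lface w relB ` B \<subseteq> G - graphX" if "w \<in> fib" for w
    proof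
      fix y assume "y \<in> lface w relB ` B"
      then obtain z where z: "z \<in> B" "y = lface w relB z" by blast
      have n: "norm z < 1" "1 - t < norm z" using z(1) by (auto simp: B_def)
      then have "z \<in> W w relB" using tW[OF that] by auto
      then have "y \<in> G" using z(2) by (simp add: W_def)
      then show "y \<in> G - graphX" using lface_p[OF that rB, of z] n z(2) by (simp add: graphX_def face_map_inner)
    qed
    have mid: "circ 18 (8 + t/2) \<in> A 4" "circ 18 (17 + t/2) \<in> A 13"
    proof -
      have "circ 18 (8 + t/2) \<notin> circ 18 ` {0..8}" "circ 18 (17 + t/2) \<notin> circ 18 ` {9..17}"
        using circ18_in_arc[of "8 + t/2" 0 8] circ18_in_arc[of "17 + t/2" 9 17] t by simp_all
      moreover have "circ 18 (8 + t/2) \<in> collar 4 t"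
        unfolding collar_polar[OF t] using t by (intro exI[of _ 1] exI[of _ "8 + t/2"]) simp
      moreover have "circ 18 (17 + t/2) \<in> collar 13 t"
        unfolding collar_polar[OF t] using t by (intro exI[of _ 1] exI[of _ "17 + t/2"]) simp
      ultimately show "circ 18 (8 + t/2) \<in> A 4" "circ 18 (17 + t/2) \<in> A 13" unfolding A_def arcs by blast+
    qed
    show "connectedin X (Y k) \<and> Y k \<subseteq> G - graphX" if k: "k \<in> fib \<times> UNIV" for k
    proof -
      obtain w c where w: "k = (w, c)" "w \<in> fib" using k by blast
      have cA: "connected (A x)" for x unfolding A_def by (rule connected_collar[OF t])
      show ?thesis
      proof (cases c)
        case True
        have "connected B"
          unfolding B_def using connected_annulus(1)[where a = "0::complex" and ?r1.0 = "1 - t" and ?r2.0 = 1] by simp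
        then show ?thesis using True w lface_connected[OF w(2) rB _ B1] ngB[OF w(2)] by (simp add: Y_def)
      next
        case False
        have "connectedin X (\<Union>(\<Y> w))"
        proof (rule connectedin_Union)
          show "connectedin X S" if "S \<in> \<Y> w" for S
            using that lface_connected[OF _ rA cA A1] w(2) by (auto simp: \<Y>_def)
          have "lface w rA (circ 18 (8 + t/2)) \<in> S" if "S \<in> \<Y> w" for S
            using that mid \<sigma>(2) by (auto simp: \<Y>_def)
          then show "\<Inter>(\<Y> w) \<noteq> {}" by blast
        qed
        moreover have "\<Union>(\<Y> w) \<subseteq> G - graphX"
        proof (rule Union_least)
          fix S assume "S \<in> \<Y> w"
          then obtain w' x where "w' \<in> fib" "x = 4 \<or> x = 13" "S = lface w' rA ` A x" using w(2) unfolding \<Y>_def by blast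
          then show "S \<subseteq> G - graphX" using ng by simp
        qed
        ultimately show ?thesis using False w by (simp add: Y_def)
      qed
    qed
    show "N - graphX \<subseteq> (\<Union>k\<in>fib \<times> UNIV. Y k)"
    proof
      fix x assume x: "x \<in> N - graphX"
      have tx: "x \<in> topspace X" and xg: "p x \<notin> graph" using x by (auto simp: N_def graphX_def)
      from nongraph_face[OF p_carrier[OF tx] xg] obtain r z where rz: "r \<in> {rA, relB}" "norm z \<le> 1" "p x = face_map r z" .
      from lface_through[OF rz(1) tx rz(2,3)] obtain w where w: "w \<in> fib" "lface w r z = x" .
      have "\<exists>k\<in>fib \<times> UNIV. x \<in> Y k"
      proof (cases "r = relB")
        case True
        have "\<not> norm z \<le> 1 - t"
        proof
          assume "norm z \<le> 1 - t"
          then have "x \<in> lface w relB ` cball 0 (1 - t)" using w(2) True by (intro image_eqI[of _ _ z]) auto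
          then show False using x w(1) by (auto simp: N_def)
        qed
        moreover have "norm z \<noteq> 1" using face_relB_boundary[of z] rz(3) xg True by auto
        ultimately have "z \<in> B" using rz(2) by (simp add: B_def)
        then have "x \<in> Y (w, True)" using w(2) True by (auto simp: Y_def)
        then show ?thesis using w(1) by blast
      next
        case False
        then have r: "r = rA" using rz(1) by simp
        have "z \<in> collar 4 t \<union> collar 13 t"
        proof (rule ccontr)
          assume "z \<notin> collar 4 t \<union> collar 13 t"
          then have "x \<in> lface w rA ` (cball 0 1 - (collar 4 t \<union> collar 13 t))" using w(2) r rz(2) by (intro image_eqI[of _ _ z]) auto
          then show False using x w(1) by (auto simp: N_def)
        qed
        moreover have "z \<notin> arc 4 \<union> arc 13" using arc_graph(1)[of z] rz(3) xg r by auto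
        ultimately have "z \<in> A 4 \<or> z \<in> A 13" by (auto simp: A_def)
        then show ?thesis
        proof
          assume "z \<in> A 4"
          then have "x \<in> Y (w, False)" using w(2) r by (auto simp: Y_def \<Y>_def)
          then show ?thesis using w(1) by blast
        next
          assume "z \<in> A 13"
          then have "x \<in> lface w rA ` A 13" using w(2) r by blast
          then have "x \<in> Y (\<sigma> w, False)" using w(1) by (auto simp: Y_def \<Y>_def)
          then show ?thesis using \<sigma>(1)[OF w(1)] by blast
        qed
      qed
      then show "x \<in> (\<Union>k\<in>fib \<times> UNIV. Y k)" by blast
    qed
  qed
qed

end

section \<open>Comparison of two coverings of a common space\<close>

lemma graphX_subset:
  assumes "compact_cover b X p" "compact_cover b' X p'"
  shows "compact_cover.graphX X p \<subseteq> compact_cover.graphX X p'"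
proof -
  interpret A: compact_cover b X p by (rule assms(1))
  interpret B: compact_cover b' X p' by (rule assms(2))
  \<comment> \<open>At a point of an open edge of the first graph the space branches in dimension 2,
    which is impossible off the second graph, where it is planar.\<close>
  have off: "x \<in> B.graphX" if x: "x \<in> A.graphX" "x \<notin> A.fib" for x
    using A.branches_at_graphX[OF x] B.euclidean_at_off_graphX[of x] A.graphX_topspace x(1) euclidean_not_branches[of X x] by (metis subsetD)
  \<comment> \<open>The second graph is closed. A vertex off it would have points of open edges of
    the first graph nearby that are off it too.\<close>
  have "x \<in> B.graphX" if x: "x \<in> A.fib" for x
  proof (rule ccontr)
    assume nx: "x \<notin> B.graphX"
    have "openin X (topspace X - B.graphX)" using B.closedin_graphX by blast
    moreover have "x \<in> topspace X - B.graphX" using x nx by (simp add: A.fib_def)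
    ultimately obtain y where "y \<in> topspace X - B.graphX" "y \<in> A.graphX" "y \<notin> A.fib" by (rule A.fib_closure[OF x])
    then show False using off by blast
  qed
  then show ?thesis using off by blast
qed

text \<open>Once the two graphs coincide as sets, the vertices are the points where this
  one-dimensional space branches, a property that mentions neither covering.\<close>

lemma fib_subset:
  assumes "compact_cover b X p" "compact_cover b' X p'"
  shows "compact_cover.fib X p \<subseteq> compact_cover.fib X p'"
proof
  interpret A: compact_cover b X p by (rule assms(1))
  interpret B: compact_cover b' X p' by (rule assms(2))
  fix x assume x: "x \<in> A.fib"
  have eq: "A.graphX = B.graphX" using graphX_subset[OF assms] graphX_subset[OF assms(2,1)] by (rule equalityI)
  have xB: "x \<in> B.graphX" using x A.fib_graphX eq by auto
  have "branches_at TYPE(real) (subtopology X B.graphX) x" using A.branches_at_fib[OF x] unfolding eq .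
  then show "x \<in> B.fib" using B.euclidean_at_in_graphX[OF xB] euclidean_not_branches[of "subtopology X B.graphX" x] by metis
qed

text \<open>Pigeonhole: each of the 3n pieces meets one of the 2n connected sets, so some connected
  set meets two pieces, although it lies in the union of the disjoint open pieces.\<close>

lemma no_common_compact_cover:
  assumes P: "compact_cover False X p" and N: "compact_cover True X q" and ne: "topspace X \<noteq> {}"
  shows False
proof -
  interpret P: compact_cover False X p by (rule P)
  interpret N: compact_cover True X q by (rule N)
  have graphX: "N.graphX = P.graphX" using graphX_subset[OF P N] graphX_subset[OF N P] by (rule equalityI[rotated])
  have fib: "N.fib = P.fib" using fib_subset[OF P N] fib_subset[OF N P] by (rule equalityI[rotated])
  have "P.fib \<noteq> {}"
  proof -
    have "Vertex \<in> p ` topspace X"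
      using P.cov by (simp add: covering_map_def P.base.topspace_Q P.base.carrier_def P.base.skel_def)
    then show ?thesis by (auto simp: P.fib_def)
  qed
  then have card: "card P.fib > 0" using P.finite_fib by (simp add: card_gt_0_iff)
  have nb: "\<not> False" by simp
  from N.connected_collars[OF TrueI P.open_uncutX] P.graphX_uncutX graphX
  obtain N Y where oN: "openin X N" and gN: "N.graphX \<subseteq> N"
    and Y: "\<And>k. k \<in> N.fib \<times> (UNIV :: bool set) \<Longrightarrow> connectedin X (Y k) \<and> Y k \<subseteq> P.uncutX - N.graphX"
    and NY: "N - N.graphX \<subseteq> (\<Union>k\<in>N.fib \<times> UNIV. Y k)" by metis
  have "\<exists>j\<in>P.fib \<times> UNIV. P.piece_sheet k \<inter> Y j \<noteq> {}" if k: "k \<in> P.fib \<times> UNIV" for k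
  proof -
    from P.piece_sheet_meets[OF nb k oN] gN graphX obtain x where "x \<in> P.piece_sheet k" "x \<in> N" "x \<notin> P.graphX" by metis
    then show ?thesis using NY fib graphX by blast
  qed
  then obtain f where f: "\<And>k. k \<in> P.fib \<times> UNIV \<Longrightarrow> f k \<in> P.fib \<times> UNIV"
    "\<And>k. k \<in> P.fib \<times> UNIV \<Longrightarrow> P.piece_sheet k \<inter> Y (f k) \<noteq> {}" by metis
  have "card (P.fib \<times> (UNIV :: bool set)) < card (P.fib \<times> (UNIV :: bool option set))"
    using card by (simp add: card_cartesian_product card_UNIV_option)
  then have "\<not> inj_on f (P.fib \<times> UNIV)"
    using card_inj_on_le[of f "P.fib \<times> UNIV" "P.fib \<times> UNIV"] f(1) P.finite_fib by fastforce
  then obtain k k' where k: "k \<in> P.fib \<times> UNIV" "k' \<in> P.fib \<times> UNIV" "k \<noteq> k'" "f k = f k'" unfolding inj_on_def by blast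
  define j where "j = f k"
  \<comment> \<open>All other pieces together: this open set and the piece of \<open>k\<close> would
    disconnect \<open>Y j\<close>.\<close>
  define V where "V = (\<Union>i\<in>P.fib \<times> UNIV - {k}. P.piece_sheet i)"
  have Yj: "connectedin X (Y j)" "Y j \<subseteq> P.uncutX - P.graphX" using Y[of j] f(1)[OF k(1)] fib graphX by (auto simp: j_def)
  have oV: "openin X V" unfolding V_def by (intro openin_Union) (auto intro: P.open_piece_sheet[OF nb])
  have "Y j \<subseteq> P.piece_sheet k \<union> V" using Yj(2) P.uncutX_pieces[OF nb] unfolding V_def by blast
  moreover have "P.piece_sheet k \<inter> V = {}" using P.disjoint_piece_sheet[OF nb] unfolding V_def by blast
  moreover have "P.piece_sheet k \<inter> Y j \<noteq> {}" using f(2)[OF k(1)] by (simp add: j_def)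
  moreover have "V \<inter> Y j \<noteq> {}" using f(2)[OF k(2)] k by (auto simp: j_def V_def)
  ultimately show False using Yj(1) P.open_piece_sheet[OF nb, of k] oV unfolding connectedin by blast
qed

section \<open>Compactness of finite CW-complexes, and the conclusion\<close>

lemma compact_space_closed_disc: "compact_space (closed_disc n)"
proof -
  define S where "S = {x :: nat \<Rightarrow> real. (\<forall>i\<ge>n. x i = 0) \<and> (\<Sum>i<n. (x i)\<^sup>2) \<le> 1}"
  have d: "closed_disc n = subtopology euclidean S"
    unfolding closed_disc_def Euclidean_space_def euclidean_product_topology subtopology_subtopology
    by (rule arg_cong2[where f = subtopology]) (auto simp: S_def)
  have "closed {x :: nat \<Rightarrow> real. (\<Sum>i<n. (x i)\<^sup>2) \<le> 1}"
    by (intro closed_Collect_le continuous_intros continuous_on_product_coordinates)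
  moreover have "closed {x :: nat \<Rightarrow> real. x i = 0}" for i
    by (intro closed_Collect_eq continuous_intros continuous_on_product_coordinates)
  moreover have "S = (\<Inter>i\<in>{n..}. {x. x i = 0}) \<inter> {x. (\<Sum>i<n. (x i)\<^sup>2) \<le> 1}" by (auto simp: S_def)
  ultimately have "closed S" by (simp add: closed_INT closed_Int)
  moreover have "compact (PiE UNIV (\<lambda>_. {-1..1}) :: (nat \<Rightarrow> real) set)"
    using compactin_PiE[of "\<lambda>_::nat. euclideanreal" UNIV "\<lambda>_. {-1..1}"]
    by (simp add: euclidean_product_topology)
  moreover have "S \<subseteq> PiE UNIV (\<lambda>_. {-1..1})"
  proof
    fix x assume x: "x \<in> S"
    have "\<bar>x i\<bar> \<le> 1" for i
    proof (cases "i < n")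
      case True
      then have "(x i)\<^sup>2 \<le> (\<Sum>i<n. (x i)\<^sup>2)" by (intro member_le_sum) auto
      then have "(x i)\<^sup>2 \<le> 1" using x by (simp add: S_def)
      then show ?thesis by (simp add: abs_square_le_1)
    qed (use x in \<open>simp add: S_def\<close>)
    then show "x \<in> PiE UNIV (\<lambda>_. {-1..1})" by (auto simp: abs_le_iff minus_le_iff)
  qed
  ultimately have "compact S" by (metis compact_Int_closed inf.absorb_iff2)
  then show ?thesis unfolding d by (simp add: compact_space_subtopology)
qed

lemma finite_cw_complex_compact:
  assumes "finite_cw_complex K" shows "compact_space (space_of K)"
proof -
  have cw: "cw_complex K" and fin: "finite (SIGMA n:UNIV. cells K n)" using assms by (auto simp: finite_cw_complex_def)
  have ch: "\<exists>\<phi>. characteristic_map K n e \<phi>" if "e \<in> cells K n" for n e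
    using cw that by (auto simp: cw_complex_def)
  have \<phi>: "characteristic_map K n e (SOME \<phi>. characteristic_map K n e \<phi>)" if "e \<in> cells K n" for n e
    by (rule someI_ex[OF ch[OF that]])
  define \<phi> where "\<phi> n e = (SOME \<phi>. characteristic_map K n e \<phi>)" for n e
  note \<phi> = \<phi>[folded \<phi>_def]
  define D where "D c = \<phi> (fst c) (snd c) ` topspace (closed_disc (fst c))" for c
  have top: "(\<Union>n. \<Union>(cells K n)) = topspace (space_of K)" using cw by (simp add: cw_complex_def)
  have "compactin (space_of K) (D c)" if c: "c \<in> (SIGMA n:UNIV. cells K n)" for c
    unfolding D_def
  proof (rule image_compactin)
    show "compactin (closed_disc (fst c)) (topspace (closed_disc (fst c)))"
      using compact_space_closed_disc by (simp add: compact_space_def)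
    show "continuous_map (closed_disc (fst c)) (space_of K) (\<phi> (fst c) (snd c))"
      using \<phi>[of "snd c" "fst c"] c by (auto simp: characteristic_map_def)
  qed
  then have co: "compactin (space_of K) (\<Union>(D ` (SIGMA n:UNIV. cells K n)))"
    using fin by (intro compactin_Union) auto
  have "topspace (space_of K) \<subseteq> \<Union>(D ` (SIGMA n:UNIV. cells K n))"
  proof
    fix x assume x: "x \<in> topspace (space_of K)"
    then obtain n e where e: "e \<in> cells K n" "x \<in> e" using top by blast
    have h: "homeomorphic_map (open_disc n) (subtopology (space_of K) e) (\<phi> n e)"
      using \<phi>[OF e(1)] by (simp add: characteristic_map_def)
    have "\<phi> n e ` topspace (open_disc n) = topspace (space_of K) \<inter> e"
      using homeomorphic_imp_surjective_map[OF h] by simp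
    then have "x \<in> \<phi> n e ` topspace (open_disc n)" using x e(2) by blast
    moreover have "topspace (open_disc n) \<subseteq> topspace (closed_disc n)" by (auto simp: open_disc_def closed_disc_def)
    ultimately have "x \<in> D (n, e)" by (auto simp: D_def)
    then show "x \<in> \<Union>(D ` (SIGMA n:UNIV. cells K n))" using e(1) by blast
  qed
  then have "\<Union>(D ` (SIGMA n:UNIV. cells K n)) = topspace (space_of K)" using compactin_subset_topspace[OF co] by (simp add: equalityI)
  then show ?thesis using co by (simp add: compact_space_def)
qed

lemma (in K_eps) K_complex_CX: "K_complex (if b then - 1 else 1) = base.CX"
proof -
  have "H_relators (if b then - 1 else 1) = {relA b, relB}" by (cases b) (simp_all add: H_relators_eq)
  then show ?thesis unfolding K_complex_def gens_def[symmetric]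
    by (simp only:) (rule standard_complex_CX, unfold_locales)
qed

lemma (in K_eps) K_complex_cells:
  "finite_cw_complex base.CX \<and> card (cells base.CX 0) = 1 \<and> card (cells base.CX 1) = 3 \<and>
   card (cells base.CX 2) = 2 \<and> (\<forall>n>2. cells base.CX n = {})"
proof -
  have gf: "finite gens" "card gens = 3" by (simp_all add: gens_def)
  have "inj_on (\<lambda>e. edge_map e ` {0<..<1}) gens"
  proof (rule inj_onI)
    fix g h assume "edge_map g ` {0<..<1} = edge_map h ` {0<..<1}"
    then have "edge_map g (1/2) \<in> edge_map h ` {0<..<1}" by (rule subst[of _ _ "\<lambda>S. edge_map g (1/2) \<in> S"]) simp
    then show "g = h" by (auto simp: edge_map_inner)
  qed
  moreover have "inj_on (\<lambda>r. face_map r ` ball 0 1) {rA, relB}"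
  proof (rule inj_onI)
    fix r s :: "gen word" assume "face_map r ` ball 0 1 = face_map s ` ball 0 1"
    then have "face_map r 0 \<in> face_map s ` ball 0 1" by (rule subst[of _ _ "\<lambda>S. face_map r 0 \<in> S"]) simp
    then show "r = s" by (auto simp: face_map_inner)
  qed
  moreover have "card {rA, relB} = 2" using rel_distinct by simp
  ultimately have "card (cells base.CX 1) = 3" "card (cells base.CX 2) = 2"
    using gf card_image[of "\<lambda>e. edge_map e ` {0<..<1}" gens] card_image[of "\<lambda>r. face_map r ` ball 0 1" "{rA, relB}"]
    by (simp_all only: base.CX_simps)
  then show ?thesis
    unfolding finite_cw_complex_def using base.cw_complex_CX base.finite_cells gf
    by (simp add: base.CX_simps)
qed

theorem mainTheorem1:
  shows "(\<forall>\<epsilon>\<in>{1, -1}.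
            finite_cw_complex (K_complex \<epsilon>) \<and>
            card (cells (K_complex \<epsilon>) 0) = 1 \<and>
            card (cells (K_complex \<epsilon>) 1) = 3 \<and>
            card (cells (K_complex \<epsilon>) 2) = 2 \<and>
            (\<forall>n>2. cells (K_complex \<epsilon>) n = {})) \<and>
         (\<exists>K :: (nat \<times> gen point) cell_complex.
            common_covering K (K_complex 1) (K_complex (-1))) \<and>
         \<not> (\<exists>K :: 'a cell_complex.
            finite_common_covering K (K_complex 1) (K_complex (-1)))"
proof (intro conjI)
  interpret P: K_eps False .
  interpret N: K_eps True .
  have K: "K_complex 1 = P.base.CX" "K_complex (- 1) = N.base.CX" using P.K_complex_CX N.K_complex_CX by simp_all
  show "\<forall>\<epsilon>\<in>{1, -1}. finite_cw_complex (K_complex \<epsilon>) \<and> card (cells (K_complex \<epsilon>) 0) = 1 \<and>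
      card (cells (K_complex \<epsilon>) 1) = 3 \<and> card (cells (K_complex \<epsilon>) 2) = 2 \<and>
      (\<forall>n>2. cells (K_complex \<epsilon>) n = {})"
    using P.K_complex_cells N.K_complex_cells by (simp add: K)
  show "\<exists>K :: (nat \<times> gen point) cell_complex. common_covering K (K_complex 1) (K_complex (-1))"
  proof -
    obtain C D U :: "nat \<Rightarrow> nat" and s :: "nat \<Rightarrow> bool" where "bij C" "bij D" "\<And>x. D (C x) = U (D x)"
      "\<And>x. U (U (U x)) = C (C (C (C (C x))))" "\<And>x. s (C (U x)) \<longleftrightarrow> \<not> s (U (C x))"
      by (rule twisted_permutations) (rule that; (assumption | simp))
    then interpret twisted_action C D U s by unfold_locales
    show ?thesis by (rule common_covering_exists)
  qed
  show "\<not> (\<exists>K :: 'a cell_complex. finite_common_covering K (K_complex 1) (K_complex (-1)))"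
  proof
    assume "\<exists>K :: 'a cell_complex. finite_common_covering K (K_complex 1) (K_complex (-1))"
    then obtain K :: "'a cell_complex" where K': "finite_cw_complex K" "common_covering K P.base.CX N.base.CX"
      unfolding finite_common_covering_def K by blast
    obtain p q where pq: "covering_map (space_of K) P.base.Q p" "covering_map (space_of K) N.base.Q q"
      using K'(2) unfolding common_covering_def P.base.CX_simps N.base.CX_simps by blast
    have "Hausdorff_space (space_of K)" "compact_space (space_of K)" "topspace (space_of K) \<noteq> {}"
      using K' finite_cw_complex_compact by (auto simp: common_covering_def cw_complex_def)
    then show False
      using no_common_compact_cover[of "space_of K" p q] pq by (simp add: compact_cover_def)
  qed
qed

end
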